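(* There is an algorithm that, given a graph $G$ on $n$ vertices, computes the treewidth of $G$ in time $O^*(3^k)$, where $k$ is the size of a minimum vertex cover of $G$.
   Context: All graphs are finite, simple and undirected. A vertex cover of $G=(V,E)$ is a set $C\subseteq V$ containing at least one endpoint of every edge. A tree decomposition of $G$ is a pair $(T,\{X_i\}_{i\in I})$ with $T=(I,F)$ a tree and $X_i\subseteq V$ (bags) such that every vertex lies in some bag, every edge has both endpoints in some bag, and for each vertex $v$ the nodes whose bags contain $v$ induce a connected subtree of $T$; its width is $\max_i|X_i|-1$, and the treewidth of $G$ is the minimum width of a tree decomposition of $G$. The notation $f(n,k)=O^*(g(n,k))$ means $f(n,k)=O(g(n,k)\cdot n^{O(1)})$, i.e. polynomial factors in $n$ are suppressed. *)

theory Defs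
  imports Complex_Main "HOL-Library.Log_Nat"
begin

section \<open>Graphs, vertex covers and treewidth\<close>

text \<open>
  A graph is given by its vertex set and its edge set, an edge being a set of two distinct vertices.
\<close>

definition simple_graph :: "'a set \<Rightarrow> 'a set set \<Rightarrow> bool" where
  "simple_graph V E \<longleftrightarrow> finite V \<and> (\<forall>e\<in>E. \<exists>u\<in>V. \<exists>v\<in>V. u \<noteq> v \<and> e = {u, v})"

definition vertex_cover :: "'a set \<Rightarrow> 'a set set \<Rightarrow> 'a set \<Rightarrow> bool" where
  "vertex_cover V E C \<longleftrightarrow> C \<subseteq> V \<and> (\<forall>e\<in>E. e \<inter> C \<noteq> {})"

definition vertex_cover_number :: "'a set \<Rightarrow> 'a set set \<Rightarrow> nat" where
  "vertex_cover_number V E = (LEAST k. \<exists>C. vertex_cover V E C \<and> card C = k)"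

text \<open>The subgraph induced by \<open>S\<close> is nonempty and connected.\<close>

definition connected_on :: "'a set set \<Rightarrow> 'a set \<Rightarrow> bool" where
  "connected_on E S \<longleftrightarrow>
     S \<noteq> {} \<and> (\<forall>u\<in>S. \<forall>v\<in>S. (u, v) \<in> {(x, y). x \<in> S \<and> y \<in> S \<and> {x, y} \<in> E}\<^sup>*)"

text \<open>A cycle is given by the list of its vertices, the last one being adjacent to the first one.\<close>

definition graph_cycle :: "'a set set \<Rightarrow> 'a list \<Rightarrow> bool" where
  "graph_cycle E p \<longleftrightarrow> length p \<ge> 3 \<and> distinct p \<and>
     (\<forall>i<length p. {p ! i, p ! (Suc i mod length p)} \<in> E)"

definition is_tree :: "'a set \<Rightarrow> 'a set set \<Rightarrow> bool" where
  "is_tree V E \<longleftrightarrow> simple_graph V E \<and> connected_on E V \<and> (\<nexists>p. graph_cycle E p)"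

definition tree_decomposition ::
    "'a set \<Rightarrow> 'a set set \<Rightarrow> 'i set \<Rightarrow> 'i set set \<Rightarrow> ('i \<Rightarrow> 'a set) \<Rightarrow> bool" where
  "tree_decomposition V E I F X \<longleftrightarrow>
     is_tree I F \<and>
     (\<forall>i\<in>I. X i \<subseteq> V) \<and>
     (\<forall>v\<in>V. \<exists>i\<in>I. v \<in> X i) \<and>
     (\<forall>e\<in>E. \<exists>i\<in>I. e \<subseteq> X i) \<and>
     (\<forall>v\<in>V. connected_on F {i \<in> I. v \<in> X i})"

text \<open>The width is an integer: it is \<open>-1\<close> if all bags are empty.\<close>

definition td_width :: "'i set \<Rightarrow> ('i \<Rightarrow> 'a set) \<Rightarrow> int" where
  "td_width I X = Max ((\<lambda>i. int (card (X i))) ` I) - 1"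

text \<open>
  Trees being finite, it is no restriction that the nodes are natural numbers. The minimum exists
  since widths are bounded below by \<open>-1\<close>; see \<open>treewidth_attained\<close> and \<open>treewidth_le\<close>.
\<close>

definition treewidth :: "'a set \<Rightarrow> 'a set set \<Rightarrow> int" where
  "treewidth V E =
     (LEAST w. \<exists>(I :: nat set) F X. tree_decomposition V E I F X \<and> td_width I X = w)"

lemma td_width_ge:
  assumes "tree_decomposition V E I F X"
  shows "-1 \<le> td_width I X"
proof -
  have I: "finite I" "I \<noteq> {}"
    using assms by (auto simp: tree_decomposition_def is_tree_def simple_graph_def connected_on_def)
  then obtain i where "i \<in> I" by blast
  then have "int (card (X i)) \<le> Max ((\<lambda>i. int (card (X i))) ` I)"
    using I by (intro Max_ge) auto
  then show ?thesis by (simp add: td_width_def)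
qed

lemma tree_decomposition_trivial:
  assumes "simple_graph V E"
  shows "tree_decomposition V E {0 :: nat} {} (\<lambda>_. V)"
proof -
  have "\<not> graph_cycle {} p" for p :: "nat list"
    by (cases p) (auto simp: graph_cycle_def)
  then show ?thesis
    using assms
    by (auto simp: tree_decomposition_def is_tree_def simple_graph_def connected_on_def)
qed

lemma treewidth_Least:
  assumes "simple_graph V E"
  shows "(\<exists>(I :: nat set) F X. tree_decomposition V E I F X \<and> td_width I X = treewidth V E) \<and>
         (\<forall>(I :: nat set) F X. tree_decomposition V E I F X \<longrightarrow> treewidth V E \<le> td_width I X)"
proof -
  define P where
    "P w \<longleftrightarrow> (\<exists>(I :: nat set) F X. tree_decomposition V E I F X \<and> td_width I X = w)" for w
  have lb: "-1 \<le> w" if "P w" for w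
    using that td_width_ge by (auto simp: P_def)
  have ex: "P (int (nat (td_width {0 :: nat} (\<lambda>_. V) + 1)) - 1)"
    using tree_decomposition_trivial[OF assms] td_width_ge[OF tree_decomposition_trivial[OF assms]]
    by (auto simp: P_def)
  define m where "m = (LEAST m. P (int m - 1))"
  have Pm: "P (int m - 1)"
    unfolding m_def using ex by (rule LeastI)
  have le: "int m - 1 \<le> w" if "P w" for w
  proof -
    have "m \<le> nat (w + 1)"
      unfolding m_def by (rule Least_le) (use that lb[OF that] in simp)
    with lb[OF that] show ?thesis by linarith
  qed
  have "treewidth V E = int m - 1"
    unfolding treewidth_def P_def[symmetric] using Pm le by (intro Least_equality)
  with Pm le show ?thesis by (auto simp: P_def)
qed

lemmas treewidth_attained = treewidth_Least[THEN conjunct1]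
  and treewidth_le = treewidth_Least[THEN conjunct2, rule_format]

section \<open>Random access machines with logarithmic cost\<close>

text \<open>
  The model of computation is the random access machine of Cook and Reckhow: registers
  \<open>X\<^sub>0, X\<^sub>1, \<dots>\<close> hold integers and are initially \<open>0\<close>, and programs have direct and indirect access
  to them. A program halts when the program counter leaves the program; its result is then in \<open>X\<^sub>0\<close>.

  Indirect addressing through a negative integer accesses \<open>X\<^sub>0\<close>, and \<open>Read\<close> yields \<open>0\<close> once the
  input is exhausted.
\<close>

datatype instr =
    SetConst nat int      \<comment> \<open>\<open>X\<^sub>i := c\<close>\<close>
  | Add nat nat nat       \<comment> \<open>\<open>X\<^sub>i := X\<^sub>j + X\<^sub>k\<close>\<close>
  | Sub nat nat nat       \<comment> \<open>\<open>X\<^sub>i := X\<^sub>j - X\<^sub>k\<close>\<close>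
  | Load nat nat          \<comment> \<open>\<open>X\<^sub>i := X[X\<^sub>j]\<close>\<close>
  | Store nat nat         \<comment> \<open>\<open>X[X\<^sub>i] := X\<^sub>j\<close>\<close>
  | JumpPos nat nat       \<comment> \<open>if \<open>X\<^sub>j > 0\<close> go to instruction \<open>l\<close>\<close>
  | Read nat              \<comment> \<open>\<open>X\<^sub>i :=\<close> next input\<close>

record config =
  pc :: nat
  mem :: "nat \<Rightarrow> int"
  inp :: "int list"

definition next_input :: "config \<Rightarrow> int" where
  "next_input s = (case inp s of [] \<Rightarrow> 0 | x # _ \<Rightarrow> x)"

fun step :: "instr \<Rightarrow> config \<Rightarrow> config" where
  "step (SetConst i c) s = s\<lparr>pc := pc s + 1, mem := (mem s)(i := c)\<rparr>"
| "step (Add i j k) s = s\<lparr>pc := pc s + 1, mem := (mem s)(i := mem s j + mem s k)\<rparr>"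
| "step (Sub i j k) s = s\<lparr>pc := pc s + 1, mem := (mem s)(i := mem s j - mem s k)\<rparr>"
| "step (Load i j) s = s\<lparr>pc := pc s + 1, mem := (mem s)(i := mem s (nat (mem s j)))\<rparr>"
| "step (Store i j) s = s\<lparr>pc := pc s + 1, mem := (mem s)(nat (mem s i) := mem s j)\<rparr>"
| "step (JumpPos j l) s = s\<lparr>pc := (if mem s j > 0 then l else pc s + 1)\<rparr>"
| "step (Read i) s =
     s\<lparr>pc := pc s + 1, mem := (mem s)(i := next_input s), inp := tl (inp s)\<rparr>"

text \<open>
  An instruction costs the total binary length of the integers it operates on, including addresses
  that are computed at run time; the register indices occurring in a program are constants.
\<close>

definition bits :: "int \<Rightarrow> nat" where
  "bits x = max 1 (floorlog 2 (nat \<bar>x\<bar>))"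

fun cost :: "instr \<Rightarrow> config \<Rightarrow> nat" where
  "cost (SetConst i c) s = bits c"
| "cost (Add i j k) s = bits (mem s j) + bits (mem s k)"
| "cost (Sub i j k) s = bits (mem s j) + bits (mem s k)"
| "cost (Load i j) s = bits (mem s j) + bits (mem s (nat (mem s j)))"
| "cost (Store i j) s = bits (mem s i) + bits (mem s j)"
| "cost (JumpPos j l) s = bits (mem s j)"
| "cost (Read i) s = bits (next_input s)"

text \<open>\<open>exec P s t s'\<close>: started in \<open>s\<close>, program \<open>P\<close> halts in \<open>s'\<close> at total cost \<open>t\<close>.\<close>

inductive exec :: "instr list \<Rightarrow> config \<Rightarrow> nat \<Rightarrow> config \<Rightarrow> bool" for P where
  exec_halt: "pc s \<ge> length P \<Longrightarrow> exec P s 0 s"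
| exec_step: "pc s < length P \<Longrightarrow> exec P (step (P ! pc s) s) t s' \<Longrightarrow>
    exec P s (cost (P ! pc s) s + t) s'"

definition computes_within :: "instr list \<Rightarrow> int list \<Rightarrow> int \<Rightarrow> real \<Rightarrow> bool" where
  "computes_within P xs y b \<longleftrightarrow>
     (\<exists>t s. exec P \<lparr>pc = 0, mem = (\<lambda>_. 0), inp = xs\<rparr> t s \<and> mem s 0 = y \<and> real t \<le> b)"

text \<open>
  The graph with vertices \<open>{..<n}\<close> is input as \<open>n\<close> followed by its adjacency matrix, row by row.
\<close>

definition graph_input :: "nat \<Rightarrow> nat set set \<Rightarrow> int list" where
  "graph_input n E = int n # [of_bool ({i, j} \<in> E). i \<leftarrow> [0..<n], j \<leftarrow> [0..<n]]"

section \<open>Suppressing polynomial factors\<close>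

text \<open>The bound is required for \<open>n \<ge> 1\<close> only, as \<open>n ^ d\<close> vanishes for \<open>n = 0\<close> and \<open>d > 0\<close>.\<close>

definition O_star :: "(nat \<Rightarrow> nat \<Rightarrow> real) \<Rightarrow> (nat \<Rightarrow> nat \<Rightarrow> real) set" where
  "O_star g = {f. \<exists>c d. \<forall>n\<ge>1. \<forall>k. \<bar>f n k\<bar> \<le> c * \<bar>g n k\<bar> * real n ^ d}"

end

theory Submission
  imports Defs
begin

text \<open>
  A tree decomposition of width below \<open>q\<close> amounts to a rooted one built by introducing, forgetting
  and joining with bags of at most \<open>q\<close> elements. Fix a vertex cover \<open>C\<close> of size \<open>k\<close>. For a node let
  \<open>B\<close> be the part of \<open>C\<close> in its bag and \<open>L\<close> the part of \<open>C\<close> strictly below. The vertices outside \<open>C\<close>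
  are independent, so it can be read off from \<open>(L, B)\<close> which of them the bag must contain: those with
  a neighbour in \<open>L\<close> and another one in \<open>C - L - B\<close>. Hence there are \<open>3 ^ k\<close> states, coded
  in ternary, and whether a state is realizable is computed by dynamic programming.

  Join nodes, which split \<open>L\<close> into two parts, would lead to \<open>4 ^ k\<close> combinations. Here all of them are
  treated at once by subset convolution: a good state is given the weight \<open>XX ^ e\<close>, where \<open>e\<close>
  records \<open>n - |L|\<close> and the number of independent vertices below, the weights are transformed by
  the zeta transform over \<open>L\<close>, squared, and transformed back. Comparison with a power of \<open>XX\<close>
  then tells whether some disjoint pair fits. All numbers have polynomially many bits.

  A vertex cover of size \<open>k\<close> is found by branching on the endpoints of uncovered edges, for which
  \<open>2 ^ k \<le> 3 ^ k\<close> sequences of choices have to be tried.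
\<close>

subsection \<open>Nice tree decompositions\<close>

text \<open>The join condition bounds a set \<open>Jjoin\<close> that belongs to a pair of states,
  which a convolution cannot see. What makes the convolution possible is the identity
  \<open>card_Jjoin\<close>: it turns the condition into a lower bound for
  \<open>va t1 + va t2\<close>, and an additive quantity can be carried in an exponent. Squaring a
  zeta transform yields the product over unions and mixes overlapping with disjoint pairs. Instead
  of ranked transforms, the exponent \<open>ee\<close> gets an upper digit \<open>n - |L|\<close> to
  the base \<open>M = 2 * n + 1\<close>; two values of \<open>va\<close> add up to at most
  \<open>2 * n\<close>, so nothing is carried. Fewer than \<open>XX = 2 ^ M\<close> pairs meet in
  one code, so lower powers of \<open>XX\<close> cannot add up to a higher one. Exponents stay below
  \<open>M ^ 2\<close>, hence the \<open>M ^ 3\<close> bits of all numbers. A join refers to good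
  codes that must be known before the transform, so for each width the whole table is recomputed in
  \<open>2 * k + 1\<close> rounds, a polynomial factor. The machine only adds and subtracts; every
  product, quotient and power is produced by doubling, repeated subtraction or tables.\<close>

definition nbhd :: "'a set set \<Rightarrow> 'a \<Rightarrow> 'a set" where
  "nbhd E v = {u. {u, v} \<in> E}"

lemma nbhd_sym: "u \<in> nbhd E v \<longleftrightarrow> v \<in> nbhd E u"
  by (simp add: nbhd_def insert_commute)

text \<open>Only the root bag \<open>S\<close> and the set \<open>D\<close> of vertices already
  forgotten are kept; the tree is implicit. The edge condition is moved to the moment of forgetting:
  a neighbour of \<open>x\<close> in \<open>D\<close> was itself forgotten while \<open>x\<close>
  was still in its bag.\<close>

inductive nice_dec :: "'a set set \<Rightarrow> nat \<Rightarrow> 'a set \<Rightarrow> 'a set \<Rightarrow> bool" for E q where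
  leaf: "finite S \<Longrightarrow> card S \<le> q \<Longrightarrow> nice_dec E q S {}"
| forget: "nice_dec E q S D \<Longrightarrow> x \<in> S \<Longrightarrow> nbhd E x \<subseteq> D \<union> S \<Longrightarrow> nice_dec E q (S - {x}) (insert x D)"
| intro: "nice_dec E q S D \<Longrightarrow> x \<notin> S \<Longrightarrow> x \<notin> D \<Longrightarrow> card (insert x S) \<le> q \<Longrightarrow> nice_dec E q (insert x S) D"
| join: "nice_dec E q S D1 \<Longrightarrow> nice_dec E q S D2 \<Longrightarrow> D1 \<inter> D2 = {} \<Longrightarrow> nice_dec E q S (D1 \<union> D2)"

text \<open>The last clause says that \<open>S\<close> separates \<open>D\<close> from the rest of
  the graph; all later arguments about where a neighbour lies rest on it.\<close>

lemma nice_dec_inv: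
  assumes "nice_dec E q S D"
  shows "finite S" "finite D" "card S \<le> q" "S \<inter> D = {}" "\<And>x. x \<in> D \<Longrightarrow> nbhd E x \<subseteq> D \<union> S"
proof -
  have "finite S \<and> finite D \<and> card S \<le> q \<and> S \<inter> D = {} \<and> (\<forall>x\<in>D. nbhd E x \<subseteq> D \<union> S)"
    using assms
  proof induction
    case (forget S D x)
    then have "card (S - {x}) \<le> q" by (meson Diff_subset card_mono le_trans)
    with forget show ?case by blast
  qed (auto)
  then show "finite S" "finite D" "card S \<le> q" "S \<inter> D = {}" "\<And>x. x \<in> D \<Longrightarrow> nbhd E x \<subseteq> D \<union> S"
    by auto
qed

lemma nice_dec_forget_many:
  assumes "nice_dec E q S D" "finite W" "W \<subseteq> S" "\<And>x. x \<in> W \<Longrightarrow> nbhd E x \<subseteq> D \<union> S"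
  shows "nice_dec E q (S - W) (D \<union> W)"
  using assms(2,3,4)
proof (induction W)
  case empty
  then show ?case using assms(1) by simp
next
  case (insert x W)
  have "nice_dec E q (S - W - {x}) (insert x (D \<union> W))"
  proof (rule nice_dec.forget)
    show "nice_dec E q (S - W) (D \<union> W)" using insert by simp
    show "nbhd E x \<subseteq> D \<union> W \<union> (S - W)" using insert.prems(2)[of x] by auto
  qed (use insert in auto)
  moreover have "S - W - {x} = S - insert x W" by auto
  ultimately show ?case by simp
qed

lemma nice_dec_intro_many:
  assumes "nice_dec E q S D" "finite W" "W \<inter> D = {}" "card (S \<union> W) \<le> q"
  shows "nice_dec E q (S \<union> W) D"
  using assms(2,3,4)
proof (induction W)
  case empty
  then show ?case using assms(1) by simp
next
  case (insert x W)
  have fin: "finite (S \<union> insert x W)" using nice_dec_inv(1)[OF assms(1)] insert by simp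
  have "card (S \<union> W) \<le> card (S \<union> insert x W)" by (rule card_mono[OF fin]) auto
  then have IH: "nice_dec E q (S \<union> W) D" using insert by simp
  show ?case
  proof (cases "x \<in> S \<union> W")
    case True
    then have "S \<union> insert x W = S \<union> W" by auto
    then show ?thesis using IH by simp
  next
    case False
    have "nice_dec E q (insert x (S \<union> W)) D"
      by (rule nice_dec.intro[OF IH]) (use insert False in auto)
    then show ?thesis by simp
  qed
qed

lemma nice_dec_union:
  assumes "finite A" "\<And>a. a \<in> A \<Longrightarrow> nice_dec E q S (f a)" "finite S" "card S \<le> q"
    "\<And>a b. a \<in> A \<Longrightarrow> b \<in> A \<Longrightarrow> a \<noteq> b \<Longrightarrow> f a \<inter> f b = {}"
  shows "nice_dec E q S (\<Union>a\<in>A. f a)"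
  using assms(1,2,5)
proof (induction A)
  case empty
  then show ?case using assms nice_dec.leaf by simp
next
  case (insert a A)
  have "nice_dec E q S (f a \<union> (\<Union>a\<in>A. f a))"
  proof (rule nice_dec.join)
    show "nice_dec E q S (\<Union>a\<in>A. f a)" using insert by simp
    show "f a \<inter> (\<Union>a\<in>A. f a) = {}"
      using insert.prems(2)[of a] insert.hyps(2) by fastforce
  qed (use insert in auto)
  then show ?case by simp
qed

subsection \<open>From nice decompositions to tree decompositions\<close>

text \<open>Parents have smaller numbers than their children and the root is 0, so that acyclicity
  follows from the order of the numbers. Connectedness is encoded without paths: a vertex of
  \<open>S\<close> is passed on to every parent, a vertex of \<open>D\<close> to every parent up to
  a topmost node \<open>h\<close>. Edges inside \<open>S\<close> are in the root bag anyway.\<close>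

definition rooted_td ::
  "'a set set \<Rightarrow> nat \<Rightarrow> 'a set \<Rightarrow> 'a set \<Rightarrow> nat \<Rightarrow> (nat \<Rightarrow> nat) \<Rightarrow> (nat \<Rightarrow> 'a set) \<Rightarrow> bool" where
  "rooted_td E q S D m par X \<longleftrightarrow> 0 < m \<and> X 0 = S \<and> (\<forall>i. 0 < i \<and> i < m \<longrightarrow> par i < i)
    \<and> (\<forall>i<m. X i \<subseteq> S \<union> D \<and> card (X i) \<le> q)
    \<and> (\<forall>i v. 0 < i \<longrightarrow> i < m \<longrightarrow> v \<in> S \<longrightarrow> v \<in> X i \<longrightarrow> v \<in> X (par i))
    \<and> (\<forall>v\<in>D. \<exists>h<m. v \<in> X h \<and> (\<forall>i<m. v \<in> X i \<longrightarrow> i \<noteq> h \<longrightarrow> 0 < i \<and> v \<in> X (par i)))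
    \<and> (\<forall>x\<in>D. \<forall>y\<in>nbhd E x. \<exists>i<m. {x, y} \<subseteq> X i)"

text \<open>The root of the second tree, shifted to number \<open>m1\<close>, becomes a child of the
  root of the first. One construction serves three rules: a first tree with a single node forgets
  \<open>S2 - S1\<close> or introduces \<open>S1 - S2\<close>, and \<open>S1 = S2\<close> is a
  join.\<close>

lemma rooted_td_glue:
  assumes 1: "rooted_td E q S1 D1 m1 par1 X1" and 2: "rooted_td E q S2 D2 m2 par2 X2"
    and disj: "D1 \<inter> (D2 \<union> S2) = {}" "D2 \<inter> S1 = {}"
    and nbs: "\<And>x. x \<in> S2 - S1 \<Longrightarrow> nbhd E x \<subseteq> D2 \<union> S2"
  shows "\<exists>m par X. rooted_td E q S1 (D1 \<union> D2 \<union> (S2 - S1)) m par X"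
proof -
  define par where "par i = (if i < m1 then par1 i else if i = m1 then 0 else par2 (i - m1) + m1)" for i
  define X where "X i = (if i < m1 then X1 i else X2 (i - m1))" for i
  note d1 = 1[unfolded rooted_td_def] and d2 = 2[unfolded rooted_td_def]
  have Xl: "X i = X1 i" if "i < m1" for i using that by (simp add: X_def)
  have Xr: "X (m1 + i) = X2 i" for i by (simp add: X_def)
  have pl: "par i = par1 i" if "i < m1" for i using that by (simp add: par_def)
  have pr: "par (m1 + i) = m1 + par2 i" if "i > 0" for i using that by (simp add: par_def)
  have pm: "par m1 = 0" by (simp add: par_def)
  have split: "(\<forall>i<m1 + m2. P i) \<longleftrightarrow> (\<forall>i<m1. P i) \<and> (\<forall>i<m2. P (m1 + i))" for P :: "nat \<Rightarrow> bool"
  proof -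
    have "P i" if "\<forall>i<m1. P i" "\<forall>i<m2. P (m1 + i)" "i < m1 + m2" for i
    proof (cases "i < m1")
      case False
      then have "i - m1 < m2" using that(3) by linarith
      then have "P (m1 + (i - m1))" using that(2) by blast
      then show ?thesis using False by simp
    qed (use that in auto)
    then show ?thesis by auto
  qed
  have m1: "0 < m1" and m2: "0 < m2" using d1 d2 by auto
  have parlt: "par1 i < m1" if "0 < i" "i < m1" for i using d1 that by (meson order.strict_trans)
  have parlt2: "par2 i < m2" if "0 < i" "i < m2" for i using d2 that by (meson order.strict_trans)
  have X20: "X2 0 = S2" and X10: "X1 0 = S1" using d1 d2 by auto
  have sub1: "X1 i \<subseteq> S1 \<union> D1" if "i < m1" for i using d1 that by blast
  have sub2: "X2 i \<subseteq> S2 \<union> D2" if "i < m2" for i using d2 that by blast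
  have S1up: "v \<in> X1 (par1 i)" if "0 < i" "i < m1" "v \<in> S1" "v \<in> X1 i" for i v using d1 that by blast
  have S2up: "v \<in> X2 (par2 i)" if "0 < i" "i < m2" "v \<in> S2" "v \<in> X2 i" for i v using d2 that by blast
  have top1: "\<And>v. v \<in> D1 \<Longrightarrow> \<exists>h<m1. v \<in> X1 h \<and> (\<forall>i<m1. v \<in> X1 i \<longrightarrow> i \<noteq> h \<longrightarrow> 0 < i \<and> v \<in> X1 (par1 i))"
    using d1 by simp
  have top2: "\<And>v. v \<in> D2 \<Longrightarrow> \<exists>h<m2. v \<in> X2 h \<and> (\<forall>i<m2. v \<in> X2 i \<longrightarrow> i \<noteq> h \<longrightarrow> 0 < i \<and> v \<in> X2 (par2 i))"
    using d2 by simp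
  have ed1: "\<And>x y. x \<in> D1 \<Longrightarrow> y \<in> nbhd E x \<Longrightarrow> \<exists>i<m1. {x, y} \<subseteq> X1 i"
    using d1 by simp
  have ed2: "\<And>x y. x \<in> D2 \<Longrightarrow> y \<in> nbhd E x \<Longrightarrow> \<exists>i<m2. {x, y} \<subseteq> X2 i"
    using d2 by simp
  have "rooted_td E q S1 (D1 \<union> D2 \<union> (S2 - S1)) (m1 + m2) par X"
    unfolding rooted_td_def
  proof (intro conjI)
    show "0 < m1 + m2" using m1 by simp
    show "X 0 = S1" using m1 X10 by (simp add: X_def)
    have "\<forall>i<m1 + m2. 0 < i \<longrightarrow> par i < i"
      unfolding split
    proof (intro conjI allI impI)
      fix i assume "i < m1" "0 < i" then show "par i < i" using d1 by (simp add: pl)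
    next
      fix i assume "i < m2" "0 < m1 + i" then show "par (m1 + i) < m1 + i"
        using d2 m1 by (cases "i = 0") (auto simp: pr pm)
    qed
    then show "\<forall>i. 0 < i \<and> i < m1 + m2 \<longrightarrow> par i < i" by blast
    show "\<forall>i<m1 + m2. X i \<subseteq> S1 \<union> (D1 \<union> D2 \<union> (S2 - S1)) \<and> card (X i) \<le> q"
      unfolding split using d1 sub1 d2 sub2 by (auto simp: Xl Xr)
    have "\<forall>i<m1 + m2. \<forall>v. 0 < i \<longrightarrow> v \<in> S1 \<longrightarrow> v \<in> X i \<longrightarrow> v \<in> X (par i)"
      unfolding split
    proof (intro conjI allI impI)
      fix i v assume "i < m1" "0 < i" "v \<in> S1" "v \<in> X i"
      then show "v \<in> X (par i)" using S1up[of i v] parlt[of i] by (simp add: pl Xl)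
    next
      fix i v assume i: "i < m2" "v \<in> S1" "v \<in> X (m1 + i)"
      show "v \<in> X (par (m1 + i))"
      proof (cases "i = 0")
        case True then show ?thesis using i m1 X10 by (simp add: pm Xl)
      next
        case False
        have "v \<in> S2" using i sub2[of i] disj by (auto simp: Xr)
        then show ?thesis using S2up[of i v] i False by (simp add: pr Xr)
      qed
    qed
    then show "\<forall>i v. 0 < i \<longrightarrow> i < m1 + m2 \<longrightarrow> v \<in> S1 \<longrightarrow> v \<in> X i \<longrightarrow> v \<in> X (par i)" by blast
    show "\<forall>v\<in>D1 \<union> D2 \<union> (S2 - S1). \<exists>h<m1 + m2. v \<in> X h \<and>
      (\<forall>i<m1 + m2. v \<in> X i \<longrightarrow> i \<noteq> h \<longrightarrow> 0 < i \<and> v \<in> X (par i))"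
    proof
      fix v assume "v \<in> D1 \<union> D2 \<union> (S2 - S1)"
      then consider "v \<in> D1" | "v \<in> D2" | "v \<in> S2 - S1" "v \<notin> D1" by blast
      then show "\<exists>h<m1 + m2. v \<in> X h \<and> (\<forall>i<m1 + m2. v \<in> X i \<longrightarrow> i \<noteq> h \<longrightarrow> 0 < i \<and> v \<in> X (par i))"
      proof cases
        case 1
        obtain h where h: "h < m1" "v \<in> X1 h" "\<forall>i<m1. v \<in> X1 i \<longrightarrow> i \<noteq> h \<longrightarrow> 0 < i \<and> v \<in> X1 (par1 i)"
          using top1[OF 1] by blast
        have n2: "v \<notin> X2 i" if "i < m2" for i using sub2[OF that] 1 disj by blast
        show ?thesis
        proof (intro exI[of _ h] conjI)
          show "\<forall>i<m1 + m2. v \<in> X i \<longrightarrow> i \<noteq> h \<longrightarrow> 0 < i \<and> v \<in> X (par i)"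
            unfolding split using h(3) parlt n2 by (simp add: Xl Xr pl)
        qed (use h in \<open>auto simp: Xl\<close>)
      next
        case 2
        obtain h where h: "h < m2" "v \<in> X2 h" "\<forall>i<m2. v \<in> X2 i \<longrightarrow> i \<noteq> h \<longrightarrow> 0 < i \<and> v \<in> X2 (par2 i)"
          using top2[OF 2] by blast
        have n1: "v \<notin> X1 i" if "i < m1" for i using sub1[OF that] 2 disj by blast
        show ?thesis
        proof (intro exI[of _ "m1 + h"] conjI)
          show "\<forall>i<m1 + m2. v \<in> X i \<longrightarrow> i \<noteq> m1 + h \<longrightarrow> 0 < i \<and> v \<in> X (par i)"
            unfolding split using h(3) n1 by (simp add: Xl Xr pr)
        qed (use h in \<open>auto simp: Xr\<close>)
      next
        \<comment> \<open>Such a vertex occurs in no bag of the first tree, so its topmost node is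
          the grafted root \<open>m1\<close>.\<close>
        case 3
        have n1: "v \<notin> X1 i" if "i < m1" for i using sub1[OF that] 3 by blast
        have "0 < i \<and> v \<in> X2 (par2 i)" if "i < m2" "v \<in> X2 i" "i \<noteq> 0" for i
          using S2up[of i v] that 3 by simp
        then have up: "\<And>i. i < m2 \<Longrightarrow> v \<in> X2 i \<Longrightarrow> i \<noteq> 0 \<Longrightarrow> v \<in> X2 (par2 i)" by blast
        show ?thesis
        proof (intro exI[of _ m1] conjI)
          show "\<forall>i<m1 + m2. v \<in> X i \<longrightarrow> i \<noteq> m1 \<longrightarrow> 0 < i \<and> v \<in> X (par i)"
            unfolding split using n1 up by (simp add: Xl Xr pr)
        qed (use m2 3 X20 Xr[of 0] in auto)
      qed
    qed
    show "\<forall>x\<in>D1 \<union> D2 \<union> (S2 - S1). \<forall>y\<in>nbhd E x. \<exists>i<m1 + m2. {x, y} \<subseteq> X i"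
    proof (intro ballI)
      fix x y assume x: "x \<in> D1 \<union> D2 \<union> (S2 - S1)" and y: "y \<in> nbhd E x"
      have g1: "\<exists>i<m1 + m2. {x, y} \<subseteq> X i" if "\<exists>i<m1. {x, y} \<subseteq> X1 i"
      proof -
        from that obtain i where "i < m1" "{x, y} \<subseteq> X1 i" by blast
        then show ?thesis by (intro exI[of _ i]) (simp add: Xl)
      qed
      have g2: "\<exists>i<m1 + m2. {x, y} \<subseteq> X i" if "\<exists>i<m2. {x, y} \<subseteq> X2 i"
      proof -
        from that obtain i where "i < m2" "{x, y} \<subseteq> X2 i" by blast
        then show ?thesis by (intro exI[of _ "m1 + i"]) (simp add: Xr)
      qed
      consider "x \<in> D1" | "x \<in> D2" | "x \<in> S2 - S1" using x by blast
      then show "\<exists>i<m1 + m2. {x, y} \<subseteq> X i"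
      proof cases
        case 1 then show ?thesis using ed1[OF _ y] by (intro g1)
      next
        case 2 then show ?thesis using ed2[OF _ y] by (intro g2)
      next
        case 3
        then have "y \<in> D2 \<union> S2" using nbs y by blast
        moreover have "\<exists>i<m2. {y, x} \<subseteq> X2 i" if "y \<in> D2"
          using ed2[OF that, of x] y by (simp add: nbhd_sym)
        ultimately show ?thesis
          using 3 X20 m2 by (intro g2) (auto simp: insert_commute)
      qed
    qed
  qed
  then show ?thesis by blast
qed

lemma rooted_td_single: "card S \<le> q \<Longrightarrow> rooted_td E q S {} 1 id (\<lambda>_. S)"
  unfolding rooted_td_def by auto

lemma nice_dec_ptd: "nice_dec E q S D \<Longrightarrow> \<exists>m par X. rooted_td E q S D m par X"
proof (induction rule: nice_dec.induct)
  case (leaf S)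
  then show ?case using rooted_td_single by blast
next
  case (forget S D x)
  then obtain m par X where "rooted_td E q S D m par X" by blast
  moreover have "card (S - {x}) \<le> q" using nice_dec_inv[OF forget(1)]
    by (meson Diff_subset card_mono le_trans)
  moreover have "D \<inter> (S - {x}) = {}" using nice_dec_inv[OF forget(1)] by blast
  ultimately have "\<exists>m par X. rooted_td E q (S - {x}) ({} \<union> D \<union> (S - (S - {x}))) m par X"
    using forget.hyps by (intro rooted_td_glue[OF rooted_td_single]) auto
  moreover have "{} \<union> D \<union> (S - (S - {x})) = insert x D" using forget by auto
  ultimately show ?case by simp
next
  case (intro S D x)
  then obtain m par X where "rooted_td E q S D m par X" by blast
  moreover have "D \<inter> insert x S = {}" using nice_dec_inv[OF intro(1)] intro by blast
  ultimately have "\<exists>m par X. rooted_td E q (insert x S) ({} \<union> D \<union> (S - insert x S)) m par X"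
    using intro.hyps by (intro rooted_td_glue[OF rooted_td_single]) auto
  moreover have "{} \<union> D \<union> (S - insert x S) = D" by auto
  ultimately show ?case by simp
next
  case (join S D1 D2)
  then obtain m par X m' par' X' where "rooted_td E q S D1 m par X" "rooted_td E q S D2 m' par' X'" by blast
  moreover have "D1 \<inter> S = {}" "D2 \<inter> S = {}" using nice_dec_inv(4)[OF join(1)] nice_dec_inv(4)[OF join(2)] by blast+
  ultimately have "\<exists>m par X. rooted_td E q S (D1 \<union> D2 \<union> (S - S)) m par X"
    using join.hyps by (intro rooted_td_glue[of E q S D1 m par X S D2 m' par' X']) auto
  then show ?case by simp
qed

definition par_edges :: "nat \<Rightarrow> (nat \<Rightarrow> nat) \<Rightarrow> nat set set" where
  "par_edges m par = {{i, par i} | i. 0 < i \<and> i < m}"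

text \<open>Climbing to the parent stays in \<open>T\<close> and lowers the number until
  \<open>h\<close> is reached.\<close>

lemma par_connected:
  assumes par: "\<And>i. 0 < i \<Longrightarrow> i < m \<Longrightarrow> par i < i"
    and T: "T \<subseteq> {..<m}" "h \<in> T" and up: "\<And>i. i \<in> T \<Longrightarrow> i \<noteq> h \<Longrightarrow> 0 < i \<and> par i \<in> T"
  shows "connected_on (par_edges m par) T"
proof -
  let ?R = "{(x, y). x \<in> T \<and> y \<in> T \<and> {x, y} \<in> par_edges m par}"
  have to: "(i, h) \<in> ?R\<^sup>*" if "i \<in> T" for i
    using that
  proof (induction i rule: less_induct)
    case (less i)
    show ?case
    proof (cases "i = h")
      case False
      then have i: "0 < i" "i < m" "par i \<in> T" using up[of i] T less by auto
      then have "(i, par i) \<in> ?R" using less by (auto simp: par_edges_def)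
      moreover have "(par i, h) \<in> ?R\<^sup>*" using less i par by blast
      ultimately show ?thesis by (rule converse_rtrancl_into_rtrancl)
    qed simp
  qed
  have "sym ?R" by (auto simp: sym_def insert_commute)
  then have "sym (?R\<^sup>*)" by (rule sym_rtrancl)
  then have "(u, v) \<in> ?R\<^sup>*" if "u \<in> T" "v \<in> T" for u v
    using to[OF that(1)] to[OF that(2)] by (meson rtrancl_trans symD)
  then show ?thesis using T by (auto simp: connected_on_def)
qed

text \<open>In a cycle, both neighbours of the largest node would be its parent.\<close>

lemma par_acyclic:
  assumes par: "\<And>i. 0 < i \<Longrightarrow> i < m \<Longrightarrow> par i < i"
  shows "\<not> graph_cycle (par_edges m par) p"
proof
  assume "graph_cycle (par_edges m par) p"
  then have len: "length p \<ge> 3" and dist: "distinct p"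
    and e: "\<And>i. i < length p \<Longrightarrow> {p ! i, p ! (Suc i mod length p)} \<in> par_edges m par"
    by (auto simp: graph_cycle_def)
  let ?n = "length p"
  have "Max (set p) \<in> set p" using len by (intro Max_in) auto
  then obtain j where j: "j < ?n" "p ! j = Max (set p)" by (auto simp: in_set_conv_nth)
  have max: "p ! i \<le> p ! j" if "i < ?n" for i using that j by simp
  have nbr: "y = par x" if "{x, y} \<in> par_edges m par" "y \<le> x" for x y
  proof -
    obtain i where i: "0 < i" "i < m" "{x, y} = {i, par i}"
      using \<open>{x, y} \<in> par_edges m par\<close> by (auto simp: par_edges_def)
    then show ?thesis using par[OF i(1,2)] \<open>y \<le> x\<close> by (auto simp: doubleton_eq_iff)
  qed
  define a where "a = Suc j mod ?n"
  define b where "b = (if j = 0 then ?n - 1 else j - 1)"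
  have "0 < ?n" using len by linarith
  then have ab: "a < ?n" "b < ?n" using j by (auto simp: a_def b_def)
  have b': "Suc b mod ?n = j" using j len by (auto simp: b_def)
  \<comment> \<open>The successor \<open>a\<close> and the predecessor \<open>b\<close> of the
    largest node differ because a cycle has length at least 3.\<close>
  have "a \<noteq> b"
  proof (cases "Suc j < ?n")
    case True then show ?thesis using len by (auto simp: a_def b_def)
  next
    case False then have "Suc j = ?n" using j by simp
    then show ?thesis using len by (auto simp: a_def b_def)
  qed
  have "p ! a = par (p ! j)" using e[OF j(1)] max[OF ab(1)] nbr by (simp add: a_def)
  moreover have "p ! b = par (p ! j)"
    using e[OF ab(2)] max[OF ab(2)] nbr b' by (simp add: insert_commute)
  ultimately show False using dist ab \<open>a \<noteq> b\<close> by (metis nth_eq_iff_index_eq)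
qed

text \<open>With an empty root bag every vertex falls under the clauses for \<open>D\<close>, which
  supply covering, connectedness and edges at once.\<close>

lemma nice_dec_treewidth:
  fixes V :: "'a set"
  assumes G: "simple_graph V E" and nice_dec: "nice_dec E q {} V"
  shows "treewidth V E \<le> int q - 1"
proof -
  obtain m par and X :: "nat \<Rightarrow> 'a set" where P: "rooted_td E q {} V m par X" using nice_dec_ptd[OF nice_dec] by blast
  note d = P[unfolded rooted_td_def]
  have m: "0 < m" and par: "\<And>i. 0 < i \<Longrightarrow> i < m \<Longrightarrow> par i < i" using d by auto
  have top: "\<And>v. v \<in> V \<Longrightarrow> \<exists>h<m. v \<in> X h \<and> (\<forall>i<m. v \<in> X i \<longrightarrow> i \<noteq> h \<longrightarrow> 0 < i \<and> v \<in> X (par i))"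
    using d by simp
  have ed: "\<And>x y. x \<in> V \<Longrightarrow> y \<in> nbhd E x \<Longrightarrow> \<exists>i<m. {x, y} \<subseteq> X i"
    using d by simp
  let ?F = "par_edges m par"
  have edge: "\<exists>u v. e = {u, v} \<and> u \<in> V \<and> v \<in> V" if "e \<in> E" for e
    using G that unfolding simple_graph_def by blast
  have "tree_decomposition V E {..<m} ?F X"
    unfolding tree_decomposition_def is_tree_def
  proof (intro conjI)
    show "simple_graph {..<m} ?F"
      unfolding simple_graph_def
    proof (intro conjI ballI)
      fix e assume "e \<in> ?F"
      then obtain i where "0 < i" "i < m" "e = {i, par i}" by (auto simp: par_edges_def)
      moreover then have "par i < m" "par i \<noteq> i" using par[of i] by auto
      ultimately show "\<exists>u\<in>{..<m}. \<exists>v\<in>{..<m}. u \<noteq> v \<and> e = {u, v}"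
        by (intro bexI[of _ i] bexI[of _ "par i"]) auto
    qed simp
    show "connected_on ?F {..<m}"
    proof (rule par_connected[OF par, where h = 0])
      show "0 < i \<and> par i \<in> {..<m}" if "i \<in> {..<m}" "i \<noteq> 0" for i
        using that par[of i] by auto
    qed (use m in auto)
    show "\<nexists>p. graph_cycle ?F p" using par_acyclic[of m par] par by blast
    show "\<forall>i\<in>{..<m}. X i \<subseteq> V" using d by auto
    show "\<forall>v\<in>V. \<exists>i\<in>{..<m}. v \<in> X i" using top by blast
    show "\<forall>e\<in>E. \<exists>i\<in>{..<m}. e \<subseteq> X i"
    proof
      fix e assume e: "e \<in> E"
      then obtain u v where uv: "e = {u, v}" "u \<in> V" using edge by blast
      then have "v \<in> nbhd E u" using e by (simp add: nbhd_def insert_commute)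
      then have "\<exists>i<m. {u, v} \<subseteq> X i" using ed uv by simp
      then show "\<exists>i\<in>{..<m}. e \<subseteq> X i" using uv by auto
    qed
    show "\<forall>v\<in>V. connected_on ?F {i \<in> {..<m}. v \<in> X i}"
    proof
      fix v assume "v \<in> V"
      then obtain h where h: "h < m" "v \<in> X h" "\<forall>i<m. v \<in> X i \<longrightarrow> i \<noteq> h \<longrightarrow> 0 < i \<and> v \<in> X (par i)"
        using top by blast
      show "connected_on ?F {i \<in> {..<m}. v \<in> X i}"
      proof (rule par_connected[OF par, where h = h])
        fix i assume "i \<in> {i \<in> {..<m}. v \<in> X i}" "i \<noteq> h"
        then show "0 < i \<and> par i \<in> {i \<in> {..<m}. v \<in> X i}" using h par[of i] by auto
      qed (use h in auto)
    qed
  qed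
  then have "treewidth V E \<le> td_width {..<m} X" using treewidth_le[OF G] by blast
  also have "Max ((\<lambda>i. int (card (X i))) ` {..<m}) \<le> int q" using d m by (subst Max_le_iff) auto
  then have "td_width {..<m} X \<le> int q - 1" by (simp add: td_width_def)
  finally show ?thesis .
qed

subsection \<open>From tree decompositions to nice decompositions\<close>

definition tree_path :: "'i set set \<Rightarrow> 'i set \<Rightarrow> 'i list \<Rightarrow> bool" where
  "tree_path F I p \<longleftrightarrow> p \<noteq> [] \<and> distinct p \<and> set p \<subseteq> I \<and> (\<forall>i. Suc i < length p \<longrightarrow> {p ! i, p ! Suc i} \<in> F)"

text \<open>The end \<open>l\<close> of a longest path is a leaf: a neighbour off the path would
  prolong it, and a neighbour on the path other than the second vertex would close a cycle.\<close>

lemma tree_leaf: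
  assumes T: "is_tree I F" and card: "card I \<ge> 2"
  shows "\<exists>l\<in>I. \<exists>p\<in>I. l \<noteq> p \<and> {l, p} \<in> F \<and> (\<forall>y. {l, y} \<in> F \<longrightarrow> y = p)"
proof -
  have fin: "finite I" using T by (simp add: is_tree_def simple_graph_def)
  have edge: "x \<in> I \<and> y \<in> I \<and> x \<noteq> y" if "{x, y} \<in> F" for x y
    using T that by (auto simp: is_tree_def simple_graph_def doubleton_eq_iff)
  obtain x0 where "x0 \<in> I" using card by fastforce
  then have ex: "tree_path F I [x0]" by (simp add: tree_path_def)
  have bound: "length p \<le> card I" if "tree_path F I p" for p
    using that fin by (metis card_mono distinct_card tree_path_def)
  obtain p where p: "tree_path F I p" and max: "\<And>p'. tree_path F I p' \<Longrightarrow> length p' \<le> length p"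
    using ex_has_greatest_nat[where P = "tree_path F I" and k = "[x0]" and f = length and b = "Suc (card I)", OF ex]
      bound by (auto simp: less_Suc_eq_le)
  obtain l ps where lp: "p = l # ps" using p by (cases p) (auto simp: tree_path_def)
  have lI: "l \<in> I" using p lp by (simp add: tree_path_def)
  have inp: "y \<in> set p" if "{l, y} \<in> F" for y
  proof (rule ccontr)
    assume "y \<notin> set p"
    then have "tree_path F I (y # p)"
      using p that edge[OF that] lp by (auto simp: tree_path_def nth_Cons insert_commute split: nat.splits)
    then show False using max by fastforce
  qed
  obtain z where "z \<in> I" "z \<noteq> l"
    using card fin lI by (metis One_nat_def card_le_Suc0_iff_eq not_less_eq_eq numeral_2_eq_2)
  moreover have "(l, z) \<in> {(x, y). x \<in> I \<and> y \<in> I \<and> {x, y} \<in> F}\<^sup>*"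
    using T lI \<open>z \<in> I\<close> by (auto simp: is_tree_def connected_on_def)
  ultimately obtain y where y: "{l, y} \<in> F" by (auto elim: converse_rtranclE)
  have only: "y = ps ! 0" if y: "{l, y} \<in> F" for y
  proof (rule ccontr)
    assume ne: "y \<noteq> ps ! 0"
    obtain j where j: "j < length p" "p ! j = y" using inp[OF y] by (auto simp: in_set_conv_nth)
    have "j \<noteq> 0" using j lp edge[OF y] by (cases j) auto
    moreover have "j \<noteq> 1" using j ne lp by auto
    ultimately have j2: "j \<ge> 2" by simp
    have "graph_cycle F (take (Suc j) p)"
      unfolding graph_cycle_def
    proof (intro conjI allI impI)
      show "3 \<le> length (take (Suc j) p)" using j j2 by simp
      show "distinct (take (Suc j) p)" using p by (simp add: tree_path_def)
      fix i assume "i < length (take (Suc j) p)"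
      then have i: "i \<le> j" using j by simp
      have l: "length (take (Suc j) p) = Suc j" using j by simp
      show "{take (Suc j) p ! i, take (Suc j) p ! (Suc i mod length (take (Suc j) p))} \<in> F"
      proof (cases "i = j")
        case True
        have "take (Suc j) p ! j = y" using j by simp
        moreover have "take (Suc j) p ! 0 = l" using lp by simp
        ultimately show ?thesis using y True unfolding l by (simp add: insert_commute)
      next
        case False
        then show ?thesis using i j p unfolding l by (simp add: tree_path_def)
      qed
    qed
    then show False using T by (auto simp: is_tree_def)
  qed
  have "\<forall>y'. {l, y'} \<in> F \<longrightarrow> y' = y" using only[OF y] only by simp
  then show ?thesis using edge[OF y] y lI by blast
qed

text \<open>Retracting \<open>l\<close> onto its only neighbour \<open>p\<close> collapses the edges
  at \<open>l\<close> and keeps all others, so it turns a walk in \<open>S\<close> into a walk that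
  avoids \<open>l\<close>.\<close>

lemma connected_remove_leaf:
  assumes con: "connected_on F S" and ne: "S - {l} \<noteq> {}"
    and leaf: "\<And>y. {l, y} \<in> F \<Longrightarrow> y = p"
  shows "connected_on {e \<in> F. l \<notin> e} (S - {l})"
proof -
  let ?R = "{(x, y). x \<in> S \<and> y \<in> S \<and> {x, y} \<in> F}"
  let ?R' = "{(x, y). x \<in> S - {l} \<and> y \<in> S - {l} \<and> {x, y} \<in> {e \<in> F. l \<notin> e}}"
  define f where "f x = (if x = l then p else x)" for x
  have fstep: "(f x, f y) \<in> ?R'\<^sup>*" if "(x, y) \<in> ?R" for x y
  proof (cases "x = l \<or> y = l")
    case True
    then have "f x = f y" using that leaf[of x] leaf[of y] by (auto simp: f_def insert_commute)
    then show ?thesis by simp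
  next
    case False
    then show ?thesis using that by (intro r_into_rtrancl) (auto simp: f_def)
  qed
  have fsteps: "(f x, f y) \<in> ?R'\<^sup>*" if "(x, y) \<in> ?R\<^sup>*" for x y
    using that
  proof induction
    case (step y z)
    show ?case by (rule rtrancl_trans[OF step.IH fstep[OF step.hyps(2)]])
  qed simp
  have fR: "(x, y) \<in> ?R'\<^sup>*" if "x \<in> S - {l}" "y \<in> S - {l}" for x y
  proof -
    have "(x, y) \<in> ?R\<^sup>*" using con that by (simp add: connected_on_def)
    then have "(f x, f y) \<in> ?R'\<^sup>*" by (rule fsteps)
    then show ?thesis using that by (simp add: f_def)
  qed
  then show ?thesis using ne unfolding connected_on_def by blast
qed

text \<open>The first step of a walk from \<open>l\<close> to \<open>z\<close> can only lead to
  \<open>p\<close>.\<close>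

lemma connected_leaf_nb:
  assumes "connected_on F S" "l \<in> S" "z \<in> S" "z \<noteq> l" "\<And>y. {l, y} \<in> F \<Longrightarrow> y = p"
  shows "p \<in> S"
proof -
  have "(l, z) \<in> {(x, y). x \<in> S \<and> y \<in> S \<and> {x, y} \<in> F}\<^sup>*"
    using assms by (auto simp: connected_on_def)
  then show ?thesis using assms by (auto elim: converse_rtranclE)
qed

text \<open>
  Leaves of the tree are removed one by one. The subtrees removed so far that hang below node
  \<open>i\<close> have been turned into a nice decomposition with root bag \<open>X i\<close> and lower part \<open>A i\<close>.
\<close>

lemma tree_nd:
  fixes X A :: "'i \<Rightarrow> 'a set"
  assumes "is_tree I F" "card I = m"
    and "\<And>i. i \<in> I \<Longrightarrow> nice_dec E q (X i) (A i)"
    and "\<And>i j. i \<in> I \<Longrightarrow> j \<in> I \<Longrightarrow> A i \<inter> X j = {}"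
    and "\<And>i j. i \<in> I \<Longrightarrow> j \<in> I \<Longrightarrow> i \<noteq> j \<Longrightarrow> A i \<inter> A j = {}"
    and "\<And>v. v \<in> (\<Union>i\<in>I. X i) \<Longrightarrow> connected_on F {i \<in> I. v \<in> X i}"
    and "\<And>u v. v \<in> nbhd E u \<Longrightarrow> u \<notin> (\<Union>i\<in>I. A i) \<Longrightarrow> v \<notin> (\<Union>i\<in>I. A i) \<Longrightarrow> \<exists>i\<in>I. {u, v} \<subseteq> X i"
  shows "nice_dec E q {} ((\<Union>i\<in>I. X i) \<union> (\<Union>i\<in>I. A i))"
  using assms
proof (induction m arbitrary: I F A)
  case 0
  then show ?case by (auto simp: is_tree_def simple_graph_def connected_on_def)
next
  case (Suc m)
  note T = Suc.prems(1) and nds = Suc.prems(3) and AX = Suc.prems(4) and AA = Suc.prems(5)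
    and con = Suc.prems(6) and ed = Suc.prems(7)
  have fin: "finite I" using T by (simp add: is_tree_def simple_graph_def)
  show ?case
  proof (cases "m = 0")
    case True
    then obtain r where r: "I = {r}" using Suc.prems(2) by (auto simp: card_1_singleton_iff)
    have n: "nice_dec E q (X r) (A r)" using nds r by simp
    have "nice_dec E q (X r - X r) (A r \<union> X r)"
    proof (rule nice_dec_forget_many[OF n])
      fix x assume x: "x \<in> X r"
      show "nbhd E x \<subseteq> A r \<union> X r"
      proof
        fix y assume "y \<in> nbhd E x"
        then show "y \<in> A r \<union> X r" using ed[of y x] AX[of r r] r x by auto
      qed
    qed (use nice_dec_inv[OF n] in auto)
    then show ?thesis using r by (simp add: Un_commute)
  next
    case False
    then have c2: "card I \<ge> 2" using Suc.prems(2) by simp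
    obtain l p where lp: "l \<in> I" "p \<in> I" "l \<noteq> p" "{l, p} \<in> F"
      and only: "\<And>y. {l, y} \<in> F \<Longrightarrow> y = p"
      using tree_leaf[OF T c2] by blast
    \<comment> \<open>The vertices that occur in no remaining bag except that of the leaf: a second
      bag would force them into \<open>X p\<close> by connectedness. They can therefore be forgotten
      together with \<open>l\<close>.\<close>
    define W where "W = X l - X p"
    define A' where "A' = A(p := A p \<union> (A l \<union> W))"
    have Wonly: "i = l" if "i \<in> I" "x \<in> W" "x \<in> X i" for i x
    proof (rule ccontr)
      assume il: "i \<noteq> l"
      have "p \<in> {i \<in> I. x \<in> X i}"
      proof (rule connected_leaf_nb[where l = l and z = i and p = p, OF con _ _ _ only])
        show "x \<in> (\<Union>i\<in>I. X i)" "i \<in> {i \<in> I. x \<in> X i}" using that by auto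
        show "l \<in> {i \<in> I. x \<in> X i}" using that lp by (simp add: W_def)
      qed (use il in auto)
      then show False using that by (auto simp: W_def)
    qed
    have nl: "nice_dec E q (X l) (A l)" and np: "nice_dec E q (X p) (A p)" using nds lp by auto
    have WA: "x \<notin> A i" if "x \<in> W" "i \<in> I" for x i using that AX[of i l] lp by (auto simp: W_def)
    have nbW: "nbhd E x \<subseteq> A l \<union> X l" if x: "x \<in> W" for x
    proof
      fix y assume y: "y \<in> nbhd E x"
      show "y \<in> A l \<union> X l"
      proof (cases "y \<in> (\<Union>i\<in>I. A i)")
        case True
        then obtain j where j: "j \<in> I" "y \<in> A j" by blast
        then have "x \<in> A j \<union> X j" using nice_dec_inv(5)[OF nds[OF j(1)] j(2)] y by (auto simp: nbhd_sym)
        then have "j = l" using Wonly x j WA by blast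
        then show ?thesis using j by simp
      next
        case False
        then obtain i where "i \<in> I" "{x, y} \<subseteq> X i"
          using ed[of y x] y WA[OF x] by auto
        moreover then have "i = l" using Wonly x by blast
        ultimately show ?thesis by simp
      qed
    qed
    \<comment> \<open>Forgetting comes before introducing: the bag shrinks to
      \<open>X l \<inter> X p\<close> and then grows to \<open>X p\<close>, so it never exceeds the
      larger of the two.\<close>
    have "nice_dec E q (X l - W) (A l \<union> W)"
      using nbW nice_dec_inv(1)[OF nl] by (intro nice_dec_forget_many[OF nl]) (auto simp: W_def)
    then have "nice_dec E q ((X l - W) \<union> (X p - X l)) (A l \<union> W)"
    proof (rule nice_dec_intro_many)
      show "finite (X p - X l)" using nice_dec_inv[OF np] by simp
      show "(X p - X l) \<inter> (A l \<union> W) = {}" using AX[of l p] lp by (auto simp: W_def)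
      have "(X l - W) \<union> (X p - X l) = X p" by (auto simp: W_def)
      then show "card ((X l - W) \<union> (X p - X l)) \<le> q" using nice_dec_inv[OF np] by simp
    qed
    moreover have "(X l - W) \<union> (X p - X l) = X p" by (auto simp: W_def)
    ultimately have nlp: "nice_dec E q (X p) (A l \<union> W)" by simp
    have "nice_dec E q (X p) (A p \<union> (A l \<union> W))"
      using AA[of p l] WA lp by (intro nice_dec.join[OF np nlp]) auto
    then have nds': "nice_dec E q (X i) (A' i)" if "i \<in> I - {l}" for i
      using that nds by (simp add: A'_def)
    have "nice_dec E q {} ((\<Union>i\<in>I - {l}. X i) \<union> (\<Union>i\<in>I - {l}. A' i))"
    proof (rule Suc.IH[where F = "{e \<in> F. l \<notin> e}"])
      have "simple_graph (I - {l}) {e \<in> F. l \<notin> e}"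
        using T unfolding is_tree_def simple_graph_def by fastforce
      moreover have "connected_on {e \<in> F. l \<notin> e} (I - {l})"
        by (rule connected_remove_leaf[OF _ _ only]) (use T lp in \<open>auto simp: is_tree_def\<close>)
      moreover have "\<not> graph_cycle {e \<in> F. l \<notin> e} c" for c
        using T by (auto simp: is_tree_def graph_cycle_def)
      ultimately show "is_tree (I - {l}) {e \<in> F. l \<notin> e}" by (simp add: is_tree_def)
      show "card (I - {l}) = m" using Suc.prems(2) lp fin by simp
      show "A' i \<inter> X j = {}" if "i \<in> I - {l}" "j \<in> I - {l}" for i j
        using that AX lp Wonly[of j] by (auto simp: A'_def split: if_splits)
      show "A' i \<inter> A' j = {}" if "i \<in> I - {l}" "j \<in> I - {l}" "i \<noteq> j" for i j
        using that AA[of i j] AA[of l i] AA[of l j] lp WA by (auto simp: A'_def split: if_splits)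
      show "connected_on {e \<in> F. l \<notin> e} {i \<in> I - {l}. v \<in> X i}" if "v \<in> (\<Union>i\<in>I - {l}. X i)" for v
      proof -
        have "connected_on {e \<in> F. l \<notin> e} ({i \<in> I. v \<in> X i} - {l})"
          by (rule connected_remove_leaf[OF con _ only]) (use that in auto)
        moreover have "{i \<in> I. v \<in> X i} - {l} = {i \<in> I - {l}. v \<in> X i}" by auto
        ultimately show ?thesis by simp
      qed
      show "\<exists>i\<in>I - {l}. {u, v} \<subseteq> X i" if "v \<in> nbhd E u" "u \<notin> (\<Union>i\<in>I - {l}. A' i)"
        "v \<notin> (\<Union>i\<in>I - {l}. A' i)" for u v
      proof -
        have n: "u \<notin> A i \<and> v \<notin> A i" if "i \<in> I" for i
        proof (cases "i = l")
          case True
          then show ?thesis using \<open>u \<notin> _\<close> \<open>v \<notin> _\<close> lp by (auto simp: A'_def)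
        next
          case False
          then show ?thesis using \<open>u \<notin> _\<close> \<open>v \<notin> _\<close> that by (auto simp: A'_def split: if_splits)
        qed
        have w: "u \<notin> W" "v \<notin> W" using that lp by (auto simp: A'_def)
        obtain i where i: "i \<in> I" "{u, v} \<subseteq> X i" using ed[OF \<open>v \<in> nbhd E u\<close>] n by auto
        show ?thesis
        proof (cases "i = l")
          case True
          then have "{u, v} \<subseteq> X p" using i w by (auto simp: W_def)
          then show ?thesis using lp by auto
        qed (use i in auto)
      qed
    qed (use nds' in auto)
    moreover have "(\<Union>i\<in>I - {l}. X i) \<union> (\<Union>i\<in>I - {l}. A' i) = (\<Union>i\<in>I. X i) \<union> (\<Union>i\<in>I. A i)"
      using lp by (auto simp: A'_def W_def split: if_splits)
    ultimately show ?thesis by simp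
  qed
qed

text \<open>\<open>tree_nd\<close> is started with nothing removed: every node carries the one-leaf
  decomposition of its own bag, with empty lower part.\<close>

lemma treewidth_nd:
  fixes V :: "'a set"
  assumes G: "simple_graph V E" and tw: "treewidth V E \<le> int q - 1"
  shows "nice_dec E q {} V"
proof -
  obtain I :: "nat set" and F X where td: "tree_decomposition V E I F X" "td_width I X = treewidth V E"
    using treewidth_attained[OF G] by blast
  have T: "is_tree I F" and sub: "\<And>i. i \<in> I \<Longrightarrow> X i \<subseteq> V" and cov: "\<And>v. v \<in> V \<Longrightarrow> \<exists>i\<in>I. v \<in> X i"
    and ed: "\<And>e. e \<in> E \<Longrightarrow> \<exists>i\<in>I. e \<subseteq> X i" and con: "\<And>v. v \<in> V \<Longrightarrow> connected_on F {i \<in> I. v \<in> X i}"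
    using td by (auto simp: tree_decomposition_def)
  have fin: "finite I" using T by (simp add: is_tree_def simple_graph_def)
  have finV: "finite V" using G by (simp add: simple_graph_def)
  have leaf: "nice_dec E q (X i) {}" if "i \<in> I" for i
  proof (rule nice_dec.leaf)
    show "finite (X i)" using finV sub[OF that] finite_subset by blast
    have "int (card (X i)) \<le> Max ((\<lambda>i. int (card (X i))) ` I)"
      using that fin by (intro Max_ge) auto
    then show "card (X i) \<le> q" using td(2) tw by (simp add: td_width_def)
  qed
  have UV: "(\<Union>i\<in>I. X i) = V" using sub cov by blast
  have "nice_dec E q {} ((\<Union>i\<in>I. X i) \<union> (\<Union>i\<in>I. {}))"
  proof (rule tree_nd[OF T refl leaf])
    fix u v assume "v \<in> nbhd E u"
    then show "\<exists>i\<in>I. {u, v} \<subseteq> X i" using ed[of "{v, u}"] by (auto simp: nbhd_def insert_commute)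
  qed (use con UV in auto)
  then show ?thesis using UV by simp
qed

lemma nice_dec_iff_treewidth:
  "simple_graph V E \<Longrightarrow> nice_dec E q {} V \<longleftrightarrow> treewidth V E \<le> int q - 1"
  using nice_dec_treewidth treewidth_nd by blast

subsection \<open>States on a vertex cover\<close>

definition Jset :: "'a set set \<Rightarrow> 'a set \<Rightarrow> 'a set \<Rightarrow> 'a set \<Rightarrow> 'a set" where
  "Jset E I L B = {v \<in> I. nbhd E v \<inter> L \<noteq> {} \<and> \<not> nbhd E v \<subseteq> L \<union> B}"

text \<open>What the bag of a join node has to contain outside the cover: a vertex with a neighbour
  below may be absent only if one of the two children sees all its neighbours.\<close>

definition Jjoin :: "'a set set \<Rightarrow> 'a set \<Rightarrow> 'a set \<Rightarrow> 'a set \<Rightarrow> 'a set \<Rightarrow> 'a set" where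
  "Jjoin E I L1 L2 B = {v \<in> I. nbhd E v \<inter> (L1 \<union> L2) \<noteq> {} \<and> \<not> nbhd E v \<subseteq> L1 \<union> B \<and> \<not> nbhd E v \<subseteq> L2 \<union> B}"

text \<open>The independent vertices counted as lying strictly below. A vertex with all its
  neighbours in \<open>B\<close> is in neither \<open>Jset\<close> nor \<open>Dset\<close>; it is
  attached when its first neighbour is forgotten.\<close>

definition Dset :: "'a set set \<Rightarrow> 'a set \<Rightarrow> 'a set \<Rightarrow> 'a set \<Rightarrow> 'a set" where
  "Dset E I L B = {v \<in> I. nbhd E v \<inter> L \<noteq> {} \<and> nbhd E v \<subseteq> L \<union> B}"

text \<open>
  The trace of a nice decomposition on the vertex cover \<open>C\<close>: \<open>L\<close> is the part of \<open>C\<close> strictly below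
  a node and \<open>B\<close> the part of \<open>C\<close> in its bag. The part of the bag outside \<open>C\<close> need not be guessed:
  it can be taken to be the set \<open>Jset\<close> of the vertices with a neighbour in \<open>L\<close> and one in \<open>C - L - B\<close>.
\<close>

inductive good :: "'a set set \<Rightarrow> 'a set \<Rightarrow> 'a set \<Rightarrow> nat \<Rightarrow> 'a set \<Rightarrow> 'a set \<Rightarrow> bool" for E C I q where
  base: "B \<subseteq> C \<Longrightarrow> card B \<le> q \<Longrightarrow> good E C I q {} B"
| forget: "good E C I q L (insert c B) \<Longrightarrow> c \<notin> L \<Longrightarrow> c \<notin> B \<Longrightarrow>
    \<forall>x\<in>insert c L. nbhd E x \<inter> C \<subseteq> insert c L \<union> B \<Longrightarrow>
    card B + 1 + card (Jset E I (insert c L) B) \<le> q \<Longrightarrow>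
    \<forall>v\<in>I. nbhd E v \<subseteq> insert c B \<longrightarrow> card (nbhd E v) < q \<Longrightarrow> good E C I q (insert c L) B"
| intro: "good E C I q L B \<Longrightarrow> b \<in> C \<Longrightarrow> b \<notin> L \<Longrightarrow> b \<notin> B \<Longrightarrow>
    card B + 1 + card (Jset E I L B) \<le> q \<Longrightarrow> good E C I q L (insert b B)"
| join: "good E C I q L1 B \<Longrightarrow> good E C I q L2 B \<Longrightarrow> L1 \<noteq> {} \<Longrightarrow> L2 \<noteq> {} \<Longrightarrow> L1 \<inter> L2 = {} \<Longrightarrow>
    card B + card (Jjoin E I L1 L2 B) \<le> q \<Longrightarrow> good E C I q (L1 \<union> L2) B"

lemma good_inv:
  assumes "good E C I q L B"
  shows "L \<subseteq> C" "B \<subseteq> C" "L \<inter> B = {}" "\<And>x. x \<in> L \<Longrightarrow> nbhd E x \<inter> C \<subseteq> L \<union> B"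
proof -
  have "L \<subseteq> C \<and> B \<subseteq> C \<and> L \<inter> B = {} \<and> (\<forall>x\<in>L. nbhd E x \<inter> C \<subseteq> L \<union> B)"
    using assms by induction (simp_all, blast+)
  then show "L \<subseteq> C" "B \<subseteq> C" "L \<inter> B = {}" "\<And>x. x \<in> L \<Longrightarrow> nbhd E x \<inter> C \<subseteq> L \<union> B" by auto
qed

section \<open>Equivalence of good states and nice decompositions\<close>

locale covered_graph =
  fixes V :: "'a set" and E :: "'a set set" and C :: "'a set"
  assumes G: "simple_graph V E" and VC: "vertex_cover V E C"
begin

abbreviation "I \<equiv> V - C"

lemma finV: "finite V" using G by (simp add: simple_graph_def)
lemma CV: "C \<subseteq> V" using VC by (simp add: vertex_cover_def)
lemma finC: "finite C" using finite_subset[OF CV finV] .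
lemma nbV: "nbhd E v \<subseteq> V" using G by (auto simp: nbhd_def simple_graph_def doubleton_eq_iff)
lemma nbhd_irrefl: "v \<notin> nbhd E v" using G by (auto simp: nbhd_def simple_graph_def doubleton_eq_iff)
lemma nbI: "v \<in> I \<Longrightarrow> nbhd E v \<subseteq> C" using VC by (auto simp: nbhd_def vertex_cover_def)
lemma fin_nb: "finite (nbhd E v)" using finite_subset[OF nbV finV] .
lemma fin_J: "finite (Jset E I L B)" "finite (Jjoin E I L1 L2 B)" "finite (Dset E I L B)"
  using finV by (auto simp: Jset_def Jjoin_def Dset_def)

text \<open>The sizes tested by \<open>good\<close> are those of the largest bag passed through: at
  a forget, \<open>c\<close> and \<open>B\<close> together with the vertices that wait once
  \<open>c\<close> counts as below; at an introduction, \<open>b\<close> next to the old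
  \<open>Jset\<close>, before the finished vertices leave; at a join, \<open>B\<close> with
  \<open>Jjoin\<close>.\<close>

lemma good_nd:
  assumes "good E C I q L B"
  shows "nice_dec E q (B \<union> Jset E I L B) (L \<union> Dset E I L B)"
  using assms
proof induction
  case (base B)
  have "finite B" using finite_subset[OF base(1) finC] .
  then show ?case using base nice_dec.leaf[of B q E] by (simp add: Jset_def Dset_def)
next
  case (forget L c B)
  note gi = good_inv[OF forget(1)]
  have cC: "c \<in> C" using gi by auto
  have finB: "finite B" using finite_subset[OF _ finC] gi(2) by simp
  define L' where "L' = insert c L"
  define J1 where "J1 = Jset E I L' B"
  define S1 where "S1 = insert c B \<union> J1"
  define D0 where "D0 = L \<union> Dset E I L (insert c B)"
  \<comment> \<open>The neighbours of \<open>c\<close> outside the cover that are not yet below and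
    whose neighbours are all in the bag. Once \<open>c\<close> is gone they could no longer be
    attached.\<close>
  define Q where "Q = {v \<in> I. c \<in> nbhd E v \<and> nbhd E v \<subseteq> insert c B}"
  have finJ: "finite J1" by (simp add: J1_def fin_J)
  have sub: "Jset E I L (insert c B) \<subseteq> J1" by (auto simp: J1_def Jset_def L'_def)
  have "card S1 \<le> card (insert c B) + card J1" unfolding S1_def by (rule card_Un_le)
  also have "\<dots> \<le> q" using forget.hyps(5) finB forget.hyps(3) by (simp add: J1_def L'_def)
  finally have cS1: "card S1 \<le> q" .
  have fS1: "finite S1" using finJ finB by (simp add: S1_def)
  have "(insert c B \<union> Jset E I L (insert c B)) \<union> J1 = S1" using sub by (auto simp: S1_def)
  moreover have "J1 \<inter> D0 = {}" using gi by (auto simp: D0_def J1_def Jset_def Dset_def L'_def)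
  ultimately have n0: "nice_dec E q S1 D0"
    using nice_dec_intro_many[OF forget.IH finJ] cS1 by (simp add: D0_def)
  \<comment> \<open>Each vertex of \<open>Q\<close> gets a leaf of its own whose bag is the vertex
    with its neighbours; the degree condition of \<open>good.forget\<close> makes it fit.\<close>
  have nQ: "nice_dec E q S1 {v}" if v: "v \<in> Q" for v
  proof -
    have vI: "v \<in> I" "nbhd E v \<subseteq> insert c B" using v by (auto simp: Q_def)
    then have "card (nbhd E v) < q" using forget.hyps(6) by blast
    then have "nice_dec E q (insert v (nbhd E v)) {}"
      using fin_nb[of v] nbhd_irrefl[of v] by (intro nice_dec.leaf) auto
    from nice_dec.forget[OF this, of v] have "nice_dec E q (nbhd E v) {v}"
      using nbhd_irrefl[of v] by (auto simp: insert_absorb)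
    moreover have "v \<notin> S1" using vI cC gi by (auto simp: S1_def J1_def Jset_def L'_def)
    moreover have "nbhd E v \<union> S1 = S1" using vI by (auto simp: S1_def)
    ultimately show ?thesis using nice_dec_intro_many[of E q "nbhd E v" "{v}" S1] fS1 cS1 by simp
  qed
  have "finite Q" using finV by (simp add: Q_def)
  then have "nice_dec E q S1 (\<Union>v\<in>Q. {v})" using nQ fS1 cS1 by (intro nice_dec_union) auto
  moreover have "D0 \<inter> Q = {}" using gi by (auto simp: D0_def Q_def Dset_def)
  ultimately have "nice_dec E q S1 (D0 \<union> Q)" using nice_dec.join[OF n0, of Q] by simp
  moreover have "nbhd E c \<subseteq> (D0 \<union> Q) \<union> S1"
  proof
    fix y assume y: "y \<in> nbhd E c"
    show "y \<in> (D0 \<union> Q) \<union> S1"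
    proof (cases "y \<in> C")
      case True
      then have "y \<in> insert c L \<union> B" using forget.hyps(4) y by blast
      then show ?thesis by (auto simp: D0_def S1_def)
    next
      case False
      then have "y \<in> I" "c \<in> nbhd E y" using y nbV nbhd_sym by fastforce+
      then show ?thesis by (auto simp: D0_def S1_def Q_def J1_def Jset_def Dset_def L'_def)
    qed
  qed
  ultimately have n: "nice_dec E q (S1 - {c}) (insert c (D0 \<union> Q))"
    by (intro nice_dec.forget) (auto simp: S1_def)
  have "S1 - {c} = B \<union> J1" using forget.hyps(3) cC by (auto simp: S1_def J1_def Jset_def)
  moreover have "insert c (D0 \<union> Q) = L' \<union> Dset E I L' B"
    by (auto simp: D0_def Q_def Dset_def L'_def)
  ultimately show ?case using n by (simp add: L'_def J1_def)
next
  case (intro L B b)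
  note gi = good_inv[OF intro(1)]
  have finB: "finite B" using finite_subset[OF gi(2) finC] .
  let ?J0 = "Jset E I L B" and ?J1 = "Jset E I L (insert b B)"
  have sub: "?J1 \<subseteq> ?J0" by (auto simp: Jset_def)
  have "card (insert b (B \<union> ?J0)) \<le> card (insert b B) + card ?J0"
    using card_Un_le[of "insert b B" ?J0] by simp
  also have "\<dots> \<le> q" using intro finB by simp
  finally have "nice_dec E q (insert b (B \<union> ?J0)) (L \<union> Dset E I L B)"
    using intro.hyps intro.IH by (intro nice_dec.intro) (auto simp: Jset_def Dset_def)
  \<comment> \<open>For the vertices of \<open>?J0 - ?J1\<close>, \<open>b\<close> was the only
    neighbour still missing, so they can be forgotten now.\<close>
  then have n: "nice_dec E q (insert b (B \<union> ?J0) - (?J0 - ?J1)) ((L \<union> Dset E I L B) \<union> (?J0 - ?J1))"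
    by (rule nice_dec_forget_many[OF _ finite_Diff[OF fin_J(1)]]) (auto simp: Jset_def)
  have "insert b (B \<union> ?J0) - (?J0 - ?J1) = insert b B \<union> ?J1"
    using sub gi intro.hyps by (auto simp: Jset_def)
  moreover have "(L \<union> Dset E I L B) \<union> (?J0 - ?J1) = L \<union> Dset E I L (insert b B)"
    by (auto simp: Jset_def Dset_def)
  ultimately show ?case using n by simp
next
  case (join L1 B L2)
  note g1 = good_inv[OF join(1)] and g2 = good_inv[OF join(2)]
  have finB: "finite B" using finite_subset[OF g1(2) finC] .
  let ?J = "Jset E I (L1 \<union> L2) B" and ?J3 = "Jjoin E I L1 L2 B"
  have card: "card (B \<union> ?J3) \<le> q" using card_Un_le[of B ?J3] join by simp
  \<comment> \<open>A neighbour in \<open>L1\<close> lies neither in \<open>L2\<close> nor in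
    \<open>B\<close>, so the second child cannot have seen all neighbours of
    \<open>v\<close>.\<close>
  have s1: "Jset E I L1 B \<subseteq> ?J3"
  proof
    fix v assume v: "v \<in> Jset E I L1 B"
    then obtain y where "y \<in> nbhd E v" "y \<in> L1" by (auto simp: Jset_def)
    moreover then have "y \<notin> L2 \<union> B" using g1(3) join.hyps(5) by blast
    ultimately show "v \<in> ?J3" using v unfolding Jset_def Jjoin_def by blast
  qed
  have s2: "Jset E I L2 B \<subseteq> ?J3"
  proof
    fix v assume v: "v \<in> Jset E I L2 B"
    then obtain y where "y \<in> nbhd E v" "y \<in> L2" by (auto simp: Jset_def)
    moreover then have "y \<notin> L1 \<union> B" using g2(3) join.hyps(5) by blast
    ultimately show "v \<in> ?J3" using v unfolding Jset_def Jjoin_def by blast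
  qed
  have n1: "nice_dec E q ((B \<union> Jset E I L1 B) \<union> ?J3) (L1 \<union> Dset E I L1 B)"
  proof (rule nice_dec_intro_many[OF join.IH(1)])
    have "(B \<union> Jset E I L1 B) \<union> ?J3 = B \<union> ?J3" using s1 by blast
    then show "card ((B \<union> Jset E I L1 B) \<union> ?J3) \<le> q" using card by simp
  qed (use g1 fin_J in \<open>auto simp: Jjoin_def Dset_def\<close>)
  have n2: "nice_dec E q ((B \<union> Jset E I L2 B) \<union> ?J3) (L2 \<union> Dset E I L2 B)"
  proof (rule nice_dec_intro_many[OF join.IH(2)])
    have "(B \<union> Jset E I L2 B) \<union> ?J3 = B \<union> ?J3" using s2 by blast
    then show "card ((B \<union> Jset E I L2 B) \<union> ?J3) \<le> q" using card by simp
  qed (use g2 fin_J in \<open>auto simp: Jjoin_def Dset_def\<close>)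
  have e: "(B \<union> Jset E I L1 B) \<union> ?J3 = B \<union> ?J3" "(B \<union> Jset E I L2 B) \<union> ?J3 = B \<union> ?J3"
    using s1 s2 by blast+
  have "Dset E I L1 B \<inter> Dset E I L2 B = {}"
  proof -
    have False if v: "v \<in> Dset E I L1 B" "v \<in> Dset E I L2 B" for v
    proof -
      obtain y where "y \<in> nbhd E v" "y \<in> L1" using v(1) by (auto simp: Dset_def)
      moreover have "y \<in> L2 \<union> B" using v(2) \<open>y \<in> nbhd E v\<close> by (auto simp: Dset_def)
      ultimately show False using g1(3) join.hyps(5) by blast
    qed
    then show ?thesis by blast
  qed
  moreover have "L1 \<inter> Dset E I L2 B = {}" "L2 \<inter> Dset E I L1 B = {}"
    using g1(1) g2(1) by (auto simp: Dset_def)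
  ultimately have "(L1 \<union> Dset E I L1 B) \<inter> (L2 \<union> Dset E I L2 B) = {}"
    using join.hyps(5) by blast
  then have n12: "nice_dec E q (B \<union> ?J3) ((L1 \<union> Dset E I L1 B) \<union> (L2 \<union> Dset E I L2 B))"
    by (rule nice_dec.join[OF n1[unfolded e] n2[unfolded e]])
  \<comment> \<open>The vertices of \<open>?J3 - ?J\<close> have all their neighbours in
    \<open>L1 \<union> L2 \<union> B\<close>, but not on one side alone: they are finished exactly
    at the join.\<close>
  have "nice_dec E q ((B \<union> ?J3) - (?J3 - ?J)) (((L1 \<union> Dset E I L1 B) \<union> (L2 \<union> Dset E I L2 B)) \<union> (?J3 - ?J))"
    by (rule nice_dec_forget_many[OF n12 finite_Diff[OF fin_J(2)]]) (auto simp: Jset_def Jjoin_def)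
  moreover have "(B \<union> ?J3) - (?J3 - ?J) = B \<union> ?J"
    using g1 by (auto simp: Jset_def Jjoin_def)
  moreover have "((L1 \<union> Dset E I L1 B) \<union> (L2 \<union> Dset E I L2 B)) \<union> (?J3 - ?J)
      = (L1 \<union> L2) \<union> Dset E I (L1 \<union> L2) B"
    unfolding Jset_def Jjoin_def Dset_def by blast
  ultimately show ?case by simp
qed

text \<open>The second conjunct is carried along for the degree condition of
  \<open>good.forget\<close>: a forgotten vertex whose neighbours are all in the present bag shared
  a bag with all of them when it was forgotten, so its degree is less than \<open>q\<close>.\<close>

lemma nice_dec_good:
  assumes "nice_dec E q S D" "S \<union> D \<subseteq> V"
  shows "good E C I q (D \<inter> C) (S \<inter> C) \<and> (\<forall>v\<in>D - C. nbhd E v \<subseteq> S \<longrightarrow> card (nbhd E v) < q)"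
  using assms
proof induction
  case (leaf S)
  have "card (S \<inter> C) \<le> card S" using leaf by (intro card_mono) auto
  then show ?case using leaf good.base[of "S \<inter> C" C q E I] by simp
next
  case (forget S D x)
  note n = nice_dec_inv[OF forget(1)]
  have IH: "good E C I q (D \<inter> C) (S \<inter> C)" "\<And>v. v \<in> D - C \<Longrightarrow> nbhd E v \<subseteq> S \<Longrightarrow> card (nbhd E v) < q"
    using forget by auto
  have bag: "card (nbhd E v) < q" if "v \<in> S" "nbhd E v \<subseteq> S" for v
  proof -
    have "card (insert v (nbhd E v)) \<le> card S" using that n by (intro card_mono) auto
    then show ?thesis using n nbhd_irrefl[of v] fin_nb[of v] by simp
  qed
  have "\<forall>v\<in>insert x D - C. nbhd E v \<subseteq> S - {x} \<longrightarrow> card (nbhd E v) < q"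
    using IH(2) bag forget by blast
  moreover have "good E C I q (insert x D \<inter> C) ((S - {x}) \<inter> C)"
  proof (cases "x \<in> C")
    case False
    then have "insert x D \<inter> C = D \<inter> C" "(S - {x}) \<inter> C = S \<inter> C" by auto
    then show ?thesis using IH by simp
  next
    case True
    let ?L = "D \<inter> C" and ?B = "(S - {x}) \<inter> C"
    let ?J = "Jset E I (insert x ?L) ?B"
    have e: "S \<inter> C = insert x ?B" "insert x D \<inter> C = insert x ?L" using True forget by auto
    have nbx: "nbhd E x \<subseteq> D \<union> S" using forget by blast
    \<comment> \<open>A neighbour that is below, or is \<open>x\<close> itself, puts
      \<open>v\<close> into \<open>D \<union> S\<close>; a neighbour not seen yet keeps it out of
      \<open>D\<close>.\<close>
    have JS: "?J \<subseteq> S"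
    proof
      fix v assume v: "v \<in> ?J"
      then have "v \<in> I" and "\<exists>y\<in>insert x ?L. v \<in> nbhd E y" and no: "\<not> nbhd E v \<subseteq> D \<union> S"
        using nbI[of v] by (auto simp: Jset_def nbhd_sym)
      then have "v \<in> D \<union> S" using n(5) nbx by blast
      then show "v \<in> S" using n(5)[of v] no by blast
    qed
    have fB: "finite ?B" using n by simp
    have "card (insert x ?B \<union> ?J) = card (insert x ?B) + card ?J"
      using fB fin_J(1)[of "insert x ?L" ?B] True by (intro card_Un_disjoint) (auto simp: Jset_def)
    moreover have "card (insert x ?B \<union> ?J) \<le> card S"
      using JS forget n by (intro card_mono) auto
    ultimately have c1: "card ?B + 1 + card ?J \<le> q" using n fB by simp
    have "good E C I q (insert x ?L) ?B"
    proof (rule good.forget)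
      show "good E C I q ?L (insert x ?B)" using IH e by simp
      show "x \<notin> ?L" "x \<notin> ?B" using n forget by auto
      show "\<forall>y\<in>insert x ?L. nbhd E y \<inter> C \<subseteq> insert x ?L \<union> ?B" using n(5) nbx by blast
      show "card ?B + 1 + card ?J \<le> q" by (rule c1)
      show "\<forall>v\<in>I. nbhd E v \<subseteq> insert x ?B \<longrightarrow> card (nbhd E v) < q"
      proof (intro ballI impI)
        fix v assume v: "v \<in> I" "nbhd E v \<subseteq> insert x ?B"
        then have vS: "nbhd E v \<subseteq> S" using forget by auto
        show "card (nbhd E v) < q"
        \<comment> \<open>If \<open>x\<close> is a neighbour, then \<open>v\<close> is below or in
          the bag; if not, all neighbours are in \<open>?B\<close> and the size test already bounds
          their number.\<close>
        proof (cases "x \<in> nbhd E v")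
          case True
          then have "v \<in> D \<union> S" using nbx nbhd_sym by fast
          then show ?thesis using IH(2) bag vS v by blast
        next
          case False
          then have "card (nbhd E v) \<le> card ?B" using v fB by (intro card_mono) auto
          then show ?thesis using c1 by simp
        qed
      qed
    qed
    then show ?thesis using e by simp
  qed
  ultimately show ?case by blast
next
  case (intro S D x)
  note n = nice_dec_inv[OF intro(1)]
  have IH: "good E C I q (D \<inter> C) (S \<inter> C)" "\<And>v. v \<in> D - C \<Longrightarrow> nbhd E v \<subseteq> S \<Longrightarrow> card (nbhd E v) < q"
    using intro by auto
  have "\<forall>v\<in>D - C. nbhd E v \<subseteq> insert x S \<longrightarrow> card (nbhd E v) < q"
    using IH(2) n(5) intro by blast
  moreover have "good E C I q (D \<inter> C) (insert x S \<inter> C)"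
  proof (cases "x \<in> C")
    case False
    then show ?thesis using IH by simp
  next
    case True
    let ?J = "Jset E I (D \<inter> C) (S \<inter> C)"
    have JS: "?J \<subseteq> S"
    proof
      fix v assume v: "v \<in> ?J"
      then have "v \<in> I" and "\<exists>y\<in>D. v \<in> nbhd E y" and no: "\<not> nbhd E v \<subseteq> D \<union> S"
        using nbI[of v] by (auto simp: Jset_def nbhd_sym)
      then have "v \<in> D \<union> S" using n(5) by blast
      then show "v \<in> S" using n(5)[of v] no by blast
    qed
    have fB: "finite (S \<inter> C)" using n by simp
    have "card (insert x (S \<inter> C) \<union> ?J) = card (insert x (S \<inter> C)) + card ?J"
      using fB fin_J(1) True by (intro card_Un_disjoint) (auto simp: Jset_def)
    moreover have "card (insert x (S \<inter> C) \<union> ?J) \<le> card (insert x S)"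
      using JS n by (intro card_mono) auto
    ultimately have c1: "card (S \<inter> C) + 1 + card ?J \<le> q" using intro fB by simp
    have "good E C I q (D \<inter> C) (insert x (S \<inter> C))"
      using IH True intro c1 by (intro good.intro) auto
    then show ?thesis using True by simp
  qed
  ultimately show ?case by blast
next
  case (join S D1 D2)
  note n1 = nice_dec_inv[OF join(1)] and n2 = nice_dec_inv[OF join(2)]
  have IH: "good E C I q (D1 \<inter> C) (S \<inter> C)" "good E C I q (D2 \<inter> C) (S \<inter> C)"
    "\<forall>v\<in>(D1 \<union> D2) - C. nbhd E v \<subseteq> S \<longrightarrow> card (nbhd E v) < q"
    using join by auto
  have "good E C I q ((D1 \<union> D2) \<inter> C) (S \<inter> C)"
  proof (cases "D1 \<inter> C = {} \<or> D2 \<inter> C = {}")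
    case True
    then show ?thesis using IH by (auto simp: Int_Un_distrib2)
  next
    case False
    let ?J = "Jjoin E I (D1 \<inter> C) (D2 \<inter> C) (S \<inter> C)"
    have JS: "?J \<subseteq> S"
    proof
      fix v assume v: "v \<in> ?J"
      then have "v \<in> I" "\<exists>y\<in>D1 \<union> D2. v \<in> nbhd E y" and no: "\<not> nbhd E v \<subseteq> D1 \<union> S" "\<not> nbhd E v \<subseteq> D2 \<union> S"
        using nbI[of v] by (auto simp: Jjoin_def nbhd_sym)
      then have "v \<in> D1 \<union> D2 \<union> S" using n1(5) n2(5) by blast
      then show "v \<in> S" using n1(5)[of v] n2(5)[of v] no by blast
    qed
    have fB: "finite (S \<inter> C)" using n1 by simp
    have "card ((S \<inter> C) \<union> ?J) = card (S \<inter> C) + card ?J"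
      using fB fin_J(2) by (intro card_Un_disjoint) (auto simp: Jjoin_def)
    moreover have "card ((S \<inter> C) \<union> ?J) \<le> card S" using JS n1 by (intro card_mono) auto
    ultimately have "card (S \<inter> C) + card ?J \<le> q" using n1 by simp
    then have "good E C I q ((D1 \<inter> C) \<union> (D2 \<inter> C)) (S \<inter> C)"
      using IH False join.hyps by (intro good.join) auto
    then show ?thesis by (simp add: Int_Un_distrib2)
  qed
  then show ?case using IH by blast
qed

lemma good_iff_treewidth:
  assumes q: "1 \<le> q"
  shows "good E C I q C {} \<longleftrightarrow> treewidth V E \<le> int q - 1"
proof
  assume "good E C I q C {}"
  then have "nice_dec E q ({} \<union> Jset E I C {}) (C \<union> Dset E I C {})" by (rule good_nd)
  moreover have "Jset E I C {} = {}" using nbI by (auto simp: Jset_def)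
  ultimately have n: "nice_dec E q {} (C \<union> Dset E I C {})" by simp
  \<comment> \<open>Isolated vertices outside the cover are in no \<open>Dset\<close>; each is
    joined with a bag of its own, which needs \<open>1 \<le> q\<close>.\<close>
  define I0 where "I0 = {v \<in> I. nbhd E v = {}}"
  have "nice_dec E q {} {v}" if "v \<in> I0" for v
    using nice_dec.forget[OF nice_dec.leaf[of "{v}" q E], of v] that q by (simp add: I0_def)
  moreover have "finite I0" using finV by (simp add: I0_def)
  ultimately have "nice_dec E q {} (\<Union>v\<in>I0. {v})" by (intro nice_dec_union) auto
  then have "nice_dec E q {} (C \<union> Dset E I C {} \<union> I0)"
    using nice_dec.join[OF n, of I0] by (auto simp: I0_def Dset_def)
  moreover have "C \<union> Dset E I C {} \<union> I0 = V"
    using CV nbI by (auto simp: I0_def Dset_def)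
  ultimately show "treewidth V E \<le> int q - 1" using nice_dec_iff_treewidth[OF G] by simp
next
  assume "treewidth V E \<le> int q - 1"
  then have "nice_dec E q {} V" using nice_dec_iff_treewidth[OF G] by simp
  then have "good E C I q (V \<inter> C) ({} \<inter> C)" using nice_dec_good[of q "{}" V] by simp
  moreover have "V \<inter> C = C" using CV by auto
  ultimately show "good E C I q C {}" by simp
qed

end

subsection \<open>Ternary codes and the zeta transform\<close>

definition digit :: "nat \<Rightarrow> nat \<Rightarrow> nat" where
  "digit t p = (t div 3 ^ p) mod 3"

lemma digit_less: "digit t p < 3" by (simp add: digit_def)

lemma digit_cases: "digit t p = 0 \<or> digit t p = 1 \<or> digit t p = 2" using digit_less[of t p] by linarith

lemma add_div3: "x mod 3 + d < 3 \<Longrightarrow> (x + d) div 3 = x div 3" for x d :: nat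
proof -
  assume l: "x mod 3 + d < 3"
  have "x + d = (x mod 3 + d) + (x div 3) * 3" using mod_div_mult_eq[of x 3] by linarith
  then have "(x + d) div 3 = x div 3 + (x mod 3 + d) div 3" by (simp only: div_mult_self1[OF zero_neq_numeral[symmetric]])
  then show ?thesis using l by simp
qed

lemma add_mod3: "x mod 3 + d < 3 \<Longrightarrow> (x + d) mod 3 = x mod 3 + d" for x d :: nat
  by (metis mod_add_left_eq mod_less)

text \<open>A residue of at least \<open>d\<close> after the addition of \<open>d\<close> shows that
  there was no carry.\<close>

lemma add_mod3': "d \<le> (x + d) mod 3 \<Longrightarrow> (x + d) mod 3 = x mod 3 + d" for x d :: nat
proof -
  assume l: "d \<le> (x + d) mod 3"
  define y where "y = x mod 3"
  have e: "(x + d) mod 3 = (y + d) mod 3" by (simp add: y_def mod_add_left_eq)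
  have "(x + d) mod 3 < 3" by simp
  then have "d < 3" using l by linarith
  moreover have "y < 3" by (simp add: y_def)
  ultimately have "(y = 0 \<or> y = 1 \<or> y = 2) \<and> (d = 0 \<or> d = 1 \<or> d = 2)" by linarith
  then have "(y + d) mod 3 = y + d" using l unfolding e by (elim conjE disjE) simp_all
  then show ?thesis using e by (simp add: y_def)
qed

text \<open>Nothing is carried out of position \<open>p\<close>, so all higher digits
  survive.\<close>

lemma add_div_high:
  assumes "digit t p + d < 3" "p < r"
  shows "(t + d * 3 ^ p) div 3 ^ r = t div 3 ^ r"
proof -
  obtain j where r: "r = p + Suc j" using assms less_iff_Suc_add by auto
  have e: "(3::nat) ^ r = 3 ^ p * (3 * 3 ^ j)" by (simp add: r power_add)
  have "(t + d * 3 ^ p) div 3 ^ r = (t div 3 ^ p + d) div 3 div 3 ^ j"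
    by (simp add: e div_mult2_eq add.commute)
  also have "\<dots> = t div 3 ^ p div 3 div 3 ^ j" using add_div3[of "t div 3 ^ p" d] assms(1) by (simp add: digit_def)
  also have "\<dots> = t div 3 ^ r" by (simp add: e div_mult2_eq)
  finally show ?thesis .
qed

lemma digit_add:
  assumes "digit t p + d < 3"
  shows "digit (t + d * 3 ^ p) r = (if r = p then digit t p + d else digit t r)"
proof -
  consider "r < p" | "r = p" | "p < r" by linarith
  then show ?thesis
  proof cases
    case 1
    then obtain j where j: "p = r + Suc j" using less_iff_Suc_add by auto
    have e: "d * 3 ^ p = 3 * (d * 3 ^ j) * 3 ^ r" by (simp add: j power_add)
    have "(t + d * 3 ^ p) div 3 ^ r = (t + 3 * (d * 3 ^ j) * 3 ^ r) div 3 ^ r" by (simp only: e)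
    also have "\<dots> = 3 * (d * 3 ^ j) + t div 3 ^ r" by (rule div_mult_self1) simp
    finally have "(t + d * 3 ^ p) div 3 ^ r = 3 * (d * 3 ^ j) + t div 3 ^ r" .
    then show ?thesis using 1 by (simp add: digit_def)
  next
    case 2
    have "(t + d * 3 ^ p) div 3 ^ p = t div 3 ^ p + d" by simp
    then show ?thesis using 2 assms add_mod3[of "t div 3 ^ p" d] by (simp add: digit_def add.commute)
  next
    case 3
    then show ?thesis using add_div_high[OF assms 3] by (simp add: digit_def)
  qed
qed

lemma add_less:
  assumes "digit t p + d < 3" "p < k" "t < 3 ^ k"
  shows "t + d * 3 ^ p < 3 ^ k"
  using add_div_high[OF assms(1,2)] assms(3) by (simp add: div_eq_0_iff)

lemma digit_le: "d \<le> digit t p \<Longrightarrow> d * 3 ^ p \<le> t"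
proof -
  assume "d \<le> digit t p"
  then have "d \<le> t div 3 ^ p" by (metis digit_def le_trans mod_less_eq_dividend)
  then have "d * 3 ^ p \<le> t div 3 ^ p * 3 ^ p" by simp
  then show ?thesis using div_times_less_eq_dividend le_trans by blast
qed

lemma digit_sub:
  assumes "d \<le> digit t p"
  shows "digit (t - d * 3 ^ p) r = (if r = p then digit t p - d else digit t r)"
proof -
  let ?t = "t - d * 3 ^ p"
  have t: "t = ?t + d * 3 ^ p" using digit_le[OF assms] by simp
  then have "t div 3 ^ p = ?t div 3 ^ p + d"
    by (metis div_mult_self1 power_not_zero zero_neq_numeral add.commute)
  then have "digit t p = (?t div 3 ^ p + d) mod 3" by (simp add: digit_def)
  then have e: "digit t p = digit ?t p + d" using assms add_mod3'[of d "?t div 3 ^ p"] by (simp add: digit_def)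
  then have "digit ?t p + d < 3" using digit_less[of t p] by simp
  then show ?thesis using digit_add[of ?t p d r] t e by simp
qed

lemma digit_0_le: "t < 3 ^ p \<Longrightarrow> p \<le> r \<Longrightarrow> digit t r = 0"
proof -
  assume "t < 3 ^ p" "p \<le> r"
  then have "t < 3 ^ r" using power_increasing[of p r "3::nat"] by linarith
  then show ?thesis by (simp add: digit_def)
qed

lemma digits_exist:
  assumes "\<And>p. f p < 3"
  shows "\<exists>t < 3 ^ k. \<forall>p<k. digit t p = f p"
proof (induction k)
  case (Suc k)
  then obtain t where t: "t < 3 ^ k" "\<forall>p<k. digit t p = f p" by blast
  have 0: "digit t k = 0" using t digit_0_le by blast
  then have a: "digit (t + f k * 3 ^ k) p = (if p = k then f k else digit t p)" for p
    using digit_add[of t k "f k" p] assms by simp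
  have "t + f k * 3 ^ k < 3 ^ Suc k"
    using 0 assms[of k] t by (intro add_less) auto
  then show ?case using a t by (intro exI[of _ "t + f k * 3 ^ k"]) (auto simp: less_Suc_eq)
qed auto

lemma digits_inj:
  assumes "t < 3 ^ k" "u < 3 ^ k" "\<And>p. p < k \<Longrightarrow> digit t p = digit u p"
  shows "t = u"
  using assms
proof (induction k arbitrary: t u)
  case (Suc k)
  have "t div 3 = u div 3"
  proof (rule Suc.IH)
    show "t div 3 < 3 ^ k" "u div 3 < 3 ^ k" using Suc.prems by auto
    show "digit (t div 3) p = digit (u div 3) p" if "p < k" for p
      using Suc.prems(3)[of "Suc p"] that by (simp add: digit_def div_mult2_eq)
  qed
  moreover have "t mod 3 = u mod 3" using Suc.prems(3)[of 0] by (simp add: digit_def)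
  ultimately show ?case by (metis div_mult_mod_eq)
qed simp

text \<open>The first \<open>j\<close> digits have been processed; digit \<open>1\<close> may be lowered to \<open>0\<close>, digit \<open>2\<close> is kept.\<close>

fun zeta :: "nat \<Rightarrow> (nat \<Rightarrow> int) \<Rightarrow> nat \<Rightarrow> int" where
  "zeta 0 f t = f t"
| "zeta (Suc j) f t = zeta j f t + (if digit t j = 1 then zeta j f (t - 3 ^ j) else 0)"

definition zset :: "nat \<Rightarrow> nat \<Rightarrow> nat \<Rightarrow> nat set" where
  "zset k j t = {t'. t' < 3 ^ k \<and> (\<forall>p<k. digit t' p = digit t p \<or> p < j \<and> digit t p = 1 \<and> digit t' p = 0)}"

lemma zeta_zset:
  assumes "j \<le> k" "t < 3 ^ k"
  shows "zeta j f t = sum f (zset k j t)"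
  using assms
proof (induction j arbitrary: t)
  case 0
  have "zset k 0 t = {t}" using 0 digits_inj[of _ k t] by (auto simp: zset_def)
  then show ?case by simp
next
  case (Suc j)
  show ?case
  proof (cases "digit t j = 1")
    case False
    then have "zset k (Suc j) t = zset k j t" by (auto simp: zset_def less_Suc_eq)
    then show ?thesis using False Suc by simp
  next
    case True
    have d: "digit (t - 3 ^ j) r = (if r = j then 0 else digit t r)" for r
      using digit_sub[of 1 t j r] True by simp
    have z: "zset k (Suc j) t = zset k j t \<union> zset k j (t - 3 ^ j)"
      using True Suc.prems unfolding zset_def d by (auto simp: less_Suc_eq)
    have dis: "zset k j t \<inter> zset k j (t - 3 ^ j) = {}"
    proof -
      have False if u: "u \<in> zset k j t" "u \<in> zset k j (t - 3 ^ j)" for u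
      proof -
        have "j < k" using Suc.prems by simp
        then have "digit u j = digit t j" "digit u j = digit (t - 3 ^ j) j"
          using u unfolding zset_def by blast+
        then show False using True d[of j] by simp
      qed
      then show ?thesis by blast
    qed
    have fin: "finite (zset k j u)" for u
      by (rule finite_subset[of _ "{..<3 ^ k}"]) (auto simp: zset_def)
    have "zeta (Suc j) f t = zeta j f t + zeta j f (t - 3 ^ j)" using True by simp
    also have "\<dots> = sum f (zset k j t) + sum f (zset k j (t - 3 ^ j))" using Suc by simp
    also have "\<dots> = sum f (zset k (Suc j) t)"
      unfolding z by (rule sum.union_disjoint[OF fin fin dis, symmetric])
    finally show ?thesis .
  qed
qed

lemma zeta_bounds:
  assumes "\<And>t. 0 \<le> f t \<and> f t \<le> F"
  shows "0 \<le> zeta j f t \<and> zeta j f t \<le> 2 ^ j * F"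
proof (induction j arbitrary: t)
  case (Suc j)
  have "0 \<le> F" using assms[of 0] by linarith
  then have "0 \<le> 2 ^ j * F" by simp
  then show ?case using Suc[of t] Suc[of "t - 3 ^ j"] by (auto simp: algebra_simps)
qed (use assms in simp)

text \<open>Reduces the size bounds for all partial transforms to a bound for the last one.\<close>

lemma zeta_mono:
  assumes "\<And>t. 0 \<le> f t" "i \<le> j"
  shows "0 \<le> zeta i f t \<and> zeta i f t \<le> zeta j f t"
proof -
  have nn: "0 \<le> zeta j f t" for j t
    by (induction j arbitrary: t) (auto simp: assms)
  have "zeta j f t \<le> zeta (Suc j) f t" for j using nn by auto
  then have "zeta i f t \<le> zeta j f t" using assms(2) by (rule lift_Suc_mono_le)
  then show ?thesis using nn by simp
qed

section \<open>Coding of the states and the one-step operator\<close>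

locale dp = covered_graph "{..<n}" E C for n :: nat and E C +
  fixes k :: nat and cl :: "nat \<Rightarrow> nat"
  assumes cl: "bij_betw cl {..<k} C"
begin

definition Ls :: "nat \<Rightarrow> nat set" where "Ls t = cl ` {p. p < k \<and> digit t p = 1}"
definition Bs :: "nat \<Rightarrow> nat set" where "Bs t = cl ` {p. p < k \<and> digit t p = 2}"

lemma cl_inj: "p < k \<Longrightarrow> r < k \<Longrightarrow> cl p = cl r \<longleftrightarrow> p = r"
  using cl by (auto simp: bij_betw_def inj_on_def)

lemma cl_C: "cl ` {..<k} = C" using cl by (simp add: bij_betw_def)

lemma cl_in: "p < k \<Longrightarrow> cl p \<in> C" using cl_C by blast

lemma in_Ls: "p < k \<Longrightarrow> cl p \<in> Ls t \<longleftrightarrow> digit t p = 1"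
  using cl_inj by (auto simp: Ls_def)

lemma in_Bs: "p < k \<Longrightarrow> cl p \<in> Bs t \<longleftrightarrow> digit t p = 2"
  using cl_inj by (auto simp: Bs_def)

lemma LsC: "Ls t \<subseteq> C" and BsC: "Bs t \<subseteq> C" and LB: "Ls t \<inter> Bs t = {}"
  using cl_C cl_inj by (auto simp: Ls_def Bs_def)

lemma fin_LB: "finite (Ls t)" "finite (Bs t)" by (auto simp: Ls_def Bs_def)

lemma kC: "k = card C" using cl bij_betw_same_card by fastforce

lemma k_le_n: "k \<le> n" using kC card_mono[OF finV CV] by simp

lemma set_eq_C: "A \<subseteq> C \<Longrightarrow> B \<subseteq> C \<Longrightarrow> A = B \<longleftrightarrow> (\<forall>p<k. cl p \<in> A \<longleftrightarrow> cl p \<in> B)"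
  using cl_C by blast

lemma code_exists:
  assumes "L \<subseteq> C" "B \<subseteq> C" "L \<inter> B = {}"
  obtains t where "t < 3 ^ k" "Ls t = L" "Bs t = B"
proof -
  define f :: "nat \<Rightarrow> nat" where "f p = (if cl p \<in> L then 1 else if cl p \<in> B then 2 else 0)" for p
  have "f p < 3" for p by (simp add: f_def)
  then obtain t where t: "t < 3 ^ k" "\<forall>p<k. digit t p = f p"
    using digits_exist[of f k] by blast
  have "Ls t = L"
    unfolding set_eq_C[OF LsC assms(1)] using t(2) by (auto simp: in_Ls f_def)
  moreover have "Bs t = B"
    unfolding set_eq_C[OF BsC assms(2)] using t(2) assms(3) by (auto simp: in_Bs f_def)
  ultimately show thesis using that t(1) by blast
qed

lemma code_inj:
  assumes "t < 3 ^ k" "u < 3 ^ k" "Ls t = Ls u" "Bs t = Bs u"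
  shows "t = u"
proof (rule digits_inj[OF assms(1,2)])
  fix p assume "p < k"
  then show "digit t p = digit u p"
    using in_Ls[of p t] in_Ls[of p u] in_Bs[of p t] in_Bs[of p u] assms digit_cases[of t p] digit_cases[of u p]
    by auto
qed

text \<open>In the state before the forget, \<open>cl p\<close> is in the bag: digit 1 becomes 2,
  which is the addition of \<open>3 ^ p\<close>.\<close>

lemma forget_code:
  assumes "p < k" "digit t p = 1"
  shows "Ls t = insert (cl p) (Ls (t + 3 ^ p))" "cl p \<notin> Ls (t + 3 ^ p)"
    "Bs (t + 3 ^ p) = insert (cl p) (Bs t)" "cl p \<notin> Bs t"
proof -
  have d: "digit (t + 3 ^ p) r = (if r = p then 2 else digit t r)" for r
    using digit_add[of t p 1 r] assms by simp
  have c: "insert (cl p) (Ls (t + 3 ^ p)) \<subseteq> C" "insert (cl p) (Bs t) \<subseteq> C"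
    using LsC BsC cl_in[OF assms(1)] by auto
  show "Ls t = insert (cl p) (Ls (t + 3 ^ p))"
    unfolding set_eq_C[OF LsC c(1)] using assms cl_inj by (auto simp: in_Ls d)
  show "cl p \<notin> Ls (t + 3 ^ p)" using assms by (simp add: in_Ls d)
  show "Bs (t + 3 ^ p) = insert (cl p) (Bs t)"
    unfolding set_eq_C[OF BsC c(2)] using assms cl_inj by (auto simp: in_Bs d)
  show "cl p \<notin> Bs t" using assms by (simp add: in_Bs)
qed

text \<open>In the state before the introduction, \<open>cl p\<close> has not been seen: digit 2
  becomes 0.\<close>

lemma intro_code:
  assumes "p < k" "digit t p = 2"
  shows "Ls (t - 2 * 3 ^ p) = Ls t" "cl p \<notin> Ls t"
    "Bs t = insert (cl p) (Bs (t - 2 * 3 ^ p))" "cl p \<notin> Bs (t - 2 * 3 ^ p)"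
proof -
  have d: "digit (t - 2 * 3 ^ p) r = (if r = p then 0 else digit t r)" for r
    using digit_sub[of 2 t p r] assms by simp
  have c: "insert (cl p) (Bs (t - 2 * 3 ^ p)) \<subseteq> C"
    using BsC cl_in[OF assms(1)] by auto
  show "Ls (t - 2 * 3 ^ p) = Ls t"
    unfolding set_eq_C[OF LsC LsC] using assms by (auto simp: in_Ls d)
  show "cl p \<notin> Ls t" using assms by (simp add: in_Ls)
  show "Bs t = insert (cl p) (Bs (t - 2 * 3 ^ p))"
    unfolding set_eq_C[OF BsC c] using assms cl_inj by (auto simp: in_Bs d)
  show "cl p \<notin> Bs (t - 2 * 3 ^ p)" using assms by (simp add: in_Bs d)
qed

definition vl :: "nat \<Rightarrow> nat" where "vl t = card (Ls t)"
definition vb :: "nat \<Rightarrow> nat" where "vb t = card (Bs t)"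
definition vj :: "nat \<Rightarrow> nat" where "vj t = card (Jset E I (Ls t) (Bs t))"
definition va :: "nat \<Rightarrow> nat" where "va t = card (Dset E I (Ls t) (Bs t))"
definition okE :: "nat \<Rightarrow> bool" where "okE t \<longleftrightarrow> (\<forall>x\<in>Ls t. nbhd E x \<inter> C \<subseteq> Ls t \<union> Bs t)"
definition okD :: "nat \<Rightarrow> nat \<Rightarrow> bool" where
  "okD q t \<longleftrightarrow> (\<forall>v\<in>I. nbhd E v \<subseteq> Bs t \<longrightarrow> card (nbhd E v) < q)"

definition joins :: "nat \<Rightarrow> nat \<Rightarrow> nat \<Rightarrow> bool" where
  "joins t t1 t2 \<longleftrightarrow> Bs t1 = Bs t \<and> Bs t2 = Bs t \<and> Ls t1 \<union> Ls t2 = Ls t"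

text \<open>The rules of \<open>good\<close> read on codes. The join rule is written additively in
  \<open>va t1\<close> and \<open>va t2\<close>, the form that the convolution can test;
  \<open>join_iff\<close> translates it back.\<close>

definition stepp :: "nat \<Rightarrow> nat set \<Rightarrow> nat \<Rightarrow> bool" where
  "stepp q G t \<longleftrightarrow> (vl t = 0 \<and> vb t \<le> q)
    \<or> (\<exists>p<k. digit t p = 1 \<and> t + 3 ^ p \<in> G \<and> okE t \<and> vb t + 1 + vj t \<le> q \<and> okD q (t + 3 ^ p))
    \<or> (\<exists>p<k. digit t p = 2 \<and> t - 2 * 3 ^ p \<in> G \<and> vb t + vj (t - 2 * 3 ^ p) \<le> q)
    \<or> (\<exists>t1\<in>G. \<exists>t2\<in>G. joins t t1 t2 \<and> Ls t1 \<inter> Ls t2 = {}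
          \<and> vb t + va t + vj t \<le> va t1 + va t2 + q)"

definition Goods :: "nat \<Rightarrow> nat set" where
  "Goods q = {t. t < 3 ^ k \<and> good E C I q (Ls t) (Bs t)}"

text \<open>Both sides count the vertices outside the cover with a neighbour in
  \<open>L1 \<union> L2\<close>. On the left each is finished in one of the children or kept in the
  bag of the join; on the right it is finished or waiting for the joined state.\<close>

lemma card_Jjoin:
  assumes "L1 \<inter> L2 = {}" "L1 \<inter> B = {}" "L2 \<inter> B = {}"
  shows "card (Jjoin E I L1 L2 B) + card (Dset E I L1 B) + card (Dset E I L2 B)
    = card (Dset E I (L1 \<union> L2) B) + card (Jset E I (L1 \<union> L2) B)"
proof -
  have d12: "Dset E I L1 B \<inter> Dset E I L2 B = {}"
  proof -
    have False if v: "v \<in> Dset E I L1 B" "v \<in> Dset E I L2 B" for v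
    proof -
      obtain y where "y \<in> nbhd E v" "y \<in> L1" using v(1) by (auto simp: Dset_def)
      moreover have "y \<in> L2 \<union> B" using v(2) \<open>y \<in> nbhd E v\<close> by (auto simp: Dset_def)
      ultimately show False using assms by blast
    qed
    then show ?thesis by blast
  qed
  have dj: "Jjoin E I L1 L2 B \<inter> (Dset E I L1 B \<union> Dset E I L2 B) = {}"
    by (auto simp: Jjoin_def Dset_def)
  have "Jjoin E I L1 L2 B \<union> (Dset E I L1 B \<union> Dset E I L2 B)
    = Dset E I (L1 \<union> L2) B \<union> Jset E I (L1 \<union> L2) B" (is "?A = ?B")
  proof
    show "?A \<subseteq> ?B" by (auto simp: Jjoin_def Dset_def Jset_def)
    show "?B \<subseteq> ?A"
    proof
      fix v assume "v \<in> ?B"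
      then have v: "v \<in> I" "nbhd E v \<inter> (L1 \<union> L2) \<noteq> {}" by (auto simp: Dset_def Jset_def)
      have "nbhd E v \<inter> L1 \<noteq> {}" if "nbhd E v \<subseteq> L1 \<union> B" using that v(2) assms by blast
      moreover have "nbhd E v \<inter> L2 \<noteq> {}" if "nbhd E v \<subseteq> L2 \<union> B" using that v(2) assms by blast
      ultimately show "v \<in> ?A" using v unfolding Jjoin_def Dset_def by blast
    qed
  qed
  moreover have "Dset E I (L1 \<union> L2) B \<inter> Jset E I (L1 \<union> L2) B = {}" by (auto simp: Dset_def Jset_def)
  ultimately show ?thesis
    using d12 dj card_Un_disjoint[of "Jjoin E I L1 L2 B" "Dset E I L1 B \<union> Dset E I L2 B"]
      card_Un_disjoint[of "Dset E I L1 B" "Dset E I L2 B"]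
      card_Un_disjoint[of "Dset E I (L1 \<union> L2) B" "Jset E I (L1 \<union> L2) B"] fin_J
    by simp
qed

lemma join_iff:
  assumes "joins t t1 t2" "Ls t1 \<inter> Ls t2 = {}"
  shows "vb t + va t + vj t \<le> va t1 + va t2 + q \<longleftrightarrow>
    card (Bs t) + card (Jjoin E I (Ls t1) (Ls t2) (Bs t)) \<le> q"
  using card_Jjoin[OF assms(2), of "Bs t"] assms LB[of t1] LB[of t2]
  by (auto simp: joins_def vb_def va_def vj_def)

lemma step_sound:
  assumes G: "G \<subseteq> Goods q" and t: "t < 3 ^ k" and s: "stepp q G t"
  shows "t \<in> Goods q"
proof -
  from s consider
    "vl t = 0" "vb t \<le> q"
  | p where "p < k" "digit t p = 1" "t + 3 ^ p \<in> G" "okE t" "vb t + 1 + vj t \<le> q" "okD q (t + 3 ^ p)"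
  | p where "p < k" "digit t p = 2" "t - 2 * 3 ^ p \<in> G" "vb t + vj (t - 2 * 3 ^ p) \<le> q"
  | t1 t2 where "t1 \<in> G" "t2 \<in> G" "joins t t1 t2" "Ls t1 \<inter> Ls t2 = {}"
      "vb t + va t + vj t \<le> va t1 + va t2 + q"
    unfolding stepp_def by (elim disjE exE bexE conjE) metis+
  then have "good E C I q (Ls t) (Bs t)"
  proof cases
    case 1
    then show ?thesis using good.base[of "Bs t" C q E I] BsC fin_LB by (simp add: vl_def vb_def)
  next
    case 2
    note f = forget_code[OF 2(1,2)]
    have "good E C I q (insert (cl p) (Ls (t + 3 ^ p))) (Bs t)"
    proof (rule good.forget)
      show "good E C I q (Ls (t + 3 ^ p)) (insert (cl p) (Bs t))" using 2 G f by (auto simp: Goods_def)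
    qed (use 2 f in \<open>auto simp: okE_def okD_def vb_def vj_def\<close>)
    then show ?thesis using f by simp
  next
    case 3
    note f = intro_code[OF 3(1,2)]
    have c: "card (Bs t) = card (Bs (t - 2 * 3 ^ p)) + 1" using f(3,4) fin_LB by simp
    have "good E C I q (Ls t) (insert (cl p) (Bs (t - 2 * 3 ^ p)))"
    proof (rule good.intro)
      show "good E C I q (Ls t) (Bs (t - 2 * 3 ^ p))" using 3 G f by (auto simp: Goods_def)
      show "card (Bs (t - 2 * 3 ^ p)) + 1 + card (Jset E I (Ls t) (Bs (t - 2 * 3 ^ p))) \<le> q"
        using 3 c f(1) by (simp add: vb_def vj_def)
    qed (use 3 f cl_in in auto)
    then show ?thesis using f(3) by simp
  next
    case 4
    have g: "good E C I q (Ls t1) (Bs t)" "good E C I q (Ls t2) (Bs t)" and e: "Ls t = Ls t1 \<union> Ls t2"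
      using 4 G by (auto simp: Goods_def joins_def)
    show ?thesis
    proof (cases "Ls t1 = {} \<or> Ls t2 = {}")
      \<comment> \<open>With one lower part empty, the other code describes the same state as
        \<open>t\<close>.\<close>
      case True
      then show ?thesis using g e by auto
    next
      case False
      then show ?thesis unfolding e using g 4 join_iff[OF 4(3,4), of q] by (intro good.join) auto
    qed
  qed
  then show ?thesis using t by (simp add: Goods_def)
qed

text \<open>The weight 2 makes a forget count as progress too, as it moves a vertex from the bag to
  the lower part. Every rule then derives a state from states of smaller measure.\<close>

definition meas :: "nat \<Rightarrow> nat" where "meas t = 2 * vl t + vb t"

lemma step_complete:
  assumes t: "t \<in> Goods q" and G: "\<And>u. u \<in> Goods q \<Longrightarrow> meas u < meas t \<Longrightarrow> u \<in> G"
  shows "stepp q G t"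
proof -
  have tk: "t < 3 ^ k" using t by (simp add: Goods_def)
  have "good E C I q (Ls t) (Bs t)" using t by (simp add: Goods_def)
  then show ?thesis
  proof cases
    case base
    then show ?thesis by (simp add: stepp_def vl_def vb_def)
  next
    case (forget L c)
    then have "c \<in> Ls t" by simp
    then obtain p where p: "p < k" "digit t p = 1" "c = cl p" by (auto simp: Ls_def)
    note f = forget_code[OF p(1,2)]
    have L: "L = Ls (t + 3 ^ p)" using forget f p by (metis insert_ident)
    have lt: "t + 3 ^ p < 3 ^ k" using add_less[of t p 1 k] p tk by simp
    have in_Goods: "t + 3 ^ p \<in> Goods q" using forget lt L f p by (simp add: Goods_def)
    have "meas (t + 3 ^ p) < meas t"
      using f fin_LB card_insert_disjoint[of "Ls (t + 3 ^ p)" "cl p"] card_insert_disjoint[of "Bs t" "cl p"]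
      by (simp add: meas_def vl_def vb_def)
    then have "t + 3 ^ p \<in> G" using G in_Goods by blast
    moreover have "okE t" "okD q (t + 3 ^ p)" "vb t + 1 + vj t \<le> q"
      using forget f p by (auto simp: okE_def okD_def vb_def vj_def)
    ultimately show ?thesis using p unfolding stepp_def by blast
  next
    case (intro B b)
    then have "b \<in> Bs t" by simp
    then obtain p where p: "p < k" "digit t p = 2" "b = cl p" by (auto simp: Bs_def)
    note f = intro_code[OF p(1,2)]
    let ?u = "t - 2 * 3 ^ p"
    have B: "B = Bs ?u" using intro f p by (metis insert_ident)
    have in_Goods: "?u \<in> Goods q" using intro tk B f by (simp add: Goods_def)
    have c: "card (Bs t) = card (Bs ?u) + 1" using f(3,4) fin_LB by simp
    then have "meas ?u < meas t" using f by (simp add: meas_def vl_def vb_def)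
    then have "?u \<in> G" using G in_Goods by blast
    moreover have "vb t + vj ?u \<le> q" using intro B f c by (simp add: vb_def vj_def)
    ultimately show ?thesis using p unfolding stepp_def by blast
  next
    case (join L1 L2)
    obtain t1 where t1: "t1 < 3 ^ k" "Ls t1 = L1" "Bs t1 = Bs t"
      using code_exists good_inv(1-3)[OF join(2)] by blast
    obtain t2 where t2: "t2 < 3 ^ k" "Ls t2 = L2" "Bs t2 = Bs t"
      using code_exists good_inv(1-3)[OF join(3)] by blast
    have "card (L1 \<union> L2) = card L1 + card L2"
      using join fin_LB[of t1] fin_LB[of t2] t1 t2 by (intro card_Un_disjoint) auto
    moreover have "card L1 > 0" "card L2 > 0"
      using join fin_LB[of t1] fin_LB[of t2] t1 t2 by (auto simp: card_gt_0_iff)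
    ultimately have "meas t1 < meas t" "meas t2 < meas t"
      using t1 t2 join(1) by (auto simp: meas_def vl_def vb_def)
    then have "t1 \<in> G" "t2 \<in> G" using G t1 t2 join by (auto simp: Goods_def)
    moreover have j: "joins t t1 t2" "Ls t1 \<inter> Ls t2 = {}" using t1 t2 join by (auto simp: joins_def)
    moreover have "vb t + va t + vj t \<le> va t1 + va t2 + q"
      using join_iff[OF j, of q] join t1 t2 by simp
    ultimately show ?thesis unfolding stepp_def by blast
  qed
qed

lemma card_LB: "vl t + vb t \<le> k"
  using card_Un_disjoint[OF fin_LB LB, of t] card_mono[OF finC, of "Ls t \<union> Bs t"] LsC[of t] BsC[of t] kC[symmetric]
  by (simp add: vl_def vb_def)

lemma meas_le: "meas t \<le> 2 * k"
  using card_LB[of t] by (simp add: meas_def)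

text \<open>The three numbers count disjoint sets of vertices.\<close>

lemma card_VBAJ: "vb t + va t + vj t \<le> n"
proof -
  let ?D = "Dset E I (Ls t) (Bs t)" and ?J = "Jset E I (Ls t) (Bs t)"
  have "Bs t \<inter> (?D \<union> ?J) = {}" "?D \<inter> ?J = {}"
    using BsC[of t] unfolding Dset_def Jset_def by blast+
  then have "card (Bs t \<union> (?D \<union> ?J)) = card (Bs t) + (card ?D + card ?J)"
    using card_Un_disjoint[of "Bs t" "?D \<union> ?J"] card_Un_disjoint[of ?D ?J] fin_LB fin_J by simp
  moreover have "card (Bs t \<union> (Dset E I (Ls t) (Bs t) \<union> Jset E I (Ls t) (Bs t))) \<le> card {..<n}"
    using BsC[of t] CV by (intro card_mono) (auto simp: Dset_def Jset_def)
  ultimately show ?thesis by (simp add: vb_def va_def vj_def)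
qed

lemma va_sum_le: "va t1 + va t2 \<le> 2 * n"
  using card_VBAJ[of t1] card_VBAJ[of t2] by simp

lemma full_code:
  assumes "\<And>p. p < k \<Longrightarrow> digit t p = 1"
  shows "Ls t = C" "Bs t = {}"
  using assms cl_C by (auto simp: Ls_def Bs_def)

subsection \<open>Subset convolution\<close>

text \<open>Exceeds \<open>2 * n\<close>, the bound for \<open>va t1 + va t2\<close>, so that
  exponents \<open>ee\<close> add digit by digit to the base \<open>mm\<close>; exceeds
  \<open>2 * k\<close> as well, so that \<open>XX\<close> exceeds the number \<open>4 ^ k\<close> of
  pairs.\<close>

definition mm :: nat where "mm = 2 * n + 1"
definition XX :: int where "XX = 2 ^ mm"
definition ee :: "nat \<Rightarrow> nat" where "ee t = (n - vl t) * mm + va t"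
text \<open>The subtraction is truncated on purpose: a negative requirement on
  \<open>va t1 + va t2\<close> is met by every pair.\<close>

definition tau :: "nat \<Rightarrow> nat \<Rightarrow> nat" where "tau q t = vb t + va t + vj t - q"

text \<open>
  Pairs whose lower parts overlap have a smaller exponent than the disjoint ones, so that a
  single comparison with a power of \<open>XX\<close> detects a disjoint pair of large enough weight.
\<close>

definition enc :: "nat set \<Rightarrow> nat \<Rightarrow> int" where "enc G t = (if t \<in> G then XX ^ ee t else 0)"
definition Ps :: "nat \<Rightarrow> (nat \<times> nat) set" where
  "Ps t = {(t1, t2). t1 < 3 ^ k \<and> t2 < 3 ^ k \<and> joins t t1 t2}"
definition conv :: "nat set \<Rightarrow> nat \<Rightarrow> int" where
  "conv G t = (\<Sum>(t1, t2)\<in>Ps t. enc G t1 * enc G t2)"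

lemma zset_k: "zset k k t = {t'. t' < 3 ^ k \<and> Bs t' = Bs t \<and> Ls t' \<subseteq> Ls t}"
proof -
  have "(\<forall>p<k. digit t' p = digit t p \<or> p < k \<and> digit t p = 1 \<and> digit t' p = 0) \<longleftrightarrow> Bs t' = Bs t \<and> Ls t' \<subseteq> Ls t"
    (is "?l \<longleftrightarrow> ?r") for t'
  proof
    assume l: ?l
    have "digit t' p = 2 \<longleftrightarrow> digit t p = 2" if "p < k" for p
    proof -
      have "digit t' p = digit t p \<or> digit t p = 1 \<and> digit t' p = 0" using l that by blast
      then show ?thesis by auto
    qed
    then have "Bs t' = Bs t" by (auto simp: Bs_def)
    moreover have "Ls t' \<subseteq> Ls t"
    proof
      fix x assume "x \<in> Ls t'"
      then obtain p where p: "p < k" "x = cl p" "digit t' p = 1" by (auto simp: Ls_def)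
      then have "digit t' p = digit t p \<or> digit t p = 1 \<and> digit t' p = 0" using l by blast
      then have "digit t p = 1" using p by simp
      then show "x \<in> Ls t" using p in_Ls by simp
    qed
    ultimately show ?r by simp
  next
    assume r: ?r
    show ?l
    proof (intro allI impI)
      fix p assume p: "p < k"
      have "digit t' p = 2 \<longleftrightarrow> digit t p = 2" using r in_Bs[OF p] by metis
      moreover have "digit t' p = 1 \<longrightarrow> digit t p = 1" using r in_Ls[OF p] by blast
      ultimately show "digit t' p = digit t p \<or> p < k \<and> digit t p = 1 \<and> digit t' p = 0"
        using digit_cases[of t p] digit_cases[of t' p] p by auto
    qed
  qed
  then show ?thesis by (simp add: zset_def)
qed

lemma fin_Ps: "finite (Ps t)"
  by (rule finite_subset[of _ "{..<3 ^ k} \<times> {..<3 ^ k}"]) (auto simp: Ps_def)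

text \<open>Every pair of codes below \<open>t\<close> belongs to exactly one code \<open>u\<close>
  below \<open>t\<close>, that of the union of the lower parts, so the product of the two sums
  splits according to \<open>u\<close>.\<close>

lemma zeta_square:
  assumes t: "t < 3 ^ k"
  shows "(zeta k (enc G) t)\<^sup>2 = zeta k (conv G) t"
proof -
  let ?S = "zset k k t"
  have fin: "finite ?S" by (rule finite_subset[of _ "{..<3 ^ k}"]) (auto simp: zset_def)
  have U: "(\<Union>u\<in>?S. Ps u) = ?S \<times> ?S"
  proof
    show "(\<Union>u\<in>?S. Ps u) \<subseteq> ?S \<times> ?S" by (auto simp: zset_k Ps_def joins_def)
    show "?S \<times> ?S \<subseteq> (\<Union>u\<in>?S. Ps u)"
    proof
      fix x assume "x \<in> ?S \<times> ?S"
      then obtain t1 t2 where x: "x = (t1, t2)" "t1 \<in> ?S" "t2 \<in> ?S" by auto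
      have "(Ls t1 \<union> Ls t2) \<inter> Bs t = {}"
        using x LB[of t] by (auto simp: zset_k)
      moreover have "Ls t1 \<union> Ls t2 \<subseteq> C" using LsC by simp
      ultimately obtain u where u: "u < 3 ^ k" "Ls u = Ls t1 \<union> Ls t2" "Bs u = Bs t"
        using code_exists BsC by metis
      moreover from u x have "u \<in> ?S" by (simp add: zset_k)
      ultimately have "x \<in> Ps u" using x by (simp add: zset_k Ps_def joins_def)
      then show "x \<in> (\<Union>u\<in>?S. Ps u)" using \<open>u \<in> ?S\<close> by blast
    qed
  qed
  have "(zeta k (enc G) t)\<^sup>2 = (\<Sum>t1\<in>?S. enc G t1) * (\<Sum>t2\<in>?S. enc G t2)"
    using zeta_zset[OF _ t] by (simp add: power2_eq_square)
  also have "\<dots> = (\<Sum>(t1, t2)\<in>?S \<times> ?S. enc G t1 * enc G t2)"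
    by (simp add: sum_product sum.cartesian_product)
  also have "\<dots> = (\<Sum>u\<in>?S. \<Sum>(t1, t2)\<in>Ps u. enc G t1 * enc G t2)"
    unfolding U[symmetric]
  proof (rule sum.UNION_disjoint[OF fin])
    show "\<forall>u\<in>?S. finite (Ps u)" by (simp add: fin_Ps)
    show "\<forall>u\<in>?S. \<forall>v\<in>?S. u \<noteq> v \<longrightarrow> Ps u \<inter> Ps v = {}"
      using code_inj by (fastforce simp: zset_k Ps_def joins_def)
  qed
  also have "\<dots> = zeta k (conv G) t" using zeta_zset[OF _ t] by (simp add: conv_def)
  finally show ?thesis .
qed

lemma XX_pos: "XX > 0" by (simp add: XX_def)

lemma XX_ge: "XX \<ge> 2"
proof -
  have "(2::int) ^ 1 \<le> 2 ^ mm" by (intro power_increasing) (auto simp: mm_def)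
  then show ?thesis by (simp add: XX_def)
qed

lemma enc_bounds: "0 \<le> enc G t \<and> enc G t \<le> XX ^ (n * mm + n)"
proof -
  have "va t \<le> n" using card_VBAJ[of t] by simp
  then have "ee t \<le> n * mm + n" by (simp add: ee_def add_mono)
  then have "XX ^ ee t \<le> XX ^ (n * mm + n)" using XX_ge by (intro power_increasing) auto
  then show ?thesis using XX_pos by (auto simp: enc_def)
qed

lemma conv_nonneg: "0 \<le> conv G t"
  using enc_bounds[of G] by (auto simp: conv_def intro!: sum_nonneg)

text \<open>If no pair fits, every term is at most the threshold divided by \<open>XX\<close>: an
  overlap lowers the upper digit of the exponent, since \<open>vl t1 + vl t2\<close> exceeds
  \<open>vl t\<close>, and a disjoint pair that fails has too small a lower digit. Fewer than
  \<open>XX\<close> such terms stay below the threshold.\<close>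

lemma conv_iff:
  assumes G: "G \<subseteq> {..<3 ^ k}" and t: "t < 3 ^ k"
  shows "XX ^ ((2 * n - vl t) * mm + tau q t) \<le> conv G t \<longleftrightarrow>
    (\<exists>t1\<in>G. \<exists>t2\<in>G. joins t t1 t2 \<and> Ls t1 \<inter> Ls t2 = {} \<and> vb t + va t + vj t \<le> va t1 + va t2 + q)"
    (is "XX ^ ?e \<le> _ \<longleftrightarrow> ?r")
proof -
  have vln: "vl u \<le> n" for u using card_LB[of u] k_le_n by simp
  have eesum: "ee t1 + ee t2 = (2 * n - (vl t1 + vl t2)) * mm + (va t1 + va t2)" for t1 t2
  proof -
    have "(n - vl t1) + (n - vl t2) = 2 * n - (vl t1 + vl t2)" using vln[of t1] vln[of t2] by simp
    then show ?thesis by (simp add: ee_def flip: add_mult_distrib)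
  qed
  have enc_pair: "enc G t1 * enc G t2 = (if t1 \<in> G \<and> t2 \<in> G then XX ^ (ee t1 + ee t2) else 0)" for t1 t2
    by (simp add: enc_def power_add)
  show ?thesis
  proof
    assume ?r
    then obtain t1 t2 where r: "t1 \<in> G" "t2 \<in> G" "joins t t1 t2" "Ls t1 \<inter> Ls t2 = {}"
      "vb t + va t + vj t \<le> va t1 + va t2 + q" by blast
    have "vl t = vl t1 + vl t2"
      using r card_Un_disjoint[OF fin_LB(1) fin_LB(1) r(4)] by (simp add: vl_def joins_def)
    then have "?e \<le> ee t1 + ee t2" using r eesum[of t1 t2] by (simp add: tau_def)
    then have "XX ^ ?e \<le> XX ^ (ee t1 + ee t2)" using XX_ge by (intro power_increasing) auto
    also have "\<dots> = (case (t1, t2) of (t1, t2) \<Rightarrow> enc G t1 * enc G t2)" using r enc_pair by simp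
    also have "\<dots> \<le> conv G t"
      unfolding conv_def
    proof (rule member_le_sum)
      show "(t1, t2) \<in> Ps t" using r G by (auto simp: Ps_def)
    qed (use enc_bounds[of G] fin_Ps in auto)
    finally show "XX ^ ?e \<le> conv G t" .
  next
    assume l: "XX ^ ?e \<le> conv G t"
    show ?r
    proof (rule ccontr)
      assume nr: "\<not> ?r"
      have small: "enc G t1 * enc G t2 * XX \<le> XX ^ ?e" if P: "(t1, t2) \<in> Ps t" for t1 t2
      proof (cases "t1 \<in> G \<and> t2 \<in> G")
        case False
        then show ?thesis unfolding enc_pair using XX_pos by auto
      next
        case True
        have j: "joins t t1 t2" using P by (simp add: Ps_def)
        have "Suc (ee t1 + ee t2) \<le> ?e"
        proof (cases "Ls t1 \<inter> Ls t2 = {}")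
          case dis: True
          have "vl t = vl t1 + vl t2"
            using j card_Un_disjoint[OF fin_LB(1) fin_LB(1) dis] by (simp add: vl_def joins_def)
          moreover have "\<not> vb t + va t + vj t \<le> va t1 + va t2 + q" using nr True j dis by blast
          ultimately show ?thesis using eesum[of t1 t2] by (simp add: tau_def)
        next
          case False
          have "card (Ls t1 \<union> Ls t2) + card (Ls t1 \<inter> Ls t2) = vl t1 + vl t2"
            using card_Un_Int[OF fin_LB(1) fin_LB(1), of t1 t2] by (simp add: vl_def)
          moreover have "card (Ls t1 \<inter> Ls t2) > 0" using False fin_LB by (simp add: card_gt_0_iff)
          ultimately have "vl t < vl t1 + vl t2" using j by (simp add: vl_def joins_def)
          moreover have "vl t1 + vl t2 \<le> 2 * n" using vln[of t1] vln[of t2] by simp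
          ultimately have "2 * n - (vl t1 + vl t2) + 1 \<le> 2 * n - vl t" by simp
          then have "(2 * n - (vl t1 + vl t2) + 1) * mm \<le> (2 * n - vl t) * mm" by (rule mult_le_mono1)
          moreover have "va t1 + va t2 < mm" using va_sum_le[of t1 t2] by (simp add: mm_def)
          ultimately show ?thesis unfolding eesum by simp
        qed
        then have "XX ^ Suc (ee t1 + ee t2) \<le> XX ^ ?e" using XX_ge by (intro power_increasing) auto
        then show ?thesis using True unfolding enc_pair by (simp add: mult.commute)
      qed
      have "conv G t * XX = (\<Sum>x\<in>Ps t. (case x of (t1, t2) \<Rightarrow> enc G t1 * enc G t2) * XX)"
        by (simp add: conv_def sum_distrib_right)
      also have "\<dots> \<le> (\<Sum>x\<in>Ps t. XX ^ ?e)" using small by (intro sum_mono) auto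
      also have "\<dots> = int (card (Ps t)) * XX ^ ?e" by simp
      also have "\<dots> < XX * XX ^ ?e"
      proof -
        \<comment> \<open>The bag parts of a pair are those of \<open>t\<close>, so the pair is
          determined by its two lower parts, which are subsets of \<open>C\<close>.\<close>
        have Pc: "card (Ps t) \<le> 2 ^ k * 2 ^ k"
        proof -
          let ?g = "\<lambda>(t1, t2). (Ls t1, Ls t2)"
          have "inj_on ?g (Ps t)"
            using code_inj by (auto simp: inj_on_def Ps_def joins_def)
          moreover have "?g ` Ps t \<subseteq> Pow C \<times> Pow C" using LsC by fastforce
          ultimately have "card (Ps t) \<le> card (Pow C \<times> Pow C)"
            using finC by (intro card_inj_on_le) auto
          then show ?thesis using finC by (simp add: card_cartesian_product card_Pow kC[symmetric])
        qed
        have "(2::nat) ^ k * 2 ^ k = 2 ^ (2 * k)" by (simp add: mult_2 power_add)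
        also have "\<dots> < 2 ^ mm" using k_le_n by (intro power_strict_increasing) (auto simp: mm_def)
        finally have "card (Ps t) < 2 ^ mm" using Pc by simp
        then have "int (card (Ps t)) < XX" by (simp add: XX_def)
        then show ?thesis using XX_pos by (intro mult_strict_right_mono) auto
      qed
      finally have "conv G t < XX ^ ?e" using XX_pos by (simp add: mult.commute)
      then show False using l by simp
    qed
  qed
qed

end

subsection \<open>A programming language for random access machines\<close>

text \<open>
  The array element with name \<open>a\<close> and index \<open>i\<close> lives in register \<open>128 * i + a\<close>, scalars being
  elements with index \<open>0\<close>. Names are below \<open>64\<close>; registers \<open>64, \<dots>, 95\<close> hold intermediate values
  of expressions and register \<open>96 + d\<close> the number of remaining iterations of the loop at nesting
  depth \<open>d\<close>. Name \<open>64\<close> stands for the unread part of the input.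
\<close>

type_synonym store = "nat \<Rightarrow> nat \<Rightarrow> int"

datatype exp = Cn int | Ar nat exp | Pl exp exp | Mi exp exp

abbreviation Vr :: "nat \<Rightarrow> exp" where "Vr x \<equiv> Ar x (Cn 0)"

fun eval :: "exp \<Rightarrow> store \<Rightarrow> int" where
  "eval (Cn c) \<sigma> = c"
| "eval (Ar a e) \<sigma> = \<sigma> a (nat (eval e \<sigma>))"
| "eval (Pl e1 e2) \<sigma> = eval e1 \<sigma> + eval e2 \<sigma>"
| "eval (Mi e1 e2) \<sigma> = eval e1 \<sigma> - eval e2 \<sigma>"

fun okx :: "exp \<Rightarrow> store \<Rightarrow> bool" where
  "okx (Cn c) \<sigma> \<longleftrightarrow> True"
| "okx (Ar a e) \<sigma> \<longleftrightarrow> okx e \<sigma> \<and> 0 \<le> eval e \<sigma>"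
| "okx (Pl e1 e2) \<sigma> \<longleftrightarrow> okx e1 \<sigma> \<and> okx e2 \<sigma>"
| "okx (Mi e1 e2) \<sigma> \<longleftrightarrow> okx e1 \<sigma> \<and> okx e2 \<sigma>"

fun nodes :: "exp \<Rightarrow> nat" where
  "nodes (Cn c) = 1"
| "nodes (Ar a e) = Suc (nodes e)"
| "nodes (Pl e1 e2) = Suc (nodes e1 + nodes e2)"
| "nodes (Mi e1 e2) = Suc (nodes e1 + nodes e2)"

fun wfx :: "exp \<Rightarrow> bool" where
  "wfx (Cn c) \<longleftrightarrow> \<bar>c\<bar> \<le> 64"
| "wfx (Ar a e) \<longleftrightarrow> a < 64 \<and> wfx e"
| "wfx (Pl e1 e2) \<longleftrightarrow> wfx e1 \<and> wfx e2"
| "wfx (Mi e1 e2) \<longleftrightarrow> wfx e1 \<and> wfx e2"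

text \<open>The bound 24 keeps the intermediate values of an expression inside the registers 64 to
  95 and their size below \<open>24 * Bd\<close>.\<close>

definition wfe :: "exp \<Rightarrow> bool" where "wfe e \<longleftrightarrow> wfx e \<and> nodes e \<le> 24"

datatype com =
    CSkip
  | CAsg nat exp exp
  | CRd nat
  | CSeq com com  (infixr ";;" 60)
  | CIf exp com com
  | CFor nat exp com

abbreviation CSet :: "nat \<Rightarrow> exp \<Rightarrow> com" where "CSet x e \<equiv> CAsg x (Cn 0) e"

fun wfc :: "nat \<Rightarrow> com \<Rightarrow> bool" where
  "wfc d CSkip \<longleftrightarrow> True"
| "wfc d (CAsg a i e) \<longleftrightarrow> d \<le> 32 \<and> a < 64 \<and> wfe i \<and> wfe e"
| "wfc d (CRd a) \<longleftrightarrow> d \<le> 32 \<and> a < 64"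
| "wfc d (c1 ;; c2) \<longleftrightarrow> wfc d c1 \<and> wfc d c2"
| "wfc d (CIf e c1 c2) \<longleftrightarrow> wfe e \<and> wfc d c1 \<and> wfc d c2"
| "wfc d (CFor x e c) \<longleftrightarrow> d < 32 \<and> x < 64 \<and> wfe e \<and> wfc (Suc d) c"

fun mods :: "com \<Rightarrow> nat set" where
  "mods CSkip = {}"
| "mods (CAsg a i e) = {a}"
| "mods (CRd a) = {a, 64}"
| "mods (c1 ;; c2) = mods c1 \<union> mods c2"
| "mods (CIf e c1 c2) = mods c1 \<union> mods c2"
| "mods (CFor x e c) = insert x (mods c)"

fun cexp :: "exp \<Rightarrow> nat \<Rightarrow> instr list" where
  "cexp (Cn c) d = [SetConst d c]"
| "cexp (Ar a e) d =
     cexp e d @ replicate 7 (Add d d d) @ [SetConst (d + 1) (int a), Add d d (d + 1), Load d d]"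
| "cexp (Pl e1 e2) d = cexp e1 d @ cexp e2 (d + 1) @ [Add d d (d + 1)]"
| "cexp (Mi e1 e2) d = cexp e1 d @ cexp e2 (d + 1) @ [Sub d d (d + 1)]"

text \<open>Jump targets are absolute, hence the argument \<open>l\<close> for the address of the
  first instruction; \<open>d\<close> is the loop depth. \<open>SetConst 64 1\<close> followed by
  \<open>JumpPos 64\<close> is an unconditional jump. In a conditional the negative branch comes
  first, so that the positive one is reached by the test itself.\<close>

fun comp :: "com \<Rightarrow> nat \<Rightarrow> nat \<Rightarrow> instr list" where
  "comp CSkip l d = []"
| "comp (CAsg a i e) l d = cexp i 64 @ cexp e 65 @ replicate 7 (Add 64 64 64) @
     [SetConst 66 (int a), Add 64 64 66, Store 64 65]"
| "comp (CRd a) l d = [Read a]"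
| "comp (c1 ;; c2) l d = (let p = comp c1 l d in p @ comp c2 (l + length p) d)"
| "comp (CIf e c1 c2) l d =
    (let pe = cexp e 64; p2 = comp c2 (l + length pe + 1) d; l1 = l + length pe + length p2 + 3;
         p1 = comp c1 l1 d
     in pe @ [JumpPos 64 l1] @ p2 @ [SetConst 64 1, JumpPos 64 (l1 + length p1)] @ p1)"
| "comp (CFor x e c) l d =
    (let pe = cexp e 64; lt = l + length pe + 3; p = comp c (lt + 3) (Suc d)
     in pe @ [SetConst 65 0, Add (96 + d) 64 65, SetConst x 0,
              JumpPos (96 + d) (lt + 3), SetConst 64 1, JumpPos 64 (lt + length p + 7)] @
        p @ [SetConst 64 1, Add x x 64, Sub (96 + d) (96 + d) 64, JumpPos 64 lt])"

section \<open>Runs of bounded cost inside a larger program\<close>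

inductive run :: "instr list \<Rightarrow> nat \<Rightarrow> config \<Rightarrow> nat \<Rightarrow> config \<Rightarrow> bool" for P K where
  run_refl: "run P K s 0 s"
| run_step: "pc s < length P \<Longrightarrow> cost (P ! pc s) s \<le> K \<Longrightarrow> run P K (step (P ! pc s) s) n s' \<Longrightarrow>
    run P K s (Suc n) s'"

lemma run_trans: "run P K s m s' \<Longrightarrow> run P K s' n s'' \<Longrightarrow> run P K s (m + n) s''"
  by (induction rule: run.induct) (auto intro: run.intros)

text \<open>Replaces the exact logarithmic cost by the number of instructions times a uniform bound,
  so that the program logic has only to count instructions.\<close>

lemma run_exec:
  assumes "run P K s n s'" "length P \<le> pc s'"
  shows "\<exists>t \<le> n * K. exec P s t s'"
  using assms
proof induction
  case (run_refl s)
  then show ?case using exec_halt by auto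
next
  case (run_step s n s')
  then obtain t where t: "t \<le> n * K" "exec P (step (P ! pc s) s) t s'" by blast
  then have "exec P s (cost (P ! pc s) s + t) s'" using run_step by (intro exec_step)
  then show ?case using t run_step by (intro exI[of _ "cost (P ! pc s) s + t"]) simp
qed

text \<open>A compiled command is verified in place: it occupies the addresses from \<open>l\<close>
  on in an arbitrary surrounding program.\<close>

definition seg :: "instr list \<Rightarrow> nat \<Rightarrow> instr list \<Rightarrow> bool" where
  "seg P l xs \<longleftrightarrow> (\<exists>ys zs. P = ys @ xs @ zs \<and> length ys = l)"

lemma seg_append: "seg P l (xs @ ys) \<Longrightarrow> seg P l xs \<and> seg P (l + length xs) ys"
  unfolding seg_def by (metis append.assoc length_append)

lemma seg_Cons: "seg P l (x # xs) \<Longrightarrow> l < length P \<and> P ! l = x \<and> seg P (Suc l) xs"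
proof -
  assume "seg P l (x # xs)"
  then obtain ys zs where P: "P = ys @ (x # xs) @ zs" "length ys = l" by (auto simp: seg_def)
  then have "P = (ys @ [x]) @ xs @ zs" "length (ys @ [x]) = Suc l" by auto
  then have "seg P (Suc l) xs" unfolding seg_def by blast
  then show ?thesis using P by (auto simp: nth_append)
qed

text \<open>An index is at most \<open>24 * Bd\<close>, so an address is at most
  \<open>128 * 24 * Bd\<close> plus a name; 4096 is the power of two above \<open>128 * 24\<close>.
  \<open>KB\<close> allows for two operands of that size.\<close>

definition MB :: "int \<Rightarrow> int" where "MB Bd = 4096 * Bd"
definition KB :: "int \<Rightarrow> nat" where "KB Bd = 2 * bits (MB Bd)"
definition mok :: "int \<Rightarrow> config \<Rightarrow> bool" where "mok Bd s \<longleftrightarrow> (\<forall>r. \<bar>mem s r\<bar> \<le> MB Bd)"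
definition relm :: "store \<Rightarrow> config \<Rightarrow> bool" where
  "relm \<sigma> s \<longleftrightarrow> (\<forall>a<64. \<forall>i. mem s (128 * i + a) = \<sigma> a i)"
definition bnd :: "int \<Rightarrow> store \<Rightarrow> bool" where "bnd Bd \<sigma> \<longleftrightarrow> (\<forall>a<64. \<forall>i. \<bar>\<sigma> a i\<bar> \<le> Bd)"

lemma bits_mono: "\<bar>x\<bar> \<le> \<bar>y\<bar> \<Longrightarrow> bits x \<le> bits y"
  unfolding bits_def using floorlog_mono[of "nat \<bar>x\<bar>" "nat \<bar>y\<bar>" 2]
  by (intro max.mono) (auto simp: nat_le_eq_zle)

lemma bits_KB: "\<bar>x\<bar> \<le> MB Bd \<Longrightarrow> \<bar>y\<bar> \<le> MB Bd \<Longrightarrow> bits x + bits y \<le> KB Bd"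
  using bits_mono[of x "MB Bd"] bits_mono[of y "MB Bd"] by (simp add: KB_def)

lemma bits_KB1: "\<bar>x\<bar> \<le> MB Bd \<Longrightarrow> bits x \<le> KB Bd"
  using bits_mono[of x "MB Bd"] by (simp add: KB_def)

text \<open>\<open>Read\<close> is left out because its cost depends on the input, which
  \<open>mok\<close> does not bound.\<close>

fun plain :: "int \<Rightarrow> instr \<Rightarrow> bool" where
  "plain Bd (SetConst i c) \<longleftrightarrow> \<bar>c\<bar> \<le> MB Bd"
| "plain Bd (Read i) \<longleftrightarrow> False"
| "plain Bd ins \<longleftrightarrow> True"

lemma cost_plain: "mok Bd s \<Longrightarrow> plain Bd ins \<Longrightarrow> cost ins s \<le> KB Bd"
  by (cases ins) (auto simp: mok_def intro: bits_KB bits_KB1)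

lemma mok_step:
  "mok Bd s \<Longrightarrow> \<bar>c\<bar> \<le> MB Bd \<Longrightarrow> mok Bd (step (SetConst i c) s)"
  "mok Bd s \<Longrightarrow> \<bar>mem (step (Add i j k) s) i\<bar> \<le> MB Bd \<Longrightarrow> mok Bd (step (Add i j k) s)"
  "mok Bd s \<Longrightarrow> \<bar>mem (step (Sub i j k) s) i\<bar> \<le> MB Bd \<Longrightarrow> mok Bd (step (Sub i j k) s)"
  "mok Bd s \<Longrightarrow> mok Bd (step (Load i j) s)"
  "mok Bd s \<Longrightarrow> mok Bd (step (Store i j) s)"
  "mok Bd s \<Longrightarrow> mok Bd (step (JumpPos i l) s)"
  by (auto simp: mok_def)

lemma run_one:
  assumes "seg P (pc s) (x # xs)" "mok Bd s" "plain Bd x" "run P (KB Bd) (step x s) n s'"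
  shows "run P (KB Bd) s (Suc n) s'"
  using assms seg_Cons[OF assms(1)] cost_plain[OF assms(2,3)] by (intro run_step) auto

lemma run_one':
  assumes "seg P (pc s) (x # xs)" "mok Bd s" "plain Bd x" "s' = step x s"
  shows "run P (KB Bd) s 1 s'"
  using run_one[OF assms(1-3) run_refl] assms(4) by simp

lemma run_double:
  assumes "seg P (pc s) (replicate m (Add d d d))" "mok Bd s" "2 ^ m * \<bar>mem s d\<bar> \<le> MB Bd"
  shows "\<exists>s'. run P (KB Bd) s m s' \<and> pc s' = pc s + m \<and> inp s' = inp s \<and> mem s' d = 2 ^ m * mem s d
    \<and> (\<forall>r. r \<noteq> d \<longrightarrow> mem s' r = mem s r) \<and> mok Bd s'"
  using assms
proof (induction m arbitrary: s)
  case 0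
  then show ?case using run_refl by auto
next
  case (Suc m)
  let ?s = "step (Add d d d) s"
  have sg: "seg P (pc s) (Add d d d # replicate m (Add d d d))" using Suc.prems by simp
  have "(1::int) * \<bar>mem s d\<bar> \<le> 2 ^ m * \<bar>mem s d\<bar>" by (intro mult_right_mono) auto
  then have "2 * \<bar>mem s d\<bar> \<le> MB Bd" using Suc.prems(3) by simp
  then have mok: "mok Bd ?s" using Suc.prems(2) by (auto simp: mok_def)
  have "\<exists>s'. run P (KB Bd) ?s m s' \<and> pc s' = pc ?s + m \<and> inp s' = inp ?s \<and> mem s' d = 2 ^ m * mem ?s d
    \<and> (\<forall>r. r \<noteq> d \<longrightarrow> mem s' r = mem ?s r) \<and> mok Bd s'"
    using seg_Cons[OF sg] Suc.prems(3) mok by (intro Suc.IH) (auto simp: abs_mult algebra_simps)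
  then obtain s' where s': "run P (KB Bd) ?s m s'" "pc s' = pc ?s + m" "inp s' = inp ?s"
    "mem s' d = 2 ^ m * mem ?s d" "\<forall>r. r \<noteq> d \<longrightarrow> mem s' r = mem ?s r" "mok Bd s'" by blast
  have "run P (KB Bd) s (Suc m) s'" using run_one[OF sg Suc.prems(2) _ s'(1)] by simp
  then show ?case using s' by (intro exI[of _ s']) auto
qed

text \<open>No array element lives in the registers 64 to 127, since names are below 64 and the
  stride is 128. Intermediate values and loop counters may change freely there.\<close>

lemma relm_cong:
  assumes "relm \<sigma> s" "\<And>r. r \<notin> {64..<128} \<Longrightarrow> mem s' r = mem s r"
  shows "relm \<sigma> s'"
proof -
  have "128 * i + a \<notin> {64..<128}" if "a < 64" for i a :: nat
    using that by (cases i) auto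
  then show ?thesis using assms by (simp add: relm_def)
qed

lemma eval_le:
  assumes "bnd Bd \<sigma>" "wfx e" "64 \<le> Bd"
  shows "\<bar>eval e \<sigma>\<bar> \<le> int (nodes e) * Bd"
  using assms(2)
proof (induction e)
  case (Ar a e)
  then have "\<bar>eval (Ar a e) \<sigma>\<bar> \<le> Bd" using assms by (simp add: bnd_def)
  also have "\<dots> \<le> int (nodes (Ar a e)) * Bd" using assms(3) by (simp add: algebra_simps)
  finally show ?case .
qed (use assms(3) in \<open>auto simp: algebra_simps\<close>)

lemma length_cexp: "length (cexp e d) \<le> 11 * nodes e"
proof (induction e arbitrary: d)
  case (Ar a e)
  show ?case using Ar[of d] by simp
next
  case (Pl e1 e2)
  show ?case using Pl(1)[of d] Pl(2)[of "d + 1"] by simp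
next
  case (Mi e1 e2)
  show ?case using Mi(1)[of d] Mi(2)[of "d + 1"] by simp
qed simp

lemma nodes_pos: "0 < nodes e" by (induction e) auto

lemma addr_ok:
  assumes "\<bar>v\<bar> \<le> 24 * Bd" "128 \<le> Bd" "a < 64" "0 \<le> v"
  shows "128 * \<bar>v\<bar> \<le> MB Bd" "\<bar>int a\<bar> \<le> MB Bd" "\<bar>128 * v + int a\<bar> \<le> MB Bd"
    "nat (128 * v + int a) = 128 * nat v + a"
  using assms by (auto simp: MB_def)

text \<open>Registers below \<open>d\<close> are left alone; so the second operand can be evaluated
  from \<open>d + 1\<close> on while the first waits in \<open>d\<close>.\<close>

lemma cexp_run:
  assumes "seg P (pc s) (cexp e d)" "relm \<sigma> s" "mok Bd s" "bnd Bd \<sigma>" "wfx e" "nodes e \<le> 24"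
    "okx e \<sigma>" "64 \<le> d" "d + nodes e \<le> 95" "128 \<le> Bd"
  shows "\<exists>s'. run P (KB Bd) s (length (cexp e d)) s' \<and> pc s' = pc s + length (cexp e d)
    \<and> inp s' = inp s \<and> mem s' d = eval e \<sigma> \<and> (\<forall>r. r \<notin> {d..<96} \<longrightarrow> mem s' r = mem s r) \<and> mok Bd s'"
  using assms(1-9)
proof (induction e arbitrary: d s)
  case (Cn c)
  let ?s = "step (SetConst d c) s"
  have c: "\<bar>c\<bar> \<le> MB Bd" using Cn.prems assms(10) by (simp add: MB_def)
  have "run P (KB Bd) s 1 ?s" using Cn.prems c by (intro run_one'[of _ _ _ "[]"]) auto
  then show ?case using Cn.prems c by (intro exI[of _ ?s]) (auto simp: mok_def)
next
  case (Ar a e)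
  note pr = Ar.prems
  note sg1 = seg_append[OF pr(1)[unfolded cexp.simps]]
  let ?n = "length (cexp e d)"
  obtain s1 where s1: "run P (KB Bd) s ?n s1" "pc s1 = pc s + ?n" "inp s1 = inp s"
    "mem s1 d = eval e \<sigma>" "\<forall>r. r \<notin> {d..<96} \<longrightarrow> mem s1 r = mem s r" "mok Bd s1"
    using Ar.IH[of s d] pr sg1 by auto
  have "int (nodes e) * Bd \<le> 24 * Bd" using pr(6) assms(10) by (intro mult_right_mono) auto
  then have v: "\<bar>eval e \<sigma>\<bar> \<le> 24 * Bd" using eval_le[of Bd \<sigma> e] pr assms(10) by (simp add: order_trans)
  have v0: "0 \<le> eval e \<sigma>" and a: "a < 64" using pr by auto
  note ao = addr_ok[OF v assms(10) a v0]
  note sg2 = seg_append[OF conjunct2[OF sg1]]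
  have "\<exists>s'. run P (KB Bd) s1 7 s' \<and> pc s' = pc s1 + 7 \<and> inp s' = inp s1 \<and> mem s' d = 2 ^ 7 * mem s1 d
    \<and> (\<forall>r. r \<noteq> d \<longrightarrow> mem s' r = mem s1 r) \<and> mok Bd s'"
    using sg2 s1 ao by (intro run_double) auto
  then obtain s2 where s2: "run P (KB Bd) s1 7 s2" "pc s2 = pc s1 + 7" "inp s2 = inp s1"
    "mem s2 d = 2 ^ 7 * mem s1 d" "\<forall>r. r \<noteq> d \<longrightarrow> mem s2 r = mem s1 r" "mok Bd s2" by blast
  have sg3: "seg P (pc s2) [SetConst (d + 1) (int a), Add d d (d + 1), Load d d]"
    using conjunct2[OF sg2] s1 s2 by (simp add: add.assoc)
  let ?s3 = "step (SetConst (d + 1) (int a)) s2"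
  let ?s4 = "step (Add d d (d + 1)) ?s3"
  let ?s5 = "step (Load d d) ?s4"
  have m3: "mok Bd ?s3" using s2 ao by (auto simp: mok_def)
  have d4: "mem ?s4 d = 128 * eval e \<sigma> + int a" using s1 s2 by simp
  have m4: "mok Bd ?s4" using m3 ao s1 s2 by (auto simp: mok_def)
  have m5: "mok Bd ?s5" using m4 by (rule mok_step)
  have sg4: "seg P (pc ?s3) [Add d d (d + 1), Load d d]" using seg_Cons[OF sg3] by simp
  have sg5: "seg P (pc ?s4) [Load d d]" using seg_Cons[OF sg4] by simp
  have "run P (KB Bd) s2 (Suc (Suc (Suc 0))) ?s5"
    by (rule run_one[OF sg3 s2(6) _ run_one[OF sg4 m3 _ run_one[OF sg5 m4 _ run_refl]]]) (use ao in auto)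
  then have r: "run P (KB Bd) s (?n + (7 + Suc (Suc (Suc 0)))) ?s5"
    by (rule run_trans[OF s1(1) run_trans[OF s2(1)]])
  have rel4: "relm \<sigma> ?s4"
    using s1 s2 pr by (intro relm_cong[OF pr(2)]) auto
  have "mem ?s5 d = mem ?s4 (128 * nat (eval e \<sigma>) + a)" using d4 ao by simp
  also have "\<dots> = eval (Ar a e) \<sigma>" using rel4 a by (simp add: relm_def)
  finally have "mem ?s5 d = eval (Ar a e) \<sigma>" .
  moreover have "\<forall>r. r \<notin> {d..<96} \<longrightarrow> mem ?s5 r = mem s r" using s1 s2 pr by auto
  moreover have "pc ?s5 = pc s + length (cexp (Ar a e) d)" using s1 s2 by simp
  moreover have "inp ?s5 = inp s" using s1 s2 by simp
  moreover have "length (cexp (Ar a e) d) = ?n + (7 + Suc (Suc (Suc 0)))" by simp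
  ultimately show ?case using r m5 by metis
next
  case (Pl e1 e2)
  note pr = Pl.prems
  let ?n = "length (cexp e1 d)" and ?m = "length (cexp e2 (d + 1))"
  note sg1 = seg_append[OF pr(1)[unfolded cexp.simps]]
  note sg2 = seg_append[OF conjunct2[OF sg1]]
  obtain s1 where s1: "run P (KB Bd) s ?n s1" "pc s1 = pc s + ?n" "inp s1 = inp s"
    "mem s1 d = eval e1 \<sigma>" "\<forall>r. r \<notin> {d..<96} \<longrightarrow> mem s1 r = mem s r" "mok Bd s1"
    using Pl.IH(1)[of s d] pr sg1 by auto
  have rel1: "relm \<sigma> s1" using s1 pr by (intro relm_cong[OF pr(2)]) auto
  obtain s2 where s2: "run P (KB Bd) s1 ?m s2" "pc s2 = pc s1 + ?m" "inp s2 = inp s1"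
    "mem s2 (d + 1) = eval e2 \<sigma>" "\<forall>r. r \<notin> {d + 1..<96} \<longrightarrow> mem s2 r = mem s1 r" "mok Bd s2"
    using Pl.IH(2)[of s1 "d + 1"] pr sg2 s1 rel1 nodes_pos[of e1] by auto
  let ?s3 = "step (Add d d (d + 1)) s2"
  have "int (nodes (Pl e1 e2)) * Bd \<le> 24 * Bd" using pr(6) assms(10) by (intro mult_right_mono) auto
  then have "\<bar>eval (Pl e1 e2) \<sigma>\<bar> \<le> 24 * Bd"
    using eval_le[of Bd \<sigma> "Pl e1 e2"] pr(4,5) assms(10) by linarith
  moreover have d3: "mem ?s3 d = eval (Pl e1 e2) \<sigma>" using s1 s2 by simp
  ultimately have m3: "mok Bd ?s3" using s2(6) assms(10) by (auto simp: mok_def MB_def)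
  have "run P (KB Bd) s2 1 ?s3"
    using conjunct2[OF sg2] s1 s2 by (intro run_one'[of _ _ _ "[]"]) (auto simp: add.assoc)
  then have "run P (KB Bd) s (?n + (?m + 1)) ?s3"
    by (rule run_trans[OF s1(1) run_trans[OF s2(1)]])
  then have "run P (KB Bd) s (length (cexp (Pl e1 e2) d)) ?s3" by simp
  moreover have "\<forall>r. r \<notin> {d..<96} \<longrightarrow> mem ?s3 r = mem s r" using s1 s2 pr by auto
  moreover have "pc ?s3 = pc s + length (cexp (Pl e1 e2) d)" "inp ?s3 = inp s" using s1 s2 by auto
  ultimately show ?case using d3 m3 by metis
next
  case (Mi e1 e2)
  note pr = Mi.prems
  let ?n = "length (cexp e1 d)" and ?m = "length (cexp e2 (d + 1))"
  note sg1 = seg_append[OF pr(1)[unfolded cexp.simps]]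
  note sg2 = seg_append[OF conjunct2[OF sg1]]
  obtain s1 where s1: "run P (KB Bd) s ?n s1" "pc s1 = pc s + ?n" "inp s1 = inp s"
    "mem s1 d = eval e1 \<sigma>" "\<forall>r. r \<notin> {d..<96} \<longrightarrow> mem s1 r = mem s r" "mok Bd s1"
    using Mi.IH(1)[of s d] pr sg1 by auto
  have rel1: "relm \<sigma> s1" using s1 pr by (intro relm_cong[OF pr(2)]) auto
  obtain s2 where s2: "run P (KB Bd) s1 ?m s2" "pc s2 = pc s1 + ?m" "inp s2 = inp s1"
    "mem s2 (d + 1) = eval e2 \<sigma>" "\<forall>r. r \<notin> {d + 1..<96} \<longrightarrow> mem s2 r = mem s1 r" "mok Bd s2"
    using Mi.IH(2)[of s1 "d + 1"] pr sg2 s1 rel1 nodes_pos[of e1] by auto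
  let ?s3 = "step (Sub d d (d + 1)) s2"
  have "int (nodes (Mi e1 e2)) * Bd \<le> 24 * Bd" using pr(6) assms(10) by (intro mult_right_mono) auto
  then have "\<bar>eval (Mi e1 e2) \<sigma>\<bar> \<le> 24 * Bd"
    using eval_le[of Bd \<sigma> "Mi e1 e2"] pr(4,5) assms(10) by linarith
  moreover have d3: "mem ?s3 d = eval (Mi e1 e2) \<sigma>" using s1 s2 by simp
  ultimately have m3: "mok Bd ?s3" using s2(6) assms(10) by (auto simp: mok_def MB_def)
  have "run P (KB Bd) s2 1 ?s3"
    using conjunct2[OF sg2] s1 s2 by (intro run_one'[of _ _ _ "[]"]) (auto simp: add.assoc)
  then have "run P (KB Bd) s (?n + (?m + 1)) ?s3"
    by (rule run_trans[OF s1(1) run_trans[OF s2(1)]])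
  then have "run P (KB Bd) s (length (cexp (Mi e1 e2) d)) ?s3" by simp
  moreover have "\<forall>r. r \<notin> {d..<96} \<longrightarrow> mem ?s3 r = mem s r" using s1 s2 pr by auto
  moreover have "pc ?s3 = pc s + length (cexp (Mi e1 e2) d)" "inp ?s3 = inp s" using s1 s2 by auto
  ultimately show ?case using d3 m3 by metis
qed

section \<open>Program logic with time bounds\<close>

definition rep :: "int \<Rightarrow> store \<Rightarrow> config \<Rightarrow> bool" where
  "rep Bd \<sigma> s \<longleftrightarrow> relm \<sigma> s \<and> bnd Bd \<sigma> \<and> mok Bd s \<and> (\<forall>x\<in>set (inp s). \<bar>x\<bar> \<le> Bd) \<and>
     (\<forall>i. \<sigma> 64 i = (if i < length (inp s) then inp s ! i else 0))"

text \<open>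
  Programs are verified by triples with a time bound \<open>T\<close>, one unit of which pays for \<open>600\<close> machine
  instructions: an assignment has two expressions of at most \<open>24\<close> nodes each, a node is compiled to at
  most \<open>11\<close> instructions, and \<open>10\<close> more are needed for the address and the store. Array elements are bounded by \<open>Bd\<close>, hence
  addresses and intermediate values by \<open>4096 * Bd\<close>, and \<open>KB Bd\<close> bounds the cost of an instruction.
\<close>

definition ht :: "int \<Rightarrow> (store \<Rightarrow> bool) \<Rightarrow> com \<Rightarrow> nat \<Rightarrow> (store \<Rightarrow> bool) \<Rightarrow> bool" where
  "ht Bd P c T Q \<longleftrightarrow> (\<forall>prog d (s :: config) \<sigma>. wfc d c \<longrightarrow> seg prog (pc s) (comp c (pc s) d) \<longrightarrow> rep Bd \<sigma> s \<longrightarrow> P \<sigma> \<longrightarrow>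
     (\<exists>m s' \<sigma>'. run prog (KB Bd) s m s' \<and> m \<le> 600 * T \<and> pc s' = pc s + length (comp c (pc s) d) \<and>
        rep Bd \<sigma>' s' \<and> Q \<sigma>' \<and> (\<forall>a. a \<notin> mods c \<longrightarrow> \<sigma>' a = \<sigma> a) \<and>
        (\<forall>j<d. mem s' (96 + j) = mem s (96 + j))))"

lemma htI:
  assumes "\<And>prog d (s :: config) \<sigma>. wfc d c \<Longrightarrow> seg prog (pc s) (comp c (pc s) d) \<Longrightarrow> rep Bd \<sigma> s \<Longrightarrow> P \<sigma> \<Longrightarrow>
     \<exists>m s' \<sigma>'. run prog (KB Bd) s m s' \<and> m \<le> 600 * T \<and> pc s' = pc s + length (comp c (pc s) d) \<and>
        rep Bd \<sigma>' s' \<and> Q \<sigma>' \<and> (\<forall>a. a \<notin> mods c \<longrightarrow> \<sigma>' a = \<sigma> a) \<and>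
        (\<forall>j<d. mem s' (96 + j) = mem s (96 + j))"
  shows "ht Bd P c T Q"
  unfolding ht_def using assms by blast

lemma htD:
  fixes s :: config
  assumes "ht Bd P c T Q" "wfc d c" "seg prog (pc s) (comp c (pc s) d)" "rep Bd \<sigma> s" "P \<sigma>"
  obtains m s' \<sigma>' where "run prog (KB Bd) s m s'" "m \<le> 600 * T" "pc s' = pc s + length (comp c (pc s) d)"
    "rep Bd \<sigma>' s'" "Q \<sigma>'" "\<And>a. a \<notin> mods c \<Longrightarrow> \<sigma>' a = \<sigma> a" "\<And>j. j < d \<Longrightarrow> mem s' (96 + j) = mem s (96 + j)"
  using assms unfolding ht_def by blast

text \<open>Consequence and frame rule in one: the new postcondition may use that names outside
  \<open>mods c\<close> are unchanged, and both conditions may use the size bound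
  \<open>bnd\<close>.\<close>

lemma ht_use:
  assumes h: "ht Bd P c T Q" and pre: "\<And>\<sigma>. P' \<sigma> \<Longrightarrow> bnd Bd \<sigma> \<Longrightarrow> P \<sigma>" and T: "T \<le> T'"
    and post: "\<And>\<sigma> \<sigma>'. P' \<sigma> \<Longrightarrow> bnd Bd \<sigma> \<Longrightarrow> Q \<sigma>' \<Longrightarrow> (\<And>a. a \<notin> mods c \<Longrightarrow> \<sigma>' a = \<sigma> a) \<Longrightarrow> bnd Bd \<sigma>' \<Longrightarrow> Q' \<sigma>'"
  shows "ht Bd P' c T' Q'"
proof (rule htI)
  fix prog d and s :: config and \<sigma>
  assume a: "wfc d c" "seg prog (pc s) (comp c (pc s) d)" "rep Bd \<sigma> s" "P' \<sigma>"
  have b: "bnd Bd \<sigma>" using a(3) by (simp add: rep_def)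
  from htD[OF h a(1-3) pre[OF a(4) b]] obtain m s' \<sigma>' where
    r: "run prog (KB Bd) s m s'" "m \<le> 600 * T" "pc s' = pc s + length (comp c (pc s) d)"
    "rep Bd \<sigma>' s'" "Q \<sigma>'" "\<And>a. a \<notin> mods c \<Longrightarrow> \<sigma>' a = \<sigma> a" "\<And>j. j < d \<Longrightarrow> mem s' (96 + j) = mem s (96 + j)"
    by blast
  have "Q' \<sigma>'" using post[OF a(4) b r(5,6)] r(4) by (simp add: rep_def)
  moreover have "m \<le> 600 * T'" using r(2) T by simp
  ultimately show "\<exists>m s' \<sigma>'. run prog (KB Bd) s m s' \<and> m \<le> 600 * T' \<and> pc s' = pc s + length (comp c (pc s) d) \<and>
        rep Bd \<sigma>' s' \<and> Q' \<sigma>' \<and> (\<forall>a. a \<notin> mods c \<longrightarrow> \<sigma>' a = \<sigma> a) \<and>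
        (\<forall>j<d. mem s' (96 + j) = mem s (96 + j))"
    using r by blast
qed

text \<open>Fixes the initial store, so that the witnesses of an existential precondition can be
  chosen before the triple is proved.\<close>

lemma ht_init:
  assumes "\<And>\<sigma>0. P \<sigma>0 \<Longrightarrow> bnd Bd \<sigma>0 \<Longrightarrow> ht Bd (\<lambda>\<sigma>. \<sigma> = \<sigma>0) c T Q"
  shows "ht Bd P c T Q"
  using assms unfolding ht_def rep_def by blast

lemma ht_skip: "ht Bd Q CSkip 0 Q"
  by (rule htI) (use run_refl in fastforce)

lemma ht_seq:
  assumes h1: "ht Bd P c1 T1 Q" and h2: "ht Bd Q c2 T2 R"
  shows "ht Bd P (c1 ;; c2) (T1 + T2) R"
proof (rule htI)
  fix prog d and s :: config and \<sigma>
  let ?p = "comp c1 (pc s) d"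
  assume a: "wfc d (c1 ;; c2)" "seg prog (pc s) (comp (c1 ;; c2) (pc s) d)" "rep Bd \<sigma> s" "P \<sigma>"
  have sg: "seg prog (pc s) ?p" "seg prog (pc s + length ?p) (comp c2 (pc s + length ?p) d)"
    using a(2) seg_append by (auto simp: Let_def)
  have w: "wfc d c1" "wfc d c2" using a by auto
  from htD[OF h1 w(1) sg(1) a(3,4)] obtain m1 s1 \<sigma>1 where
    r: "run prog (KB Bd) s m1 s1" "m1 \<le> 600 * T1" "pc s1 = pc s + length ?p" "rep Bd \<sigma>1 s1" "Q \<sigma>1"
    "\<And>a. a \<notin> mods c1 \<Longrightarrow> \<sigma>1 a = \<sigma> a" "\<And>j. j < d \<Longrightarrow> mem s1 (96 + j) = mem s (96 + j)"
    by blast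
  have "seg prog (pc s1) (comp c2 (pc s1) d)" using sg r by simp
  from htD[OF h2 w(2) this r(4,5)] obtain m2 s2 \<sigma>2 where
    r2: "run prog (KB Bd) s1 m2 s2" "m2 \<le> 600 * T2" "pc s2 = pc s1 + length (comp c2 (pc s1) d)"
    "rep Bd \<sigma>2 s2" "R \<sigma>2"
    "\<And>a. a \<notin> mods c2 \<Longrightarrow> \<sigma>2 a = \<sigma>1 a" "\<And>j. j < d \<Longrightarrow> mem s2 (96 + j) = mem s1 (96 + j)"
    by blast
  have "run prog (KB Bd) s (m1 + m2) s2" using run_trans r r2 by blast
  moreover have "m1 + m2 \<le> 600 * (T1 + T2)" using r r2 by simp
  moreover have "pc s2 = pc s + length (comp (c1 ;; c2) (pc s) d)" using r r2 by (simp add: Let_def)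
  ultimately show "\<exists>m s' \<sigma>'. run prog (KB Bd) s m s' \<and> m \<le> 600 * (T1 + T2) \<and>
        pc s' = pc s + length (comp (c1 ;; c2) (pc s) d) \<and>
        rep Bd \<sigma>' s' \<and> R \<sigma>' \<and> (\<forall>a. a \<notin> mods (c1 ;; c2) \<longrightarrow> \<sigma>' a = \<sigma> a) \<and>
        (\<forall>j<d. mem s' (96 + j) = mem s (96 + j))"
    using r r2 by (intro exI[of _ "m1 + m2"] exI[of _ s2] exI[of _ \<sigma>2]) auto
qed

lemma ht_asg:
  assumes B: "128 \<le> Bd"
  shows "ht Bd (\<lambda>\<sigma>. okx i \<sigma> \<and> 0 \<le> eval i \<sigma> \<and> okx e \<sigma> \<and> \<bar>eval e \<sigma>\<bar> \<le> Bd \<and>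
      Q (\<sigma>(a := (\<sigma> a)(nat (eval i \<sigma>) := eval e \<sigma>)))) (CAsg a i e) 1 Q"
proof (rule htI)
  fix prog d and s :: config and \<sigma>
  assume w: "wfc d (CAsg a i e)" and sg: "seg prog (pc s) (comp (CAsg a i e) (pc s) d)"
    and rep: "rep Bd \<sigma> s" and pre: "okx i \<sigma> \<and> 0 \<le> eval i \<sigma> \<and> okx e \<sigma> \<and> \<bar>eval e \<sigma>\<bar> \<le> Bd \<and>
      Q (\<sigma>(a := (\<sigma> a)(nat (eval i \<sigma>) := eval e \<sigma>)))"
  let ?n = "length (cexp i 64)" and ?m = "length (cexp e 65)"
  have a: "a < 64" and wi: "wfx i" "nodes i \<le> 24" and we: "wfx e" "nodes e \<le> 24" using w by (auto simp: wfe_def)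
  have rl: "relm \<sigma> s" and b: "bnd Bd \<sigma>" and mk: "mok Bd s" using rep by (auto simp: rep_def)
  note sg1 = seg_append[OF sg[unfolded comp.simps]]
  note sg2 = seg_append[OF conjunct2[OF sg1]]
  note sg3 = seg_append[OF conjunct2[OF sg2]]
  obtain s1 where s1: "run prog (KB Bd) s ?n s1" "pc s1 = pc s + ?n" "inp s1 = inp s"
    "mem s1 64 = eval i \<sigma>" "\<forall>r. r \<notin> {64..<96} \<longrightarrow> mem s1 r = mem s r" "mok Bd s1"
    using cexp_run[OF _ rl mk b wi, of prog 64] sg1 pre B wi by auto
  have rl1: "relm \<sigma> s1" using s1 by (intro relm_cong[OF rl]) auto
  obtain s2 where s2: "run prog (KB Bd) s1 ?m s2" "pc s2 = pc s1 + ?m" "inp s2 = inp s1"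
    "mem s2 65 = eval e \<sigma>" "\<forall>r. r \<notin> {65..<96} \<longrightarrow> mem s2 r = mem s1 r" "mok Bd s2"
    using cexp_run[OF _ rl1 s1(6) b we, of prog 65] sg2 s1 pre B we by auto
  have d2: "mem s2 64 = eval i \<sigma>" using s1 s2 by simp
  have "int (nodes i) * Bd \<le> 24 * Bd" using wi B by (intro mult_right_mono) auto
  then have v: "\<bar>eval i \<sigma>\<bar> \<le> 24 * Bd" using eval_le[OF b wi(1)] B by (simp add: order_trans)
  have v0: "0 \<le> eval i \<sigma>" using pre by simp
  note ao = addr_ok[OF v B a v0]
  have "\<exists>s'. run prog (KB Bd) s2 7 s' \<and> pc s' = pc s2 + 7 \<and> inp s' = inp s2 \<and> mem s' 64 = 2 ^ 7 * mem s2 64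
    \<and> (\<forall>r. r \<noteq> 64 \<longrightarrow> mem s' r = mem s2 r) \<and> mok Bd s'"
    using sg3 s1 s2 ao d2 by (intro run_double) (auto simp: add.assoc)
  then obtain s3 where s3: "run prog (KB Bd) s2 7 s3" "pc s3 = pc s2 + 7" "inp s3 = inp s2"
    "mem s3 64 = 2 ^ 7 * mem s2 64" "\<forall>r. r \<noteq> 64 \<longrightarrow> mem s3 r = mem s2 r" "mok Bd s3" by blast
  have sg4: "seg prog (pc s3) [SetConst 66 (int a), Add 64 64 66, Store 64 65]"
    using conjunct2[OF sg3] s1 s2 s3 by (simp add: add.assoc)
  let ?s4 = "step (SetConst 66 (int a)) s3"
  let ?s5 = "step (Add 64 64 66) ?s4"
  let ?s6 = "step (Store 64 65) ?s5"
  have m4: "mok Bd ?s4" using s3 ao by (auto simp: mok_def)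
  have d5: "mem ?s5 64 = 128 * eval i \<sigma> + int a" "mem ?s5 65 = eval e \<sigma>" using d2 s2 s3 by auto
  have m5: "mok Bd ?s5" using m4 ao d2 s3 by (auto simp: mok_def)
  have m6: "mok Bd ?s6" using m5 by (rule mok_step)
  have sg5: "seg prog (pc ?s4) [Add 64 64 66, Store 64 65]" using seg_Cons[OF sg4] by simp
  have sg6: "seg prog (pc ?s5) [Store 64 65]" using seg_Cons[OF sg5] by simp
  have "run prog (KB Bd) s3 (Suc (Suc (Suc 0))) ?s6"
    by (rule run_one[OF sg4 s3(6) _ run_one[OF sg5 m4 _ run_one[OF sg6 m5 _ run_refl]]]) (use ao in auto)
  then have r: "run prog (KB Bd) s (?n + (?m + (7 + Suc (Suc (Suc 0))))) ?s6"
    by (rule run_trans[OF s1(1) run_trans[OF s2(1) run_trans[OF s3(1)]]])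
  let ?\<sigma> = "\<sigma>(a := (\<sigma> a)(nat (eval i \<sigma>) := eval e \<sigma>))"
  let ?r = "128 * nat (eval i \<sigma>) + a"
  have m6': "mem ?s6 = (mem ?s5)(?r := eval e \<sigma>)"
    using d5 ao by simp
  have rl5: "relm \<sigma> ?s5" using s2 s3 by (intro relm_cong[OF rl1]) auto
  have "relm ?\<sigma> ?s6"
    unfolding relm_def
  proof (intro allI impI)
    fix a' j :: nat assume a': "a' < 64"
    \<comment> \<open>Index and name are recovered as quotient and remainder, so the store
      instruction hits no other element.\<close>
    have "(128 * j + a') div 128 = j" "(128 * j + a') mod 128 = a'" "?r div 128 = nat (eval i \<sigma>)" "?r mod 128 = a"
      using a a' by auto
    then have "128 * j + a' = ?r \<longleftrightarrow> j = nat (eval i \<sigma>) \<and> a' = a" by metis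
    then show "mem ?s6 (128 * j + a') = ?\<sigma> a' j"
      using rl5 a' unfolding m6' by (auto simp: relm_def)
  qed
  moreover have "bnd Bd ?\<sigma>" using b pre by (auto simp: bnd_def)
  ultimately have "rep Bd ?\<sigma> ?s6" using rep m6 s1 s2 s3 a by (auto simp: rep_def)
  moreover have "?n + (?m + (7 + Suc (Suc (Suc 0)))) \<le> 600 * 1"
    using length_cexp[of i 64] length_cexp[of e 65] wi we by simp
  moreover have "mem ?s6 (96 + j) = mem s (96 + j)" if "j < d" for j
  proof -
    have "96 + j \<noteq> ?r"
    proof
      assume r: "96 + j = ?r"
      have "96 + j < 128" using that w by simp
      then have "(96 + j) mod 128 = 96 + j" by (rule mod_less)
      moreover have "?r mod 128 = a" using a by simp
      ultimately have "96 + j = a" using r by metis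
      then show False using a by simp
    qed
    then show ?thesis unfolding m6' using s1 s2 s3 by simp
  qed
  moreover have "pc ?s6 = pc s + length (comp (CAsg a i e) (pc s) d)" using s1 s2 s3 by simp
  ultimately show "\<exists>m s' \<sigma>'. run prog (KB Bd) s m s' \<and> m \<le> 600 * 1 \<and>
        pc s' = pc s + length (comp (CAsg a i e) (pc s) d) \<and>
        rep Bd \<sigma>' s' \<and> Q \<sigma>' \<and> (\<forall>a'. a' \<notin> mods (CAsg a i e) \<longrightarrow> \<sigma>' a' = \<sigma> a') \<and>
        (\<forall>j<d. mem s' (96 + j) = mem s (96 + j))"
    using r pre by (intro exI[of _ "?n + (?m + (7 + Suc (Suc (Suc 0))))"] exI[of _ ?s6] exI[of _ ?\<sigma>]) auto
qed

text \<open>The unread input appears to the logic as an array with name 64 that loses its first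
  entry; no register represents it.\<close>

lemma ht_rd:
  fixes Q :: "store \<Rightarrow> bool"
  shows
  "ht Bd (\<lambda>\<sigma>. Q (\<sigma>(a := (\<sigma> a)(0 := \<sigma> 64 0), 64 := (\<lambda>i. \<sigma> 64 (Suc i))))) (CRd a) 1 Q"
proof (rule htI)
  fix prog d and s :: config and \<sigma> :: store
  let ?\<sigma> = "\<sigma>(a := (\<sigma> a)(0 := \<sigma> 64 0), 64 := (\<lambda>i. \<sigma> 64 (Suc i)))"
  assume w: "wfc d (CRd a)" and sg: "seg prog (pc s) (comp (CRd a) (pc s) d)"
    and rep: "rep Bd \<sigma> s" and pre: "Q ?\<sigma>"
  have a: "a < 64" using w by simp
  let ?s = "step (Read a) s"
  have "\<bar>\<sigma> a 0\<bar> \<le> Bd" using rep a by (simp add: rep_def bnd_def)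
  then have B0: "0 \<le> Bd" by linarith
  have nx: "next_input s = \<sigma> 64 0" "\<bar>next_input s\<bar> \<le> Bd"
    using rep B0 by (auto simp: rep_def next_input_def split: list.splits)
  have nM: "\<bar>next_input s\<bar> \<le> MB Bd" using nx B0 by (simp add: MB_def)
  have ad: "128 * i + a' = a \<longleftrightarrow> i = 0 \<and> a' = a" if "a' < 64" for i a' :: nat
    using that a by (cases i) auto
  have "relm ?\<sigma> ?s"
    using rep nx(1) a by (auto simp: rep_def relm_def ad)
  moreover have "bnd Bd ?\<sigma>" using rep nx by (auto simp: rep_def bnd_def)
  moreover have "mok Bd ?s" using rep nM by (auto simp: rep_def mok_def)
  moreover have "\<forall>x\<in>set (inp ?s). \<bar>x\<bar> \<le> Bd" using rep by (cases "inp s") (auto simp: rep_def)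
  moreover have "?\<sigma> 64 i = (if i < length (inp ?s) then inp ?s ! i else 0)" for i
    using rep by (auto simp: rep_def nth_tl)
  ultimately have "rep Bd ?\<sigma> ?s" by (simp add: rep_def)
  moreover have "run prog (KB Bd) s (Suc 0) ?s"
  proof -
    have "cost (Read a) s \<le> KB Bd" using nM by (simp add: bits_KB1)
    then have "run prog (KB Bd) s (Suc 0) (step (prog ! pc s) s)"
      using sg seg_Cons[of prog "pc s" "Read a" "[]"] by (intro run_step run_refl) auto
    then show ?thesis using sg seg_Cons[of prog "pc s" "Read a" "[]"] by simp
  qed
  moreover have "mem ?s (96 + j) = mem s (96 + j)" if "j < d" for j using a by simp
  ultimately show "\<exists>m s' \<sigma>'. run prog (KB Bd) s m s' \<and> m \<le> 600 * 1 \<and>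
        pc s' = pc s + length (comp (CRd a) (pc s) d) \<and>
        rep Bd \<sigma>' s' \<and> Q \<sigma>' \<and> (\<forall>a'. a' \<notin> mods (CRd a) \<longrightarrow> \<sigma>' a' = \<sigma> a') \<and>
        (\<forall>j<d. mem s' (96 + j) = mem s (96 + j))"
    using pre by (intro exI[of _ "Suc 0"] exI[of _ ?s] exI[of _ ?\<sigma>]) auto
qed

lemma cexp_rep:
  fixes s :: config
  assumes sg: "seg prog (pc s) (cexp e 64)" and rep: "rep Bd \<sigma> s" and w: "wfe e" and ok: "okx e \<sigma>"
    and B: "128 \<le> Bd"
  obtains s1 where "run prog (KB Bd) s (length (cexp e 64)) s1" "length (cexp e 64) \<le> 264"
    "pc s1 = pc s + length (cexp e 64)" "rep Bd \<sigma> s1" "mem s1 64 = eval e \<sigma>"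
    "\<And>r. r \<notin> {64..<96} \<Longrightarrow> mem s1 r = mem s r" "\<bar>eval e \<sigma>\<bar> \<le> MB Bd"
proof -
  have w': "wfx e" "nodes e \<le> 24" using w by (auto simp: wfe_def)
  have rl: "relm \<sigma> s" and b: "bnd Bd \<sigma>" and mk: "mok Bd s" using rep by (auto simp: rep_def)
  obtain s1 where s1: "run prog (KB Bd) s (length (cexp e 64)) s1" "pc s1 = pc s + length (cexp e 64)"
    "inp s1 = inp s" "mem s1 64 = eval e \<sigma>" "\<forall>r. r \<notin> {64..<96} \<longrightarrow> mem s1 r = mem s r" "mok Bd s1"
    using cexp_run[OF sg rl mk b w' ok] B w' by auto
  have "relm \<sigma> s1" using s1 by (intro relm_cong[OF rl]) auto
  then have "rep Bd \<sigma> s1" using s1 rep by (simp add: rep_def)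
  moreover have "length (cexp e 64) \<le> 264" using length_cexp[of e 64] w' by simp
  moreover have "\<bar>eval e \<sigma>\<bar> \<le> MB Bd" using s1(4,6) by (metis mok_def)
  ultimately show thesis using that s1 by blast
qed

lemma rep_cong:
  fixes s s' :: config
  assumes "rep Bd \<sigma> s" "\<And>r. r \<notin> {64..<128} \<Longrightarrow> mem s' r = mem s r" "inp s' = inp s" "mok Bd s'"
  shows "rep Bd \<sigma> s'"
  using assms relm_cong[of \<sigma> s s'] by (auto simp: rep_def)

lemma ht_if:
  assumes h1: "ht Bd P1 c1 T Q" and h2: "ht Bd P2 c2 T Q" and B: "128 \<le> Bd"
  shows "ht Bd (\<lambda>\<sigma>. okx e \<sigma> \<and> (if 0 < eval e \<sigma> then P1 \<sigma> else P2 \<sigma>)) (CIf e c1 c2) (Suc T) Q"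
proof (rule htI)
  fix prog d and s :: config and \<sigma>
  assume w: "wfc d (CIf e c1 c2)" and sg: "seg prog (pc s) (comp (CIf e c1 c2) (pc s) d)"
    and rep: "rep Bd \<sigma> s" and pre: "okx e \<sigma> \<and> (if 0 < eval e \<sigma> then P1 \<sigma> else P2 \<sigma>)"
  define n where "n = length (cexp e 64)"
  define p2 where "p2 = comp c2 (pc s + n + 1) d"
  define l1 where "l1 = pc s + n + length p2 + 3"
  define p1 where "p1 = comp c1 l1 d"
  have code: "comp (CIf e c1 c2) (pc s) d =
    cexp e 64 @ [JumpPos 64 l1] @ p2 @ [SetConst 64 1, JumpPos 64 (l1 + length p1)] @ p1"
    by (simp add: n_def p2_def l1_def p1_def Let_def)
  then have len: "pc s + length (comp (CIf e c1 c2) (pc s) d) = l1 + length p1"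
    by (simp add: n_def l1_def)
  note sg1 = seg_append[OF sg[unfolded code]]
  note sg2 = seg_append[OF conjunct2[OF sg1]]
  note sg3 = seg_append[OF conjunct2[OF sg2]]
  note sg4 = seg_append[OF conjunct2[OF sg3]]
  have we: "wfe e" and w1: "wfc d c1" and w2: "wfc d c2" using w by auto
  from cexp_rep[OF conjunct1[OF sg1] rep we _ B] pre obtain s1 where
    s1: "run prog (KB Bd) s n s1" "n \<le> 264" "pc s1 = pc s + n" "rep Bd \<sigma> s1" "mem s1 64 = eval e \<sigma>"
    "\<And>r. r \<notin> {64..<96} \<Longrightarrow> mem s1 r = mem s r"
    unfolding n_def by blast
  have mk1: "mok Bd s1" using s1 by (simp add: rep_def)
  let ?s2 = "step (JumpPos 64 l1) s1"
  have r2: "run prog (KB Bd) s (n + 1) ?s2"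
    using sg2 s1 mk1 by (intro run_trans[OF s1(1)] run_one'[of _ _ _ "[]"]) (auto simp: n_def)
  have rep2: "rep Bd \<sigma> ?s2" using s1(4) by (simp add: rep_def relm_def mok_def)
  show "\<exists>m s' \<sigma>'. run prog (KB Bd) s m s' \<and> m \<le> 600 * Suc T \<and>
        pc s' = pc s + length (comp (CIf e c1 c2) (pc s) d) \<and>
        rep Bd \<sigma>' s' \<and> Q \<sigma>' \<and> (\<forall>a'. a' \<notin> mods (CIf e c1 c2) \<longrightarrow> \<sigma>' a' = \<sigma> a') \<and>
        (\<forall>j<d. mem s' (96 + j) = mem s (96 + j))"
  proof (cases "0 < eval e \<sigma>")
    case True
    have pc2: "pc ?s2 = l1" using True s1 by simp
    have "seg prog (pc ?s2) (comp c1 (pc ?s2) d)"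
      using conjunct2[OF sg4] unfolding pc2 p1_def[symmetric] by (simp add: l1_def n_def eval_nat_numeral)
    from htD[OF h1 w1 this rep2] True pre obtain m s' \<sigma>' where
      r: "run prog (KB Bd) ?s2 m s'" "m \<le> 600 * T" "pc s' = pc ?s2 + length (comp c1 (pc ?s2) d)"
      "rep Bd \<sigma>' s'" "Q \<sigma>'" "\<And>a. a \<notin> mods c1 \<Longrightarrow> \<sigma>' a = \<sigma> a" "\<And>j. j < d \<Longrightarrow> mem s' (96 + j) = mem ?s2 (96 + j)"
      by metis
    show ?thesis
      using r s1 run_trans[OF r2 r(1)] unfolding len pc2 p1_def[symmetric]
      by (intro exI[of _ "n + 1 + m"] exI[of _ s'] exI[of _ \<sigma>']) auto
  next
    case False
    have pc2: "pc ?s2 = pc s + n + 1" using False s1 by simp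
    have "seg prog (pc ?s2) (comp c2 (pc ?s2) d)"
      using conjunct1[OF sg3] unfolding pc2 p2_def[symmetric] by (simp add: n_def)
    from htD[OF h2 w2 this rep2] False pre obtain m s' \<sigma>' where
      r: "run prog (KB Bd) ?s2 m s'" "m \<le> 600 * T" "pc s' = pc ?s2 + length (comp c2 (pc ?s2) d)"
      "rep Bd \<sigma>' s'" "Q \<sigma>'" "\<And>a. a \<notin> mods c2 \<Longrightarrow> \<sigma>' a = \<sigma> a" "\<And>j. j < d \<Longrightarrow> mem s' (96 + j) = mem ?s2 (96 + j)"
      by metis
    have pc': "pc s' = pc s + n + 1 + length p2" using r(3) unfolding pc2 p2_def[symmetric] .
    have mk': "mok Bd s'" using r by (simp add: rep_def)
    let ?s3 = "step (SetConst 64 1) s'"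
    let ?s4 = "step (JumpPos 64 (l1 + length p1)) ?s3"
    have sg5: "seg prog (pc s') [SetConst 64 1, JumpPos 64 (l1 + length p1)]"
      using conjunct1[OF sg4] unfolding pc' by (simp add: n_def)
    have mk3: "mok Bd ?s3" using mk' B by (auto simp: mok_def MB_def)
    have "run prog (KB Bd) s' (Suc (Suc 0)) ?s4"
      by (rule run_one[OF sg5 mk' _ run_one[OF _ mk3 _ run_refl]])
        (use B seg_Cons[OF sg5] in \<open>auto simp: MB_def\<close>)
    then have run: "run prog (KB Bd) s (n + 1 + (m + Suc (Suc 0))) ?s4"
      by (rule run_trans[OF r2 run_trans[OF r(1)]])
    have rep4: "rep Bd \<sigma>' ?s4" using mk3 by (intro rep_cong[OF r(4)]) (auto simp: mok_def)
    show ?thesis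
      using r s1 run rep4 unfolding len
      by (intro exI[of _ "n + 1 + (m + Suc (Suc 0))"] exI[of _ ?s4] exI[of _ \<sigma>']) auto
  qed
qed

text \<open>The invariant for \<open>Suc i\<close> is demanded of the store with the counter already
  raised, since the compiled loop does this after the body. The number of iterations is evaluated
  once, at entry, and kept in the register of the nesting depth.\<close>

lemma ht_for:
  assumes N: "\<And>\<sigma>. P \<sigma> \<Longrightarrow> bnd Bd \<sigma> \<Longrightarrow> okx e \<sigma> \<and> eval e \<sigma> = int N \<and> Inv 0 (\<sigma>(x := (\<sigma> x)(0 := 0)))"
    and NB: "int N \<le> Bd"
    and body: "\<And>i. i < N \<Longrightarrow> ht Bd (\<lambda>\<sigma>. Inv i \<sigma> \<and> \<sigma> x 0 = int i) c T
        (\<lambda>\<sigma>. Inv (Suc i) (\<sigma>(x := (\<sigma> x)(0 := int (Suc i)))))"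
    and x: "x \<notin> mods c" and B: "128 \<le> Bd"
  shows "ht Bd P (CFor x e c) (N * Suc T + 1) (Inv N)"
proof (rule htI)
  fix prog d and s :: config and \<sigma>
  assume w: "wfc d (CFor x e c)" and sg: "seg prog (pc s) (comp (CFor x e c) (pc s) d)"
    and rep: "rep Bd \<sigma> s" and pre: "P \<sigma>"
  define n where "n = length (cexp e 64)"
  define lt where "lt = pc s + n + 3"
  define p where "p = comp c (lt + 3) (Suc d)"
  define h where "h = 96 + d"
  have d: "d < 32" and x64: "x < 64" and we: "wfe e" and wc: "wfc (Suc d) c" using w by auto
  have code: "comp (CFor x e c) (pc s) d =
    cexp e 64 @ [SetConst 65 0, Add h 64 65, SetConst x 0,
      JumpPos h (lt + 3), SetConst 64 1, JumpPos 64 (lt + length p + 7)] @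
        p @ [SetConst 64 1, Add x x 64, Sub h h 64, JumpPos 64 lt]"
    by (simp add: n_def p_def lt_def h_def Let_def)
  then have len: "pc s + length (comp (CFor x e c) (pc s) d) = lt + length p + 7"
    by (simp add: n_def lt_def)
  note sg1 = seg_append[OF sg[unfolded code]]
  note sg2 = seg_append[OF conjunct2[OF sg1]]
  note sg3 = seg_append[OF conjunct2[OF sg2]]
  have pre': "okx e \<sigma>" "eval e \<sigma> = int N" "Inv 0 (\<sigma>(x := (\<sigma> x)(0 := 0)))"
    using N[OF pre] rep by (auto simp: rep_def)
  have sgp: "seg prog (lt + 3) p" using conjunct1[OF sg3] by (simp add: n_def lt_def eval_nat_numeral)
  have sge: "seg prog (lt + 3 + length p) [SetConst 64 1, Add x x 64, Sub h h 64, JumpPos 64 lt]"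
    using conjunct2[OF sg3] by (simp add: n_def lt_def eval_nat_numeral)
  note c1 = seg_Cons[OF conjunct1[OF sg2, folded n_def]]
  note c2 = seg_Cons[OF conjunct2[OF conjunct2[OF c1]]]
  note c3 = seg_Cons[OF conjunct2[OF conjunct2[OF c2]]]
  have sgt: "seg prog lt [JumpPos h (lt + 3), SetConst 64 1, JumpPos 64 (lt + length p + 7)]"
    using conjunct2[OF conjunct2[OF c3]] by (simp add: lt_def eval_nat_numeral)
  have NMB: "int N \<le> MB Bd" using NB B by (simp add: MB_def)
  \<comment> \<open>Induction on the number \<open>m\<close> of iterations left, which is the
    content of register \<open>h\<close>. The final 3 pays for the instructions that leave the
    loop.\<close>
  have loop: "\<exists>m' s' \<sigma>'. run prog (KB Bd) t m' s' \<and> m' \<le> 600 * (m * Suc T) + 3 \<and>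
        pc s' = lt + length p + 7 \<and>
        rep Bd \<sigma>' s' \<and> Inv N \<sigma>' \<and> (\<forall>a'. a' \<notin> insert x (mods c) \<longrightarrow> \<sigma>' a' = \<tau> a') \<and>
        (\<forall>j<d. mem s' (96 + j) = mem t (96 + j))"
    if "i + m = N" "pc t = lt" "rep Bd \<tau> t" "mem t h = int m" "Inv i \<tau>" "\<tau> x 0 = int i"
    for i m \<tau> and t :: config
    using that
  proof (induction m arbitrary: i \<tau> t)
    case 0
    have mk: "mok Bd t" using 0 by (simp add: rep_def)
    let ?t1 = "step (JumpPos h (lt + 3)) t"
    let ?t2 = "step (SetConst 64 1) ?t1"
    let ?t3 = "step (JumpPos 64 (lt + length p + 7)) ?t2"
    have sga: "seg prog (pc t) [JumpPos h (lt + 3), SetConst 64 1, JumpPos 64 (lt + length p + 7)]"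
      using sgt 0 by simp
    have pc1: "pc ?t1 = Suc (pc t)" using 0 by simp
    have sgb: "seg prog (pc ?t1) [SetConst 64 1, JumpPos 64 (lt + length p + 7)]"
      using seg_Cons[OF sga] pc1 by simp
    have sgc: "seg prog (pc ?t2) [JumpPos 64 (lt + length p + 7)]"
      using seg_Cons[OF sgb] by simp
    have mk1: "mok Bd ?t1" using mk by (simp add: mok_def)
    have mk2: "mok Bd ?t2" using mk B by (auto simp: mok_def MB_def)
    have "run prog (KB Bd) t (Suc (Suc (Suc 0))) ?t3"
      by (rule run_one[OF sga mk _ run_one[OF sgb mk1 _ run_one[OF sgc mk2 _ run_refl]]])
        (use B in \<open>auto simp: MB_def\<close>)
    moreover have "rep Bd \<tau> ?t3" using mk2 by (intro rep_cong[OF 0(3)]) (auto simp: mok_def)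
    moreover have "pc ?t3 = lt + length p + 7" by simp
    moreover have "\<forall>j<d. mem ?t3 (96 + j) = mem t (96 + j)" by simp
    ultimately show ?case using 0 by (intro exI[of _ "Suc (Suc (Suc 0))"] exI[of _ ?t3] exI[of _ \<tau>]) auto
  next
    case (Suc m)
    have mk: "mok Bd t" using Suc.prems by (simp add: rep_def)
    let ?t1 = "step (JumpPos h (lt + 3)) t"
    have r1: "run prog (KB Bd) t 1 ?t1"
      using sgt Suc.prems mk by (intro run_one') auto
    have pc1: "pc ?t1 = lt + 3" using Suc.prems by simp
    have rep1: "rep Bd \<tau> ?t1" using Suc.prems(3) by (simp add: rep_def relm_def mok_def)
    have iN: "i < N" using Suc.prems by simp
    have "seg prog (pc ?t1) (comp c (pc ?t1) (Suc d))" unfolding pc1 using sgp by (simp add: p_def)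
    from htD[OF body[OF iN] wc this rep1] Suc.prems obtain m1 t2 \<tau>2 where
      r2: "run prog (KB Bd) ?t1 m1 t2" "m1 \<le> 600 * T" "pc t2 = pc ?t1 + length (comp c (pc ?t1) (Suc d))"
      "rep Bd \<tau>2 t2" "Inv (Suc i) (\<tau>2(x := (\<tau>2 x)(0 := int (Suc i))))"
      "\<And>a. a \<notin> mods c \<Longrightarrow> \<tau>2 a = \<tau> a" "\<And>j. j < Suc d \<Longrightarrow> mem t2 (96 + j) = mem ?t1 (96 + j)"
      by metis
    have pc2: "pc t2 = lt + 3 + length p" using r2(3) unfolding pc1 p_def .
    have mk2: "mok Bd t2" using r2 by (simp add: rep_def)
    have x2: "\<tau>2 x 0 = int i" using r2(6)[OF x] Suc.prems by simp
    have mx: "mem t2 x = int i"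
    proof -
      have "mem t2 (128 * 0 + x) = \<tau>2 x 0" using r2(4) x64 unfolding rep_def relm_def by blast
      then show ?thesis using x2 by simp
    qed
    have mh: "mem t2 h = int (Suc m)" using r2(7)[of d] Suc.prems by (simp add: h_def)
    let ?t3 = "step (SetConst 64 1) t2"
    let ?t4 = "step (Add x x 64) ?t3"
    let ?t5 = "step (Sub h h 64) ?t4"
    let ?t6 = "step (JumpPos 64 lt) ?t5"
    have hx: "h \<noteq> x" "h \<noteq> 64" "x \<noteq> 64" using x64 by (auto simp: h_def)
    have sga: "seg prog (pc t2) [SetConst 64 1, Add x x 64, Sub h h 64, JumpPos 64 lt]"
      using sge pc2 by simp
    have sgb: "seg prog (pc ?t3) [Add x x 64, Sub h h 64, JumpPos 64 lt]"
      using seg_Cons[OF sga] by simp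
    have sgc: "seg prog (pc ?t4) [Sub h h 64, JumpPos 64 lt]"
      using seg_Cons[OF sgb] by simp
    have sgd: "seg prog (pc ?t5) [JumpPos 64 lt]"
      using seg_Cons[OF sgc] by simp
    have mk3: "mok Bd ?t3" using mk2 B by (auto simp: mok_def MB_def)
    have v4: "mem ?t4 x = int (Suc i)" using mx hx by simp
    have "int (Suc i) \<le> MB Bd" using iN NMB by linarith
    then have mk4: "mok Bd ?t4" using v4 by (intro mok_step(2)[OF mk3]) simp
    have v5: "mem ?t5 h = int m" using mh hx by simp
    have "int m \<le> MB Bd" using Suc.prems(1) NMB by linarith
    then have mk5: "mok Bd ?t5" using v5 by (intro mok_step(3)[OF mk4]) simp
    have "run prog (KB Bd) t2 (Suc (Suc (Suc (Suc 0)))) ?t6"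
      by (rule run_one[OF sga mk2 _ run_one[OF sgb mk3 _ run_one[OF sgc mk4 _ run_one[OF sgd mk5 _ run_refl]]]])
        (use B in \<open>auto simp: MB_def\<close>)
    then have run6: "run prog (KB Bd) t (1 + (m1 + Suc (Suc (Suc (Suc 0))))) ?t6"
      by (rule run_trans[OF r1 run_trans[OF r2(1)]])
    let ?\<tau> = "\<tau>2(x := (\<tau>2 x)(0 := int (Suc i)))"
    have ad: "128 * j + a' = x \<longleftrightarrow> j = 0 \<and> a' = x" if "a' < 64" for j a' :: nat
      using that x64 by (cases j) auto
    have rl2: "relm \<tau>2 t2" using r2(4) by (simp add: rep_def)
    have "relm ?\<tau> ?t6"
      unfolding relm_def
    proof (intro allI impI)
      fix a' j :: nat assume a': "a' < 64"
      have m: "mem t2 (128 * j + a') = \<tau>2 a' j" using rl2 a' by (simp add: relm_def)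
      show "mem ?t6 (128 * j + a') = ?\<tau> a' j"
      proof (cases "128 * j + a' = x")
        case True
        then show ?thesis using ad[OF a'] mx hx by simp
      next
        case False
        moreover have "128 * j + a' \<noteq> h" "128 * j + a' \<noteq> 64"
          using a' d by (cases j; simp add: h_def)+
        ultimately show ?thesis using m ad[OF a', of j] by auto
      qed
    qed
    moreover have "bnd Bd ?\<tau>" using r2(4) iN NB by (auto simp: rep_def bnd_def)
    moreover have "mok Bd ?t6" using mk5 by (simp add: mok_def)
    moreover have "?\<tau> 64 = \<tau>2 64" using hx by auto
    ultimately have rep6: "rep Bd ?\<tau> ?t6" using r2(4) by (simp add: rep_def)
    have pc6: "pc ?t6 = lt" using hx by simp
    have h6: "mem ?t6 h = int m" using v5 by simp
    from Suc.IH[OF _ pc6 rep6 h6 r2(5)] Suc.prems(1) obtain m' s' \<sigma>' where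
      r7: "run prog (KB Bd) ?t6 m' s'" "m' \<le> 600 * (m * Suc T) + 3" "pc s' = lt + length p + 7"
        "rep Bd \<sigma>' s'" "Inv N \<sigma>'" "\<forall>a'. a' \<notin> insert x (mods c) \<longrightarrow> \<sigma>' a' = ?\<tau> a'"
        "\<forall>j<d. mem s' (96 + j) = mem ?t6 (96 + j)"
      by auto
    have "\<forall>j<d. mem s' (96 + j) = mem t (96 + j)"
      using r7(7) r2(7) x64 by (auto simp: h_def)
    moreover have "1 + (m1 + Suc (Suc (Suc (Suc 0)))) + m' \<le> 600 * (Suc m * Suc T) + 3" using r7(2) r2(2) by simp
    ultimately show ?case
      using run_trans[OF run6 r7(1)] r7 r2(6)
      by (intro exI[of _ "1 + (m1 + Suc (Suc (Suc (Suc 0)))) + m'"] exI[of _ s'] exI[of _ \<sigma>']) auto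
  qed
  from cexp_rep[OF conjunct1[OF sg1] rep we pre'(1) B] obtain s1 where
    s1: "run prog (KB Bd) s n s1" "n \<le> 264" "pc s1 = pc s + n" "rep Bd \<sigma> s1" "mem s1 64 = eval e \<sigma>"
    "\<And>r. r \<notin> {64..<96} \<Longrightarrow> mem s1 r = mem s r"
    unfolding n_def by blast
  have mk1: "mok Bd s1" using s1 by (simp add: rep_def)
  let ?s2 = "step (SetConst 65 0) s1"
  let ?s3 = "step (Add h 64 65) ?s2"
  let ?s4 = "step (SetConst x 0) ?s3"
  let ?\<sigma> = "\<sigma>(x := (\<sigma> x)(0 := 0))"
  have hx: "h \<noteq> x" "h \<noteq> 64" "x \<noteq> 64" "x \<noteq> 65" "h \<noteq> 65" using x64 by (auto simp: h_def)
  have mk2: "mok Bd ?s2" using mk1 B by (auto simp: mok_def MB_def)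
  have v3: "mem ?s3 h = int N" using s1 pre' hx by simp
  have mk3: "mok Bd ?s3" using mk2 v3 NMB by (auto simp: mok_def)
  have mk4: "mok Bd ?s4" using mk3 B by (auto simp: mok_def MB_def)
  have sga: "seg prog (pc s1) [SetConst 65 0, Add h 64 65, SetConst x 0,
      JumpPos h (lt + 3), SetConst 64 1, JumpPos 64 (lt + length p + 7)]"
    using conjunct1[OF sg2] s1 by (simp add: n_def)
  have sgb: "seg prog (pc ?s2) [Add h 64 65, SetConst x 0,
      JumpPos h (lt + 3), SetConst 64 1, JumpPos 64 (lt + length p + 7)]"
    using seg_Cons[OF sga] by simp
  have sgc: "seg prog (pc ?s3) [SetConst x 0,
      JumpPos h (lt + 3), SetConst 64 1, JumpPos 64 (lt + length p + 7)]"
    using seg_Cons[OF sgb] by simp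
  have "run prog (KB Bd) s1 (Suc (Suc (Suc 0))) ?s4"
    by (rule run_one[OF sga mk1 _ run_one[OF sgb mk2 _ run_one[OF sgc mk3 _ run_refl]]])
      (use B in \<open>auto simp: MB_def\<close>)
  then have run4: "run prog (KB Bd) s (n + Suc (Suc (Suc 0))) ?s4"
    by (rule run_trans[OF s1(1)])
  have rl1: "relm \<sigma> s1" using s1(4) by (simp add: rep_def)
  have "relm ?\<sigma> ?s4"
    unfolding relm_def
  proof (intro allI impI)
    fix a' j :: nat assume a': "a' < 64"
    have m: "mem s1 (128 * j + a') = \<sigma> a' j" using rl1 a' by (simp add: relm_def)
    have "128 * j + a' = x \<longleftrightarrow> j = 0 \<and> a' = x" using a' x64 by (cases j) auto
    moreover have "128 * j + a' \<noteq> h" "128 * j + a' \<noteq> 64" "128 * j + a' \<noteq> 65"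
      using a' d by (cases j; simp add: h_def)+
    ultimately show "mem ?s4 (128 * j + a') = ?\<sigma> a' j" using m by auto
  qed
  moreover have "bnd Bd ?\<sigma>" using rep B by (auto simp: rep_def bnd_def)
  moreover have "?\<sigma> 64 = \<sigma> 64" using hx by auto
  ultimately have rep4: "rep Bd ?\<sigma> ?s4" using s1(4) mk4 by (simp add: rep_def)
  have pc4: "pc ?s4 = lt" using s1 by (simp add: lt_def)
  have h4: "mem ?s4 h = int N" using v3 hx by simp
  have x4: "?\<sigma> x 0 = int 0" by simp
  from loop[OF add_0 pc4 rep4 h4 pre'(3) x4] obtain m' s' \<sigma>' where
    r: "run prog (KB Bd) ?s4 m' s'" "m' \<le> 600 * (N * Suc T) + 3" "pc s' = lt + length p + 7"
      "rep Bd \<sigma>' s'" "Inv N \<sigma>'" "\<forall>a'. a' \<notin> insert x (mods c) \<longrightarrow> \<sigma>' a' = ?\<sigma> a'"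
      "\<forall>j<d. mem s' (96 + j) = mem ?s4 (96 + j)"
    by auto
  have "\<forall>j<d. mem s' (96 + j) = mem s (96 + j)"
    using r(7) s1(6) x64 by (auto simp: h_def)
  moreover have "n + Suc (Suc (Suc 0)) + m' \<le> 600 * (N * Suc T + 1)" using r(2) s1(2) by simp
  ultimately show "\<exists>m s' \<sigma>'. run prog (KB Bd) s m s' \<and> m \<le> 600 * (N * Suc T + 1) \<and>
        pc s' = pc s + length (comp (CFor x e c) (pc s) d) \<and>
        rep Bd \<sigma>' s' \<and> Inv N \<sigma>' \<and> (\<forall>a'. a' \<notin> mods (CFor x e c) \<longrightarrow> \<sigma>' a' = \<sigma> a') \<and>
        (\<forall>j<d. mem s' (96 + j) = mem s (96 + j))"
    using run_trans[OF run4 r(1)] r unfolding len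
    by (intro exI[of _ "n + Suc (Suc (Suc 0)) + m'"] exI[of _ s'] exI[of _ \<sigma>']) auto
qed

section \<open>Whole programs and rules for backward reasoning\<close>

definition inp_store :: "int list \<Rightarrow> store" where
  "inp_store xs = (\<lambda>a i. if a = 64 \<and> i < length xs then xs ! i else 0)"

lemma ht_computes:
  assumes h: "ht Bd (\<lambda>\<sigma>. \<sigma> = inp_store xs) c T (\<lambda>\<sigma>. \<sigma> 0 0 = y)" and w: "wfc 0 c"
    and B: "128 \<le> Bd" and xs: "\<forall>x\<in>set xs. \<bar>x\<bar> \<le> Bd" and b: "real (600 * T * KB Bd) \<le> b"
  shows "computes_within (comp c 0 0) xs y b"
proof -
  let ?s = "\<lparr>pc = 0, mem = (\<lambda>_. 0), inp = xs\<rparr> :: config"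
  have sg: "seg (comp c 0 0) (pc ?s) (comp c (pc ?s) 0)"
    unfolding seg_def by (intro exI[of _ "[]"]) simp
  have "rep Bd (inp_store xs) ?s"
    using B xs by (auto simp: rep_def inp_store_def relm_def bnd_def mok_def MB_def)
  from htD[OF h w sg this refl] obtain m s' \<sigma>' where
    r: "run (comp c 0 0) (KB Bd) ?s m s'" "m \<le> 600 * T" "pc s' = pc ?s + length (comp c (pc ?s) 0)"
      "rep Bd \<sigma>' s'" "\<sigma>' 0 0 = y"
    by blast
  obtain t where t: "t \<le> m * KB Bd" "exec (comp c 0 0) ?s t s'"
    using run_exec[OF r(1)] r(3) by auto
  have "mem s' (128 * 0 + 0) = \<sigma>' 0 0" using r(4) unfolding rep_def relm_def by (meson zero_less_numeral)
  then have "mem s' 0 = y" using r by simp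
  moreover have "t \<le> 600 * T * KB Bd" using t(1) r(2) by (meson le_trans mult_le_mono1)
  then have "real t \<le> b" using b by (meson le_trans of_nat_le_iff order_trans)
  ultimately show ?thesis using t(2) unfolding computes_within_def by blast
qed

text \<open>The premises stand in the order of backward reasoning: the precondition found for
  \<open>c2\<close> becomes the postcondition of \<open>c1\<close>.\<close>

lemma ht_seq2: "ht Bd Q c2 T2 R \<Longrightarrow> ht Bd P c1 T1 Q \<Longrightarrow> ht Bd P (c1 ;; c2) (T1 + T2) R"
  by (rule ht_seq)

text \<open>The sum of the two times replaces the maximum, so that a time bound arises by
  unification alone.\<close>

lemma ht_if2:
  assumes "128 \<le> Bd" "ht Bd P1 c1 T1 Q" "ht Bd P2 c2 T2 Q"
  shows "ht Bd (\<lambda>\<sigma>. okx e \<sigma> \<and> (if 0 < eval e \<sigma> then P1 \<sigma> else P2 \<sigma>)) (CIf e c1 c2) (Suc (T1 + T2)) Q"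
  by (rule ht_if) (use assms ht_use[OF assms(2), of P1 "T1 + T2" Q] ht_use[OF assms(3), of P2 "T1 + T2" Q] in auto)

lemma ht_pre:
  "ht Bd P c T Q \<Longrightarrow> (\<And>\<sigma>. P' \<sigma> \<Longrightarrow> bnd Bd \<sigma> \<Longrightarrow> P \<sigma>) \<Longrightarrow> T \<le> T' \<Longrightarrow> ht Bd P' c T' Q"
  by (rule ht_use)

text \<open>The time is expressed by an upper bound \<open>M\<close> for the number of iterations,
  so that all times become expressions in \<open>2 * n + 1\<close> and \<open>3 ^ k\<close>. The
  summand 2 absorbs the extra unit for entering the loop.\<close>

lemma ht_for2:
  assumes body: "\<And>i. i < N \<Longrightarrow> ht Bd (\<lambda>\<sigma>. Inv i \<sigma> \<and> \<sigma> x 0 = int i) c T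
        (\<lambda>\<sigma>. Inv (Suc i) (\<sigma>(x := (\<sigma> x)(0 := int (Suc i)))))"
    and N: "\<And>\<sigma>. P \<sigma> \<Longrightarrow> bnd Bd \<sigma> \<Longrightarrow> okx e \<sigma> \<and> eval e \<sigma> = int N \<and> Inv 0 (\<sigma>(x := (\<sigma> x)(0 := 0)))"
    and NM: "N \<le> M" "1 \<le> M" and NB: "int N \<le> Bd"
    and x: "x \<notin> mods c" and B: "128 \<le> Bd"
  shows "ht Bd P (CFor x e c) ((T + 2) * M) (Inv N)"
proof (rule ht_use[OF ht_for[where P = P and e = e and N = N and Inv = Inv and x = x, OF N NB body x B]])
  have "N * Suc T + 1 \<le> M * Suc T + M" using NM by (intro add_mono mult_le_mono1) auto
  then show "N * Suc T + 1 \<le> (T + 2) * M" by (simp add: algebra_simps)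
qed auto

subsection \<open>Reading the graph and finding a vertex cover\<close>

text \<open>The machine cannot divide, so digits are extracted from the top by repeated subtraction.\<close>

definition dec_step :: com where
  "dec_step = CIf (Mi (Pl (Vr 14) (Cn 1)) (Ar 9 (Vr 17)))
     (CSet 14 (Mi (Vr 14) (Ar 9 (Vr 17))) ;; CAsg 16 (Vr 17) (Pl (Ar 16 (Vr 17)) (Cn 1))) CSkip"

text \<open>Here \<open>k_le_vcn\<close> is a variable name, that of the number of digits. Two
  conditional subtractions per position suffice because digits are at most 2. As \<open>CIf\<close>
  tests for a positive value, \<open>y \<le> x\<close> is written \<open>x + 1 - y\<close>, here and
  in the later commands.\<close>

definition dec :: "nat \<Rightarrow> nat \<Rightarrow> com" where
  "dec src k_le_vcn = CSet 14 (Vr src) ;; CFor 15 (Vr k_le_vcn)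
     ((CSet 17 (Mi (Mi (Vr k_le_vcn) (Cn 1)) (Vr 15)) ;; CAsg 16 (Vr 17) (Cn 0)) ;; (dec_step ;; dec_step))"

definition pow3 :: "nat \<Rightarrow> store \<Rightarrow> bool" where "pow3 n \<sigma> \<longleftrightarrow> (\<forall>p\<le>n. \<sigma> 9 p = 3 ^ p)"

lemma pow3_upd [simp]: "a \<noteq> 9 \<Longrightarrow> pow3 n (\<sigma>(a := f)) \<longleftrightarrow> pow3 n \<sigma>"
  by (simp add: pow3_def)

lemma pow3D: "pow3 n \<sigma> \<Longrightarrow> p \<le> n \<Longrightarrow> \<sigma> 9 p = 3 ^ p"
  by (simp add: pow3_def)

lemma mod_digit: "t mod 3 ^ Suc p = digit t p * 3 ^ p + t mod 3 ^ p"
  using mod_mult2_eq[of t "3 ^ p" 3] by (simp add: digit_def mult.commute)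

lemma dec_ht:
  assumes B: "128 \<le> Bd" and b: "3 ^ n \<le> Bd" and k: "k \<le> n" and n: "n \<le> M" "1 \<le> M" "int n \<le> Bd" and t: "t < 3 ^ k"
    and s: "src \<notin> {14, 15, 16, 17}" "k_le_vcn \<notin> {14, 15, 16, 17}"
  shows "ht Bd (\<lambda>\<sigma>. \<sigma> src 0 = int t \<and> \<sigma> k_le_vcn 0 = int k \<and> pow3 n \<sigma>) (dec src k_le_vcn) (10 * M + 1)
    (\<lambda>\<sigma>. \<forall>p<k. \<sigma> 16 p = int (digit t p))"
proof -
  define Inv where "Inv i \<sigma> \<longleftrightarrow> \<sigma> k_le_vcn 0 = int k \<and> pow3 n \<sigma> \<and> (\<forall>p. k \<le> p + i \<longrightarrow> p < k \<longrightarrow> \<sigma> 16 p = int (digit t p))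
    \<and> \<sigma> 14 0 = int (t mod 3 ^ (k - i))" for i and \<sigma> :: store
  have tB: "int (t mod 3 ^ j) \<le> Bd" for j
  proof -
    have "t mod 3 ^ j \<le> t" by simp
    also have "t \<le> 3 ^ n" using t power_increasing[OF k, of "3::nat"] by linarith
    finally have "int (t mod 3 ^ j) \<le> int (3 ^ n)" by (simp only: of_nat_le_iff)
    also have "int (3 ^ n) \<le> Bd" using b by simp
    finally show ?thesis .
  qed
  show ?thesis
    unfolding dec_def
  proof (rule ht_use)
    show "ht Bd (\<lambda>\<sigma>. \<sigma> src 0 = int t \<and> \<sigma> k_le_vcn 0 = int k \<and> pow3 n \<sigma>)
      (CSet 14 (Vr src) ;; CFor 15 (Vr k_le_vcn)
     ((CSet 17 (Mi (Mi (Vr k_le_vcn) (Cn 1)) (Vr 15)) ;; CAsg 16 (Vr 17) (Cn 0)) ;; (dec_step ;; dec_step))) (1 + (8 + 2) * M) (Inv k)"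
    proof (rule ht_seq)
      show "ht Bd (\<lambda>\<sigma>. \<sigma> src 0 = int t \<and> \<sigma> k_le_vcn 0 = int k \<and> pow3 n \<sigma>) (CSet 14 (Vr src)) 1
         (\<lambda>\<sigma>. \<sigma> k_le_vcn 0 = int k \<and> pow3 n \<sigma> \<and> \<sigma> 14 0 = int t)"
        by (rule ht_use[OF ht_asg[OF B]]) (use s tB[of k] t in auto)
      show "ht Bd (\<lambda>\<sigma>. \<sigma> k_le_vcn 0 = int k \<and> pow3 n \<sigma> \<and> \<sigma> 14 0 = int t) (CFor 15 (Vr k_le_vcn)
         ((CSet 17 (Mi (Mi (Vr k_le_vcn) (Cn 1)) (Vr 15)) ;; CAsg 16 (Vr 17) (Cn 0)) ;; (dec_step ;; dec_step))) ((8 + 2) * M) (Inv k)"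
      proof (rule ht_for2)
        fix i assume i: "i < k"
        define p where "p = k - 1 - i"
        have p: "p < k" "k - i = Suc p" "k - Suc i = p" "p \<le> n" using i k by (auto simp: p_def)
        have pi: "int k - 1 - int i = int p" using i by (simp add: p_def)
        define rho where "rho = int (t mod 3 ^ p)"
        define top where "top = int (t mod 3 ^ Suc p)"
        have md: "top = int (digit t p) * 3 ^ p + rho"
          unfolding top_def rho_def by (simp only: mod_digit of_nat_add of_nat_mult of_nat_power of_nat_numeral)
        have topB: "top \<le> Bd" unfolding top_def by (rule tB)
        have "t mod 3 ^ p < 3 ^ p" by simp
        then have "int (t mod 3 ^ p) < int (3 ^ p)" by (simp only: of_nat_less_iff)
        then have ml: "rho < 3 ^ p" "0 \<le> rho" by (auto simp: rho_def)
        have kle: "k \<le> q + Suc i \<longleftrightarrow> q = p \<or> k \<le> q + i" if "q < k" for q using i by (auto simp: p_def)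
        have npk: "\<not> k \<le> p + i" using i by (simp add: p_def)
        have small: "int k \<le> Bd" "int p \<le> Bd" using k p n by auto
        \<comment> \<open>\<open>d\<close> is the part of digit \<open>p\<close> still contained in
          the remainder, \<open>x\<close> the part already counted.\<close>
        define R where "R d x \<sigma> \<longleftrightarrow> \<sigma> k_le_vcn 0 = int k \<and> pow3 n \<sigma> \<and> (\<forall>q. k \<le> q + i \<longrightarrow> q < k \<longrightarrow> \<sigma> 16 q = int (digit t q))
          \<and> \<sigma> 17 0 = int p \<and> \<sigma> 14 0 = int d * 3 ^ p + rho \<and> \<sigma> 16 p = int x" for d x and \<sigma> :: store
        have step: "ht Bd (R d x) dec_step 3 (R (d - 1) (if 0 < d then x + 1 else x))"
          if d: "d \<le> 2" "x \<le> 2" "d \<le> digit t p" for d x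
        proof -
          have p3: "(0::int) < 3 ^ p" by simp
          have "int d * 3 ^ p \<le> int (digit t p) * 3 ^ p" using d by (intro mult_right_mono) auto
          then have dB: "int d * 3 ^ p + rho \<le> Bd" using topB md by linarith
          have e: "d = 0 \<or> d = Suc (d - 1)" by auto
          have ge: "3 ^ p \<le> int d * 3 ^ p + rho \<longleftrightarrow> 0 < d"
            using ml e p3 by (cases d) (auto simp: algebra_simps)
          have mi: "int (d - 1) * 3 ^ p = int d * 3 ^ p - 3 ^ p" if "0 < d"
            using that by (simp add: of_nat_diff algebra_simps)
          have pw: "(3::int) ^ p \<le> Bd" using power_increasing[OF p(4), of "3::int"] b by linarith
          have sb: "int d * 3 ^ p + rho - 3 ^ p \<le> Bd" using dB p3 by linarith
          have pl: "(0::int) \<le> int d * 3 ^ p + rho" using ml by simp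
          show ?thesis
            unfolding dec_step_def
            apply (rule ht_pre)
               apply (rule ht_if2[OF B] ht_seq2 ht_asg[OF B] ht_skip)+
            subgoal for \<sigma>
              using ge p3 dB sb mi pl s d B npk by (cases "0 < d") (auto simp: R_def pow3D[OF _ p(4)] abs_le_iff)
            by auto
        qed
        have R: "ht Bd (R (digit t p) 0) (dec_step ;; dec_step) 6 (R 0 (digit t p))"
        proof (rule ht_use[OF ht_seq])
          show "ht Bd (R (digit t p) 0) dec_step 3 (R (digit t p - 1) (if 0 < digit t p then 0 + 1 else 0))"
            using digit_cases[of t p] by (intro step) auto
          show "ht Bd (R (digit t p - 1) (if 0 < digit t p then 0 + 1 else 0)) dec_step 3
            (R (digit t p - 1 - 1) (if 0 < digit t p - 1 then (if 0 < digit t p then 0 + 1 else 0) + 1 else (if 0 < digit t p then 0 + 1 else 0)))"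
            using digit_cases[of t p] by (intro step) auto
        qed (use digit_cases[of t p] in \<open>auto simp: numeral_2_eq_2\<close>)
        have "ht Bd (\<lambda>\<sigma>. Inv i \<sigma> \<and> \<sigma> 15 0 = int i)
          (CSet 17 (Mi (Mi (Vr k_le_vcn) (Cn 1)) (Vr 15)) ;; CAsg 16 (Vr 17) (Cn 0)) (1 + 1) (R (digit t p) 0)"
          apply (rule ht_pre)
             apply (rule ht_seq2 ht_asg[OF B])+
          subgoal for \<sigma> using s small pi md B npk by (auto simp: Inv_def R_def p md[symmetric] top_def)
          by auto
        from ht_seq[OF this R] have "ht Bd (\<lambda>\<sigma>. Inv i \<sigma> \<and> \<sigma> 15 0 = int i)
          ((CSet 17 (Mi (Mi (Vr k_le_vcn) (Cn 1)) (Vr 15)) ;; CAsg 16 (Vr 17) (Cn 0)) ;; (dec_step ;; dec_step)) 8 (R 0 (digit t p))"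
          by simp
        then show "ht Bd (\<lambda>\<sigma>. Inv i \<sigma> \<and> \<sigma> 15 0 = int i)
          ((CSet 17 (Mi (Mi (Vr k_le_vcn) (Cn 1)) (Vr 15)) ;; CAsg 16 (Vr 17) (Cn 0)) ;; (dec_step ;; dec_step)) 8
          (\<lambda>\<sigma>. Inv (Suc i) (\<sigma>(15 := (\<sigma> 15)(0 := int (Suc i)))))"
          by (rule ht_use) (use s kle in \<open>auto simp: Inv_def R_def p rho_def\<close>)
      qed (use s k n B in \<open>auto simp: Inv_def dec_step_def t pow3_def\<close>)
    qed
  qed (auto simp: Inv_def)
qed

definition base :: "nat \<Rightarrow> nat set set \<Rightarrow> store \<Rightarrow> bool" where
  "base n E \<sigma> \<longleftrightarrow> \<sigma> 2 0 = int n \<and> (\<forall>i<n. \<sigma> 8 i = int (i * n)) \<and>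
     (\<forall>u<n. \<forall>v<n. \<sigma> 7 (u * n + v) = of_bool ({u, v} \<in> E))"

lemma base_upd [simp]: "a \<notin> {2, 7, 8} \<Longrightarrow> base n E (\<sigma>(a := f)) \<longleftrightarrow> base n E \<sigma>"
  by (simp add: base_def)

lemma base_cong: "base n E \<sigma> \<Longrightarrow> (\<And>a. a \<in> {2, 7, 8} \<Longrightarrow> \<sigma>' a = \<sigma> a) \<Longrightarrow> base n E \<sigma>'"
  by (simp add: base_def)

lemma pow3_cong: "pow3 n \<sigma> \<Longrightarrow> \<sigma>' 9 = \<sigma> 9 \<Longrightarrow> pow3 n \<sigma>'"
  by (simp add: pow3_def)

lemma nat_int_simps [simp]:
  "nat (int i + 1) = Suc i" "nat (1 + int i) = Suc i" "nat (int i - int j) = i - j" "nat (int i - 1) = i - 1"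
  by auto

lemma concat_nth:
  assumes "i < m" "j < n"
  shows "concat (map (\<lambda>i. map (f i) [0..<n]) [0..<m]) ! (i * n + j) = f i j"
  using assms
proof (induction m)
  case (Suc m)
  have len: "length (concat (map (\<lambda>i. map (f i) [0..<n]) [0..<m])) = m * n" for m
    by (induction m) auto
  show ?case
  proof (cases "i = m")
    case True
    then show ?thesis using Suc.prems by (simp add: nth_append len)
  next
    case False
    then have i: "i < m" using Suc.prems by simp
    then have "Suc i * n \<le> m * n" by (intro mult_le_mono1) simp
    then have "i * n + j < m * n" using Suc.prems by simp
    then show ?thesis using Suc i by (simp add: nth_append len)
  qed
qed simp

section \<open>Size bounds and reading of the input\<close>

text \<open>
  Use of the names: \<open>0\<close> result; \<open>2\<close> \<open>n\<close>; \<open>7\<close> adjacency matrix, row \<open>u\<close> of which begins at \<open>8[u]\<close>;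
  \<open>9\<close> powers of \<open>3\<close>; \<open>16\<close> digits of the current code; \<open>18\<close> characteristic function of the cover;
  \<open>23\<close> \<open>k\<close>; \<open>24\<close> its elements; \<open>26\<close> powers of \<open>XX\<close>; \<open>27\<close> powers of \<open>2\<close>; \<open>31\<close> current code \<open>t\<close>;
  \<open>38\<close> to \<open>45\<close> tables of \<open>vb t\<close>, \<open>vl t\<close>, \<open>vj t\<close>, \<open>va t\<close>, the least \<open>q\<close> with \<open>okD q t\<close>, the failure
  of \<open>okE t\<close>, \<open>XX ^ ee t\<close> and \<open>(2 * n - vl t) * M\<close>; \<open>46\<close> the good codes found so far; \<open>47\<close> the array that
  is convolved; \<open>48\<close> the width under test; \<open>53\<close> \<open>3 ^ k\<close>; \<open>54\<close> \<open>M ^ 3\<close>; \<open>55\<close> multiples of \<open>M\<close>;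
  \<open>56\<close> the code of \<open>L = C\<close>, \<open>B = {}\<close>; \<open>60\<close> the bound \<open>q\<close> on bag sizes. Name \<open>10\<close> is positive once a cover
  has been found and \<open>50\<close> once the treewidth has been found, after which the loops run idle.
\<close>

locale pctx =
  fixes n :: nat and E :: "nat set set"
  assumes graph: "simple_graph {..<n} E"
begin

definition M :: nat where "M = 2 * n + 1"
text \<open>Zeta transforms fit into \<open>M ^ 3\<close> bits and their squares into
  \<open>2 * M ^ 3\<close>; the further 16 bits provide room for constants such as the 128 that the
  proof rules demand.\<close>

definition Bd :: int where "Bd = 2 ^ (2 * M ^ 3 + 16)"
definition av :: "nat \<Rightarrow> int" where
  "av l = (if l < n * n then of_bool ({l div n, l mod n} \<in> E) else 0)"

lemma M1: "1 \<le> M" and nM: "n \<le> M" "Suc n \<le> M" "2 * n \<le> M" by (auto simp: M_def)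

lemma pow2_Bd: "j \<le> 2 * M ^ 3 + 16 \<Longrightarrow> 2 ^ j \<le> Bd"
  unfolding Bd_def by (intro power_increasing) auto

lemma small: "j \<le> 2 * M ^ 3 + 16 \<Longrightarrow> int j \<le> Bd"
proof -
  assume "j \<le> 2 * M ^ 3 + 16"
  then have "(2::int) ^ j \<le> Bd" by (rule pow2_Bd)
  moreover have "int j \<le> 2 ^ j" using less_exp[of j] by (metis less_imp_le of_nat_le_iff of_nat_numeral of_nat_power)
  ultimately show ?thesis by linarith
qed

lemma B: "128 \<le> Bd" using pow2_Bd[of 7] by simp

lemma M3: "M \<le> M ^ 3" "M * M \<le> M ^ 3" "n \<le> M ^ 3" "n * n \<le> M ^ 3"
proof -
  have "1 \<le> M * M" using M1 by (simp add: M_def)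
  then have "M * 1 \<le> M * (M * M)" by (intro mult_le_mono2)
  then show a: "M \<le> M ^ 3" by (simp add: power3_eq_cube mult.assoc)
  have "M * M * 1 \<le> M * M * M" using M1 by (intro mult_le_mono2)
  then show b: "M * M \<le> M ^ 3" by (simp add: power3_eq_cube)
  show "n \<le> M ^ 3" using a nM by simp
  have "n * n \<le> M * M" using nM by (intro mult_le_mono) auto
  then show "n * n \<le> M ^ 3" using b by simp
qed

lemma nB: "int n \<le> Bd" "int n + 1 \<le> Bd" using small[of "n + 1"] M3 by auto

lemma pow3_Bd: "j \<le> n \<Longrightarrow> 3 ^ j \<le> Bd"
proof -
  assume j: "j \<le> n"
  have "(3::int) ^ j \<le> 4 ^ j" by (intro power_mono) auto
  also have "(4::int) ^ j = 2 ^ (2 * j)" by (simp add: power_mult)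
  also have "\<dots> \<le> Bd" using j M3(1) nM by (intro pow2_Bd) simp
  finally show ?thesis .
qed

text \<open>Applied repeatedly to a command without loops, these rules compute a precondition and a
  time from the postcondition; \<open>ht_pre\<close> leaves a statement about stores.\<close>

lemmas wp = ht_if2[OF B] ht_seq2 ht_asg[OF B] ht_skip ht_rd

lemma av_less: "i < n \<Longrightarrow> j < n \<Longrightarrow> av (i * n + j) = of_bool ({i, j} \<in> E)"
proof -
  assume ij: "i < n" "j < n"
  have "Suc i * n \<le> n * n" using ij by (intro mult_le_mono1) simp
  then have "i * n + j < n * n" using ij by simp
  moreover have "(i * n + j) div n = i" "(i * n + j) mod n = j" using ij by auto
  ultimately show ?thesis by (simp add: av_def)
qed

lemma av_bd: "\<bar>av l\<bar> \<le> Bd" using B by (simp add: av_def)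

lemma graph_input_store:
  "inp_store (graph_input n E) 64 0 = int n" "inp_store (graph_input n E) 64 (Suc l) = av l"
proof -
  let ?f = "\<lambda>i j. of_bool ({i, j} \<in> E) :: int"
  let ?xs = "concat (map (\<lambda>i. map (?f i) [0..<n]) [0..<n])"
  have g: "graph_input n E = int n # ?xs" by (simp add: graph_input_def)
  have len: "length (concat (map (\<lambda>i. map (?f i) [0..<n]) [0..<m])) = m * n" for m
    by (induction m) auto
  show "inp_store (graph_input n E) 64 0 = int n" by (simp add: inp_store_def g)
  have "?xs ! l = ?f (l div n) (l mod n)" if "l < n * n"
  proof -
    have n0: "0 < n" using that by (cases n) auto
    have "l div n < n" using that by (simp add: less_mult_imp_div_less)
    then have "?xs ! (l div n * n + l mod n) = ?f (l div n) (l mod n)"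
      using n0 by (intro concat_nth) auto
    then show ?thesis by simp
  qed
  then show "inp_store (graph_input n E) 64 (Suc l) = av l"
    unfolding inp_store_def g av_def by (simp add: len)
qed

lemma graph_input_bd: "\<forall>x\<in>set (graph_input n E). \<bar>x\<bar> \<le> Bd"
  using nB B by (auto simp: graph_input_def)

text \<open>The running index 5 also yields the row offsets \<open>u * n\<close>, which spares the
  multiplication.\<close>

definition c_read :: com where
  "c_read = (CRd 2 ;; CSet 5 (Cn 0)) ;; CFor 3 (Vr 2) (CAsg 8 (Vr 3) (Vr 5) ;;
     CFor 4 (Vr 2) (CRd 6 ;; CAsg 7 (Vr 5) (Vr 6) ;; CSet 5 (Pl (Vr 5) (Cn 1))))"

lemma c_read_ht: "ht Bd (\<lambda>\<sigma>. \<sigma> = inp_store (graph_input n E)) c_read (2 + ((1 + 5 * M) + 2) * M) (base n E)"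
proof -
  define Inv where "Inv i \<sigma> \<longleftrightarrow> \<sigma> 2 0 = int n \<and> \<sigma> 5 0 = int (i * n) \<and> (\<forall>i'<i. \<sigma> 8 i' = int (i' * n))
     \<and> (\<forall>l<i * n. \<sigma> 7 l = av l) \<and> (\<forall>l. \<sigma> 64 l = av (i * n + l))" for i and \<sigma> :: store
  define InvJ where "InvJ i j \<sigma> \<longleftrightarrow> \<sigma> 2 0 = int n \<and> \<sigma> 3 0 = int i \<and> \<sigma> 5 0 = int (i * n + j)
     \<and> (\<forall>i'\<le>i. \<sigma> 8 i' = int (i' * n))
     \<and> (\<forall>l<i * n + j. \<sigma> 7 l = av l) \<and> (\<forall>l. \<sigma> 64 l = av (i * n + j + l))" for i j and \<sigma> :: store
  have nnB: "int (i * n + j) \<le> Bd" if "i < n" "j \<le> n" for i j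
  proof -
    have "Suc i * n \<le> n * n" using that by (intro mult_le_mono1) simp
    then show ?thesis using that M3 by (intro small) simp
  qed
  have inner: "ht Bd (InvJ i 0) (CFor 4 (Vr 2) (CRd 6 ;; CAsg 7 (Vr 5) (Vr 6) ;; CSet 5 (Pl (Vr 5) (Cn 1))))
      ((3 + 2) * M) (InvJ i n)" if i: "i < n" for i
  proof (rule ht_for2)
    fix j assume j: "j < n"
    have sm: "int (i * n + j) + 1 \<le> Bd" "int (i * n + j) \<le> Bd" using nnB[OF i, of "Suc j"] j by auto
    show "ht Bd (\<lambda>\<sigma>. InvJ i j \<sigma> \<and> \<sigma> 4 0 = int j) (CRd 6 ;; CAsg 7 (Vr 5) (Vr 6) ;; CSet 5 (Pl (Vr 5) (Cn 1))) 3
      (\<lambda>\<sigma>. InvJ i (Suc j) (\<sigma>(4 := (\<sigma> 4)(0 := int (Suc j)))))"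
      apply (rule ht_pre)
        apply (rule wp)+
      subgoal for \<sigma> using sm av_bd[of "i * n + j"] by (auto simp: InvJ_def less_Suc_eq nat_add_distrib nat_mult_distrib)
      by simp
  qed (use nM M1 nB B in \<open>auto simp: InvJ_def\<close>)
  have outer: "ht Bd (Inv 0) (CFor 3 (Vr 2) (CAsg 8 (Vr 3) (Vr 5) ;;
     CFor 4 (Vr 2) (CRd 6 ;; CAsg 7 (Vr 5) (Vr 6) ;; CSet 5 (Pl (Vr 5) (Cn 1))))) (((1 + 5 * M) + 2) * M) (Inv n)"
  proof (rule ht_for2)
    fix i assume i: "i < n"
    have a: "ht Bd (\<lambda>\<sigma>. Inv i \<sigma> \<and> \<sigma> 3 0 = int i) (CAsg 8 (Vr 3) (Vr 5)) 1 (InvJ i 0)"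
      apply (rule ht_pre)
        apply (rule wp)+
      subgoal premises pr for \<sigma>
      proof -
        have "\<bar>int (i * n)\<bar> \<le> Bd" using nnB[OF i, of 0] by simp
        then show ?thesis using pr by (simp add: Inv_def InvJ_def le_less) auto
      qed
      by simp
    show "ht Bd (\<lambda>\<sigma>. Inv i \<sigma> \<and> \<sigma> 3 0 = int i) (CAsg 8 (Vr 3) (Vr 5) ;;
     CFor 4 (Vr 2) (CRd 6 ;; CAsg 7 (Vr 5) (Vr 6) ;; CSet 5 (Pl (Vr 5) (Cn 1)))) (1 + 5 * M)
      (\<lambda>\<sigma>. Inv (Suc i) (\<sigma>(3 := (\<sigma> 3)(0 := int (Suc i)))))"
      by (rule ht_use[OF ht_seq[OF a inner[OF i]]]) (auto simp: Inv_def InvJ_def less_Suc_eq_le algebra_simps)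
  qed (use nM M1 nB B in \<open>auto simp: Inv_def\<close>)
  have init: "ht Bd (\<lambda>\<sigma>. \<sigma> = inp_store (graph_input n E)) (CRd 2 ;; CSet 5 (Cn 0)) 2 (Inv 0)"
    apply (rule ht_pre)
      apply (rule wp)+
    subgoal for \<sigma> using B by (auto simp: Inv_def graph_input_store)
    by simp
  have fin: "base n E \<sigma>" if "Inv n \<sigma>" for \<sigma>
  proof -
    have "u * n + v < n * n" if "u < n" "v < n" for u v
    proof -
      have "Suc u * n \<le> n * n" using that by (intro mult_le_mono1) simp
      then show ?thesis using that by simp
    qed
    then show ?thesis using that av_less by (auto simp: Inv_def base_def)
  qed
  have "ht Bd (\<lambda>\<sigma>. \<sigma> = inp_store (graph_input n E)) ((CRd 2 ;; CSet 5 (Cn 0)) ;; CFor 3 (Vr 2) (CAsg 8 (Vr 3) (Vr 5) ;;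
     CFor 4 (Vr 2) (CRd 6 ;; CAsg 7 (Vr 5) (Vr 6) ;; CSet 5 (Pl (Vr 5) (Cn 1))))) (2 + ((1 + 5 * M) + 2) * M) (base n E)"
    by (rule ht_use[OF ht_seq[OF init outer]]) (auto intro: fin)
  then show ?thesis unfolding c_read_def .
qed

definition c_pow3 :: com where
  "c_pow3 = CAsg 9 (Cn 0) (Cn 1) ;;
     CFor 3 (Vr 2) (CAsg 9 (Pl (Vr 3) (Cn 1)) (Pl (Ar 9 (Vr 3)) (Pl (Ar 9 (Vr 3)) (Ar 9 (Vr 3)))))"

lemma c_pow3_ht: "ht Bd (base n E) c_pow3 (1 + 3 * M) (\<lambda>\<sigma>. base n E \<sigma> \<and> pow3 n \<sigma>)"
proof -
  define Inv where "Inv i \<sigma> \<longleftrightarrow> base n E \<sigma> \<and> (\<forall>p\<le>i. \<sigma> 9 p = 3 ^ p)" for i and \<sigma> :: store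
  have a: "ht Bd (base n E) (CAsg 9 (Cn 0) (Cn 1)) 1 (Inv 0)"
    apply (rule ht_pre)
      apply (rule wp)+
    subgoal for \<sigma> using B by (auto simp: Inv_def)
    by simp
  have b: "ht Bd (Inv 0) (CFor 3 (Vr 2) (CAsg 9 (Pl (Vr 3) (Cn 1)) (Pl (Ar 9 (Vr 3)) (Pl (Ar 9 (Vr 3)) (Ar 9 (Vr 3))))))
     ((1 + 2) * M) (Inv n)"
  proof (rule ht_for2)
    fix i assume i: "i < n"
    have "(3::int) ^ Suc i \<le> Bd" using i by (intro pow3_Bd) simp
    then show "ht Bd (\<lambda>\<sigma>. Inv i \<sigma> \<and> \<sigma> 3 0 = int i)
      (CAsg 9 (Pl (Vr 3) (Cn 1)) (Pl (Ar 9 (Vr 3)) (Pl (Ar 9 (Vr 3)) (Ar 9 (Vr 3))))) 1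
      (\<lambda>\<sigma>. Inv (Suc i) (\<sigma>(3 := (\<sigma> 3)(0 := int (Suc i)))))"
      apply -
      apply (rule ht_pre)
        apply (rule wp)+
      subgoal for \<sigma> by (auto simp: Inv_def le_Suc_eq)
      by simp
  qed (use nM M1 nB B in \<open>auto simp: Inv_def base_def\<close>)
  show ?thesis unfolding c_pow3_def
    by (rule ht_use[OF ht_seq[OF a b]]) (auto simp: Inv_def pow3_def)
qed

end

lemma ht_disj: "ht Bd P1 c T Q \<Longrightarrow> ht Bd P2 c T Q \<Longrightarrow> ht Bd (\<lambda>\<sigma>. P1 \<sigma> \<or> P2 \<sigma>) c T Q"
  unfolding ht_def by blast

lemma upd_lambda [simp]:
  "a \<notin> {2, 7, 8} \<Longrightarrow> base n E (\<lambda>x. if x = a then f else \<sigma> x) \<longleftrightarrow> base n E \<sigma>"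
  "a \<noteq> 9 \<Longrightarrow> pow3 n (\<lambda>x. if x = a then f else \<sigma> x) \<longleftrightarrow> pow3 n \<sigma>"
  by (simp_all add: base_def pow3_def)

lemma mods_dec [simp]: "mods (dec s k) = {14, 15, 16, 17}"
  by (auto simp: dec_def dec_step_def)

section \<open>A minimum vertex cover by branching\<close>

context pctx
begin

text \<open>
  Pairs \<open>(u, v)\<close> are visited in the order of \<open>l = u * n + v\<close>; digit \<open>c\<close> of \<open>D\<close> tells which endpoint of the
  \<open>c\<close>-th uncovered edge is taken. A positive digit stands for \<open>u\<close>, so that ternary codes can be
  used here as well.
\<close>

fun branch_run :: "(nat \<Rightarrow> nat) \<Rightarrow> nat \<Rightarrow> nat \<Rightarrow> nat set \<times> nat \<times> bool" where
  "branch_run D kk 0 = ({}, 0, True)"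
| "branch_run D kk (Suc l) = (case branch_run D kk l of (S, c, b) \<Rightarrow>
     if {l div n, l mod n} \<in> E \<and> l div n \<notin> S \<and> l mod n \<notin> S
     then if c < kk then (insert (if 0 < D c then l div n else l mod n) S, Suc c, b) else (S, c, False)
     else (S, c, b))"

lemma branch_run_inv:
  assumes "l \<le> n * n" "branch_run D kk l = (S, c, b)"
  shows "S \<subseteq> {..<n} \<and> card S = c \<and> c \<le> kk \<and>
    (b \<longrightarrow> (\<forall>l'<l. {l' div n, l' mod n} \<in> E \<longrightarrow> l' div n \<in> S \<or> l' mod n \<in> S))"
  using assms
proof (induction l arbitrary: S c b)
  case (Suc l)
  obtain S0 c0 b0 where v: "branch_run D kk l = (S0, c0, b0)" by (cases "branch_run D kk l") auto
  have ih: "S0 \<subseteq> {..<n} \<and> card S0 = c0 \<and> c0 \<le> kk \<and>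
    (b0 \<longrightarrow> (\<forall>l'<l. {l' div n, l' mod n} \<in> E \<longrightarrow> l' div n \<in> S0 \<or> l' mod n \<in> S0))"
    using Suc v by simp
  have n0: "0 < n" using Suc.prems by (cases n) auto
  have lt: "l div n < n" "l mod n < n" using Suc.prems n0 by (auto simp: less_mult_imp_div_less)
  have fin: "finite S0" using ih finite_subset by blast
  show ?case
    using Suc.prems(2) v ih lt fin by (auto simp: less_Suc_eq split: if_splits)
qed auto

definition fails :: "nat \<Rightarrow> nat \<Rightarrow> bool" where
  "fails s kk \<longleftrightarrow> \<not> snd (snd (branch_run (digit s) kk (n * n)))"

lemma not_fails:
  assumes "\<not> fails s kk"
  shows "vertex_cover {..<n} E (fst (branch_run (digit s) kk (n * n)))" "card (fst (branch_run (digit s) kk (n * n))) \<le> kk"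
proof -
  obtain S c b where v: "branch_run (digit s) kk (n * n) = (S, c, b)" by (cases "branch_run (digit s) kk (n * n)") auto
  have inv: "S \<subseteq> {..<n}" "card S \<le> kk"
    "\<And>l. l < n * n \<Longrightarrow> {l div n, l mod n} \<in> E \<Longrightarrow> l div n \<in> S \<or> l mod n \<in> S"
    using branch_run_inv[OF order_refl v] assms v by (auto simp: fails_def)
  have "e \<inter> S \<noteq> {}" if e: "e \<in> E" for e
  proof -
    obtain u w where uw: "u < n" "w < n" "e = {u, w}" using e graph unfolding simple_graph_def by blast
    have "Suc u * n \<le> n * n" using uw by (intro mult_le_mono1) simp
    then have "u * n + w < n * n" using uw by simp
    moreover have "(u * n + w) div n = u" "(u * n + w) mod n = w" using uw by auto
    ultimately show ?thesis using inv(3)[of "u * n + w"] e uw by auto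
  qed
  then show "vertex_cover {..<n} E (fst (branch_run (digit s) kk (n * n)))" "card (fst (branch_run (digit s) kk (n * n))) \<le> kk"
    using inv v by (auto simp: vertex_cover_def)
qed

text \<open>Only the digits below the final counter have been read.\<close>

lemma branch_run_cong:
  assumes "\<And>x. x < fst (snd (branch_run D kk l)) \<Longrightarrow> D' x = D x"
  shows "branch_run D' kk l = branch_run D kk l"
  using assms
proof (induction l)
  case (Suc l)
  obtain S c b where v: "branch_run D kk l = (S, c, b)" by (cases "branch_run D kk l") auto
  have "c \<le> fst (snd (branch_run D kk (Suc l)))" using v by simp
  then have "branch_run D' kk l = branch_run D kk l" using Suc v by (intro Suc.IH) (auto dest: order.strict_trans2)
  then show ?case using Suc.prems v by (auto split: if_splits)
qed simp

text \<open>The branches are chosen so that only vertices of the given cover are taken.\<close>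

lemma guided:
  assumes C: "vertex_cover {..<n} E C" "card C \<le> kk" and l: "l \<le> n * n"
  shows "\<exists>D. (\<forall>x. D x < 3) \<and> fst (branch_run D kk l) \<subseteq> C \<and> snd (snd (branch_run D kk l))"
  using l
proof (induction l)
  case 0
  show ?case by (intro exI[of _ "\<lambda>_. 0"]) simp
next
  case (Suc l)
  then obtain D where D: "\<And>x. D x < 3" "fst (branch_run D kk l) \<subseteq> C" "snd (snd (branch_run D kk l))" by auto
  obtain S c b where v: "branch_run D kk l = (S, c, b)" by (cases "branch_run D kk l") auto
  have S: "S \<subseteq> C" "b" and cS: "card S = c" using D v branch_run_inv[OF _ v] Suc.prems by auto
  have finC: "finite C" using C(1) finite_subset by (auto simp: vertex_cover_def)
  let ?u = "l div n" and ?w = "l mod n"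
  show ?case
  proof (cases "{?u, ?w} \<in> E \<and> ?u \<notin> S \<and> ?w \<notin> S")
    case False
    then show ?thesis using D S v by (intro exI[of _ D]) auto
  next
    case True
    then have uw: "?u \<in> C \<or> ?w \<in> C" using C(1) by (auto simp: vertex_cover_def)
    \<comment> \<open>One endpoint is in \<open>C\<close> but neither is in \<open>S\<close>, so the
      vertices taken form a proper subset of \<open>C\<close>: the budget is not exhausted, and
      digit \<open>c\<close> can still be chosen.\<close>
    then have "S \<noteq> C" using True by blast
    then have "card S < card C" using psubset_card_mono[OF finC] S by blast
    then have ck: "c < kk" using cS C(2) by simp
    define D' where "D' = D(c := if ?u \<in> C then 1 else 0)"
    have "branch_run D' kk l = branch_run D kk l" by (rule branch_run_cong) (simp add: D'_def v)
    then have "branch_run D' kk (Suc l) = (insert (if ?u \<in> C then ?u else ?w) S, Suc c, b)"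
      using True ck v by (simp add: D'_def)
    moreover have "D' x < 3" for x using D by (simp add: D'_def)
    ultimately show ?thesis using S uw by (intro exI[of _ D']) auto
  qed
qed

text \<open>At most \<open>kk\<close> digits are read in a run, so the choices of
  \<open>guided\<close> fit into a code below \<open>3 ^ kk\<close>.\<close>

lemma exists_branch:
  assumes C: "vertex_cover {..<n} E C" "card C \<le> kk"
  shows "\<exists>s < 3 ^ kk. \<not> fails s kk"
proof -
  obtain D where D: "\<And>x. D x < 3" "snd (snd (branch_run D kk (n * n)))" using guided[OF C order_refl] by blast
  obtain s where s: "s < 3 ^ kk" "\<forall>p<kk. digit s p = D p" using digits_exist[of D kk] D(1) by blast
  have "fst (snd (branch_run D kk (n * n))) \<le> kk"
    using branch_run_inv[OF order_refl, of D kk "fst (branch_run D kk (n * n))" "fst (snd (branch_run D kk (n * n)))" "snd (snd (branch_run D kk (n * n)))"]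
    by simp
  then have "branch_run (digit s) kk (n * n) = branch_run D kk (n * n)" using s by (intro branch_run_cong) auto
  then show ?thesis using s D by (intro exI[of _ s]) (simp add: fails_def)
qed

definition vcn :: nat where "vcn = vertex_cover_number {..<n} E"

lemma vcn: "\<exists>C. vertex_cover {..<n} E C \<and> card C = vcn" "vcn \<le> n"
proof -
  have V: "vertex_cover {..<n} E {..<n} \<and> card {..<n} = n"
    using graph by (fastforce simp: vertex_cover_def simple_graph_def)
  show "\<exists>C. vertex_cover {..<n} E C \<and> card C = vcn"
    unfolding vcn_def vertex_cover_number_def by (rule LeastI[of _ n]) (use V in blast)
  show "vcn \<le> n"
    unfolding vcn_def vertex_cover_number_def by (rule Least_le) (use V in blast)
qed

text \<open>All three entries are 0 or 1, so the difference is positive exactly for an edge with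
  both endpoints uncovered.\<close>

definition c_branch :: com where
  "c_branch = CIf (Mi (Mi (Ar 7 (Pl (Ar 8 (Vr 21)) (Vr 22))) (Ar 18 (Vr 21))) (Ar 18 (Vr 22)))
     (CIf (Mi (Vr 11) (Vr 19))
       (CIf (Ar 16 (Vr 19)) (CAsg 18 (Vr 21) (Cn 1)) (CAsg 18 (Vr 22) (Cn 1)) ;; CSet 19 (Pl (Vr 19) (Cn 1)))
       (CSet 20 (Cn 0)))
     CSkip"

definition c_try :: com where
  "c_try = dec 13 11 ;; CFor 3 (Vr 2) (CAsg 18 (Vr 3) (Cn 0)) ;; (CSet 19 (Cn 0) ;; CSet 20 (Cn 1)) ;;
     CFor 21 (Vr 2) (CFor 22 (Vr 2) c_branch) ;; CSet 10 (Vr 20)"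

definition cover_inv :: "nat \<Rightarrow> nat \<Rightarrow> nat \<Rightarrow> store \<Rightarrow> bool" where
  "cover_inv s kk l \<sigma> \<longleftrightarrow> base n E \<sigma> \<and> pow3 n \<sigma> \<and> \<sigma> 11 0 = int kk \<and> (\<forall>p<kk. \<sigma> 16 p = int (digit s p))
    \<and> (\<forall>v<n. \<sigma> 18 v = of_bool (v \<in> fst (branch_run (digit s) kk l))) \<and> \<sigma> 19 0 = int (fst (snd (branch_run (digit s) kk l)))
    \<and> \<sigma> 20 0 = of_bool (snd (snd (branch_run (digit s) kk l)))"

lemma c_branch_ht:
  assumes kk: "kk \<le> n" and uw: "u < n" "w < n"
  shows "ht Bd (\<lambda>\<sigma>. cover_inv s kk (u * n + w) \<sigma> \<and> \<sigma> 21 0 = int u \<and> \<sigma> 22 0 = int w) c_branch 10 (cover_inv s kk (Suc (u * n + w)))"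
proof -
  obtain S c b where v: "branch_run (digit s) kk (u * n + w) = (S, c, b)" by (cases "branch_run (digit s) kk (u * n + w)") auto
  have dm: "(u * n + w) div n = u" "(u * n + w) mod n = w" using uw by auto
  have "Suc u * n \<le> n * n" using uw by (intro mult_le_mono1) simp
  then have "u * n + w \<le> n * n" using uw by simp
  from branch_run_inv[OF this v] have c: "c \<le> kk" by simp
  show ?thesis
    unfolding c_branch_def
    apply (rule ht_pre)
      apply (rule wp)+
    subgoal premises pr for \<sigma>
    proof -
      have b: "base n E \<sigma>" "pow3 n \<sigma>" "\<sigma> 11 0 = int kk" "\<And>p. p < kk \<Longrightarrow> \<sigma> 16 p = int (digit s p)"
        "\<And>v. v < n \<Longrightarrow> \<sigma> 18 v = of_bool (v \<in> S)" "\<sigma> 19 0 = int c" "\<sigma> 20 0 = of_bool b"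
        "\<sigma> 21 0 = int u" "\<sigma> 22 0 = int w"
        using pr v by (auto simp: cover_inv_def)
      have r: "\<sigma> 2 0 = int n" "\<sigma> 8 u = int (u * n)" "\<sigma> 7 (u * n + w) = of_bool ({u, w} \<in> E)"
        using b(1) uw by (auto simp: base_def)
      have na: "nat (int u * int n + int w) = u * n + w" by (simp add: nat_add_distrib nat_mult_distrib)
      have cB: "int c + 1 \<le> Bd" using c kk nB by simp
      show ?thesis
        using r(2) B cB b uw c
        by (cases "{u, w} \<in> E"; cases "u \<in> S"; cases "w \<in> S"; cases "c < kk"; cases "0 < digit s c")
           (simp_all add: cover_inv_def v dm na r b)
    qed
    by simp
qed

lemma c_try_ht:
  assumes kk: "kk \<le> n" and s: "s < 3 ^ kk"
  shows "ht Bd (\<lambda>\<sigma>. base n E \<sigma> \<and> pow3 n \<sigma> \<and> \<sigma> 11 0 = int kk \<and> \<sigma> 13 0 = int s) c_try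
     (10 * M + 1 + (3 * M + (2 + ((12 * M + 2) * M + 1))))
     (\<lambda>\<sigma>. cover_inv s kk (n * n) \<sigma> \<and> \<sigma> 10 0 = of_bool (\<not> fails s kk))"
proof -
  define A where "A \<sigma> \<longleftrightarrow> base n E \<sigma> \<and> pow3 n \<sigma> \<and> \<sigma> 11 0 = int kk \<and> (\<forall>p<kk. \<sigma> 16 p = int (digit s p))" for \<sigma> :: store
  have 1: "ht Bd (\<lambda>\<sigma>. base n E \<sigma> \<and> pow3 n \<sigma> \<and> \<sigma> 11 0 = int kk \<and> \<sigma> 13 0 = int s) (dec 13 11) (10 * M + 1) A"
    by (rule ht_use[OF dec_ht[OF B pow3_Bd[OF order_refl] kk nM(1) M1 nB(1) s]])
       (auto simp: A_def intro: base_cong pow3_cong)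
  have 2: "ht Bd A (CFor 3 (Vr 2) (CAsg 18 (Vr 3) (Cn 0))) ((1 + 2) * M) (\<lambda>\<sigma>. A \<sigma> \<and> (\<forall>v<n. \<sigma> 18 v = 0))"
  proof (rule ht_for2)
    fix i assume "i < n"
    show "ht Bd (\<lambda>\<sigma>. (A \<sigma> \<and> (\<forall>v<i. \<sigma> 18 v = 0)) \<and> \<sigma> 3 0 = int i) (CAsg 18 (Vr 3) (Cn 0)) 1
     (\<lambda>\<sigma>. A (\<sigma>(3 := (\<sigma> 3)(0 := int (Suc i)))) \<and> (\<forall>v<Suc i. (\<sigma>(3 := (\<sigma> 3)(0 := int (Suc i)))) 18 v = 0))"
      apply (rule ht_pre)
        apply (rule wp)+
      subgoal for \<sigma> using B by (auto simp: A_def less_Suc_eq)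
      by simp
  qed (use nM M1 nB B in \<open>auto simp: A_def base_def pow3_def\<close>)
  have 3: "ht Bd (\<lambda>\<sigma>. A \<sigma> \<and> (\<forall>v<n. \<sigma> 18 v = 0)) (CSet 19 (Cn 0) ;; CSet 20 (Cn 1)) 2 (cover_inv s kk 0)"
    apply (rule ht_pre)
      apply (rule wp)+
    subgoal for \<sigma> using B by (auto simp: A_def cover_inv_def)
    by simp
  have 4: "ht Bd (cover_inv s kk 0) (CFor 21 (Vr 2) (CFor 22 (Vr 2) c_branch)) ((12 * M + 2) * M) (cover_inv s kk (n * n))"
  proof (rule ht_for2[where Inv = "\<lambda>i. cover_inv s kk (i * n)"])
    fix i assume i: "i < n"
    have inner: "ht Bd (\<lambda>\<sigma>. cover_inv s kk (i * n + 0) \<sigma> \<and> \<sigma> 21 0 = int i) (CFor 22 (Vr 2) c_branch) ((10 + 2) * M)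
        (\<lambda>\<sigma>. cover_inv s kk (i * n + n) \<sigma> \<and> \<sigma> 21 0 = int i)"
    proof (rule ht_for2[where Inv = "\<lambda>j \<sigma>. cover_inv s kk (i * n + j) \<sigma> \<and> \<sigma> 21 0 = int i"])
      fix j assume j: "j < n"
      show "ht Bd (\<lambda>\<sigma>. (cover_inv s kk (i * n + j) \<sigma> \<and> \<sigma> 21 0 = int i) \<and> \<sigma> 22 0 = int j) c_branch 10
        (\<lambda>\<sigma>. cover_inv s kk (i * n + Suc j) (\<sigma>(22 := (\<sigma> 22)(0 := int (Suc j)))) \<and> (\<sigma>(22 := (\<sigma> 22)(0 := int (Suc j)))) 21 0 = int i)"
        by (rule ht_use[OF c_branch_ht[OF kk i j, of s]]) (auto simp: cover_inv_def c_branch_def simp del: branch_run.simps)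
    qed (use nM M1 nB B in \<open>auto simp: cover_inv_def base_def pow3_def c_branch_def\<close>)
    show "ht Bd (\<lambda>\<sigma>. cover_inv s kk (i * n) \<sigma> \<and> \<sigma> 21 0 = int i) (CFor 22 (Vr 2) c_branch) (12 * M)
        (\<lambda>\<sigma>. cover_inv s kk (Suc i * n) (\<sigma>(21 := (\<sigma> 21)(0 := int (Suc i)))))"
      by (rule ht_use[OF inner]) (auto simp: cover_inv_def add.commute)
  qed (use nM M1 nB B in \<open>auto simp: cover_inv_def base_def pow3_def c_branch_def\<close>)
  have 5: "ht Bd (cover_inv s kk (n * n)) (CSet 10 (Vr 20)) 1 (\<lambda>\<sigma>. cover_inv s kk (n * n) \<sigma> \<and> \<sigma> 10 0 = of_bool (\<not> fails s kk))"
    apply (rule ht_pre)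
      apply (rule wp)+
    subgoal for \<sigma> using B by (auto simp: cover_inv_def fails_def)
    by simp
  show ?thesis
    unfolding c_try_def using ht_seq[OF 1 ht_seq[OF 2 ht_seq[OF 3 ht_seq[OF 4 5]]]] by simp
qed

text \<open>Name 11 runs through the budgets. After a success the number 12 of codes to be tried is
  0, so that no budget above the cover number costs its power of 3.\<close>

definition c_cover :: com where
  "c_cover = CSet 10 (Cn 0) ;; CFor 11 (Pl (Vr 2) (Cn 1))
     (CIf (Vr 10) (CSet 12 (Cn 0)) (CSet 12 (Ar 9 (Vr 11))) ;; CFor 13 (Vr 12) (CIf (Vr 10) CSkip c_try))"

definition K0 :: nat where "K0 = 3 ^ vcn"

definition covered :: "store \<Rightarrow> bool" where
  "covered \<sigma> \<longleftrightarrow> base n E \<sigma> \<and> pow3 n \<sigma> \<and>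
    (\<exists>C. vertex_cover {..<n} E C \<and> card C \<le> vcn \<and> (\<forall>v<n. \<sigma> 18 v = of_bool (v \<in> C)))"

text \<open>Times are functions of free arguments and not of \<open>M\<close> and \<open>K0\<close>,
  as the growth analysis at the end has to vary them.\<close>

definition T_try :: "nat \<Rightarrow> nat" where
  "T_try m = 10 * m + 1 + (3 * m + (2 + ((12 * m + 2) * m + 1)))"

lemma c_cover_ht:
  "ht Bd (\<lambda>\<sigma>. base n E \<sigma> \<and> pow3 n \<sigma>) c_cover (1 + (3 + (Suc (T_try M) + 2) * K0 + 2) * M) covered"
proof -
  \<comment> \<open>As long as no cover has been found, the budget is at most \<open>vcn\<close>;
    this is what bounds the inner loop by \<open>K0\<close>.\<close>
  define Inv where "Inv i \<sigma> \<longleftrightarrow> (covered \<sigma> \<and> \<sigma> 10 0 = 1) \<or> (base n E \<sigma> \<and> pow3 n \<sigma> \<and> \<sigma> 10 0 = 0 \<and> i \<le> vcn)"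
    for i and \<sigma> :: store
  have K0: "1 \<le> K0" by (simp add: K0_def)
  have covupd: "covered (\<sigma>(x := f)) \<longleftrightarrow> covered \<sigma>"
    "covered (\<lambda>a. if a = x then f else \<sigma> a) \<longleftrightarrow> covered \<sigma>" if "x \<notin> {2, 7, 8, 9, 18}" for x f \<sigma>
    using that by (auto simp: covered_def)
  have loop: "ht Bd (Inv 0) (CFor 11 (Pl (Vr 2) (Cn 1))
     (CIf (Vr 10) (CSet 12 (Cn 0)) (CSet 12 (Ar 9 (Vr 11))) ;; CFor 13 (Vr 12) (CIf (Vr 10) CSkip c_try)))
     ((3 + (Suc (T_try M) + 2) * K0 + 2) * M) (Inv (Suc n))"
  proof (rule ht_for2)
    fix i assume i: "i < Suc n"
    define A where "A \<sigma> \<longleftrightarrow> covered \<sigma> \<and> \<sigma> 10 0 = 1 \<and> \<sigma> 12 0 = 0" for \<sigma> :: store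
    define R where "R s \<sigma> \<longleftrightarrow> base n E \<sigma> \<and> pow3 n \<sigma> \<and> \<sigma> 11 0 = int i \<and> i \<le> vcn \<and> \<sigma> 12 0 = 3 ^ i \<and>
       (\<sigma> 10 0 = 1 \<and> covered \<sigma> \<or> \<sigma> 10 0 = 0 \<and> (\<forall>s'<s. fails s' i))" for s and \<sigma> :: store
    have 3: "(3::int) ^ i \<le> Bd" using i by (intro pow3_Bd) simp
    have 1: "ht Bd (\<lambda>\<sigma>. Inv i \<sigma> \<and> \<sigma> 11 0 = int i) (CIf (Vr 10) (CSet 12 (Cn 0)) (CSet 12 (Ar 9 (Vr 11)))) 3
      (\<lambda>\<sigma>. A \<sigma> \<or> R 0 \<sigma>)"
      apply (rule ht_pre)
        apply (rule wp)+
      subgoal for \<sigma> using B 3 i by (auto simp: Inv_def A_def R_def covupd pow3D)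
      by simp
    have 2: "ht Bd A (CFor 13 (Vr 12) (CIf (Vr 10) CSkip c_try)) ((Suc (T_try M) + 2) * K0) (Inv (Suc i))"
    proof (rule ht_use)
      show "ht Bd A (CFor 13 (Vr 12) (CIf (Vr 10) CSkip c_try)) ((Suc (T_try M) + 2) * K0) (\<lambda>\<sigma>. covered \<sigma> \<and> \<sigma> 10 0 = 1)"
      proof (rule ht_for2[where N = 0 and Inv = "\<lambda>_ \<sigma>. covered \<sigma> \<and> \<sigma> 10 0 = 1"])
      qed (use K0 B in \<open>auto simp: A_def covupd c_try_def c_branch_def\<close>)
    qed (auto simp: Inv_def)
    have 3: "ht Bd (R 0) (CFor 13 (Vr 12) (CIf (Vr 10) CSkip c_try)) ((Suc (T_try M) + 2) * K0) (Inv (Suc i))"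
    proof (cases "i \<le> vcn")
      case False
      then show ?thesis by (auto simp: ht_def R_def)
    next
      case iv: True
      have N: "3 ^ i \<le> K0" unfolding K0_def using iv by (intro power_increasing) auto
      have in_: "i \<le> n" using i by simp
      have "ht Bd (R 0) (CFor 13 (Vr 12) (CIf (Vr 10) CSkip c_try)) ((Suc (T_try M) + 2) * K0) (R (3 ^ i))"
      proof (rule ht_for2[OF _ _ N K0])
        fix s :: nat assume s: "s < 3 ^ i"
        have tr: "ht Bd (\<lambda>\<sigma>. R s \<sigma> \<and> \<sigma> 13 0 = int s \<and> \<sigma> 10 0 = 0) c_try (T_try M) (\<lambda>\<sigma>. R (Suc s) (\<sigma>(13 := (\<sigma> 13)(0 := int (Suc s)))))"
        proof (rule ht_use[OF c_try_ht[OF in_ s]])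
          fix \<sigma> \<sigma>' assume a: "R s \<sigma> \<and> \<sigma> 13 0 = int s \<and> \<sigma> 10 0 = 0"
            "cover_inv s i (n * n) \<sigma>' \<and> \<sigma>' 10 0 = of_bool (\<not> fails s i)" "\<And>a. a \<notin> mods c_try \<Longrightarrow> \<sigma>' a = \<sigma> a"
          have f: "\<sigma>' 11 = \<sigma> 11" "\<sigma>' 12 = \<sigma> 12" using a(3) by (auto simp: c_try_def c_branch_def)
          have cov: "covered \<sigma>'" if "\<not> fails s i"
            using not_fails[OF that] a(2) iv unfolding covered_def cover_inv_def
            by (intro conjI exI[of _ "fst (branch_run (digit s) i (n * n))"]) auto
          have fl: "\<forall>s'<Suc s. fails s' i" if "fails s i" using a(1) that by (auto simp: R_def less_Suc_eq)
          show "R (Suc s) (\<sigma>'(13 := (\<sigma>' 13)(0 := int (Suc s))))"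
            using a(1,2) f cov fl by (auto simp: R_def covupd cover_inv_def)
        qed (auto simp: R_def T_try_def)
        have skip: "ht Bd (\<lambda>\<sigma>. R (Suc s) (\<sigma>(13 := (\<sigma> 13)(0 := int (Suc s))))) CSkip 0
          (\<lambda>\<sigma>. R (Suc s) (\<sigma>(13 := (\<sigma> 13)(0 := int (Suc s)))))" by (rule ht_skip)
        show "ht Bd (\<lambda>\<sigma>. R s \<sigma> \<and> \<sigma> 13 0 = int s) (CIf (Vr 10) CSkip c_try) (Suc (T_try M))
          (\<lambda>\<sigma>. R (Suc s) (\<sigma>(13 := (\<sigma> 13)(0 := int (Suc s)))))"
          by (rule ht_pre[OF ht_if2[OF B skip tr]]) (auto simp: R_def covupd)
      next
        show "int (3 ^ i) \<le> Bd" using \<open>(3::int) ^ i \<le> Bd\<close> by simp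
      qed (use B in \<open>auto simp: R_def covupd c_try_def c_branch_def\<close>)
      then show ?thesis
      proof (rule ht_use)
        fix \<sigma> assume r: "R (3 ^ i) \<sigma>"
        \<comment> \<open>At the cover number some code succeeds, so complete failure leaves
          \<open>i < vcn\<close> and the invariant passes to \<open>Suc i\<close>.\<close>
        have "i \<noteq> vcn" if "\<forall>s'<3 ^ i. fails s' i"
        proof
          assume "i = vcn"
          then have "\<exists>s<3 ^ i. \<not> fails s i" using vcn(1) exists_branch[of _ i] by auto
          then show False using that by blast
        qed
        then show "Inv (Suc i) \<sigma>" using r by (auto simp: R_def Inv_def)
      qed auto
    qed
    show "ht Bd (\<lambda>\<sigma>. Inv i \<sigma> \<and> \<sigma> 11 0 = int i)
     (CIf (Vr 10) (CSet 12 (Cn 0)) (CSet 12 (Ar 9 (Vr 11))) ;; CFor 13 (Vr 12) (CIf (Vr 10) CSkip c_try))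
     (3 + (Suc (T_try M) + 2) * K0) (\<lambda>\<sigma>. Inv (Suc i) (\<sigma>(11 := (\<sigma> 11)(0 := int (Suc i)))))"
      by (rule ht_use[OF ht_seq[OF 1 ht_disj[OF 2 3]]]) (auto simp: Inv_def covupd)
  next
    show "11 \<notin> mods (CIf (Vr 10) (CSet 12 (Cn 0)) (CSet 12 (Ar 9 (Vr 11))) ;; CFor 13 (Vr 12) (CIf (Vr 10) CSkip c_try))"
      by (simp add: c_try_def c_branch_def)
  qed (use nM M1 nB B in \<open>auto simp: Inv_def covupd covered_def base_def\<close>)
  have init: "ht Bd (\<lambda>\<sigma>. base n E \<sigma> \<and> pow3 n \<sigma>) (CSet 10 (Cn 0)) 1 (Inv 0)"
    apply (rule ht_pre)
      apply (rule wp)+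
    subgoal for \<sigma> using B by (auto simp: Inv_def)
    by simp
  show ?thesis
    unfolding c_cover_def
    by (rule ht_use[OF ht_seq[OF init loop]]) (use vcn(2) in \<open>auto simp: Inv_def\<close>)
qed

definition c_list :: com where
  "c_list = CSet 23 (Cn 0) ;; CFor 3 (Vr 2)
     (CIf (Ar 18 (Vr 3)) (CAsg 24 (Vr 23) (Vr 3) ;; CSet 23 (Pl (Vr 23) (Cn 1))) CSkip)"

definition listed :: "nat set \<Rightarrow> nat \<Rightarrow> (nat \<Rightarrow> nat) \<Rightarrow> store \<Rightarrow> bool" where
  "listed C k cl \<sigma> \<longleftrightarrow> base n E \<sigma> \<and> pow3 n \<sigma> \<and> (\<forall>v<n. \<sigma> 18 v = of_bool (v \<in> C)) \<and>
     \<sigma> 23 0 = int k \<and> (\<forall>p<k. \<sigma> 24 p = int (cl p))"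

text \<open>The cover and its enumeration are results of the run, hence the existential quantifiers;
  they become the parameters of \<open>dctx\<close>.\<close>

lemma c_list_ht:
  "ht Bd covered c_list (1 + 5 * M) (\<lambda>\<sigma>. \<exists>C k cl. vertex_cover {..<n} E C \<and> card C \<le> vcn \<and>
     bij_betw cl {..<k} C \<and> listed C k cl \<sigma>)"
proof (rule ht_init)
  fix \<sigma>0 assume "covered \<sigma>0"
  then obtain C where C: "base n E \<sigma>0" "pow3 n \<sigma>0" "vertex_cover {..<n} E C" "card C \<le> vcn"
    "\<forall>v<n. \<sigma>0 18 v = of_bool (v \<in> C)" by (auto simp: covered_def)
  define Inv where "Inv i \<sigma> \<longleftrightarrow> (\<exists>k cl. k \<le> i \<and> bij_betw cl {..<k} (C \<inter> {..<i}) \<and> listed C k cl \<sigma>)" for i and \<sigma> :: store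
  have init: "ht Bd (\<lambda>\<sigma>. \<sigma> = \<sigma>0) (CSet 23 (Cn 0)) 1 (Inv 0)"
    apply (rule ht_pre)
      apply (rule wp)+
    subgoal for \<sigma> using B C by (auto simp: Inv_def listed_def bij_betw_def)
    by simp
  have loop: "ht Bd (Inv 0) (CFor 3 (Vr 2)
     (CIf (Ar 18 (Vr 3)) (CAsg 24 (Vr 23) (Vr 3) ;; CSet 23 (Pl (Vr 23) (Cn 1))) CSkip)) ((3 + 2) * M) (Inv n)"
  proof (rule ht_for2)
    fix i assume i: "i < n"
    show "ht Bd (\<lambda>\<sigma>. Inv i \<sigma> \<and> \<sigma> 3 0 = int i) (CIf (Ar 18 (Vr 3)) (CAsg 24 (Vr 23) (Vr 3) ;; CSet 23 (Pl (Vr 23) (Cn 1))) CSkip) 3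
       (\<lambda>\<sigma>. Inv (Suc i) (\<sigma>(3 := (\<sigma> 3)(0 := int (Suc i)))))"
      apply (rule ht_pre)
        apply (rule wp)+
      subgoal premises pr for \<sigma>
      proof -
        obtain k cl where k: "k \<le> i" "bij_betw cl {..<k} (C \<inter> {..<i})" "listed C k cl \<sigma>" and s3: "\<sigma> 3 0 = int i"
          using pr by (auto simp: Inv_def)
        have ib: "int i \<le> Bd" "int k + 1 \<le> Bd" using i k nB by auto
        show ?thesis
        proof (cases "i \<in> C")
          case False
          then have "C \<inter> {..<Suc i} = C \<inter> {..<i}" by (auto simp: less_Suc_eq)
          then have "Inv (Suc i) (\<sigma>(3 := (\<sigma> 3)(0 := int (Suc i))))"
            using k unfolding Inv_def by (intro exI[of _ k] exI[of _ cl]) (auto simp: listed_def)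
          then show ?thesis using False k i s3 by (simp add: listed_def)
        next
          case True
          then have e: "C \<inter> {..<Suc i} = insert i (C \<inter> {..<i})" by (auto simp: less_Suc_eq)
          let ?\<sigma> = "\<sigma>(24 := (\<sigma> 24)(k := int i), 23 := (\<sigma> 23)(0 := int k + 1), 3 := (\<sigma> 3)(0 := int (Suc i)))"
          have "bij_betw (cl(k := i)) {..<k} (C \<inter> {..<i})"
            using k(2) by (subst bij_betw_cong[of _ _ cl]) auto
          then have "bij_betw (cl(k := i)) (insert k {..<k}) (insert i (C \<inter> {..<i}))"
            using notIn_Un_bij_betw[of k "{..<k}" "cl(k := i)" "C \<inter> {..<i}"] by simp
          then have "bij_betw (cl(k := i)) {..<Suc k} (C \<inter> {..<Suc i})" unfolding e by (simp add: lessThan_Suc)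
          then have "Inv (Suc i) ?\<sigma>"
            using k unfolding Inv_def by (intro exI[of _ "Suc k"] exI[of _ "cl(k := i)"]) (auto simp: listed_def less_Suc_eq)
          then show ?thesis using True k i s3 ib by (simp add: listed_def)
        qed
      qed
      by simp
  qed (use nM M1 nB B in \<open>auto simp: Inv_def listed_def base_def pow3_def\<close>)
  show "ht Bd (\<lambda>\<sigma>. \<sigma> = \<sigma>0) c_list (1 + 5 * M) (\<lambda>\<sigma>. \<exists>C k cl. vertex_cover {..<n} E C \<and> card C \<le> vcn \<and>
     bij_betw cl {..<k} C \<and> listed C k cl \<sigma>)"
    unfolding c_list_def
  proof (rule ht_use[OF ht_seq[OF init loop]])
    fix \<sigma> assume "Inv n \<sigma>"
    moreover have "C \<inter> {..<n} = C" using C(3) by (auto simp: vertex_cover_def)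
    ultimately show "\<exists>C k cl. vertex_cover {..<n} E C \<and> card C \<le> vcn \<and> bij_betw cl {..<k} C \<and> listed C k cl \<sigma>"
      using C by (auto simp: Inv_def)
  qed auto
qed

end

lemma base_vert: "base n E \<sigma> \<Longrightarrow> \<sigma> 2 0 = int n" by (simp add: base_def)

lemma (in pctx) listed_upd [simp]:
  "a \<notin> {2, 7, 8, 9, 18, 23, 24} \<Longrightarrow> listed C k cl (\<sigma>(a := f)) \<longleftrightarrow> listed C k cl \<sigma>"
  "a \<notin> {2, 7, 8, 9, 18, 23, 24} \<Longrightarrow> listed C k cl (\<lambda>x. if x = a then f else \<sigma> x) \<longleftrightarrow> listed C k cl \<sigma>"
  by (simp_all add: listed_def)

text \<open>Counting below a moving bound \<open>i\<close>: \<open>cnum_Suc\<close> is what one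
  iteration of a counting loop does.\<close>

definition cnum :: "nat \<Rightarrow> (nat \<Rightarrow> bool) \<Rightarrow> nat" where "cnum i P = card {p. p < i \<and> P p}"

lemma cnum_0 [simp]: "cnum 0 P = 0" by (simp add: cnum_def)

lemma cnum_Suc [simp]: "cnum (Suc i) P = (if P i then Suc (cnum i P) else cnum i P)"
proof -
  have "{p. p < Suc i \<and> P p} = (if P i then insert i {p. p < i \<and> P p} else {p. p < i \<and> P p})"
    by (auto simp: less_Suc_eq)
  then show ?thesis by (simp add: cnum_def)
qed

lemma cnum_le: "cnum i P \<le> i"
  using card_mono[of "{..<i}" "{p. p < i \<and> P p}"] by (auto simp: cnum_def)

lemma cnum_pos: "0 < cnum i P \<longleftrightarrow> (\<exists>p<i. P p)"
  by (auto simp: cnum_def card_gt_0_iff)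

subsection \<open>The dynamic program\<close>

locale dctx = pctx n E + dp n E C k cl for n E C k cl +
  assumes k_le_vcn: "k \<le> vcn"
begin

lemma mmM: "mm = M" by (simp add: mm_def M_def)
lemma XXM: "XX ^ e = 2 ^ (M * e)" by (simp add: XX_def mmM power_mult)
lemma k_le_M: "k \<le> M" using k_le_n nM by simp
lemma kB: "int k \<le> Bd" "int k + 1 \<le> Bd" using k_le_n nB by auto

lemma cl_n: "p < k \<Longrightarrow> cl p < n" using cl_in CV by auto

section \<open>The final code and the tables of powers\<close>

definition full :: nat where "full = (\<Sum>i<k. 3 ^ i)"

lemma sum3_less: "(\<Sum>i<j. (3::nat) ^ i) < 3 ^ j" by (induction j) auto

lemma digit_sum3: "digit (\<Sum>i<j. 3 ^ i) p = (if p < j then 1 else 0)"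
proof (induction j arbitrary: p)
  case 0 show ?case by (simp add: digit_def)
next
  case (Suc j)
  have "digit (\<Sum>i<j. 3 ^ i) j = 0" using Suc by simp
  then have "digit ((\<Sum>i<j. 3 ^ i) + 1 * 3 ^ j) p = (if p = j then 1 else digit (\<Sum>i<j. 3 ^ i) p)"
    by (subst digit_add) auto
  then show ?case using Suc by auto
qed

lemma full: "full < 3 ^ k" "Ls full = C" "Bs full = {}"
  using sum3_less[of k] full_code[of full] digit_sum3 by (auto simp: full_def)

text \<open>One triple loop of \<open>M ^ 3\<close> doublings fills all tables of powers. Names 54
  and 29 count the powers of 2 and of \<open>XX\<close> stored so far, and 28 is the current power
  of 2; after every \<open>M\<close> doublings it is a power of \<open>XX\<close>, and when outer
  pass \<open>i\<close> begins, name 29 holds \<open>i * M\<close>.\<close>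

definition c_tab :: com where
  "c_tab = (CSet 25 (Pl (Pl (Vr 2) (Vr 2)) (Cn 1)) ;; CSet 28 (Cn 1) ;; CSet 29 (Cn 0) ;; CSet 54 (Cn 0) ;; CSet 53 (Ar 9 (Vr 23)) ;; CSet 56 (Cn 0)) ;;
     CFor 3 (Vr 25) (CAsg 55 (Vr 3) (Vr 29) ;;
       CFor 4 (Vr 25) ((CAsg 26 (Vr 29) (Vr 28) ;; CSet 29 (Pl (Vr 29) (Cn 1))) ;;
         CFor 5 (Vr 25) (CAsg 27 (Vr 54) (Vr 28) ;; CSet 54 (Pl (Vr 54) (Cn 1)) ;; CSet 28 (Pl (Vr 28) (Vr 28))))) ;;
     CFor 3 (Vr 23) (CSet 56 (Pl (Vr 56) (Ar 9 (Vr 3))))"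

definition tabs :: "store \<Rightarrow> bool" where
  "tabs \<sigma> \<longleftrightarrow> listed C k cl \<sigma> \<and> \<sigma> 53 0 = 3 ^ k \<and> \<sigma> 54 0 = int (M ^ 3) \<and> (\<forall>b<M ^ 3. \<sigma> 27 b = 2 ^ b)
    \<and> (\<forall>e<M * M. \<sigma> 26 e = XX ^ e) \<and> (\<forall>i<M. \<sigma> 55 i = int (i * M)) \<and> \<sigma> 56 0 = int full"

lemma c_tab_ht: "ht Bd (listed C k cl) c_tab (6 + ((1 + (2 + (3 + 2) * M + 2) * M + 2) * M + (1 + 2) * M)) tabs"
proof -
  define TI where "TI e b \<sigma> \<longleftrightarrow> listed C k cl \<sigma> \<and> \<sigma> 25 0 = int M \<and> \<sigma> 53 0 = 3 ^ k \<and> \<sigma> 56 0 = 0 \<and> \<sigma> 29 0 = int e \<and> \<sigma> 54 0 = int b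
    \<and> \<sigma> 28 0 = 2 ^ b \<and> (\<forall>b'<b. \<sigma> 27 b' = 2 ^ b') \<and> (\<forall>e'<e. \<sigma> 26 e' = 2 ^ (M * e'))" for e b and \<sigma> :: store
  have TIu: "TI e b (\<sigma>(a := f)) \<longleftrightarrow> TI e b \<sigma>" "TI e b (\<lambda>x. if x = a then f else \<sigma> x) \<longleftrightarrow> TI e b \<sigma>"
    if "a \<in> {3, 4, 5, 55}" for a f e b \<sigma>
    using that by (auto simp: TI_def listed_def)
  define R where "R i \<sigma> \<longleftrightarrow> (\<forall>i'<i. \<sigma> 55 i' = int (i' * M))" for i and \<sigma> :: store
  have MB': "int M \<le> Bd" "int M + 1 \<le> Bd" using small[of "M + 1"] M3 by auto
  have bb: "(i * M + j) * M + l \<le> M ^ 3" if "i < M" "j < M" "l \<le> M" for i j l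
  proof -
    have "Suc i * M \<le> M * M" using that by (intro mult_le_mono1) simp
    then have "Suc (i * M + j) \<le> M * M" using that by simp
    then have "Suc (i * M + j) * M \<le> M * M * M" by (intro mult_le_mono1)
    then show ?thesis using that by (simp add: power3_eq_cube)
  qed
  have eb: "Suc (i * M + j) \<le> M * M" if "i < M" "j < M" for i j
  proof -
    have "Suc i * M \<le> M * M" using that by (intro mult_le_mono1) simp
    then show ?thesis using that by simp
  qed
  have init: "ht Bd (listed C k cl) (CSet 25 (Pl (Pl (Vr 2) (Vr 2)) (Cn 1)) ;; CSet 28 (Cn 1) ;; CSet 29 (Cn 0) ;; CSet 54 (Cn 0) ;;
     CSet 53 (Ar 9 (Vr 23)) ;; CSet 56 (Cn 0)) 6 (\<lambda>\<sigma>. TI 0 0 \<sigma> \<and> R 0 \<sigma>)"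
    apply (rule ht_pre)
      apply (rule wp)+
    subgoal premises pr for \<sigma>
    proof -
      have e: "2 * int n + 1 = int M" by (simp add: M_def)
      have s: "\<sigma> 2 0 = int n" "\<sigma> 9 k = 3 ^ k" "\<sigma> 23 0 = int k"
        using pr k_le_n by (auto simp: listed_def base_vert pow3D)
      show ?thesis using pr B MB' pow3_Bd[OF k_le_n] by (simp add: TI_def R_def s e)
    qed
    by simp
  have inner: "ht Bd (\<lambda>\<sigma>. TI (Suc (i * M + j)) ((i * M + j) * M + 0) \<sigma>)
     (CFor 5 (Vr 25) (CAsg 27 (Vr 54) (Vr 28) ;; CSet 54 (Pl (Vr 54) (Cn 1)) ;; CSet 28 (Pl (Vr 28) (Vr 28)))) ((3 + 2) * M)
     (\<lambda>\<sigma>. TI (Suc (i * M + j)) ((i * M + j) * M + M) \<sigma>)" if ij: "i < M" "j < M" for i j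
  proof (rule ht_for2[where Inv = "\<lambda>l. TI (Suc (i * M + j)) ((i * M + j) * M + l)"])
    fix l assume l: "l < M"
    define b where "b = (i * M + j) * M + l"
    have b: "Suc b \<le> M ^ 3" using bb[OF ij, of "Suc l"] l by (simp add: b_def)
    have bB: "int b + 1 \<le> Bd" "2 * 2 ^ b \<le> Bd" "(2::int) ^ b \<le> Bd"
      using small[of "Suc b"] pow2_Bd[of "Suc b"] pow2_Bd[of b] b by auto
    show "ht Bd (\<lambda>\<sigma>. TI (Suc (i * M + j)) ((i * M + j) * M + l) \<sigma> \<and> \<sigma> 5 0 = int l)
      (CAsg 27 (Vr 54) (Vr 28) ;; CSet 54 (Pl (Vr 54) (Cn 1)) ;; CSet 28 (Pl (Vr 28) (Vr 28))) 3
      (\<lambda>\<sigma>. TI (Suc (i * M + j)) ((i * M + j) * M + Suc l) (\<sigma>(5 := (\<sigma> 5)(0 := int (Suc l)))))"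
      unfolding add_Suc_right b_def[symmetric]
      apply (rule ht_pre)
        apply (rule wp)+
      subgoal for \<sigma> using bB by (auto simp: TIu) (auto simp: TI_def less_Suc_eq)
      by simp
  qed (use M1 MB' B in \<open>auto simp: TIu TI_def\<close>)
  have mid: "ht Bd (\<lambda>\<sigma>. TI (i * M + 0) ((i * M + 0) * M) \<sigma>)
     (CFor 4 (Vr 25) ((CAsg 26 (Vr 29) (Vr 28) ;; CSet 29 (Pl (Vr 29) (Cn 1))) ;;
         CFor 5 (Vr 25) (CAsg 27 (Vr 54) (Vr 28) ;; CSet 54 (Pl (Vr 54) (Cn 1)) ;; CSet 28 (Pl (Vr 28) (Vr 28)))))
     ((2 + (3 + 2) * M + 2) * M) (\<lambda>\<sigma>. TI (i * M + M) ((i * M + M) * M) \<sigma>)" if i: "i < M" for i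
  proof (rule ht_for2[where Inv = "\<lambda>j. TI (i * M + j) ((i * M + j) * M)"])
    fix j assume j: "j < M"
    define e where "e = i * M + j"
    have e: "int e + 1 \<le> Bd" "int e \<le> Bd" using small[of "Suc e"] eb[OF i j] M3(2) by (auto simp: e_def)
    have eM: "(2::int) ^ (e * M) \<le> Bd" using bb[OF i j, of 0] by (intro pow2_Bd) (simp add: e_def)
    have a: "ht Bd (\<lambda>\<sigma>. TI e (e * M) \<sigma>) (CAsg 26 (Vr 29) (Vr 28) ;; CSet 29 (Pl (Vr 29) (Cn 1))) 2 (\<lambda>\<sigma>. TI (Suc e) (e * M + 0) \<sigma>)"
      apply (rule ht_pre)
        apply (rule wp)+
      subgoal for \<sigma> using e eM by (auto simp: TI_def less_Suc_eq mult.commute)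
      by simp
    have "ht Bd (\<lambda>\<sigma>. TI e (e * M) \<sigma>) ((CAsg 26 (Vr 29) (Vr 28) ;; CSet 29 (Pl (Vr 29) (Cn 1))) ;;
         CFor 5 (Vr 25) (CAsg 27 (Vr 54) (Vr 28) ;; CSet 54 (Pl (Vr 54) (Cn 1)) ;; CSet 28 (Pl (Vr 28) (Vr 28))))
       (2 + (3 + 2) * M) (\<lambda>\<sigma>. TI (Suc e) (e * M + M) \<sigma>)"
      using ht_seq[OF a] inner[OF i j] unfolding e_def by blast
    then show "ht Bd (\<lambda>\<sigma>. TI (i * M + j) ((i * M + j) * M) \<sigma> \<and> \<sigma> 4 0 = int j) ((CAsg 26 (Vr 29) (Vr 28) ;; CSet 29 (Pl (Vr 29) (Cn 1))) ;;
         CFor 5 (Vr 25) (CAsg 27 (Vr 54) (Vr 28) ;; CSet 54 (Pl (Vr 54) (Cn 1)) ;; CSet 28 (Pl (Vr 28) (Vr 28))))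
       (2 + (3 + 2) * M) (\<lambda>\<sigma>. TI (i * M + Suc j) ((i * M + Suc j) * M) (\<sigma>(4 := (\<sigma> 4)(0 := int (Suc j)))))"
      by (rule ht_use) (auto simp: TIu e_def add.commute)
  qed (use M1 MB' B in \<open>auto simp: TIu TI_def\<close>)
  have outer: "ht Bd (\<lambda>\<sigma>. TI (0 * M) (0 * M * M) \<sigma> \<and> R 0 \<sigma>)
     (CFor 3 (Vr 25) (CAsg 55 (Vr 3) (Vr 29) ;; CFor 4 (Vr 25) ((CAsg 26 (Vr 29) (Vr 28) ;; CSet 29 (Pl (Vr 29) (Cn 1))) ;;
         CFor 5 (Vr 25) (CAsg 27 (Vr 54) (Vr 28) ;; CSet 54 (Pl (Vr 54) (Cn 1)) ;; CSet 28 (Pl (Vr 28) (Vr 28))))))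
     ((1 + (2 + (3 + 2) * M + 2) * M + 2) * M) (\<lambda>\<sigma>. TI (M * M) (M * M * M) \<sigma> \<and> R M \<sigma>)"
  proof (rule ht_for2[where Inv = "\<lambda>i \<sigma>. TI (i * M) (i * M * M) \<sigma> \<and> R i \<sigma>"])
    fix i assume i: "i < M"
    have iB: "int (i * M) \<le> Bd" "\<bar>int i * int M\<bar> \<le> Bd" using small[of "i * M"] eb[OF i, of 0] M3(2) M1 by auto
    have a: "ht Bd (\<lambda>\<sigma>. (TI (i * M) (i * M * M) \<sigma> \<and> R i \<sigma>) \<and> \<sigma> 3 0 = int i) (CAsg 55 (Vr 3) (Vr 29)) 1
       (\<lambda>\<sigma>. TI (i * M + 0) ((i * M + 0) * M) \<sigma> \<and> R (Suc i) \<sigma>)"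
      apply (rule ht_pre)
        apply (rule wp)+
      subgoal for \<sigma> using iB by (auto simp: TIu R_def less_Suc_eq) (auto simp: TI_def)
      by simp
    have b: "ht Bd (\<lambda>\<sigma>. TI (i * M + 0) ((i * M + 0) * M) \<sigma> \<and> R (Suc i) \<sigma>) (CFor 4 (Vr 25) ((CAsg 26 (Vr 29) (Vr 28) ;; CSet 29 (Pl (Vr 29) (Cn 1))) ;;
         CFor 5 (Vr 25) (CAsg 27 (Vr 54) (Vr 28) ;; CSet 54 (Pl (Vr 54) (Cn 1)) ;; CSet 28 (Pl (Vr 28) (Vr 28)))))
       ((2 + (3 + 2) * M + 2) * M) (\<lambda>\<sigma>. TI (i * M + M) ((i * M + M) * M) \<sigma> \<and> R (Suc i) \<sigma>)"
      by (rule ht_use[OF mid[OF i]]) (auto simp: R_def)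
    show "ht Bd (\<lambda>\<sigma>. (TI (i * M) (i * M * M) \<sigma> \<and> R i \<sigma>) \<and> \<sigma> 3 0 = int i) (CAsg 55 (Vr 3) (Vr 29) ;; CFor 4 (Vr 25) ((CAsg 26 (Vr 29) (Vr 28) ;; CSet 29 (Pl (Vr 29) (Cn 1))) ;;
         CFor 5 (Vr 25) (CAsg 27 (Vr 54) (Vr 28) ;; CSet 54 (Pl (Vr 54) (Cn 1)) ;; CSet 28 (Pl (Vr 28) (Vr 28)))))
       (1 + (2 + (3 + 2) * M + 2) * M) (\<lambda>\<sigma>. TI (Suc i * M) (Suc i * M * M) (\<sigma>(3 := (\<sigma> 3)(0 := int (Suc i)))) \<and> R (Suc i) (\<sigma>(3 := (\<sigma> 3)(0 := int (Suc i)))))"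
      by (rule ht_use[OF ht_seq[OF a b]]) (auto simp: TIu R_def add.commute)
  next
    fix \<sigma> assume a: "TI (0 * M) (0 * M * M) \<sigma> \<and> R 0 \<sigma>"
    then have "\<sigma> 25 0 = int M" by (simp add: TI_def)
    then show "okx (Vr 25) \<sigma> \<and> eval (Vr 25) \<sigma> = int M \<and>
      (TI (0 * M) (0 * M * M) (\<sigma>(3 := (\<sigma> 3)(0 := 0))) \<and> R 0 (\<sigma>(3 := (\<sigma> 3)(0 := 0))))"
      using a by (simp add: TIu R_def)
  qed (use M1 MB' B in simp_all)
  define Q where "Q i \<sigma> \<longleftrightarrow> listed C k cl \<sigma> \<and> \<sigma> 53 0 = 3 ^ k \<and> \<sigma> 54 0 = int (M ^ 3) \<and> (\<forall>b<M ^ 3. \<sigma> 27 b = 2 ^ b)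
    \<and> (\<forall>e<M * M. \<sigma> 26 e = XX ^ e) \<and> (\<forall>i<M. \<sigma> 55 i = int (i * M)) \<and> \<sigma> 56 0 = int (\<Sum>j<i. 3 ^ j)" for i and \<sigma> :: store
  have last: "ht Bd (Q 0) (CFor 3 (Vr 23) (CSet 56 (Pl (Vr 56) (Ar 9 (Vr 3))))) ((1 + 2) * M) (Q k)"
  proof (rule ht_for2)
    fix i assume i: "i < k"
    have "(\<Sum>j<Suc i. (3::int) ^ j) \<le> 3 ^ Suc i"     proof -
      have "int (\<Sum>j<Suc i. 3 ^ j) \<le> int (3 ^ Suc i)"
        using sum3_less[of "Suc i"] by (simp only: of_nat_le_iff less_imp_le)
      then show ?thesis by (simp del: sum.lessThan_Suc)
    qed
    also have "\<dots> \<le> Bd" using i k_le_n by (intro pow3_Bd) simp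
    finally have sB: "(\<Sum>j<i. (3::int) ^ j) + 3 ^ i \<le> Bd" by simp
    have s0: "0 \<le> (\<Sum>j<i. (3::int) ^ j)" by (rule sum_nonneg) simp
    show "ht Bd (\<lambda>\<sigma>. Q i \<sigma> \<and> \<sigma> 3 0 = int i) (CSet 56 (Pl (Vr 56) (Ar 9 (Vr 3)))) 1 (\<lambda>\<sigma>. Q (Suc i) (\<sigma>(3 := (\<sigma> 3)(0 := int (Suc i)))))"
      apply (rule ht_pre)
        apply (rule wp)+
      subgoal for \<sigma> using sB s0 i k_le_n pow3D[of n \<sigma> i] by (auto simp: Q_def listed_def)
      by simp
  qed (use k_le_M M1 kB B in \<open>auto simp: Q_def listed_def pow3_def base_def\<close>)
  have TQ: "Q 0 \<sigma>" if "TI (M * M) (M * M * M) \<sigma> \<and> R M \<sigma>" for \<sigma>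
    using that by (auto simp: Q_def TI_def R_def XXM power3_eq_cube)
  have outer': "ht Bd (\<lambda>\<sigma>. TI 0 0 \<sigma> \<and> R 0 \<sigma>)
     (CFor 3 (Vr 25) (CAsg 55 (Vr 3) (Vr 29) ;; CFor 4 (Vr 25) ((CAsg 26 (Vr 29) (Vr 28) ;; CSet 29 (Pl (Vr 29) (Cn 1))) ;;
         CFor 5 (Vr 25) (CAsg 27 (Vr 54) (Vr 28) ;; CSet 54 (Pl (Vr 54) (Cn 1)) ;; CSet 28 (Pl (Vr 28) (Vr 28))))))
     ((1 + (2 + (3 + 2) * M + 2) * M + 2) * M) (Q 0)"
    by (rule ht_use[OF outer]) (auto intro: TQ)
  show ?thesis
    unfolding c_tab_def
    by (rule ht_use[OF ht_seq[OF init ht_seq[OF outer' last]]]) (auto simp: Q_def tabs_def full_def)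
qed

lemma tabs_upd [simp]:
  "a \<notin> {2, 7, 8, 9, 18, 23, 24, 26, 27, 53, 54, 55, 56} \<Longrightarrow> tabs (\<sigma>(a := f)) \<longleftrightarrow> tabs \<sigma>"
  "a \<notin> {2, 7, 8, 9, 18, 23, 24, 26, 27, 53, 54, 55, 56} \<Longrightarrow> tabs (\<lambda>x. if x = a then f else \<sigma> x) \<longleftrightarrow> tabs \<sigma>"
  by (simp_all add: tabs_def)

lemma tabs_cong:
  assumes "tabs \<sigma>" "\<And>a. a \<in> {2, 7, 8, 9, 18, 23, 24, 26, 27, 53, 54, 55, 56} \<Longrightarrow> \<sigma>' a = \<sigma> a"
  shows "tabs \<sigma>'"
  using assms by (simp add: tabs_def listed_def base_def pow3_def)

lemma tabsD:
  assumes "tabs \<sigma>"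
  shows "\<sigma> 2 0 = int n" "\<sigma> 23 0 = int k" "\<sigma> 53 0 = 3 ^ k" "pow3 n \<sigma>"
    "v < n \<Longrightarrow> \<sigma> 18 v = of_bool (v \<in> C)" "p < k \<Longrightarrow> \<sigma> 24 p = int (cl p)" "v < n \<Longrightarrow> \<sigma> 8 v = int (v * n)"
    "v < n \<Longrightarrow> p < k \<Longrightarrow> \<sigma> 7 (v * n + cl p) = of_bool ({v, cl p} \<in> E)"
    "e < M * M \<Longrightarrow> \<sigma> 26 e = XX ^ e" "i < M \<Longrightarrow> \<sigma> 55 i = int (i * M)"
    "b < M ^ 3 \<Longrightarrow> \<sigma> 27 b = 2 ^ b" "\<sigma> 54 0 = int (M ^ 3)" "\<sigma> 56 0 = int full"
proof -
  have t: "listed C k cl \<sigma>" "\<sigma> 53 0 = 3 ^ k" "\<sigma> 54 0 = int (M ^ 3)" "\<forall>b<M ^ 3. \<sigma> 27 b = 2 ^ b"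
    "\<forall>e<M * M. \<sigma> 26 e = XX ^ e" "\<forall>i<M. \<sigma> 55 i = int (i * M)" "\<sigma> 56 0 = int full"
    using assms unfolding tabs_def by blast+
  have l: "base n E \<sigma>" "pow3 n \<sigma>" "\<forall>v<n. \<sigma> 18 v = of_bool (v \<in> C)" "\<sigma> 23 0 = int k" "\<forall>p<k. \<sigma> 24 p = int (cl p)"
    using t(1) unfolding listed_def by blast+
  have b: "\<sigma> 2 0 = int n" "\<forall>i<n. \<sigma> 8 i = int (i * n)" "\<forall>u<n. \<forall>v<n. \<sigma> 7 (u * n + v) = of_bool ({u, v} \<in> E)"
    using l(1) unfolding base_def by blast+
  show "\<sigma> 2 0 = int n" "\<sigma> 23 0 = int k" "\<sigma> 53 0 = 3 ^ k" "pow3 n \<sigma>"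
    "v < n \<Longrightarrow> \<sigma> 18 v = of_bool (v \<in> C)" "p < k \<Longrightarrow> \<sigma> 24 p = int (cl p)" "v < n \<Longrightarrow> \<sigma> 8 v = int (v * n)"
    "v < n \<Longrightarrow> p < k \<Longrightarrow> \<sigma> 7 (v * n + cl p) = of_bool ({v, cl p} \<in> E)"
    "e < M * M \<Longrightarrow> \<sigma> 26 e = XX ^ e" "i < M \<Longrightarrow> \<sigma> 55 i = int (i * M)"
    "b < M ^ 3 \<Longrightarrow> \<sigma> 27 b = 2 ^ b" "\<sigma> 54 0 = int (M ^ 3)" "\<sigma> 56 0 = int full"
    using t l b cl_n by blast+
qed

section \<open>Tables of the parameters of a code\<close>

lemma adj_idx: "nat (int (v * n) + int w) = v * n + w" by (simp only: nat_int_add)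

lemma adj_idx': "nat (int v * int n + int w) = v * n + w"
  using adj_idx[of v w] by (simp only: of_nat_mult)

lemma K3B: "int (3 ^ k) \<le> Bd" using pow3_Bd[OF k_le_n] by simp

lemma pow3_k: "1 \<le> (3::nat) ^ k" "3 ^ k \<le> K0"
  unfolding K0_def using k_le_vcn by (auto intro: power_increasing)

lemma K0_1: "1 \<le> K0" by (simp add: K0_def)

lemma tB: "t < 3 ^ k \<Longrightarrow> int t + 1 \<le> Bd"
proof -
  assume "t < 3 ^ k"
  then have "int (Suc t) \<le> int (3 ^ k)" by (simp only: of_nat_le_iff Suc_le_eq)
  then show ?thesis using K3B by linarith
qed

text \<open>Entry 42 is described by its comparisons with all bounds \<open>q\<close>, the only way
  in which it is used. Thus no table depends on \<open>q\<close>, and all of them are computed once,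
  before the search for the width.\<close>

definition st_ok :: "store \<Rightarrow> nat \<Rightarrow> bool" where
  "st_ok \<sigma> t \<longleftrightarrow> \<sigma> 38 t = int (vb t) \<and> \<sigma> 39 t = int (vl t) \<and> \<sigma> 40 t = int (vj t) \<and> \<sigma> 41 t = int (va t)
    \<and> (\<forall>q. \<sigma> 42 t \<le> int q \<longleftrightarrow> okD q t) \<and> (0 < \<sigma> 43 t \<longleftrightarrow> \<not> okE t)
    \<and> \<sigma> 44 t = XX ^ ee t \<and> \<sigma> 45 t = int ((2 * n - vl t) * M)"

definition stat_inv :: "nat \<Rightarrow> store \<Rightarrow> bool" where
  "stat_inv t \<sigma> \<longleftrightarrow> tabs \<sigma> \<and> \<sigma> 31 0 = int t \<and> (\<forall>p<k. \<sigma> 16 p = int (digit t p)) \<and> (\<forall>t'<t. st_ok \<sigma> t')"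

lemma stat_inv_upd [simp]:
  "a \<in> {3, 4, 32, 33, 34, 35, 36, 37} \<Longrightarrow> stat_inv t (\<sigma>(a := f)) \<longleftrightarrow> stat_inv t \<sigma>"
  "a \<in> {3, 4, 32, 33, 34, 35, 36, 37} \<Longrightarrow> stat_inv t (\<lambda>x. if x = a then f else \<sigma> x) \<longleftrightarrow> stat_inv t \<sigma>"
  by (elim insertE emptyE; simp add: stat_inv_def st_ok_def)+

definition c_sizes :: com where
  "c_sizes = (CAsg 33 (Cn 0) (Cn 0) ;; CAsg 33 (Cn 1) (Cn 0) ;; CAsg 33 (Cn 2) (Cn 0)) ;;
     CFor 3 (Vr 23) (CAsg 33 (Ar 16 (Vr 3)) (Pl (Ar 33 (Ar 16 (Vr 3))) (Cn 1)))"

lemma less3: "d < 3 \<longleftrightarrow> d = 0 \<or> d = 1 \<or> d = (2::nat)" by auto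

lemma c_sizes_ht: "ht Bd (stat_inv t) c_sizes (3 + 3 * M) (\<lambda>\<sigma>. stat_inv t \<sigma> \<and> (\<forall>d<3. \<sigma> 33 d = int (cnum k (\<lambda>p. digit t p = d))))"
proof -
  let ?I = "\<lambda>i \<sigma>. stat_inv t \<sigma> \<and> (\<forall>d<3. \<sigma> 33 d = int (cnum i (\<lambda>p. digit t p = d)))"
  have a: "ht Bd (stat_inv t) (CAsg 33 (Cn 0) (Cn 0) ;; CAsg 33 (Cn 1) (Cn 0) ;; CAsg 33 (Cn 2) (Cn 0)) 3 (?I 0)"
    apply (rule ht_pre)
      apply (rule wp)+
    subgoal for \<sigma> using B by (auto simp: less3)
    by simp
  have b: "ht Bd (?I 0) (CFor 3 (Vr 23) (CAsg 33 (Ar 16 (Vr 3)) (Pl (Ar 33 (Ar 16 (Vr 3))) (Cn 1)))) ((1 + 2) * M) (?I k)"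
  proof (rule ht_for2[where Inv = ?I])
    fix i assume i: "i < k"
    have c: "int (cnum i (\<lambda>p. digit t p = digit t i)) + 1 \<le> Bd"
      using cnum_le[of i "\<lambda>p. digit t p = digit t i"] i kB by linarith
    show "ht Bd (\<lambda>\<sigma>. ?I i \<sigma> \<and> \<sigma> 3 0 = int i) (CAsg 33 (Ar 16 (Vr 3)) (Pl (Ar 33 (Ar 16 (Vr 3))) (Cn 1))) 1
      (\<lambda>\<sigma>. ?I (Suc i) (\<sigma>(3 := (\<sigma> 3)(0 := int (Suc i)))))"
      apply (rule ht_pre)
        apply (rule wp)+
      subgoal premises pr for \<sigma>
      proof -
        have s: "\<sigma> 3 0 = int i" "\<sigma> 16 i = int (digit t i)" using pr i by (auto simp: stat_inv_def)
        show ?thesis using pr c digit_less[of t i] by (auto simp: s)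
      qed
      by simp
  next
    fix \<sigma> assume "?I 0 \<sigma>"
    then show "okx (Vr 23) \<sigma> \<and> eval (Vr 23) \<sigma> = int k \<and> ?I 0 (\<sigma>(3 := (\<sigma> 3)(0 := 0)))"
      by (simp add: stat_inv_def[of t \<sigma>] tabsD)
  qed (use k_le_M M1 kB B in simp_all)
  show ?thesis unfolding c_sizes_def by (rule ht_pre[OF ht_seq[OF a b]]) auto
qed

definition c_closed :: com where
  "c_closed = CSet 34 (Cn 0) ;; CFor 3 (Vr 23) (CFor 4 (Vr 23)
     (CIf (Ar 7 (Pl (Ar 8 (Ar 24 (Vr 3))) (Ar 24 (Vr 4))))
        (CIf (Ar 16 (Vr 4)) CSkip (CIf (Ar 16 (Vr 3)) (CIf (Mi (Ar 16 (Vr 3)) (Cn 1)) CSkip (CSet 34 (Cn 1))) CSkip)) CSkip))"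

definition badp :: "nat \<Rightarrow> nat \<Rightarrow> nat \<Rightarrow> bool" where
  "badp t p r \<longleftrightarrow> {cl p, cl r} \<in> E \<and> digit t p = 1 \<and> digit t r = 0"

lemma okE_bad: "okE t \<longleftrightarrow> \<not> (\<exists>p<k. \<exists>r<k. badp t p r)"
proof -
  have "(\<exists>p<k. \<exists>r<k. badp t p r) \<longleftrightarrow> (\<exists>x\<in>Ls t. \<exists>y\<in>nbhd E x \<inter> C. y \<notin> Ls t \<union> Bs t)"
  proof
    assume "\<exists>p<k. \<exists>r<k. badp t p r"
    then obtain p r where pr: "p < k" "r < k" "badp t p r" by blast
    then have "cl p \<in> Ls t" "cl r \<in> nbhd E (cl p) \<inter> C" "cl r \<notin> Ls t \<union> Bs t"
      using cl_in by (auto simp: badp_def in_Ls in_Bs nbhd_def insert_commute)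
    then show "\<exists>x\<in>Ls t. \<exists>y\<in>nbhd E x \<inter> C. y \<notin> Ls t \<union> Bs t" by blast
  next
    assume "\<exists>x\<in>Ls t. \<exists>y\<in>nbhd E x \<inter> C. y \<notin> Ls t \<union> Bs t"
    then obtain x y where xy: "x \<in> Ls t" "y \<in> nbhd E x" "y \<in> C" "y \<notin> Ls t \<union> Bs t" by blast
    then obtain p where p: "p < k" "digit t p = 1" "x = cl p" by (auto simp: Ls_def)
    obtain r where r: "r < k" "y = cl r" using xy(3) cl_C by blast
    then have "digit t r = 0" using xy(4) digit_cases[of t r] by (auto simp: in_Ls in_Bs)
    then show "\<exists>p<k. \<exists>r<k. badp t p r"
      using p r xy by (intro exI[of _ p] conjI exI[of _ r]) (auto simp: badp_def nbhd_def insert_commute)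
  qed
  then show ?thesis unfolding okE_def by blast
qed

lemma c_closed_ht: "ht Bd (stat_inv t) c_closed (1 + ((7 + 2) * M + 2) * M) (\<lambda>\<sigma>. stat_inv t \<sigma> \<and> \<sigma> 34 0 = of_bool (\<not> okE t))"
proof -
  let ?J = "\<lambda>i j \<sigma>. stat_inv t \<sigma> \<and> \<sigma> 34 0 = of_bool ((\<exists>p<i. \<exists>r<k. badp t p r) \<or> (\<exists>r<j. badp t i r))"
  let ?I = "\<lambda>i \<sigma>. stat_inv t \<sigma> \<and> \<sigma> 34 0 = of_bool (\<exists>p<i. \<exists>r<k. badp t p r)"
  have a: "ht Bd (stat_inv t) (CSet 34 (Cn 0)) 1 (?I 0)"
    apply (rule ht_pre)
      apply (rule wp)+
    subgoal for \<sigma> using B by simp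
    by simp
  have b: "ht Bd (?I 0) (CFor 3 (Vr 23) (CFor 4 (Vr 23)
     (CIf (Ar 7 (Pl (Ar 8 (Ar 24 (Vr 3))) (Ar 24 (Vr 4))))
        (CIf (Ar 16 (Vr 4)) CSkip (CIf (Ar 16 (Vr 3)) (CIf (Mi (Ar 16 (Vr 3)) (Cn 1)) CSkip (CSet 34 (Cn 1))) CSkip)) CSkip)))
     (((7 + 2) * M + 2) * M) (?I k)"
  proof (rule ht_for2[where Inv = ?I])
    fix i assume i: "i < k"
    have inner: "ht Bd (\<lambda>\<sigma>. ?J i 0 \<sigma> \<and> \<sigma> 3 0 = int i) (CFor 4 (Vr 23)
     (CIf (Ar 7 (Pl (Ar 8 (Ar 24 (Vr 3))) (Ar 24 (Vr 4))))
        (CIf (Ar 16 (Vr 4)) CSkip (CIf (Ar 16 (Vr 3)) (CIf (Mi (Ar 16 (Vr 3)) (Cn 1)) CSkip (CSet 34 (Cn 1))) CSkip)) CSkip))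
      ((7 + 2) * M) (\<lambda>\<sigma>. ?J i k \<sigma> \<and> \<sigma> 3 0 = int i)"
    proof (rule ht_for2[where Inv = "\<lambda>j \<sigma>. ?J i j \<sigma> \<and> \<sigma> 3 0 = int i"])
      fix j assume j: "j < k"
      show "ht Bd (\<lambda>\<sigma>. (?J i j \<sigma> \<and> \<sigma> 3 0 = int i) \<and> \<sigma> 4 0 = int j) (CIf (Ar 7 (Pl (Ar 8 (Ar 24 (Vr 3))) (Ar 24 (Vr 4))))
        (CIf (Ar 16 (Vr 4)) CSkip (CIf (Ar 16 (Vr 3)) (CIf (Mi (Ar 16 (Vr 3)) (Cn 1)) CSkip (CSet 34 (Cn 1))) CSkip)) CSkip) 7
        (\<lambda>\<sigma>. ?J i (Suc j) (\<sigma>(4 := (\<sigma> 4)(0 := int (Suc j)))) \<and> (\<sigma>(4 := (\<sigma> 4)(0 := int (Suc j)))) 3 0 = int i)"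
        apply (rule ht_pre)
          apply (rule wp)+
        subgoal premises pr for \<sigma>
        proof -
          have F: "stat_inv t \<sigma>" and tb: "tabs \<sigma>" and s: "\<sigma> 3 0 = int i" "\<sigma> 4 0 = int j" using pr by (auto simp: stat_inv_def)
          have d: "\<sigma> 16 i = int (digit t i)" "\<sigma> 16 j = int (digit t j)" using F i j by (auto simp: stat_inv_def)
          note T = tabsD(6)[OF tb i] tabsD(6)[OF tb j] tabsD(7)[OF tb cl_n[OF i]] tabsD(8)[OF tb cl_n[OF i] j]
          have o: "\<sigma> 34 0 = of_bool ((\<exists>p<i. \<exists>r<k. badp t p r) \<or> (\<exists>r<j. badp t i r))" using pr by simp
          have e: "(\<exists>r<Suc j. badp t i r) \<longleftrightarrow> (\<exists>r<j. badp t i r) \<or> badp t i j" by (auto simp: less_Suc_eq)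
          have bd: "badp t i j \<longleftrightarrow> {cl i, cl j} \<in> E \<and> digit t i = 1 \<and> digit t j = 0" by (simp add: badp_def)
          show ?thesis
            using B digit_cases[of t i] digit_cases[of t j] F
            by (cases "{cl i, cl j} \<in> E") (auto simp: s d T adj_idx' o e bd)
        qed
        by simp
    next
      fix \<sigma> assume a: "?J i 0 \<sigma> \<and> \<sigma> 3 0 = int i"
      then show "okx (Vr 23) \<sigma> \<and> eval (Vr 23) \<sigma> = int k \<and> ?J i 0 (\<sigma>(4 := (\<sigma> 4)(0 := 0))) \<and> (\<sigma>(4 := (\<sigma> 4)(0 := 0))) 3 0 = int i"
        by (simp add: stat_inv_def[of t \<sigma>] tabsD)
    qed (use k_le_M M1 kB B in simp_all)
    have e: "(\<exists>p<Suc i. \<exists>r<k. badp t p r) \<longleftrightarrow> (\<exists>p<i. \<exists>r<k. badp t p r) \<or> (\<exists>r<k. badp t i r)"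
      by (auto simp: less_Suc_eq)
    show "ht Bd (\<lambda>\<sigma>. ?I i \<sigma> \<and> \<sigma> 3 0 = int i) (CFor 4 (Vr 23)
     (CIf (Ar 7 (Pl (Ar 8 (Ar 24 (Vr 3))) (Ar 24 (Vr 4))))
        (CIf (Ar 16 (Vr 4)) CSkip (CIf (Ar 16 (Vr 3)) (CIf (Mi (Ar 16 (Vr 3)) (Cn 1)) CSkip (CSet 34 (Cn 1))) CSkip)) CSkip)) ((7 + 2) * M)
        (\<lambda>\<sigma>. ?I (Suc i) (\<sigma>(3 := (\<sigma> 3)(0 := int (Suc i)))))"
      by (rule ht_use[OF inner]) (simp_all add: e)
  next
    fix \<sigma> assume "?I 0 \<sigma>"
    then show "okx (Vr 23) \<sigma> \<and> eval (Vr 23) \<sigma> = int k \<and> ?I 0 (\<sigma>(3 := (\<sigma> 3)(0 := 0)))"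
      by (simp add: stat_inv_def[of t \<sigma>] tabsD)
  qed (use k_le_M M1 kB B in simp_all)
  show ?thesis unfolding c_closed_def by (rule ht_use[OF ht_seq[OF a b]]) (auto simp: okE_bad)
qed

text \<open>A vertex outside the cover has all its neighbours in \<open>C\<close>, so the counts for
  the digits 0, 1 and 2 account for every neighbour; which of them vanish decides how the vertex is
  classified (\<open>stjad\<close>).\<close>

definition nbr_count :: "nat \<Rightarrow> nat \<Rightarrow> nat \<Rightarrow> nat" where
  "nbr_count t v d = cnum k (\<lambda>p. digit t p = d \<and> {v, cl p} \<in> E)"

lemma nbr_count_0: "nbr_count t v 0 = 0 \<longleftrightarrow> nbhd E v \<subseteq> Ls t \<union> Bs t" if v: "v \<in> I"
proof -
  have "0 < nbr_count t v 0 \<longleftrightarrow> \<not> nbhd E v \<subseteq> Ls t \<union> Bs t"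
    unfolding nbr_count_def cnum_pos
  proof
    assume "\<exists>p<k. digit t p = 0 \<and> {v, cl p} \<in> E"
    then obtain p where "p < k" "digit t p = 0" "{v, cl p} \<in> E" by blast
    then have "cl p \<in> nbhd E v" "cl p \<notin> Ls t \<union> Bs t" by (auto simp: nbhd_def insert_commute in_Ls in_Bs)
    then show "\<not> nbhd E v \<subseteq> Ls t \<union> Bs t" by blast
  next
    assume "\<not> nbhd E v \<subseteq> Ls t \<union> Bs t"
    then obtain y where y: "y \<in> nbhd E v" "y \<notin> Ls t \<union> Bs t" by blast
    then obtain p where p: "p < k" "y = cl p" using nbI[OF v] cl_C by blast
    then have "digit t p = 0" using y digit_cases[of t p] by (auto simp: in_Ls in_Bs)
    then show "\<exists>p<k. digit t p = 0 \<and> {v, cl p} \<in> E" using p y by (auto simp: nbhd_def insert_commute)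
  qed
  then show ?thesis by auto
qed

lemma nbr_count_1: "0 < nbr_count t v 1 \<longleftrightarrow> nbhd E v \<inter> Ls t \<noteq> {}"
  unfolding nbr_count_def cnum_pos by (auto simp: Ls_def nbhd_def insert_commute)

lemma nbr_count_2: "nbr_count t v 2 = card (nbhd E v)" if v: "v \<in> I" and s: "nbhd E v \<subseteq> Bs t"
proof -
  have "nbhd E v = cl ` {p. p < k \<and> digit t p = 2 \<and> {v, cl p} \<in> E}"
    using s by (auto simp: Bs_def nbhd_def insert_commute)
  moreover have "inj_on cl {p. p < k \<and> digit t p = 2 \<and> {v, cl p} \<in> E}"
    using cl_inj by (auto simp: inj_on_def)
  ultimately show ?thesis by (simp add: nbr_count_def cnum_def card_image)
qed

lemma nbr_count_Bs: "nbr_count t v 0 = 0 \<and> \<not> 0 < nbr_count t v 1 \<longleftrightarrow> nbhd E v \<subseteq> Bs t" if v: "v \<in> I"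
  unfolding nbr_count_0[OF v] nbr_count_1 using LB[of t] by blast

lemma nbr_count_le: "nbr_count t v d \<le> n" using cnum_le[of k "\<lambda>p. digit t p = d \<and> {v, cl p} \<in> E"] k_le_n by (simp add: nbr_count_def)

definition is_J :: "nat \<Rightarrow> nat \<Rightarrow> bool" where "is_J t v \<longleftrightarrow> v \<notin> C \<and> 0 < nbr_count t v 1 \<and> 0 < nbr_count t v 0"
definition is_D :: "nat \<Rightarrow> nat \<Rightarrow> bool" where "is_D t v \<longleftrightarrow> v \<notin> C \<and> 0 < nbr_count t v 1 \<and> nbr_count t v 0 = 0"
definition is_low :: "nat \<Rightarrow> nat \<Rightarrow> bool" where "is_low t v \<longleftrightarrow> v \<notin> C \<and> \<not> 0 < nbr_count t v 1 \<and> nbr_count t v 0 = 0"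

lemma stjad:
  assumes v: "v \<in> I"
  shows "is_J t v \<longleftrightarrow> v \<in> Jset E I (Ls t) (Bs t)" "is_D t v \<longleftrightarrow> v \<in> Dset E I (Ls t) (Bs t)"
    "is_low t v \<longleftrightarrow> nbhd E v \<subseteq> Bs t"
proof -
  have p: "0 < nbr_count t v 0 \<longleftrightarrow> \<not> nbhd E v \<subseteq> Ls t \<union> Bs t" using nbr_count_0[OF v, of t] by auto
  show "is_J t v \<longleftrightarrow> v \<in> Jset E I (Ls t) (Bs t)"
    unfolding is_J_def Jset_def p nbr_count_1 using v by blast
  show "is_D t v \<longleftrightarrow> v \<in> Dset E I (Ls t) (Bs t)"
    unfolding is_D_def Dset_def nbr_count_0[OF v] nbr_count_1 using v by blast
  show "is_low t v \<longleftrightarrow> nbhd E v \<subseteq> Bs t"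
    unfolding is_low_def using nbr_count_Bs[OF v, of t] v by blast
qed

lemma vj_cnum: "vj t = cnum n (is_J t)"
proof -
  have "v \<in> Jset E I (Ls t) (Bs t) \<longleftrightarrow> v < n \<and> is_J t v" for v
  proof (cases "v \<in> I")
    case True
    then show ?thesis using stjad(1)[of v t] by simp
  next
    case False
    then show ?thesis by (auto simp: Jset_def is_J_def)
  qed
  then have "Jset E I (Ls t) (Bs t) = {v. v < n \<and> is_J t v}" by blast
  then show ?thesis by (simp add: vj_def cnum_def)
qed

lemma va_cnum: "va t = cnum n (is_D t)"
proof -
  have "v \<in> Dset E I (Ls t) (Bs t) \<longleftrightarrow> v < n \<and> is_D t v" for v
  proof (cases "v \<in> I")
    case True
    then show ?thesis using stjad(2)[of v t] by simp
  next
    case False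
    then show ?thesis by (auto simp: Dset_def is_D_def)
  qed
  then have "Dset E I (Ls t) (Bs t) = {v. v < n \<and> is_D t v}" by blast
  then show ?thesis by (simp add: va_def cnum_def)
qed

text \<open>Fixes \<open>x\<close> as one more than the largest degree of a vertex with all its
  neighbours in the bag, or as some number \<open>\<le> 0\<close> if there is none; this avoids a
  maximum over a possibly empty set.\<close>

definition dmax :: "nat \<Rightarrow> nat \<Rightarrow> int \<Rightarrow> bool" where
  "dmax t i x \<longleftrightarrow> (\<forall>q. x \<le> int q \<longleftrightarrow> (\<forall>v<i. is_low t v \<longrightarrow> nbr_count t v 2 < q))"

lemma dmax_step:
  assumes "dmax t i x"
  shows "\<not> is_low t i \<Longrightarrow> dmax t (Suc i) x" "int (nbr_count t i 2) + 1 \<le> x \<Longrightarrow> dmax t (Suc i) x"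
    "is_low t i \<Longrightarrow> x < int (nbr_count t i 2) + 1 \<Longrightarrow> dmax t (Suc i) (int (nbr_count t i 2) + 1)"
proof -
  have e: "(\<forall>v<Suc i. is_low t v \<longrightarrow> nbr_count t v 2 < q) \<longleftrightarrow> (x \<le> int q) \<and> (is_low t i \<longrightarrow> nbr_count t i 2 < q)" for q
    using assms by (auto simp: less_Suc_eq dmax_def)
  show "\<not> is_low t i \<Longrightarrow> dmax t (Suc i) x" "int (nbr_count t i 2) + 1 \<le> x \<Longrightarrow> dmax t (Suc i) x"
    "is_low t i \<Longrightarrow> x < int (nbr_count t i 2) + 1 \<Longrightarrow> dmax t (Suc i) (int (nbr_count t i 2) + 1)"
    unfolding dmax_def e by auto
qed

lemma dmax_okD: "dmax t n x \<Longrightarrow> x \<le> int q \<longleftrightarrow> okD q t"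
proof -
  assume d: "dmax t n x"
  have "okD q t \<longleftrightarrow> (\<forall>v\<in>I. is_low t v \<longrightarrow> nbr_count t v 2 < q)"
    unfolding okD_def using nbr_count_2 stjad(3) by metis
  also have "\<dots> \<longleftrightarrow> (\<forall>v<n. is_low t v \<longrightarrow> nbr_count t v 2 < q)"
    by (auto simp: is_low_def)
  finally show ?thesis using d unfolding dmax_def by blast
qed

lemma vb_cnum: "vb t = cnum k (\<lambda>p. digit t p = 2)" and vl_cnum: "vl t = cnum k (\<lambda>p. digit t p = 1)"
proof -
  have "inj_on cl {p. p < k \<and> digit t p = d}" for d
    using cl_inj by (auto simp: inj_on_def)
  then show "vb t = cnum k (\<lambda>p. digit t p = 2)" "vl t = cnum k (\<lambda>p. digit t p = 1)"
    unfolding vb_def vl_def Bs_def Ls_def cnum_def by (simp_all only: card_image)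
qed

definition c_cnt :: com where
  "c_cnt = (CAsg 32 (Cn 0) (Cn 0) ;; CAsg 32 (Cn 1) (Cn 0) ;; CAsg 32 (Cn 2) (Cn 0)) ;;
     CFor 4 (Vr 23) (CAsg 32 (Ar 16 (Vr 4)) (Pl (Ar 32 (Ar 16 (Vr 4))) (Ar 7 (Pl (Ar 8 (Vr 3)) (Ar 24 (Vr 4))))))"

lemma c_cnt_ht:
  assumes v: "v < n"
  shows "ht Bd (\<lambda>\<sigma>. stat_inv t \<sigma> \<and> \<sigma> 3 0 = int v) c_cnt (3 + 3 * M) (\<lambda>\<sigma>. stat_inv t \<sigma> \<and> \<sigma> 3 0 = int v \<and> (\<forall>d<3. \<sigma> 32 d = int (nbr_count t v d)))"
proof -
  let ?I = "\<lambda>i \<sigma>. stat_inv t \<sigma> \<and> \<sigma> 3 0 = int v \<and> (\<forall>d<3. \<sigma> 32 d = int (cnum i (\<lambda>p. digit t p = d \<and> {v, cl p} \<in> E)))"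
  have a: "ht Bd (\<lambda>\<sigma>. stat_inv t \<sigma> \<and> \<sigma> 3 0 = int v) (CAsg 32 (Cn 0) (Cn 0) ;; CAsg 32 (Cn 1) (Cn 0) ;; CAsg 32 (Cn 2) (Cn 0)) 3 (?I 0)"
    apply (rule ht_pre)
      apply (rule wp)+
    subgoal for \<sigma> using B by (auto simp: less3)
    by simp
  have b: "ht Bd (?I 0) (CFor 4 (Vr 23) (CAsg 32 (Ar 16 (Vr 4)) (Pl (Ar 32 (Ar 16 (Vr 4))) (Ar 7 (Pl (Ar 8 (Vr 3)) (Ar 24 (Vr 4))))))) ((1 + 2) * M) (?I k)"
  proof (rule ht_for2[where Inv = ?I])
    fix i assume i: "i < k"
    have c: "int (cnum i (\<lambda>p. digit t p = digit t i \<and> {v, cl p} \<in> E)) + 1 \<le> Bd"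
      using cnum_le[of i "\<lambda>p. digit t p = digit t i \<and> {v, cl p} \<in> E"] i kB by linarith
    show "ht Bd (\<lambda>\<sigma>. ?I i \<sigma> \<and> \<sigma> 4 0 = int i) (CAsg 32 (Ar 16 (Vr 4)) (Pl (Ar 32 (Ar 16 (Vr 4))) (Ar 7 (Pl (Ar 8 (Vr 3)) (Ar 24 (Vr 4)))))) 1
      (\<lambda>\<sigma>. ?I (Suc i) (\<sigma>(4 := (\<sigma> 4)(0 := int (Suc i)))))"
      apply (rule ht_pre)
        apply (rule wp)+
      subgoal premises pr for \<sigma>
      proof -
        have tb: "tabs \<sigma>" and s: "\<sigma> 3 0 = int v" "\<sigma> 4 0 = int i" "\<sigma> 16 i = int (digit t i)" using pr i by (auto simp: stat_inv_def)
        note T = tabsD(6)[OF tb i] tabsD(7)[OF tb v] tabsD(8)[OF tb v i]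
        have s': "\<sigma> 32 (digit t i) = int (cnum i (\<lambda>p. digit t p = digit t i \<and> {v, cl p} \<in> E))"
          using pr digit_less[of t i] by auto
        show ?thesis using pr c digit_less[of t i] by (auto simp: s T s' adj_idx')
      qed
      by simp
  next
    fix \<sigma> assume "?I 0 \<sigma>"
    then show "okx (Vr 23) \<sigma> \<and> eval (Vr 23) \<sigma> = int k \<and> ?I 0 (\<sigma>(4 := (\<sigma> 4)(0 := 0)))"
      by (simp add: stat_inv_def[of t \<sigma>] tabsD)
  qed (use k_le_M M1 kB B in simp_all)
  show ?thesis unfolding c_cnt_def by (rule ht_use[OF ht_seq[OF a b]]) (auto simp: nbr_count_def)
qed

definition c_indep :: com where
  "c_indep = (CSet 35 (Cn 0) ;; CSet 36 (Cn 0) ;; CSet 37 (Cn 0)) ;; CFor 3 (Vr 2) (CIf (Ar 18 (Vr 3)) CSkip (c_cnt ;;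
     CIf (Ar 32 (Cn 1))
       (CIf (Ar 32 (Cn 0)) (CSet 35 (Pl (Vr 35) (Cn 1))) (CSet 36 (Pl (Vr 36) (Cn 1))))
       (CIf (Ar 32 (Cn 0)) CSkip
         (CIf (Mi (Pl (Ar 32 (Cn 2)) (Cn 1)) (Vr 37)) (CSet 37 (Pl (Ar 32 (Cn 2)) (Cn 1))) CSkip))))"

lemma c_indep_ht: "ht Bd (stat_inv t) c_indep (3 + (Suc (3 + 3 * M + 8) + 2) * M)
   (\<lambda>\<sigma>. stat_inv t \<sigma> \<and> \<sigma> 35 0 = int (vj t) \<and> \<sigma> 36 0 = int (va t) \<and> (\<forall>q. \<sigma> 37 0 \<le> int q \<longleftrightarrow> okD q t))"
proof -
  let ?I = "\<lambda>i \<sigma>. stat_inv t \<sigma> \<and> \<sigma> 35 0 = int (cnum i (is_J t)) \<and> \<sigma> 36 0 = int (cnum i (is_D t))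
     \<and> dmax t i (\<sigma> 37 0)"
  have a: "ht Bd (stat_inv t) (CSet 35 (Cn 0) ;; CSet 36 (Cn 0) ;; CSet 37 (Cn 0)) 3 (?I 0)"
    apply (rule ht_pre)
      apply (rule wp)+
    subgoal for \<sigma> using B by (simp add: dmax_def)
    by simp
  have b: "ht Bd (?I 0) (CFor 3 (Vr 2) (CIf (Ar 18 (Vr 3)) CSkip (c_cnt ;; CIf (Ar 32 (Cn 1))
       (CIf (Ar 32 (Cn 0)) (CSet 35 (Pl (Vr 35) (Cn 1))) (CSet 36 (Pl (Vr 36) (Cn 1))))
       (CIf (Ar 32 (Cn 0)) CSkip
         (CIf (Mi (Pl (Ar 32 (Cn 2)) (Cn 1)) (Vr 37)) (CSet 37 (Pl (Ar 32 (Cn 2)) (Cn 1))) CSkip)))))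
     ((Suc (3 + 3 * M + 8) + 2) * M) (?I n)"
  proof (rule ht_for2[where Inv = ?I])
    fix i assume i: "i < n"
    let ?R = "\<lambda>\<sigma>. ?I (Suc i) (\<sigma>(3 := (\<sigma> 3)(0 := int (Suc i))))"
    have c: "int (cnum i (is_J t)) + 1 \<le> Bd" "int (cnum i (is_D t)) + 1 \<le> Bd" "int (nbr_count t i 2) + 1 \<le> Bd"
      using cnum_le[of i "is_J t"] cnum_le[of i "is_D t"] nbr_count_le[of t i 2] i nB by linarith+
    have cnt: "ht Bd (\<lambda>\<sigma>. ?I i \<sigma> \<and> \<sigma> 3 0 = int i \<and> i \<notin> C) c_cnt (3 + 3 * M)
      (\<lambda>\<sigma>. ?I i \<sigma> \<and> \<sigma> 3 0 = int i \<and> i \<notin> C \<and> (\<forall>d<3. \<sigma> 32 d = int (nbr_count t i d)))"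
      by (rule ht_use[OF c_cnt_ht[OF i, of t]]) (auto simp: c_cnt_def)
    have fin: "ht Bd (\<lambda>\<sigma>. ?I i \<sigma> \<and> \<sigma> 3 0 = int i \<and> i \<notin> C \<and> (\<forall>d<3. \<sigma> 32 d = int (nbr_count t i d))) (CIf (Ar 32 (Cn 1))
       (CIf (Ar 32 (Cn 0)) (CSet 35 (Pl (Vr 35) (Cn 1))) (CSet 36 (Pl (Vr 36) (Cn 1))))
       (CIf (Ar 32 (Cn 0)) CSkip
         (CIf (Mi (Pl (Ar 32 (Cn 2)) (Cn 1)) (Vr 37)) (CSet 37 (Pl (Ar 32 (Cn 2)) (Cn 1))) CSkip))) 8 ?R"
      apply (rule ht_pre)
        apply (rule wp)+
      subgoal premises pr for \<sigma>
      proof -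
        have s: "\<sigma> 32 0 = int (nbr_count t i 0)" "\<sigma> 32 (Suc 0) = int (nbr_count t i (Suc 0))" "\<sigma> 32 2 = int (nbr_count t i 2)"
          "\<sigma> 35 0 = int (cnum i (is_J t))" "\<sigma> 36 0 = int (cnum i (is_D t))" "stat_inv t \<sigma>"
          and D: "dmax t i (\<sigma> 37 0)" and iC: "i \<notin> C"
          using pr by auto
        consider (J) "0 < nbr_count t i (Suc 0)" "0 < nbr_count t i 0" | (A) "0 < nbr_count t i (Suc 0)" "nbr_count t i 0 = 0"
          | (N) "nbr_count t i (Suc 0) = 0" "0 < nbr_count t i 0" | (D) "nbr_count t i (Suc 0) = 0" "nbr_count t i 0 = 0" by auto
        then show ?thesis
        proof cases
          case J
          then have "is_J t i" "\<not> is_D t i" "\<not> is_low t i" using iC by (auto simp: is_J_def is_D_def is_low_def)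
          then show ?thesis using J c dmax_step(1)[OF D] by (simp add: s)
        next
          case A
          then have "\<not> is_J t i" "is_D t i" "\<not> is_low t i" using iC by (auto simp: is_J_def is_D_def is_low_def)
          then show ?thesis using A c dmax_step(1)[OF D] by (simp add: s)
        next
          case N
          then have "\<not> is_J t i" "\<not> is_D t i" "\<not> is_low t i" using iC by (auto simp: is_J_def is_D_def is_low_def)
          then show ?thesis using N c dmax_step(1)[OF D] by (simp add: s)
        next
          case Dd: D
          then have n: "\<not> is_J t i" "\<not> is_D t i" "is_low t i" using iC by (auto simp: is_J_def is_D_def is_low_def)
          show ?thesis
          proof (cases "\<sigma> 37 0 < int (nbr_count t i 2) + 1")
            case True
            have "dmax t (Suc i) (int (nbr_count t i 2) + 1)" using dmax_step(3)[OF D] True n by simp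
            then show ?thesis using True Dd c n by (simp add: s)
          next
            case False
            have "dmax t (Suc i) (\<sigma> 37 0)" using dmax_step(2)[OF D] False by simp
            then show ?thesis using False Dd c n by (simp add: s)
          qed
        qed
      qed
      by simp
    have skip: "ht Bd ?R CSkip 0 ?R" by (rule ht_skip)
    show "ht Bd (\<lambda>\<sigma>. ?I i \<sigma> \<and> \<sigma> 3 0 = int i) (CIf (Ar 18 (Vr 3)) CSkip (c_cnt ;; CIf (Ar 32 (Cn 1))
       (CIf (Ar 32 (Cn 0)) (CSet 35 (Pl (Vr 35) (Cn 1))) (CSet 36 (Pl (Vr 36) (Cn 1))))
       (CIf (Ar 32 (Cn 0)) CSkip
         (CIf (Mi (Pl (Ar 32 (Cn 2)) (Cn 1)) (Vr 37)) (CSet 37 (Pl (Ar 32 (Cn 2)) (Cn 1))) CSkip)))) (Suc (3 + 3 * M + 8)) ?R"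
    proof (rule ht_pre[OF ht_if2[OF B skip ht_seq[OF cnt fin]]])
      fix \<sigma> assume pr: "?I i \<sigma> \<and> \<sigma> 3 0 = int i"
      have tb: "\<sigma> 18 i = of_bool (i \<in> C)" using pr tabsD(5)[of \<sigma> i] i by (auto simp: stat_inv_def)
      have e: "dmax t (Suc i) (\<sigma> 37 0)" if "i \<in> C"
        using that pr dmax_step(1)[of t i "\<sigma> 37 0"] by (simp add: is_low_def)
      have n: "\<not> is_J t i" "\<not> is_D t i" if "i \<in> C" using that by (auto simp: is_J_def is_D_def)
      show "okx (Ar 18 (Vr 3)) \<sigma> \<and> (if 0 < eval (Ar 18 (Vr 3)) \<sigma> then ?R \<sigma> else ?I i \<sigma> \<and> \<sigma> 3 0 = int i \<and> i \<notin> C)"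
        using pr tb e n by auto
    qed simp
  next
    fix \<sigma> assume "?I 0 \<sigma>"
    then show "okx (Vr 2) \<sigma> \<and> eval (Vr 2) \<sigma> = int n \<and> ?I 0 (\<sigma>(3 := (\<sigma> 3)(0 := 0)))"
      by (simp add: stat_inv_def[of t \<sigma>] tabsD)
  qed (use nM M1 nB B in \<open>simp_all add: c_cnt_def\<close>)
  show ?thesis unfolding c_indep_def by (rule ht_use[OF ht_seq[OF a b]]) (auto simp: vj_cnum va_cnum dmax_okD)
qed

definition c_store :: com where
  "c_store = CAsg 38 (Vr 31) (Ar 33 (Cn 2)) ;; CAsg 39 (Vr 31) (Ar 33 (Cn 1)) ;; CAsg 40 (Vr 31) (Vr 35) ;;
     CAsg 41 (Vr 31) (Vr 36) ;; CAsg 42 (Vr 31) (Vr 37) ;; CAsg 43 (Vr 31) (Vr 34) ;;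
     CAsg 45 (Vr 31) (Ar 55 (Mi (Pl (Vr 2) (Vr 2)) (Ar 33 (Cn 1)))) ;;
     CAsg 44 (Vr 31) (Ar 26 (Pl (Ar 55 (Mi (Vr 2) (Ar 33 (Cn 1)))) (Vr 36)))"

definition c_stat :: com where
  "c_stat = CFor 31 (Vr 53) (dec 31 23 ;; c_sizes ;; c_closed ;; c_indep ;; c_store)"

lemma vl_le: "vl t \<le> k" using card_LB[of t] by simp

lemma ee_less: "ee t < M * M"
proof -
  have "va t \<le> n" using card_VBAJ[of t] by simp
  then have "ee t \<le> n * M + n" unfolding ee_def mmM by (intro add_mono mult_le_mono1) auto
  also have "\<dots> < Suc n * M" by (simp add: M_def)
  also have "\<dots> \<le> M * M" by (intro mult_le_mono1) (simp add: M_def)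
  finally show ?thesis .
qed

lemma XX_Bd: "e < M * M \<Longrightarrow> XX ^ e \<le> Bd" "0 \<le> XX ^ e"
proof -
  assume "e < M * M"
  then have "M * e \<le> M * (M * M)" by (intro mult_le_mono2) simp
  moreover have "M ^ 3 = M * (M * M)" by (simp add: power3_eq_cube)
  ultimately have "M * e \<le> 2 * M ^ 3 + 16" by linarith
  then show "XX ^ e \<le> Bd" unfolding XXM by (rule pow2_Bd)
qed (simp add: XXM)

definition stQ :: "nat \<Rightarrow> store \<Rightarrow> bool" where
  "stQ t \<sigma> \<longleftrightarrow> (\<forall>d<3. \<sigma> 33 d = int (cnum k (\<lambda>p. digit t p = d))) \<and> \<sigma> 34 0 = of_bool (\<not> okE t) \<and>
     \<sigma> 35 0 = int (vj t) \<and> \<sigma> 36 0 = int (va t) \<and> (\<forall>q. \<sigma> 37 0 \<le> int q \<longleftrightarrow> okD q t)"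

text \<open>Writing at index \<open>t\<close> cannot hurt the invariant, which speaks of the tables
  only below \<open>t\<close>.\<close>

lemma store_ht:
  assumes a: "a \<in> {38, 39, 40, 41, 42, 43, 44, 45}"
    and pre: "\<And>\<sigma>. P \<sigma> \<Longrightarrow> bnd Bd \<sigma> \<Longrightarrow> stat_inv t \<sigma> \<and> stQ t \<sigma> \<and> okx e \<sigma> \<and> \<bar>eval e \<sigma>\<bar> \<le> Bd \<and> R (eval e \<sigma>)"
  shows "ht Bd P (CAsg a (Vr 31) e) 1 (\<lambda>\<sigma>. stat_inv t \<sigma> \<and> stQ t \<sigma> \<and> R (\<sigma> a t))"
proof (rule ht_pre[OF ht_asg[OF B]])
  fix \<sigma> assume "P \<sigma>" "bnd Bd \<sigma>"
  from pre[OF this] have p: "stat_inv t \<sigma>" "stQ t \<sigma>" "okx e \<sigma>" "\<bar>eval e \<sigma>\<bar> \<le> Bd" "R (eval e \<sigma>)" by auto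
  let ?\<sigma> = "\<sigma>(a := (\<sigma> a)(t := eval e \<sigma>))"
  have s: "\<sigma> 31 0 = int t" using p by (simp add: stat_inv_def)
  have "st_ok ?\<sigma> t'" if "t' < t" for t'
  proof -
    have e: "?\<sigma> b t' = \<sigma> b t'" for b using that by simp
    have st: "st_ok \<sigma> t'" using p that by (simp add: stat_inv_def)
    show ?thesis using st unfolding st_ok_def e .
  qed
  moreover have "tabs ?\<sigma>" "?\<sigma> 31 = \<sigma> 31" "?\<sigma> 16 = \<sigma> 16" using p a by (auto simp: stat_inv_def)
  ultimately have "stat_inv t ?\<sigma>" using p by (simp add: stat_inv_def)
  moreover have "stQ t ?\<sigma>" using p a by (auto simp: stQ_def)
  ultimately show "okx (Vr 31) \<sigma> \<and> 0 \<le> eval (Vr 31) \<sigma> \<and> okx e \<sigma> \<and> \<bar>eval e \<sigma>\<bar> \<le> Bd \<and>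
    (\<lambda>\<sigma>. stat_inv t \<sigma> \<and> stQ t \<sigma> \<and> R (\<sigma> a t)) (\<sigma>(a := (\<sigma> a)(nat (eval (Vr 31) \<sigma>) := eval e \<sigma>)))"
    using p s by simp
qed simp

lemma c_store_ht: "ht Bd (\<lambda>\<sigma>. stat_inv t \<sigma> \<and> stQ t \<sigma>) c_store 8 (\<lambda>\<sigma>. stat_inv t \<sigma> \<and> st_ok \<sigma> t)"
proof -
  let ?P = "\<lambda>\<sigma>. stat_inv t \<sigma> \<and> stQ t \<sigma>"
  let ?R1 = "\<lambda>\<sigma>. \<sigma> 38 t = int (vb t)"
  let ?R2 = "\<lambda>\<sigma>. \<sigma> 39 t = int (vl t)"
  let ?R3 = "\<lambda>\<sigma>. \<sigma> 40 t = int (vj t)"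
  let ?R4 = "\<lambda>\<sigma>. \<sigma> 41 t = int (va t)"
  let ?R5 = "\<lambda>\<sigma>. \<forall>q. \<sigma> 42 t \<le> int q \<longleftrightarrow> okD q t"
  let ?R6 = "\<lambda>\<sigma>. 0 < \<sigma> 43 t \<longleftrightarrow> \<not> okE t"
  let ?R7 = "\<lambda>\<sigma>. \<sigma> 45 t = int ((2 * n - vl t) * M)"
  have q: "\<sigma> 33 2 = int (vb t)" "\<sigma> 33 (Suc 0) = int (vl t)" "\<sigma> 36 0 = int (va t)" if "stQ t \<sigma>" for \<sigma>
    using that by (auto simp: stQ_def vb_cnum vl_cnum)
  have bd: "int (vb t) \<le> Bd" "int (vl t) \<le> Bd" "int (vj t) \<le> Bd" "int (va t) \<le> Bd"
    using card_VBAJ[of t] vl_le[of t] k_le_n nB by linarith+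
  have le: "vl t \<le> n" using vl_le[of t] k_le_n by simp
  have ixs: "nat (2 * int n - int (vl t)) = 2 * n - vl t" by auto
  have r1: "\<sigma> 55 (2 * n - vl t) = int ((2 * n - vl t) * M)" "\<sigma> 55 (n - vl t) = int ((n - vl t) * M)" if "stat_inv t \<sigma>" for \<sigma>
    using that tabsD(10)[of \<sigma>] by (simp_all add: M_def stat_inv_def)
  have i2: "nat (int ((n - vl t) * M) + int (va t)) = ee t" by (simp only: ee_def mmM nat_int_add)
  have r2: "\<sigma> 26 (ee t) = XX ^ ee t" if "stat_inv t \<sigma>" for \<sigma> using that tabsD(9)[OF _ ee_less] by (simp add: stat_inv_def)
  have rn: "\<sigma> 2 0 = int n" if "stat_inv t \<sigma>" for \<sigma> using that tabsD(1) by (simp add: stat_inv_def)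
  have "(2 * n - vl t) * M \<le> M * M" by (intro mult_le_mono1) (simp add: M_def)
  then have "(2 * n - vl t) * M \<le> 2 * M ^ 3 + 16" using M3(2) by linarith
  then have bm: "int ((2 * n - vl t) * M) \<le> Bd" by (rule small)
  then have bm': "\<bar>int ((2 * n - vl t) * M)\<bar> \<le> Bd" by (simp only: abs_of_nat)
  have bx: "\<bar>XX ^ ee t\<bar> \<le> Bd" "XX ^ ee t \<le> Bd"
    using XX_Bd(1)[OF ee_less, of t] XX_Bd(2)[of "ee t"] by linarith+
  have ev1: "okx (Ar 33 (Cn 2)) \<sigma> \<and> \<bar>eval (Ar 33 (Cn 2)) \<sigma>\<bar> \<le> Bd \<and> eval (Ar 33 (Cn 2)) \<sigma> = int (vb t)" if "?P \<sigma>" for \<sigma>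
  proof -
    have "eval (Ar 33 (Cn 2)) \<sigma> = int (vb t)" using that q[of \<sigma>] by (simp add: stQ_def)
    then show ?thesis using bd by simp
  qed
  have ev2: "okx (Ar 33 (Cn 1)) \<sigma> \<and> \<bar>eval (Ar 33 (Cn 1)) \<sigma>\<bar> \<le> Bd \<and> eval (Ar 33 (Cn 1)) \<sigma> = int (vl t)" if "?P \<sigma>" for \<sigma>
  proof -
    have "eval (Ar 33 (Cn 1)) \<sigma> = int (vl t)" using that q[of \<sigma>] by (simp add: stQ_def)
    then show ?thesis using bd by simp
  qed
  have ev3: "okx (Vr 35) \<sigma> \<and> \<bar>eval (Vr 35) \<sigma>\<bar> \<le> Bd \<and> eval (Vr 35) \<sigma> = int (vj t)" if "?P \<sigma>" for \<sigma>
  proof -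
    have "eval (Vr 35) \<sigma> = int (vj t)" using that q[of \<sigma>] by (simp add: stQ_def)
    then show ?thesis using bd by simp
  qed
  have ev4: "okx (Vr 36) \<sigma> \<and> \<bar>eval (Vr 36) \<sigma>\<bar> \<le> Bd \<and> eval (Vr 36) \<sigma> = int (va t)" if "?P \<sigma>" for \<sigma>
  proof -
    have "eval (Vr 36) \<sigma> = int (va t)" using that q[of \<sigma>] by (simp add: stQ_def)
    then show ?thesis using bd by simp
  qed
  have 1: "ht Bd ?P (CAsg 38 (Vr 31) (Ar 33 (Cn 2))) 1 (\<lambda>\<sigma>. ?P \<sigma> \<and> ?R1 \<sigma>)"
    by (rule ht_use[OF store_ht[where P = ?P and R = "\<lambda>x. x = int (vb t)"]]) (use ev1 bd in \<open>auto simp del: eval.simps okx.simps\<close>)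
  have 2: "ht Bd (\<lambda>\<sigma>. ?P \<sigma> \<and> ?R1 \<sigma>) (CAsg 39 (Vr 31) (Ar 33 (Cn 1))) 1 (\<lambda>\<sigma>. ?P \<sigma> \<and> ?R1 \<sigma> \<and> ?R2 \<sigma>)"
    by (rule ht_use[OF store_ht[where P = ?P and R = "\<lambda>x. x = int (vl t)"]]) (use ev2 bd in \<open>auto simp del: eval.simps okx.simps\<close>)
  have 3: "ht Bd (\<lambda>\<sigma>. ?P \<sigma> \<and> ?R1 \<sigma> \<and> ?R2 \<sigma>) (CAsg 40 (Vr 31) (Vr 35)) 1 (\<lambda>\<sigma>. ?P \<sigma> \<and> ?R1 \<sigma> \<and> ?R2 \<sigma> \<and> ?R3 \<sigma>)"
    by (rule ht_use[OF store_ht[where P = ?P and R = "\<lambda>x. x = int (vj t)"]]) (use ev3 bd in \<open>auto simp del: eval.simps okx.simps\<close>)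
  have 4: "ht Bd (\<lambda>\<sigma>. ?P \<sigma> \<and> ?R1 \<sigma> \<and> ?R2 \<sigma> \<and> ?R3 \<sigma>) (CAsg 41 (Vr 31) (Vr 36)) 1 (\<lambda>\<sigma>. ?P \<sigma> \<and> ?R1 \<sigma> \<and> ?R2 \<sigma> \<and> ?R3 \<sigma> \<and> ?R4 \<sigma>)"
    by (rule ht_use[OF store_ht[where P = ?P and R = "\<lambda>x. x = int (va t)"]]) (use ev4 bd in \<open>auto simp del: eval.simps okx.simps\<close>)
  have 5: "ht Bd (\<lambda>\<sigma>. ?P \<sigma> \<and> ?R1 \<sigma> \<and> ?R2 \<sigma> \<and> ?R3 \<sigma> \<and> ?R4 \<sigma>) (CAsg 42 (Vr 31) (Vr 37)) 1
    (\<lambda>\<sigma>. ?P \<sigma> \<and> ?R1 \<sigma> \<and> ?R2 \<sigma> \<and> ?R3 \<sigma> \<and> ?R4 \<sigma> \<and> ?R5 \<sigma>)"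
    by (rule ht_use[OF store_ht[where P = ?P and R = "\<lambda>x. \<forall>q. x \<le> int q \<longleftrightarrow> okD q t"]])
      (auto simp: stQ_def bnd_def)
  have 6: "ht Bd (\<lambda>\<sigma>. ?P \<sigma> \<and> ?R1 \<sigma> \<and> ?R2 \<sigma> \<and> ?R3 \<sigma> \<and> ?R4 \<sigma> \<and> ?R5 \<sigma>) (CAsg 43 (Vr 31) (Vr 34)) 1
    (\<lambda>\<sigma>. ?P \<sigma> \<and> ?R1 \<sigma> \<and> ?R2 \<sigma> \<and> ?R3 \<sigma> \<and> ?R4 \<sigma> \<and> ?R5 \<sigma> \<and> ?R6 \<sigma>)"
    by (rule ht_use[OF store_ht[where P = ?P and R = "\<lambda>x. 0 < x \<longleftrightarrow> \<not> okE t"]])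
      (use B in \<open>auto simp: stQ_def\<close>)
  have e7: "okx (Ar 55 (Mi (Pl (Vr 2) (Vr 2)) (Ar 33 (Cn 1)))) \<sigma>
      \<and> eval (Ar 55 (Mi (Pl (Vr 2) (Vr 2)) (Ar 33 (Cn 1)))) \<sigma> = int ((2 * n - vl t) * M)" if "?P \<sigma>" for \<sigma>
    using that rn[of \<sigma>] q[of \<sigma>] r1(1)[of \<sigma>] le by (simp add: ixs)
  have 7: "ht Bd (\<lambda>\<sigma>. ?P \<sigma> \<and> ?R1 \<sigma> \<and> ?R2 \<sigma> \<and> ?R3 \<sigma> \<and> ?R4 \<sigma> \<and> ?R5 \<sigma> \<and> ?R6 \<sigma>)
    (CAsg 45 (Vr 31) (Ar 55 (Mi (Pl (Vr 2) (Vr 2)) (Ar 33 (Cn 1))))) 1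
    (\<lambda>\<sigma>. ?P \<sigma> \<and> ?R1 \<sigma> \<and> ?R2 \<sigma> \<and> ?R3 \<sigma> \<and> ?R4 \<sigma> \<and> ?R5 \<sigma> \<and> ?R6 \<sigma> \<and> ?R7 \<sigma>)"
    by (rule ht_use[OF store_ht[where P = ?P and R = "\<lambda>x. x = int ((2 * n - vl t) * M)"]])
      (use bm bm' e7 in \<open>auto simp del: eval.simps okx.simps of_nat_mult\<close>)
  have e8: "okx (Ar 26 (Pl (Ar 55 (Mi (Vr 2) (Ar 33 (Cn 1)))) (Vr 36))) \<sigma>
      \<and> eval (Ar 26 (Pl (Ar 55 (Mi (Vr 2) (Ar 33 (Cn 1)))) (Vr 36))) \<sigma> = XX ^ ee t" if "?P \<sigma>" for \<sigma>
    using that rn[of \<sigma>] q[of \<sigma>] r1(2)[of \<sigma>] r2[of \<sigma>] le by (simp add: i2 del: of_nat_mult)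
  have 8: "ht Bd (\<lambda>\<sigma>. ?P \<sigma> \<and> ?R1 \<sigma> \<and> ?R2 \<sigma> \<and> ?R3 \<sigma> \<and> ?R4 \<sigma> \<and> ?R5 \<sigma> \<and> ?R6 \<sigma> \<and> ?R7 \<sigma>)
    (CAsg 44 (Vr 31) (Ar 26 (Pl (Ar 55 (Mi (Vr 2) (Ar 33 (Cn 1)))) (Vr 36)))) 1 (\<lambda>\<sigma>. stat_inv t \<sigma> \<and> st_ok \<sigma> t)"
    by (rule ht_use[OF store_ht[where P = ?P and R = "\<lambda>x. x = XX ^ ee t"]])
      (use bx e8 in \<open>auto simp: st_ok_def simp del: eval.simps okx.simps\<close>)
  show ?thesis
    unfolding c_store_def
    by (rule ht_use[OF ht_seq[OF 1 ht_seq[OF 2 ht_seq[OF 3 ht_seq[OF 4 ht_seq[OF 5 ht_seq[OF 6 ht_seq[OF 7 8]]]]]]]]) auto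
qed

definition T_stat :: "nat \<Rightarrow> nat" where
  "T_stat m = 10 * m + 1 + ((3 + 3 * m) + ((1 + ((7 + 2) * m + 2) * m) + ((3 + (Suc (3 + 3 * m + 8) + 2) * m) + 8)))"

lemma c_stat_ht: "ht Bd tabs c_stat ((T_stat M + 2) * K0) (\<lambda>\<sigma>. tabs \<sigma> \<and> (\<forall>t<3 ^ k. st_ok \<sigma> t))"
  unfolding c_stat_def
proof (rule ht_for2[OF _ _ pow3_k(2) K0_1 K3B])
  fix t :: nat assume t: "t < 3 ^ k"
  let ?P = "\<lambda>\<sigma>. (tabs \<sigma> \<and> (\<forall>t'<t. st_ok \<sigma> t')) \<and> \<sigma> 31 0 = int t"
  let ?Q1 = "\<lambda>\<sigma>. \<forall>d<3. \<sigma> 33 d = int (cnum k (\<lambda>p. digit t p = d))"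
  let ?Q2 = "\<lambda>\<sigma>. \<sigma> 34 0 = of_bool (\<not> okE t)"
  let ?Q3 = "\<lambda>\<sigma>. \<sigma> 35 0 = int (vj t) \<and> \<sigma> 36 0 = int (va t) \<and> (\<forall>q. \<sigma> 37 0 \<le> int q \<longleftrightarrow> okD q t)"
  have 1: "ht Bd ?P (dec 31 23) (10 * M + 1) (stat_inv t)"
  proof (rule ht_use[OF dec_ht[OF B pow3_Bd[OF order_refl] k_le_n nM(1) M1 nB(1) t]])
    fix \<sigma> \<sigma>' assume a: "?P \<sigma>" "\<forall>p<k. \<sigma>' 16 p = int (digit t p)" "\<And>a. a \<notin> mods (dec 31 23) \<Longrightarrow> \<sigma>' a = \<sigma> a"
    have "tabs \<sigma>'" using a by (auto intro: tabs_cong)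
    then show "stat_inv t \<sigma>'" using a by (simp add: stat_inv_def st_ok_def)
  qed (auto simp: tabsD)
  have 2: "ht Bd (stat_inv t) c_sizes (3 + 3 * M) (\<lambda>\<sigma>. stat_inv t \<sigma> \<and> ?Q1 \<sigma>)" by (rule c_sizes_ht)
  have 3: "ht Bd (\<lambda>\<sigma>. stat_inv t \<sigma> \<and> ?Q1 \<sigma>) c_closed (1 + ((7 + 2) * M + 2) * M) (\<lambda>\<sigma>. stat_inv t \<sigma> \<and> ?Q1 \<sigma> \<and> ?Q2 \<sigma>)"
    by (rule ht_use[OF c_closed_ht[of t]]) (auto simp: c_closed_def)
  have 4: "ht Bd (\<lambda>\<sigma>. stat_inv t \<sigma> \<and> ?Q1 \<sigma> \<and> ?Q2 \<sigma>) c_indep (3 + (Suc (3 + 3 * M + 8) + 2) * M) (\<lambda>\<sigma>. stat_inv t \<sigma> \<and> ?Q1 \<sigma> \<and> ?Q2 \<sigma> \<and> ?Q3 \<sigma>)"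
    by (rule ht_use[OF c_indep_ht[of t]]) (auto simp: c_indep_def c_cnt_def)
  have 5: "ht Bd (\<lambda>\<sigma>. stat_inv t \<sigma> \<and> ?Q1 \<sigma> \<and> ?Q2 \<sigma> \<and> ?Q3 \<sigma>) c_store 8
    (\<lambda>\<sigma>. tabs (\<sigma>(31 := (\<sigma> 31)(0 := int (Suc t)))) \<and> (\<forall>t'<Suc t. st_ok (\<sigma>(31 := (\<sigma> 31)(0 := int (Suc t)))) t'))"
  proof (rule ht_use[OF c_store_ht[of t]])
    fix \<sigma> assume pr: "stat_inv t \<sigma> \<and> st_ok \<sigma> t"
    then have "st_ok \<sigma> t'" if "t' < Suc t" for t' using that by (auto simp: stat_inv_def less_Suc_eq)
    then show "tabs (\<sigma>(31 := (\<sigma> 31)(0 := int (Suc t)))) \<and> (\<forall>t'<Suc t. st_ok (\<sigma>(31 := (\<sigma> 31)(0 := int (Suc t)))) t')"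
      using pr by (simp add: stat_inv_def st_ok_def)
  qed (auto simp: stQ_def)
  show "ht Bd (\<lambda>\<sigma>. (tabs \<sigma> \<and> (\<forall>t'<t. st_ok \<sigma> t')) \<and> \<sigma> 31 0 = int t) (dec 31 23 ;; c_sizes ;; c_closed ;; c_indep ;; c_store) (T_stat M)
    (\<lambda>\<sigma>. tabs (\<sigma>(31 := (\<sigma> 31)(0 := int (Suc t)))) \<and> (\<forall>t'<Suc t. st_ok (\<sigma>(31 := (\<sigma> 31)(0 := int (Suc t)))) t'))"
    using ht_seq[OF 1 ht_seq[OF 2 ht_seq[OF 3 ht_seq[OF 4 5]]]] unfolding T_stat_def .
next
  fix \<sigma> assume "tabs \<sigma>"
  then show "okx (Vr 53) \<sigma> \<and> eval (Vr 53) \<sigma> = int (3 ^ k) \<and> tabs (\<sigma>(31 := (\<sigma> 31)(0 := 0))) \<and>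
    (\<forall>t<0. st_ok (\<sigma>(31 := (\<sigma> 31)(0 := 0))) t)" by (simp add: tabsD)
qed (use B in \<open>simp_all add: c_sizes_def c_closed_def c_indep_def c_cnt_def c_store_def\<close>)

definition stats :: "store \<Rightarrow> bool" where "stats \<sigma> \<longleftrightarrow> tabs \<sigma> \<and> (\<forall>t<3 ^ k. st_ok \<sigma> t)"

abbreviation "stats_names \<equiv> {2, 7, 8, 9, 18, 23, 24, 26, 27, 53, 54, 55, 56, 38, 39, 40, 41, 42, 43, 44, 45}"

lemma stats_upd [simp]:
  "a \<notin> stats_names \<Longrightarrow> stats (\<sigma>(a := f)) \<longleftrightarrow> stats \<sigma>"
  "a \<notin> stats_names \<Longrightarrow> stats (\<lambda>x. if x = a then f else \<sigma> x) \<longleftrightarrow> stats \<sigma>"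
  by (simp_all add: stats_def st_ok_def)

lemma stats_cong:
  assumes "stats \<sigma>" "\<And>a. a \<in> stats_names \<Longrightarrow> \<sigma>' a = \<sigma> a"
  shows "stats \<sigma>'"
proof -
  have "tabs \<sigma>'" using assms by (auto simp: stats_def intro: tabs_cong)
  then show ?thesis using assms by (simp add: stats_def st_ok_def)
qed

lemma stats_tabs: "stats \<sigma> \<Longrightarrow> tabs \<sigma>" by (simp add: stats_def)

lemma SSD:
  assumes "stats \<sigma>" "t < 3 ^ k"
  shows "\<sigma> 38 t = int (vb t)" "\<sigma> 39 t = int (vl t)" "\<sigma> 40 t = int (vj t)" "\<sigma> 41 t = int (va t)"
    "\<sigma> 42 t \<le> int q \<longleftrightarrow> okD q t" "0 < \<sigma> 43 t \<longleftrightarrow> \<not> okE t" "\<sigma> 44 t = XX ^ ee t"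
    "\<sigma> 45 t = int ((2 * n - vl t) * M)"
proof -
  have "st_ok \<sigma> t" using assms by (simp add: stats_def)
  then show "\<sigma> 38 t = int (vb t)" "\<sigma> 39 t = int (vl t)" "\<sigma> 40 t = int (vj t)" "\<sigma> 41 t = int (va t)"
    "\<sigma> 42 t \<le> int q \<longleftrightarrow> okD q t" "0 < \<sigma> 43 t \<longleftrightarrow> \<not> okE t" "\<sigma> 44 t = XX ^ ee t"
    "\<sigma> 45 t = int ((2 * n - vl t) * M)"
    unfolding st_ok_def by blast+
qed

lemma dec_SS:
  assumes t: "t < 3 ^ k" and P: "\<And>\<sigma>. P \<sigma> \<Longrightarrow> stats \<sigma> \<and> \<sigma> 31 0 = int t"
    and cong: "\<And>\<sigma> \<sigma>'. P \<sigma> \<Longrightarrow> (\<And>a. a \<notin> {14, 15, 16, 17} \<Longrightarrow> \<sigma>' a = \<sigma> a) \<Longrightarrow> P \<sigma>'"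
  shows "ht Bd P (dec 31 23) (10 * M + 1) (\<lambda>\<sigma>. P \<sigma> \<and> (\<forall>p<k. \<sigma> 16 p = int (digit t p)))"
proof (rule ht_use[OF dec_ht[OF B pow3_Bd[OF order_refl] k_le_n nM(1) M1 nB(1) t]])
  fix \<sigma> \<sigma>' assume a: "P \<sigma>" "\<forall>p<k. \<sigma>' 16 p = int (digit t p)" "\<And>a. a \<notin> mods (dec 31 23) \<Longrightarrow> \<sigma>' a = \<sigma> a"
  have "P \<sigma>'" by (rule cong[OF a(1)], rule a(3)) simp
  then show "P \<sigma>' \<and> (\<forall>p<k. \<sigma>' 16 p = int (digit t p))" using a by blast
next
  fix \<sigma> assume "P \<sigma>"
  then have "tabs \<sigma>" "\<sigma> 31 0 = int t" using P[of \<sigma>] stats_tabs by simp_all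
  then show "\<sigma> 31 0 = int t \<and> \<sigma> 23 0 = int k \<and> pow3 n \<sigma>" using tabsD(2,4)[of \<sigma>] by simp
qed simp_all

section \<open>Zeta transform, squaring and inverse transform in place\<close>

definition z_is :: "(nat \<Rightarrow> int) \<Rightarrow> store \<Rightarrow> bool" where "z_is f \<sigma> \<longleftrightarrow> (\<forall>t<3 ^ k. \<sigma> 47 t = f t)"

text \<open>The contents of an array in the middle of an in-place pass: new below \<open>t\<close>,
  old from \<open>t\<close> on.\<close>

definition zpart :: "nat \<Rightarrow> (nat \<Rightarrow> int) \<Rightarrow> (nat \<Rightarrow> int) \<Rightarrow> nat \<Rightarrow> int" where
  "zpart t f g u = (if u < t then g u else f u)"

lemma z_is_upd [simp]:
  "a \<noteq> 47 \<Longrightarrow> z_is f (\<sigma>(a := v)) \<longleftrightarrow> z_is f \<sigma>"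
  "a \<noteq> 47 \<Longrightarrow> z_is f (\<lambda>x. if x = a then v else \<sigma> x) \<longleftrightarrow> z_is f \<sigma>"
  by (simp_all add: z_is_def)

lemma z_is_cong: "z_is f \<sigma> \<Longrightarrow> \<sigma>' 47 = \<sigma> 47 \<Longrightarrow> z_is f \<sigma>'" by (simp add: z_is_def)

lemma zpart_0: "zpart 0 f g = f" by (simp add: zpart_def fun_eq_iff)

lemma z_is_zpart_end: "z_is (zpart (3 ^ k) f g) \<sigma> \<Longrightarrow> z_is g \<sigma>" by (simp add: z_is_def zpart_def)

lemma z_is_zpart_Suc: "z_is (zpart t f g) \<sigma> \<Longrightarrow> v = g t \<Longrightarrow> z_is (zpart (Suc t) f g) (\<sigma>(47 := (\<sigma> 47)(t := v)))"
  by (auto simp: z_is_def zpart_def less_Suc_eq)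

lemma z_is_zpart_Suc': "z_is (zpart t f g) \<sigma> \<Longrightarrow> f t = g t \<Longrightarrow> z_is (zpart (Suc t) f g) \<sigma>"
  by (auto simp: z_is_def zpart_def less_Suc_eq)

lemma z_is_at: "z_is (zpart t f g) \<sigma> \<Longrightarrow> u < 3 ^ k \<Longrightarrow> \<sigma> 47 u = (if u < t then g u else f u)"
  by (simp add: z_is_def zpart_def)

lemma over_codes:
  assumes body: "\<And>t. t < 3 ^ k \<Longrightarrow> ht Bd (\<lambda>\<sigma>. (stats \<sigma> \<and> F \<sigma> \<and> z_is (zpart t f g) \<sigma>) \<and> \<sigma> 31 0 = int t) c T
      (\<lambda>\<sigma>. stats \<sigma> \<and> F \<sigma> \<and> z_is (zpart (Suc t) f g) \<sigma>)"
    and F: "\<And>\<sigma> v. F \<sigma> \<Longrightarrow> F (\<sigma>(31 := v))" and m: "31 \<notin> mods c"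
  shows "ht Bd (\<lambda>\<sigma>. stats \<sigma> \<and> F \<sigma> \<and> z_is f \<sigma>) (CFor 31 (Vr 53) c) ((T + 2) * K0) (\<lambda>\<sigma>. stats \<sigma> \<and> F \<sigma> \<and> z_is g \<sigma>)"
proof (rule ht_use[OF ht_for2[where P = "\<lambda>\<sigma>. stats \<sigma> \<and> F \<sigma> \<and> z_is f \<sigma>" and e = "Vr 53" and x = 31 and
      Inv = "\<lambda>t \<sigma>. stats \<sigma> \<and> F \<sigma> \<and> z_is (zpart t f g) \<sigma>", OF _ _ pow3_k(2) K0_1 K3B m B]])
  fix t :: nat assume t: "t < 3 ^ k"
  show "ht Bd (\<lambda>\<sigma>. (stats \<sigma> \<and> F \<sigma> \<and> z_is (zpart t f g) \<sigma>) \<and> \<sigma> 31 0 = int t) c T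
    (\<lambda>\<sigma>. stats (\<sigma>(31 := (\<sigma> 31)(0 := int (Suc t)))) \<and> F (\<sigma>(31 := (\<sigma> 31)(0 := int (Suc t)))) \<and>
      z_is (zpart (Suc t) f g) (\<sigma>(31 := (\<sigma> 31)(0 := int (Suc t)))))"
    by (rule ht_use[OF body[OF t]]) (auto simp: F)
next
  fix \<sigma> assume a: "stats \<sigma> \<and> F \<sigma> \<and> z_is f \<sigma>"
  then have "\<sigma> 53 0 = 3 ^ k" using tabsD(3) stats_tabs by blast
  then show "okx (Vr 53) \<sigma> \<and> eval (Vr 53) \<sigma> = int (3 ^ k) \<and> stats (\<sigma>(31 := (\<sigma> 31)(0 := 0))) \<and>
    F (\<sigma>(31 := (\<sigma> 31)(0 := 0))) \<and> z_is (zpart 0 f g) (\<sigma>(31 := (\<sigma> 31)(0 := 0)))"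
    using a F by (simp add: zpart_0)
qed (auto intro: z_is_zpart_end)

definition g_is :: "nat set \<Rightarrow> store \<Rightarrow> bool" where "g_is G \<sigma> \<longleftrightarrow> (\<forall>t<3 ^ k. \<sigma> 46 t = of_bool (t \<in> G))"

lemma g_is_upd [simp]:
  "a \<noteq> 46 \<Longrightarrow> g_is f (\<sigma>(a := v)) \<longleftrightarrow> g_is f \<sigma>"
  "a \<noteq> 46 \<Longrightarrow> g_is f (\<lambda>x. if x = a then v else \<sigma> x) \<longleftrightarrow> g_is f \<sigma>"
  by (simp_all add: g_is_def)

definition round_inv :: "nat set \<Rightarrow> nat \<Rightarrow> store \<Rightarrow> bool" where "round_inv G q \<sigma> \<longleftrightarrow> g_is G \<sigma> \<and> \<sigma> 60 0 = int q"

lemma round_inv_upd [simp]: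
  "a \<notin> {46, 60} \<Longrightarrow> round_inv G q (\<sigma>(a := v)) \<longleftrightarrow> round_inv G q \<sigma>"
  "a \<notin> {46, 60} \<Longrightarrow> round_inv G q (\<lambda>x. if x = a then v else \<sigma> x) \<longleftrightarrow> round_inv G q \<sigma>"
  by (simp_all add: round_inv_def)

lemma round_inv_cong: "round_inv G q \<sigma> \<Longrightarrow> \<sigma>' 46 = \<sigma> 46 \<Longrightarrow> \<sigma>' 60 = \<sigma> 60 \<Longrightarrow> round_inv G q \<sigma>'" by (simp add: round_inv_def g_is_def)

definition c_enc :: com where
  "c_enc = CFor 31 (Vr 53) (CIf (Ar 46 (Vr 31)) (CAsg 47 (Vr 31) (Ar 44 (Vr 31))) (CAsg 47 (Vr 31) (Cn 0)))"

lemma z_is_ex: "z_is (\<sigma> 47) \<sigma>" by (simp add: z_is_def)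

lemma c_enc_ht: "ht Bd (\<lambda>\<sigma>. stats \<sigma> \<and> round_inv G q \<sigma>) c_enc (5 * K0) (\<lambda>\<sigma>. stats \<sigma> \<and> round_inv G q \<sigma> \<and> z_is (enc G) \<sigma>)"
proof (rule ht_init)
  fix \<sigma>0 assume s0: "stats \<sigma>0 \<and> round_inv G q \<sigma>0"
  have "ht Bd (\<lambda>\<sigma>. stats \<sigma> \<and> round_inv G q \<sigma> \<and> z_is (\<sigma>0 47) \<sigma>) c_enc ((3 + 2) * K0) (\<lambda>\<sigma>. stats \<sigma> \<and> round_inv G q \<sigma> \<and> z_is (enc G) \<sigma>)"
    unfolding c_enc_def
  proof (rule over_codes)
    fix t :: nat assume t: "t < 3 ^ k"
    show "ht Bd (\<lambda>\<sigma>. (stats \<sigma> \<and> round_inv G q \<sigma> \<and> z_is (zpart t (\<sigma>0 47) (enc G)) \<sigma>) \<and> \<sigma> 31 0 = int t)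
      (CIf (Ar 46 (Vr 31)) (CAsg 47 (Vr 31) (Ar 44 (Vr 31))) (CAsg 47 (Vr 31) (Cn 0))) 3
      (\<lambda>\<sigma>. stats \<sigma> \<and> round_inv G q \<sigma> \<and> z_is (zpart (Suc t) (\<sigma>0 47) (enc G)) \<sigma>)"
      apply (rule ht_pre)
        apply (rule wp)+
      subgoal premises pr for \<sigma>
      proof -
        have a: "stats \<sigma>" "round_inv G q \<sigma>" "z_is (zpart t (\<sigma>0 47) (enc G)) \<sigma>" "\<sigma> 31 0 = int t" using pr by auto
        have v: "\<sigma> 46 t = of_bool (t \<in> G)" using a(2) t by (simp add: round_inv_def g_is_def)
        have x: "\<sigma> 44 t = XX ^ ee t" using SSD(7)[OF a(1) t] .
        have xb: "\<bar>XX ^ ee t\<bar> \<le> Bd" using XX_Bd(1)[OF ee_less] XX_Bd(2) by simp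
        show ?thesis
        proof (cases "t \<in> G")
          case True
          then have "z_is (zpart (Suc t) (\<sigma>0 47) (enc G)) (\<sigma>(47 := (\<sigma> 47)(t := XX ^ ee t)))"
            by (intro z_is_zpart_Suc[OF a(3)]) (simp add: enc_def)
          then show ?thesis using True a v x xb by simp
        next
          case False
          then have "z_is (zpart (Suc t) (\<sigma>0 47) (enc G)) (\<sigma>(47 := (\<sigma> 47)(t := 0)))"
            by (intro z_is_zpart_Suc[OF a(3)]) (simp add: enc_def)
          then show ?thesis using False a v B by simp
        qed
      qed
      by simp
  qed auto
  then show "ht Bd (\<lambda>\<sigma>. \<sigma> = \<sigma>0) c_enc (5 * K0) (\<lambda>\<sigma>. stats \<sigma> \<and> round_inv G q \<sigma> \<and> z_is (enc G) \<sigma>)"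
    by (rule ht_pre) (use s0 z_is_ex in auto)
qed

text \<open>The constructor \<open>Pl\<close> or \<open>Mi\<close> is an argument, so that a pass
  and its inverse share one proof.\<close>

definition c_pass :: "(exp \<Rightarrow> exp \<Rightarrow> exp) \<Rightarrow> com" where
  "c_pass op = CFor 31 (Vr 53) (dec 31 23 ;; CIf (Ar 16 (Vr 57)) (CIf (Mi (Ar 16 (Vr 57)) (Cn 1)) CSkip
     (CAsg 47 (Vr 31) (op (Ar 47 (Vr 31)) (Ar 47 (Mi (Vr 31) (Ar 9 (Vr 57))))))) CSkip)"

text \<open>Codes are processed in increasing order, so the entry at \<open>t - 3 ^ p\<close> has
  already been treated and \<open>g\<close> occurs on the right of its own equation. Digit
  \<open>p\<close> is 0 there, so its value is still the old one.\<close>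

lemma c_pass_ht:
  assumes op: "op = Pl \<and> h = (\<lambda>x y. x + y) \<or> op = Mi \<and> h = (\<lambda>x y. x - y)" and p: "p < k"
    and g: "\<And>t. t < 3 ^ k \<Longrightarrow> g t = (if digit t p = 1 then h (f t) (g (t - 3 ^ p)) else f t)"
    and bd: "\<And>t. t < 3 ^ k \<Longrightarrow> \<bar>g t\<bar> \<le> Bd" and Fu: "\<And>\<sigma> a v. F \<sigma> \<Longrightarrow> a \<in> {14, 15, 16, 17, 31, 47} \<Longrightarrow> F (\<sigma>(a := v))"
    and Fc: "\<And>\<sigma> \<sigma>'. F \<sigma> \<Longrightarrow> (\<And>a. a \<notin> {14, 15, 16, 17} \<Longrightarrow> \<sigma>' a = \<sigma> a) \<Longrightarrow> F \<sigma>'"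
    and Fp: "\<And>\<sigma>. F \<sigma> \<Longrightarrow> \<sigma> 57 0 = int p"
  shows "ht Bd (\<lambda>\<sigma>. stats \<sigma> \<and> F \<sigma> \<and> z_is f \<sigma>) (c_pass op) ((10 * M + 1 + 4 + 2) * K0) (\<lambda>\<sigma>. stats \<sigma> \<and> F \<sigma> \<and> z_is g \<sigma>)"
  unfolding c_pass_def
proof (rule over_codes[where F = F and f = f and g = g and T = "10 * M + 1 + 4"])
  fix t :: nat assume t: "t < 3 ^ k"
  let ?P = "\<lambda>\<sigma>. (stats \<sigma> \<and> F \<sigma> \<and> z_is (zpart t f g) \<sigma>) \<and> \<sigma> 31 0 = int t"
  have a: "ht Bd ?P (dec 31 23) (10 * M + 1) (\<lambda>\<sigma>. ?P \<sigma> \<and> (\<forall>p<k. \<sigma> 16 p = int (digit t p)))"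
  proof (rule dec_SS[OF t])
    fix \<sigma> \<sigma>' assume P: "?P \<sigma>" and e: "\<And>a. a \<notin> {14, 15, 16, 17} \<Longrightarrow> \<sigma>' a = \<sigma> a"
    have s: "stats \<sigma>" "F \<sigma>" "z_is (zpart t f g) \<sigma>" "\<sigma> 31 0 = int t" using P by simp_all
    have "stats \<sigma>'" by (rule stats_cong[OF s(1)], rule e, auto)
    moreover have "F \<sigma>'" by (rule Fc[OF s(2)], rule e)
    moreover have "z_is (zpart t f g) \<sigma>'" by (rule z_is_cong[OF s(3)], rule e, simp)
    moreover have "\<sigma>' 31 0 = int t" by (subst e) (simp_all add: s)
    ultimately show "?P \<sigma>'" by blast
  qed auto
  have b: "ht Bd (\<lambda>\<sigma>. ?P \<sigma> \<and> (\<forall>p<k. \<sigma> 16 p = int (digit t p))) (CIf (Ar 16 (Vr 57)) (CIf (Mi (Ar 16 (Vr 57)) (Cn 1)) CSkip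
     (CAsg 47 (Vr 31) (op (Ar 47 (Vr 31)) (Ar 47 (Mi (Vr 31) (Ar 9 (Vr 57))))))) CSkip) 4
     (\<lambda>\<sigma>. stats \<sigma> \<and> F \<sigma> \<and> z_is (zpart (Suc t) f g) \<sigma>)"
    apply (rule ht_pre)
      apply (rule wp)+
    subgoal premises pr for \<sigma>
    proof -
      have s: "stats \<sigma>" "F \<sigma>" "z_is (zpart t f g) \<sigma>" "\<sigma> 31 0 = int t" and d: "\<sigma> 16 p = int (digit t p)" using pr p by auto
      have s57: "\<sigma> 57 0 = int p" by (rule Fp[OF s(2)])
      have p3: "\<sigma> 9 p = 3 ^ p" using tabsD(4)[OF stats_tabs[OF s(1)]] p k_le_n by (simp add: pow3D)
      show ?thesis
      proof (cases "digit t p = 1")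
        case False
        then have "f t = g t" using g[OF t] by simp
        then have "z_is (zpart (Suc t) f g) \<sigma>" using z_is_zpart_Suc'[OF s(3)] by simp
        then show ?thesis using False digit_cases[of t p] by (auto simp: s d s57)
      next
        case True
        have le: "3 ^ p \<le> t" using digit_le[of 1 t p] True by simp
        define w where "w = t - 3 ^ p"
        have p0: "(0::nat) < 3 ^ p" by simp
        have lt: "w < t" "w < 3 ^ k" using le t p0 unfolding w_def by linarith+
        have z: "\<sigma> 47 t = f t" "\<sigma> 47 w = g w"
          unfolding z_is_at[OF s(3) t] z_is_at[OF s(3) lt(2)] using lt by simp_all
        have wi: "int w = int t - 3 ^ p" using le unfolding w_def by (simp add: of_nat_diff)
        then have le': "(3::int) ^ p \<le> int t" and ix: "nat (int t - 3 ^ p) = w" by linarith+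
        have gt: "g t = h (f t) (g w)" unfolding w_def by (subst g[OF t]) (simp add: True)
        have "z_is (zpart (Suc t) f g) (\<sigma>(47 := (\<sigma> 47)(t := h (f t) (g w))))"
          by (rule z_is_zpart_Suc[OF s(3) gt[symmetric]])
        moreover have "\<bar>h (f t) (g w)\<bar> \<le> Bd" using bd[OF t] gt by simp
        moreover have "F (\<sigma>(47 := v))" for v by (rule Fu[OF s(2)]) simp
        moreover have "okx (Ar 9 (Vr 57)) \<sigma>" "eval (Ar 9 (Vr 57)) \<sigma> = 3 ^ p" by (simp_all add: s57 p3)
        ultimately show ?thesis using op
          by (elim disjE conjE; simp add: True s d s57 p3 z ix le le')
      qed
    qed
    by simp
  show "ht Bd ?P (dec 31 23 ;; CIf (Ar 16 (Vr 57)) (CIf (Mi (Ar 16 (Vr 57)) (Cn 1)) CSkip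
     (CAsg 47 (Vr 31) (op (Ar 47 (Vr 31)) (Ar 47 (Mi (Vr 31) (Ar 9 (Vr 57))))))) CSkip) (10 * M + 1 + 4)
     (\<lambda>\<sigma>. stats \<sigma> \<and> F \<sigma> \<and> z_is (zpart (Suc t) f g) \<sigma>)"
    by (rule ht_seq[OF a b])
qed (auto intro: Fu)

definition c_zeta :: com where "c_zeta = CFor 57 (Vr 23) (c_pass Pl)"
text \<open>Undoes the passes of \<open>c_zeta\<close> in reverse order, each by a
  subtraction.\<close>

definition c_moeb :: com where
  "c_moeb = CFor 58 (Vr 23) (CSet 57 (Mi (Mi (Vr 23) (Cn 1)) (Vr 58)) ;; c_pass Mi)"

lemma mods_pass [simp]: "mods (c_pass op) = {14, 15, 16, 17, 31, 47}"
  by (auto simp: c_pass_def)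

lemma zeta_low: "digit t p = 1 \<Longrightarrow> zeta (Suc p) f (t - 3 ^ p) = zeta p f (t - 3 ^ p)"
  using digit_sub[of 1 t p p] by simp

lemma c_zeta_ht:
  assumes bd: "\<And>j t. j \<le> k \<Longrightarrow> t < 3 ^ k \<Longrightarrow> \<bar>zeta j f t\<bar> \<le> Bd"
  shows "ht Bd (\<lambda>\<sigma>. stats \<sigma> \<and> round_inv G q \<sigma> \<and> z_is f \<sigma>) c_zeta (((10 * M + 1 + 4 + 2) * K0 + 2) * M)
    (\<lambda>\<sigma>. stats \<sigma> \<and> round_inv G q \<sigma> \<and> z_is (zeta k f) \<sigma>)"
  unfolding c_zeta_def
proof (rule ht_use[OF ht_for2[where P = "\<lambda>\<sigma>. stats \<sigma> \<and> round_inv G q \<sigma> \<and> z_is f \<sigma>" and e = "Vr 23" and x = 57 and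
    Inv = "\<lambda>j \<sigma>. stats \<sigma> \<and> round_inv G q \<sigma> \<and> z_is (zeta j f) \<sigma>", OF _ _ k_le_M M1 kB(1) _ B]])
  fix j assume j: "j < k"
  have "ht Bd (\<lambda>\<sigma>. stats \<sigma> \<and> (round_inv G q \<sigma> \<and> \<sigma> 57 0 = int j) \<and> z_is (zeta j f) \<sigma>) (c_pass Pl) ((10 * M + 1 + 4 + 2) * K0)
    (\<lambda>\<sigma>. stats \<sigma> \<and> (round_inv G q \<sigma> \<and> \<sigma> 57 0 = int j) \<and> z_is (zeta (Suc j) f) \<sigma>)"
  proof (rule c_pass_ht[where p = j and h = "\<lambda>x y. x + y"])
    show "zeta (Suc j) f t = (if digit t j = 1 then zeta j f t + zeta (Suc j) f (t - 3 ^ j) else zeta j f t)" for t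
      using zeta_low[of t j f] by simp
    show "\<bar>zeta (Suc j) f t\<bar> \<le> Bd" if "t < 3 ^ k" for t using bd[of "Suc j" t] j that by simp
  qed (use j round_inv_cong in auto)
  then show "ht Bd (\<lambda>\<sigma>. (stats \<sigma> \<and> round_inv G q \<sigma> \<and> z_is (zeta j f) \<sigma>) \<and> \<sigma> 57 0 = int j) (c_pass Pl) ((10 * M + 1 + 4 + 2) * K0)
    (\<lambda>\<sigma>. stats (\<sigma>(57 := (\<sigma> 57)(0 := int (Suc j)))) \<and> round_inv G q (\<sigma>(57 := (\<sigma> 57)(0 := int (Suc j)))) \<and>
      z_is (zeta (Suc j) f) (\<sigma>(57 := (\<sigma> 57)(0 := int (Suc j)))))"
    by (rule ht_use) (auto simp del: zeta.simps)
next
  fix \<sigma> assume a: "stats \<sigma> \<and> round_inv G q \<sigma> \<and> z_is f \<sigma>"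
  then have "\<sigma> 23 0 = int k" using tabsD(2) stats_tabs by blast
  then show "okx (Vr 23) \<sigma> \<and> eval (Vr 23) \<sigma> = int k \<and> stats (\<sigma>(57 := (\<sigma> 57)(0 := 0))) \<and>
    round_inv G q (\<sigma>(57 := (\<sigma> 57)(0 := 0))) \<and> z_is (zeta 0 f) (\<sigma>(57 := (\<sigma> 57)(0 := 0)))"
    using a by (simp add: z_is_def)
qed auto

lemma c_moeb_ht:
  assumes bd: "\<And>j t. j \<le> k \<Longrightarrow> t < 3 ^ k \<Longrightarrow> \<bar>zeta j f t\<bar> \<le> Bd"
  shows "ht Bd (\<lambda>\<sigma>. stats \<sigma> \<and> round_inv G q \<sigma> \<and> z_is (zeta k f) \<sigma>) c_moeb ((1 + (10 * M + 1 + 4 + 2) * K0 + 2) * M)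
    (\<lambda>\<sigma>. stats \<sigma> \<and> round_inv G q \<sigma> \<and> z_is f \<sigma>)"
  unfolding c_moeb_def
proof (rule ht_use[OF ht_for2[where P = "\<lambda>\<sigma>. stats \<sigma> \<and> round_inv G q \<sigma> \<and> z_is (zeta k f) \<sigma>" and e = "Vr 23" and x = 58 and
    Inv = "\<lambda>j \<sigma>. stats \<sigma> \<and> round_inv G q \<sigma> \<and> z_is (zeta (k - j) f) \<sigma>", OF _ _ k_le_M M1 kB(1) _ B]])
  fix j assume j: "j < k"
  define p where "p = k - Suc j"
  have p: "p < k" "k - j = Suc p" using j by (auto simp: p_def)
  have pi: "int k - 1 - int j = int p" using j by (simp add: p_def)
  let ?F = "\<lambda>\<sigma>. round_inv G q \<sigma> \<and> \<sigma> 57 0 = int p"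
  have a: "ht Bd (\<lambda>\<sigma>. (stats \<sigma> \<and> round_inv G q \<sigma> \<and> z_is (zeta (k - j) f) \<sigma>) \<and> \<sigma> 58 0 = int j) (CSet 57 (Mi (Mi (Vr 23) (Cn 1)) (Vr 58))) 1
    (\<lambda>\<sigma>. stats \<sigma> \<and> ?F \<sigma> \<and> z_is (zeta (Suc p) f) \<sigma>)"
    apply (rule ht_pre)
      apply (rule wp)+
    subgoal premises pr for \<sigma>
    proof -
      have "\<sigma> 23 0 = int k" using pr tabsD(2) stats_tabs by blast
      moreover have "int p \<le> Bd" using p kB by linarith
      ultimately show ?thesis using pr by (simp add: pi p del: zeta.simps)
    qed
    by simp
  have b: "ht Bd (\<lambda>\<sigma>. stats \<sigma> \<and> ?F \<sigma> \<and> z_is (zeta (Suc p) f) \<sigma>) (c_pass Mi) ((10 * M + 1 + 4 + 2) * K0)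
    (\<lambda>\<sigma>. stats \<sigma> \<and> ?F \<sigma> \<and> z_is (zeta p f) \<sigma>)"
  proof (rule c_pass_ht[where p = p and h = "\<lambda>x y. x - y"])
    show "zeta p f t = (if digit t p = 1 then zeta (Suc p) f t - zeta p f (t - 3 ^ p) else zeta (Suc p) f t)" for t by simp
    show "\<bar>zeta p f t\<bar> \<le> Bd" if "t < 3 ^ k" for t using bd[of p t] p that by simp
  qed (use p round_inv_cong in auto)
  show "ht Bd (\<lambda>\<sigma>. (stats \<sigma> \<and> round_inv G q \<sigma> \<and> z_is (zeta (k - j) f) \<sigma>) \<and> \<sigma> 58 0 = int j)
     (CSet 57 (Mi (Mi (Vr 23) (Cn 1)) (Vr 58)) ;; c_pass Mi) (1 + (10 * M + 1 + 4 + 2) * K0)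
    (\<lambda>\<sigma>. stats (\<sigma>(58 := (\<sigma> 58)(0 := int (Suc j)))) \<and> round_inv G q (\<sigma>(58 := (\<sigma> 58)(0 := int (Suc j)))) \<and>
      z_is (zeta (k - Suc j) f) (\<sigma>(58 := (\<sigma> 58)(0 := int (Suc j)))))"
    by (rule ht_use[OF ht_seq[OF a b]]) (auto simp: p_def simp del: zeta.simps)
next
  fix \<sigma> assume a: "stats \<sigma> \<and> round_inv G q \<sigma> \<and> z_is (zeta k f) \<sigma>"
  then have "\<sigma> 23 0 = int k" using tabsD(2) stats_tabs by blast
  then show "okx (Vr 23) \<sigma> \<and> eval (Vr 23) \<sigma> = int k \<and> stats (\<sigma>(58 := (\<sigma> 58)(0 := 0))) \<and>
    round_inv G q (\<sigma>(58 := (\<sigma> 58)(0 := 0))) \<and> z_is (zeta (k - 0) f) (\<sigma>(58 := (\<sigma> 58)(0 := 0)))"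
    using a by simp
qed (auto simp: z_is_def)

text \<open>The machine cannot multiply: the square is computed by doubling and adding, from the top bit down.\<close>

definition c_sqstep :: com where
  "c_sqstep = CSet 51 (Pl (Vr 51) (Vr 51)) ;; CSet 17 (Ar 27 (Mi (Mi (Vr 54) (Cn 1)) (Vr 52))) ;;
     CIf (Mi (Pl (Vr 14) (Cn 1)) (Vr 17)) (CSet 14 (Mi (Vr 14) (Vr 17)) ;; CSet 51 (Pl (Vr 51) (Ar 47 (Vr 31)))) CSkip"

definition c_square :: com where
  "c_square = CFor 31 (Vr 53) ((CSet 14 (Ar 47 (Vr 31)) ;; CSet 51 (Cn 0)) ;; CFor 52 (Vr 54) c_sqstep ;; CAsg 47 (Vr 31) (Vr 51))"

text \<open>Going from \<open>Suc e\<close> to \<open>e\<close> moves the top bit of the remainder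
  to the end of the quotient.\<close>

lemma square_digit:
  fixes z :: int and e :: nat assumes z: "0 \<le> z"
  defines "r \<equiv> z mod 2 ^ Suc e" and "d \<equiv> z div 2 ^ Suc e"
  shows "2 ^ e \<le> r \<Longrightarrow> z mod 2 ^ e = r - 2 ^ e \<and> z div 2 ^ e = 2 * d + 1"
    "r < 2 ^ e \<Longrightarrow> z mod 2 ^ e = r \<and> z div 2 ^ e = 2 * d"
    "0 \<le> r" "0 \<le> d"
proof -
  define b where "b = (2::int) ^ e"
  have bb: "(2::int) ^ Suc e = 2 * b" by (simp add: b_def)
  have p: "0 < b" by (simp add: b_def)
  have zr: "z = d * (2 * b) + r" unfolding r_def d_def bb by (rule div_mult_mod_eq[symmetric])
  have r: "0 \<le> r" "r < 2 * b" unfolding r_def bb using p by simp_all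
  show "0 \<le> r" by (rule r)
  show "0 \<le> d" unfolding d_def bb using z p by (intro div_int_pos_iff[THEN iffD2]) auto
  have "z mod b = r - b \<and> z div b = 2 * d + 1" if "b \<le> r"
  proof -
    have "z = b * (2 * d + 1) + (r - b)" using zr by (simp add: algebra_simps)
    moreover have "0 \<le> r - b" "r - b < b" using r that by auto
    ultimately show ?thesis using int_div_pos_eq int_mod_pos_eq by blast
  qed
  then show "2 ^ e \<le> r \<Longrightarrow> z mod 2 ^ e = r - 2 ^ e \<and> z div 2 ^ e = 2 * d + 1" by (simp add: b_def)
  have "z mod b = r \<and> z div b = 2 * d" if "r < b"
  proof -
    have "z = b * (2 * d) + r" using zr by (simp add: algebra_simps)
    then show ?thesis using int_div_pos_eq int_mod_pos_eq r that by blast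
  qed
  then show "r < 2 ^ e \<Longrightarrow> z mod 2 ^ e = r \<and> z div 2 ^ e = 2 * d" by (simp add: b_def)
qed

lemma div_le_self: "0 \<le> z \<Longrightarrow> 0 < b \<Longrightarrow> z div b \<le> z" for z b :: int
  using zdiv_mono2[of z 1 b] by simp

lemma c_square_ht:
  assumes f0: "\<And>t. t < 3 ^ k \<Longrightarrow> 0 \<le> f t \<and> f t < 2 ^ (M ^ 3)"
  shows "ht Bd (\<lambda>\<sigma>. stats \<sigma> \<and> round_inv G q \<sigma> \<and> z_is f \<sigma>) c_square ((2 + ((6 + 2) * M ^ 3 + 1) + 2) * K0)
    (\<lambda>\<sigma>. stats \<sigma> \<and> round_inv G q \<sigma> \<and> z_is (\<lambda>t. (f t)\<^sup>2) \<sigma>)"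
  unfolding c_square_def
proof (rule over_codes)
  fix t :: nat assume t: "t < 3 ^ k"
  define z where "z = f t"
  let ?N = "M ^ 3"
  let ?g = "\<lambda>t. (f t)\<^sup>2"
  have z: "0 \<le> z" "z < 2 ^ ?N" using f0[OF t] by (auto simp: z_def)
  have zzB: "z * z \<le> Bd"
  proof -
    have "z * z \<le> 2 ^ ?N * 2 ^ ?N" using z by (intro mult_mono) auto
    also have "\<dots> = 2 ^ (?N + ?N)" by (simp add: power_add)
    also have "\<dots> \<le> Bd" by (intro pow2_Bd) simp
    finally show ?thesis .
  qed
  have zB: "z \<le> Bd" using z pow2_Bd[of ?N] by simp
  \<comment> \<open>Horner scheme: after \<open>i\<close> bits, name 14 holds the bits not yet read
    and name 51 the product of \<open>z\<close> with the number formed by the bits read.\<close>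
  define I where "I i \<sigma> \<longleftrightarrow> stats \<sigma> \<and> round_inv G q \<sigma> \<and> z_is (zpart t f ?g) \<sigma> \<and> \<sigma> 31 0 = int t \<and> \<sigma> 14 0 = z mod 2 ^ (?N - i)
     \<and> \<sigma> 51 0 = z * (z div 2 ^ (?N - i))" for i and \<sigma> :: store
  have zat: "\<sigma> 47 t = z" if "z_is (zpart t f ?g) \<sigma>" for \<sigma> using z_is_at[OF that t] by (simp add: z_def)
  have s54: "\<sigma> 54 0 = int ?N" if "stats \<sigma>" for \<sigma> using tabsD(12) stats_tabs[OF that] by blast
  have 1: "ht Bd (\<lambda>\<sigma>. (stats \<sigma> \<and> round_inv G q \<sigma> \<and> z_is (zpart t f ?g) \<sigma>) \<and> \<sigma> 31 0 = int t) (CSet 14 (Ar 47 (Vr 31)) ;; CSet 51 (Cn 0)) 2 (I 0)"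
    apply (rule ht_pre)
      apply (rule wp)+
    subgoal for \<sigma> using z zB B zat[of \<sigma>] by (simp add: I_def)
    by simp
  have 2: "ht Bd (I 0) (CFor 52 (Vr 54) c_sqstep) ((6 + 2) * M ^ 3) (I ?N)"
  proof (rule ht_for2)
    fix i assume i: "i < ?N"
    define e where "e = ?N - Suc i"
    have e: "?N - i = Suc e" "e < ?N" using i by (auto simp: e_def)
    have iN: "int ?N = int (Suc (i + e))" using i by (simp only: e_def of_nat_eq_iff)
    have ie: "nat (int ?N - 1 - int i) = e" "int i + 1 \<le> int ?N" unfolding iN by auto
    note ie' = ie(1)[unfolded of_nat_power]
    define r where "r = z mod 2 ^ Suc e"
    define d where "d = z div 2 ^ Suc e"
    note sd = square_digit[OF z(1), of e, folded r_def d_def]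
    have pe: "(0::int) < 2 ^ e" "(2::int) ^ e \<le> Bd" using e pow2_Bd[of e] by auto
    have dle: "z * (z div 2 ^ e) \<le> Bd"
    proof -
      have "z div 2 ^ e \<le> z" using z pe by (intro div_le_self) auto
      then have "z * (z div 2 ^ e) \<le> z * z" using z by (intro mult_left_mono) auto
      then show ?thesis using zzB by linarith
    qed
    have rB: "r \<le> Bd"
    proof -
      have "r \<le> z" unfolding r_def using z by (intro zmod_le_nonneg_dividend)
      then show ?thesis using zB by linarith
    qed
    show "ht Bd (\<lambda>\<sigma>. I i \<sigma> \<and> \<sigma> 52 0 = int i) c_sqstep 6 (\<lambda>\<sigma>. I (Suc i) (\<sigma>(52 := (\<sigma> 52)(0 := int (Suc i)))))"
      unfolding c_sqstep_def
      apply (rule ht_pre)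
        apply (rule wp)+
      subgoal premises pr for \<sigma>
      proof -
        have s: "stats \<sigma>" "round_inv G q \<sigma>" "z_is (zpart t f ?g) \<sigma>" "\<sigma> 31 0 = int t" "\<sigma> 14 0 = r" "\<sigma> 51 0 = z * d" "\<sigma> 52 0 = int i"
          using pr by (auto simp: I_def e r_def d_def)
        note s' = zat[OF s(3)] s54[OF s(1)] tabsD(11)[OF stats_tabs[OF s(1)] e(2)]
        have zd0: "0 \<le> z * d" using z sd(4) by simp
        show ?thesis
        proof (cases "2 ^ e \<le> r")
          case True
          have q: "z mod 2 ^ e = r - 2 ^ e" "z div 2 ^ e = 2 * d + 1" using sd(1)[OF True] by auto
          have m: "z * (z div 2 ^ e) = z * d + z * d + z" unfolding q by (simp add: algebra_simps)
          have bd: "z * d + z * d \<le> Bd" "z * d + z * d + z \<le> Bd" using dle m z by linarith+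
          have "\<bar>z * d + z * d\<bar> \<le> Bd" "\<bar>z * d + z * d + z\<bar> \<le> Bd" "\<bar>r - 2 ^ e\<bar> \<le> Bd"
            using True rB pe bd zd0 z by linarith+
          then show ?thesis
            using i True s bd zd0 pe z B by (simp add: s' ie' I_def e_def[symmetric] q(1) m)
        next
          case False
          then have lt: "r < 2 ^ e" by simp
          have q: "z mod 2 ^ e = r" "z div 2 ^ e = 2 * d" using sd(2)[OF lt] by auto
          have m: "z * (z div 2 ^ e) = z * d + z * d" unfolding q by (simp add: algebra_simps)
          have bd: "z * d + z * d \<le> Bd" using dle m by linarith
          have "\<bar>z * d + z * d\<bar> \<le> Bd" using bd zd0 by linarith
          then show ?thesis
            using i lt s bd zd0 pe z B by (simp add: s' ie' I_def e_def[symmetric] q(1) m)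
        qed
      qed
      by simp
  next
    fix \<sigma> assume "I 0 \<sigma>"
    then show "okx (Vr 54) \<sigma> \<and> eval (Vr 54) \<sigma> = int ?N \<and> I 0 (\<sigma>(52 := (\<sigma> 52)(0 := 0)))"
      using s54[of \<sigma>] by (simp add: I_def)
  next
    show "1 \<le> ?N" using M1 M3(1) by linarith
    show "int ?N \<le> Bd" by (intro small) simp
  qed (use B in \<open>auto simp: c_sqstep_def\<close>)
  have 3: "ht Bd (I ?N) (CAsg 47 (Vr 31) (Vr 51)) 1 (\<lambda>\<sigma>. stats \<sigma> \<and> round_inv G q \<sigma> \<and> z_is (zpart (Suc t) f ?g) \<sigma>)"
    apply (rule ht_pre)
      apply (rule wp)+
    subgoal premises pr for \<sigma>
    proof -
      have s: "stats \<sigma>" "round_inv G q \<sigma>" "z_is (zpart t f ?g) \<sigma>" "\<sigma> 31 0 = int t" "\<sigma> 51 0 = z * z"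
        using pr by (auto simp: I_def)
      have "z_is (zpart (Suc t) f ?g) (\<sigma>(47 := (\<sigma> 47)(t := z * z)))"
        by (rule z_is_zpart_Suc[OF s(3)]) (simp add: z_def power2_eq_square)
      moreover have "\<bar>z * z\<bar> \<le> Bd" using zzB by simp
      ultimately show ?thesis using s by simp
    qed
    by simp
  show "ht Bd (\<lambda>\<sigma>. (stats \<sigma> \<and> round_inv G q \<sigma> \<and> z_is (zpart t f ?g) \<sigma>) \<and> \<sigma> 31 0 = int t)
    ((CSet 14 (Ar 47 (Vr 31)) ;; CSet 51 (Cn 0)) ;; CFor 52 (Vr 54) c_sqstep ;; CAsg 47 (Vr 31) (Vr 51)) (2 + ((6 + 2) * M ^ 3 + 1))
    (\<lambda>\<sigma>. stats \<sigma> \<and> round_inv G q \<sigma> \<and> z_is (zpart (Suc t) f ?g) \<sigma>)"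
    by (rule ht_seq[OF 1 ht_seq[OF 2 3]])
qed (auto simp: c_sqstep_def)

text \<open>The origin of \<open>M ^ 3\<close>: a zeta transform adds at most \<open>2 ^ k\<close>
  powers of \<open>XX = 2 ^ M\<close> with exponents at most \<open>n * M + n\<close>.\<close>

lemma kM3: "k + M * (n * M + n) < M ^ 3"
proof -
  have k: "k < M" using k_le_n by (simp add: M_def)
  have "n * M + n + 1 \<le> M * M"
  proof -
    have "M * M = 2 * n * M + M" by (simp add: M_def)
    moreover have "n \<le> n * M" using M1 by simp
    ultimately show ?thesis using M1 nM by linarith
  qed
  then have "M * (n * M + n + 1) \<le> M * (M * M)" by (intro mult_le_mono2)
  then have "M * (n * M + n) + M \<le> M ^ 3" by (simp add: power3_eq_cube mult.assoc distrib_left)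
  then show ?thesis using k by linarith
qed

lemma zeta_ff: "0 \<le> zeta k (enc G) t \<and> zeta k (enc G) t < 2 ^ (M ^ 3)"
proof -
  define F where "F = XX ^ (n * mm + n)"
  have "0 \<le> zeta k (enc G) t \<and> zeta k (enc G) t \<le> 2 ^ k * F"
    unfolding F_def by (rule zeta_bounds[OF enc_bounds])
  moreover have "2 ^ k * F = 2 ^ (k + M * (n * M + n))" by (simp add: F_def XXM mmM power_add distrib_left)
  moreover have "(2::int) ^ (k + M * (n * M + n)) < 2 ^ (M ^ 3)" using kM3 by (intro power_strict_increasing) auto
  ultimately show ?thesis by linarith
qed

lemma zeta_ff_Bd: "j \<le> k \<Longrightarrow> \<bar>zeta j (enc G) t\<bar> \<le> Bd"
proof -
  assume "j \<le> k"
  then have "0 \<le> zeta j (enc G) t \<and> zeta j (enc G) t \<le> zeta k (enc G) t"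
    using enc_bounds by (intro zeta_mono) auto
  moreover have "(2::int) ^ (M ^ 3) \<le> Bd" by (intro pow2_Bd) simp
  ultimately show ?thesis using zeta_ff[of G t] by linarith
qed

text \<open>The inverse transform runs through the partial transforms of \<open>conv G\<close>; they
  increase with \<open>j\<close> and end in the square of a number below
  \<open>2 ^ (M ^ 3)\<close>.\<close>

lemma zeta_hh_Bd: "j \<le> k \<Longrightarrow> t < 3 ^ k \<Longrightarrow> \<bar>zeta j (conv G) t\<bar> \<le> Bd"
proof -
  assume j: "j \<le> k" and t: "t < 3 ^ k"
  define z where "z = zeta k (enc G) t"
  define N where "N = (2::int) ^ (M ^ 3)"
  have z: "0 \<le> z" "z < N" using zeta_ff[of G t] by (auto simp: z_def N_def)
  have "0 \<le> zeta j (conv G) t \<and> zeta j (conv G) t \<le> zeta k (conv G) t"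
    using conv_nonneg j by (intro zeta_mono) auto
  moreover have "zeta k (conv G) t = z\<^sup>2" unfolding z_def by (rule zeta_square[OF t, symmetric])
  moreover have "z\<^sup>2 \<le> N * N" unfolding power2_eq_square using z by (intro mult_mono) auto
  moreover have "N * N = 2 ^ (M ^ 3 + M ^ 3)" by (simp add: N_def power_add)
  moreover have "(2::int) ^ (M ^ 3 + M ^ 3) \<le> Bd" by (intro pow2_Bd) simp
  ultimately show ?thesis by linarith
qed

definition c_conv :: com where "c_conv = c_enc ;; c_zeta ;; c_square ;; c_moeb"

definition T_conv :: "nat \<Rightarrow> nat \<Rightarrow> nat" where
  "T_conv m x = 5 * x + (((10 * m + 1 + 4 + 2) * x + 2) * m + ((2 + ((6 + 2) * m ^ 3 + 1) + 2) * x +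
     (1 + (10 * m + 1 + 4 + 2) * x + 2) * m))"

lemma c_conv_ht: "ht Bd (\<lambda>\<sigma>. stats \<sigma> \<and> round_inv G q \<sigma>) c_conv (T_conv M K0) (\<lambda>\<sigma>. stats \<sigma> \<and> round_inv G q \<sigma> \<and> z_is (conv G) \<sigma>)"
  unfolding c_conv_def T_conv_def
proof (rule ht_seq[OF c_enc_ht ht_seq[OF c_zeta_ht ht_seq[OF _ c_moeb_ht]]])
  have "ht Bd (\<lambda>\<sigma>. stats \<sigma> \<and> round_inv G q \<sigma> \<and> z_is (zeta k (enc G)) \<sigma>) c_square ((2 + ((6 + 2) * M ^ 3 + 1) + 2) * K0)
    (\<lambda>\<sigma>. stats \<sigma> \<and> round_inv G q \<sigma> \<and> z_is (\<lambda>t. (zeta k (enc G) t)\<^sup>2) \<sigma>)"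
    by (rule c_square_ht) (rule zeta_ff)
  then show "ht Bd (\<lambda>\<sigma>. stats \<sigma> \<and> round_inv G q \<sigma> \<and> z_is (zeta k (enc G)) \<sigma>) c_square ((2 + ((6 + 2) * M ^ 3 + 1) + 2) * K0)
    (\<lambda>\<sigma>. stats \<sigma> \<and> round_inv G q \<sigma> \<and> z_is (zeta k (conv G)) \<sigma>)"
    by (rule ht_use) (simp_all add: z_is_def zeta_square)
qed (auto intro: zeta_ff_Bd zeta_hh_Bd)

section \<open>One round of the dynamic program\<close>

definition forget_intro :: "nat \<Rightarrow> nat set \<Rightarrow> nat \<Rightarrow> nat \<Rightarrow> bool" where
  "forget_intro q G t p \<longleftrightarrow> (digit t p = 1 \<and> t + 3 ^ p \<in> G \<and> okE t \<and> vb t + 1 + vj t \<le> q \<and> okD q (t + 3 ^ p))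
    \<or> (digit t p = 2 \<and> t - 2 * 3 ^ p \<in> G \<and> vb t + vj (t - 2 * 3 ^ p) \<le> q)"

definition join_ok :: "nat \<Rightarrow> nat set \<Rightarrow> nat \<Rightarrow> bool" where
  "join_ok q G t \<longleftrightarrow> (\<exists>t1\<in>G. \<exists>t2\<in>G. joins t t1 t2 \<and> Ls t1 \<inter> Ls t2 = {} \<and> vb t + va t + vj t \<le> va t1 + va t2 + q)"

text \<open>Codes found within a round are used at once, except in joins, which were prepared before.\<close>

definition stepm :: "nat \<Rightarrow> nat set \<Rightarrow> nat set \<Rightarrow> nat \<Rightarrow> bool" where
  "stepm q G0 G t \<longleftrightarrow> ((vl t = 0 \<and> vb t \<le> q) \<or> (\<exists>p<k. forget_intro q G t p)) \<or> join_ok q G0 t"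

lemma stepp_stepm: "stepp q G t \<longleftrightarrow> stepm q G G t"
  unfolding stepp_def stepm_def forget_intro_def join_ok_def by blast

text \<open>Squeezes the step of a round between \<open>stepp\<close> from the initial set
  \<open>G0\<close>, which gives progress, and \<open>stepp\<close> from the current set
  \<open>G\<close>, which is sound.\<close>

lemma stepm_mono: "G0 \<subseteq> G0' \<Longrightarrow> G \<subseteq> G' \<Longrightarrow> stepm q G0 G t \<Longrightarrow> stepm q G0' G' t"
  unfolding stepm_def forget_intro_def join_ok_def by blast

definition c_base :: com where
  "c_base = CSet 61 (Cn 0) ;; CIf (Ar 39 (Vr 31)) CSkip
     (CIf (Mi (Pl (Vr 60) (Cn 1)) (Ar 38 (Vr 31))) (CSet 61 (Cn 1)) CSkip)"

text \<open>The two size tests differ by 1: at a forget the bag holds \<open>cl p\<close> in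
  addition to the \<open>vb t\<close> vertices of the resulting state, at an introduction
  \<open>cl p\<close> is one of them.\<close>

definition c_forget_intro :: com where
  "c_forget_intro = CFor 57 (Vr 23) (CIf (Ar 16 (Vr 57)) (CIf (Mi (Ar 16 (Vr 57)) (Cn 1))
     (CIf (Ar 46 (Mi (Mi (Vr 31) (Ar 9 (Vr 57))) (Ar 9 (Vr 57))))
       (CIf (Mi (Mi (Pl (Vr 60) (Cn 1)) (Ar 38 (Vr 31))) (Ar 40 (Mi (Mi (Vr 31) (Ar 9 (Vr 57))) (Ar 9 (Vr 57)))))
         (CSet 61 (Cn 1)) CSkip) CSkip)
     (CIf (Ar 46 (Pl (Vr 31) (Ar 9 (Vr 57)))) (CIf (Ar 43 (Vr 31)) CSkip
       (CIf (Mi (Mi (Vr 60) (Ar 38 (Vr 31))) (Ar 40 (Vr 31)))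
         (CIf (Mi (Pl (Vr 60) (Cn 1)) (Ar 42 (Pl (Vr 31) (Ar 9 (Vr 57))))) (CSet 61 (Cn 1)) CSkip) CSkip)) CSkip)) CSkip)"

text \<open>Name 59 becomes \<open>tau q t\<close>, the conditional supplying the truncation at 0;
  together with entry 45 it addresses the power of \<open>XX\<close> that \<open>conv_iff\<close>
  compares with.\<close>

definition c_join :: com where
  "c_join = CSet 59 (Mi (Pl (Ar 38 (Vr 31)) (Pl (Ar 41 (Vr 31)) (Ar 40 (Vr 31)))) (Vr 60)) ;;
     CIf (Vr 59) CSkip (CSet 59 (Cn 0)) ;;
     CIf (Mi (Pl (Ar 47 (Vr 31)) (Cn 1)) (Ar 26 (Pl (Ar 45 (Vr 31)) (Vr 59)))) (CSet 61 (Cn 1)) CSkip"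

definition c_mark :: com where "c_mark = CIf (Vr 61) (CAsg 46 (Vr 31) (Cn 1)) CSkip"

definition upd_inv :: "nat \<Rightarrow> nat set \<Rightarrow> nat set \<Rightarrow> nat \<Rightarrow> store \<Rightarrow> bool" where
  "upd_inv q G0 G t \<sigma> \<longleftrightarrow> (stats \<sigma> \<and> round_inv G q \<sigma> \<and> z_is (conv G0) \<sigma>) \<and> \<sigma> 31 0 = int t"

definition digits_at :: "nat \<Rightarrow> store \<Rightarrow> bool" where "digits_at t \<sigma> \<longleftrightarrow> (\<forall>p<k. \<sigma> 16 p = int (digit t p))"

lemma upd_inv_upd [simp]:
  "a \<in> {57, 59, 61} \<Longrightarrow> upd_inv q G0 G t (\<sigma>(a := v)) \<longleftrightarrow> upd_inv q G0 G t \<sigma>"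
  "a \<in> {57, 59, 61} \<Longrightarrow> upd_inv q G0 G t (\<lambda>x. if x = a then v else \<sigma> x) \<longleftrightarrow> upd_inv q G0 G t \<sigma>"
  by (elim insertE emptyE; simp add: upd_inv_def)+

lemma digits_at_upd [simp]:
  "a \<in> {57, 59, 61} \<Longrightarrow> digits_at t (\<sigma>(a := v)) \<longleftrightarrow> digits_at t \<sigma>"
  "a \<in> {57, 59, 61} \<Longrightarrow> digits_at t (\<lambda>x. if x = a then v else \<sigma> x) \<longleftrightarrow> digits_at t \<sigma>"
  by (elim insertE emptyE; simp add: digits_at_def)+

lemma UUD:
  assumes "upd_inv q G0 G t \<sigma>"
  shows "stats \<sigma>" "\<sigma> 31 0 = int t" "\<sigma> 60 0 = int q" "u < 3 ^ k \<Longrightarrow> \<sigma> 46 u = of_bool (u \<in> G)"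
    "u < 3 ^ k \<Longrightarrow> \<sigma> 47 u = conv G0 u" "\<sigma> 23 0 = int k" "p < k \<Longrightarrow> \<sigma> 9 p = 3 ^ p"
  using assms tabsD(2)[OF stats_tabs, of \<sigma>] pow3D[OF tabsD(4)[OF stats_tabs, of \<sigma>], of p] k_le_n
  by (auto simp: upd_inv_def round_inv_def g_is_def z_is_def)

lemma c_base_ht:
  assumes t: "t < 3 ^ k"
  shows "ht Bd (\<lambda>\<sigma>. upd_inv q G0 G t \<sigma> \<and> digits_at t \<sigma>) c_base 4 (\<lambda>\<sigma>. (upd_inv q G0 G t \<sigma> \<and> digits_at t \<sigma>) \<and> \<sigma> 61 0 = of_bool (vl t = 0 \<and> vb t \<le> q))"
  unfolding c_base_def
  apply (rule ht_pre)
    apply (rule wp)+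
  subgoal premises pr for \<sigma>
  proof -
    have u: "upd_inv q G0 G t \<sigma>" and d: "digits_at t \<sigma>" using pr by auto
    note S = SSD(1,2)[OF UUD(1)[OF u] t]
    have le: "0 < int q + 1 - int (vb t) \<longleftrightarrow> vb t \<le> q" by auto
    show ?thesis using u d B by (auto simp: UUD(2,3)[OF u] S le)
  qed
  by simp

lemma c_forget_intro_ht:
  assumes t: "t < 3 ^ k"
  shows "ht Bd (\<lambda>\<sigma>. (upd_inv q G0 G t \<sigma> \<and> digits_at t \<sigma>) \<and> \<sigma> 61 0 = of_bool b) c_forget_intro ((10 + 2) * M)
    (\<lambda>\<sigma>. (upd_inv q G0 G t \<sigma> \<and> digits_at t \<sigma>) \<and> \<sigma> 61 0 = of_bool (b \<or> (\<exists>p<k. forget_intro q G t p)))"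
  unfolding c_forget_intro_def
proof (rule ht_for2[where Inv = "\<lambda>i \<sigma>. (upd_inv q G0 G t \<sigma> \<and> digits_at t \<sigma>) \<and> \<sigma> 61 0 = of_bool (b \<or> (\<exists>p<i. forget_intro q G t p))"])
  fix p assume p: "p < k"
  have ex: "(\<exists>r<Suc p. forget_intro q G t r) \<longleftrightarrow> (\<exists>r<p. forget_intro q G t r) \<or> forget_intro q G t p" by (auto simp: less_Suc_eq)
  define b' where "b' \<longleftrightarrow> b \<or> (\<exists>r<p. forget_intro q G t r)"
  have ex': "(b \<or> (\<exists>r<Suc p. forget_intro q G t r)) \<longleftrightarrow> b' \<or> forget_intro q G t p" unfolding ex b'_def by blast
  define w where "w = t + 3 ^ p"
  define x where "x = t - 2 * 3 ^ p"
  have wi: "int t + 3 ^ p = int w" by (simp add: w_def)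
  have wn: "nat (int t + 3 ^ p) = w" unfolding wi by simp
  have xi: "digit t p = 2 \<Longrightarrow> int t - 3 ^ p - 3 ^ p = int x"
    using digit_le[of 2 t p] by (simp add: x_def of_nat_diff)
  have w3: "digit t p = 1 \<Longrightarrow> w < 3 ^ k" using add_less[of t p 1 k] p t by (simp add: w_def)
  have x3: "x < 3 ^ k" using t unfolding x_def by linarith
  show "ht Bd (\<lambda>\<sigma>. ((upd_inv q G0 G t \<sigma> \<and> digits_at t \<sigma>) \<and> \<sigma> 61 0 = of_bool (b \<or> (\<exists>r<p. forget_intro q G t r))) \<and> \<sigma> 57 0 = int p)
     (CIf (Ar 16 (Vr 57)) (CIf (Mi (Ar 16 (Vr 57)) (Cn 1))
     (CIf (Ar 46 (Mi (Mi (Vr 31) (Ar 9 (Vr 57))) (Ar 9 (Vr 57))))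
       (CIf (Mi (Mi (Pl (Vr 60) (Cn 1)) (Ar 38 (Vr 31))) (Ar 40 (Mi (Mi (Vr 31) (Ar 9 (Vr 57))) (Ar 9 (Vr 57)))))
         (CSet 61 (Cn 1)) CSkip) CSkip)
     (CIf (Ar 46 (Pl (Vr 31) (Ar 9 (Vr 57)))) (CIf (Ar 43 (Vr 31)) CSkip
       (CIf (Mi (Mi (Vr 60) (Ar 38 (Vr 31))) (Ar 40 (Vr 31)))
         (CIf (Mi (Pl (Vr 60) (Cn 1)) (Ar 42 (Pl (Vr 31) (Ar 9 (Vr 57))))) (CSet 61 (Cn 1)) CSkip) CSkip)) CSkip)) CSkip) 10
     (\<lambda>\<sigma>. (upd_inv q G0 G t (\<sigma>(57 := (\<sigma> 57)(0 := int (Suc p)))) \<and> digits_at t (\<sigma>(57 := (\<sigma> 57)(0 := int (Suc p))))) \<and>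
       (\<sigma>(57 := (\<sigma> 57)(0 := int (Suc p)))) 61 0 = of_bool (b \<or> (\<exists>r<Suc p. forget_intro q G t r)))"
    unfolding ex' b'_def[symmetric]
    apply (rule ht_pre)
      apply (rule wp)+
    subgoal premises pr for \<sigma>
    proof -
      have u: "upd_inv q G0 G t \<sigma>" and d: "digits_at t \<sigma>" and s: "\<sigma> 61 0 = of_bool b'" "\<sigma> 57 0 = int p" using pr by auto
      have d': "\<sigma> 16 p = int (digit t p)" using d p by (simp add: digits_at_def)
      note U = UUD(2,3)[OF u] UUD(7)[OF u p]
      note S = SSD(1,3,6)[OF UUD(1)[OF u] t]
      consider "digit t p = 0" | "digit t p = 1" | "digit t p = 2" using digit_cases[of t p] by argo
      then show ?thesis
      proof cases
        case 1
        then have "\<not> forget_intro q G t p" by (simp add: forget_intro_def)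
        then show ?thesis using 1 u d by (simp add: s d')
      next
        case 2
        have f: "forget_intro q G t p \<longleftrightarrow> w \<in> G \<and> okE t \<and> vb t + 1 + vj t \<le> q \<and> okD q w" using 2 by (simp add: forget_intro_def w_def)
        have le: "0 < int q - int (vb t) - int (vj t) \<longleftrightarrow> vb t + 1 + vj t \<le> q" by auto
        have od: "\<sigma> 42 w \<le> int q \<longleftrightarrow> okD q w" by (rule SSD(5)[OF UUD(1)[OF u] w3[OF 2]])
        show ?thesis
          using 2 u d B
          by (simp add: s d' U S le wi UUD(4)[OF u w3[OF 2]] od f)
      next
        case 3
        have f: "forget_intro q G t p \<longleftrightarrow> x \<in> G \<and> vb t + vj x \<le> q" using 3 by (simp add: forget_intro_def x_def)
        have le: "0 < int q + 1 - int (vb t) - int (vj x) \<longleftrightarrow> vb t + vj x \<le> q" by auto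
        show ?thesis
          using 3 u d B
          by (simp add: s d' U S le xi[OF 3] UUD(4)[OF u x3] SSD(3)[OF UUD(1)[OF u] x3] f)
      qed
    qed
    by simp
next
  fix \<sigma> assume a: "(upd_inv q G0 G t \<sigma> \<and> digits_at t \<sigma>) \<and> \<sigma> 61 0 = of_bool b"
  then show "okx (Vr 23) \<sigma> \<and> eval (Vr 23) \<sigma> = int k \<and> (upd_inv q G0 G t (\<sigma>(57 := (\<sigma> 57)(0 := 0))) \<and> digits_at t (\<sigma>(57 := (\<sigma> 57)(0 := 0)))) \<and>
      (\<sigma>(57 := (\<sigma> 57)(0 := 0))) 61 0 = of_bool (b \<or> (\<exists>p<0. forget_intro q G t p))"
    using UUD(6)[of q G0 G t \<sigma>] by simp
qed (use k_le_M M1 kB B in simp_all)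

lemma c_join_ht:
  assumes t: "t < 3 ^ k" and q: "q \<le> n" and G0: "G0 \<subseteq> {..<3 ^ k}"
  shows "ht Bd (\<lambda>\<sigma>. (upd_inv q G0 G t \<sigma> \<and> digits_at t \<sigma>) \<and> \<sigma> 61 0 = of_bool b) c_join 5
    (\<lambda>\<sigma>. upd_inv q G0 G t \<sigma> \<and> \<sigma> 61 0 = of_bool (b \<or> join_ok q G0 t))"
  unfolding c_join_def
  apply (rule ht_pre)
    apply (rule wp)+
  subgoal premises pr for \<sigma>
  proof -
    have u: "upd_inv q G0 G t \<sigma>" and s: "\<sigma> 61 0 = of_bool b" using pr by auto
    note U = UUD(2,3)[OF u] UUD(5)[OF u t]
    note S = SSD(1,3,4,8)[OF UUD(1)[OF u] t]
    define y where "y = vb t + va t + vj t"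
    define j where "j = (2 * n - vl t) * M"
    have yn: "y \<le> n" unfolding y_def by (rule card_VBAJ)
    have yi: "int (vb t) + (int (va t) + int (vj t)) - int q = int y - int q" by (simp add: y_def)
    have yB: "\<bar>int y - int q\<bar> \<le> Bd" using yn q nB by linarith
    have tq: "tau q t = y - q" by (simp add: tau_def y_def)
    \<comment> \<open>The exponent stays inside the table of powers, as
      \<open>2 * n * M + n < M * M\<close>.\<close>
    have jM: "j + (y - q) < M * M"
    proof -
      have "j \<le> 2 * n * M" unfolding j_def by (intro mult_le_mono1) simp
      moreover have "M * M = 2 * n * M + M" by (simp add: M_def)
      ultimately show ?thesis using yn nM by linarith
    qed
    define e where "e = j + (y - q)"
    have X: "\<sigma> 26 e = XX ^ e" unfolding e_def by (rule tabsD(9)[OF stats_tabs[OF UUD(1)[OF u]] jM])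
    have J: "XX ^ e \<le> conv G0 t \<longleftrightarrow> join_ok q G0 t"
      using conv_iff[OF G0 t, of q] unfolding tq mmM j_def join_ok_def e_def .
    have J1: "0 < conv G0 t + 1 - XX ^ e \<longleftrightarrow> join_ok q G0 t" using J by linarith
    note S' = S(1-3) S(4)[folded j_def]
    show ?thesis
    proof (cases "q < y")
      case True
      have ix: "int j + (int y - int q) = int e" using True unfolding e_def by simp
      have J2: "0 < int y - int q" using True by simp
      show ?thesis using u B yB J2 by (simp add: U S' s yi ix X J1 del: diff_gt_0_iff_gt)
    next
      case False
      have J2: "\<not> 0 < int y - int q" "e = j" using False by (auto simp: e_def)
      show ?thesis using u B yB J2(1) X J1 unfolding J2(2) by (simp add: U S' s yi del: diff_gt_0_iff_gt)
    qed
  qed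
  by simp

lemma c_mark_ht:
  assumes t: "t < 3 ^ k"
  shows "ht Bd (\<lambda>\<sigma>. upd_inv q G0 G t \<sigma> \<and> \<sigma> 61 0 = of_bool b) c_mark 2
    (\<lambda>\<sigma>. upd_inv q G0 (if b then insert t G else G) t \<sigma>)"
  unfolding c_mark_def
  apply (rule ht_pre)
    apply (rule wp)+
  subgoal for \<sigma> using B t by (auto simp: upd_inv_def round_inv_def g_is_def)
  by simp

definition c_upd :: com where "c_upd = CFor 31 (Vr 53) (dec 31 23 ;; c_base ;; c_forget_intro ;; c_join ;; c_mark)"

lemma mods_u [simp]: "mods c_base = {61}" "mods c_forget_intro = {57, 61}" "mods c_join = {59, 61}" "mods c_mark = {46}"
  by (auto simp: c_base_def c_forget_intro_def c_join_def c_mark_def)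

definition T_upd :: "nat \<Rightarrow> nat" where "T_upd m = (10 * m + 1) + (4 + ((10 + 2) * m + (5 + 2)))"

lemma upd_body_ht:
  assumes t: "t < 3 ^ k" and q: "q \<le> n" and G0: "G0 \<subseteq> {..<3 ^ k}"
  shows "ht Bd (upd_inv q G0 G t) (dec 31 23 ;; c_base ;; c_forget_intro ;; c_join ;; c_mark) (T_upd M)
    (upd_inv q G0 (if stepm q G0 G t then insert t G else G) t)"
proof -
  have "ht Bd (upd_inv q G0 G t) (dec 31 23) (10 * M + 1) (\<lambda>\<sigma>. upd_inv q G0 G t \<sigma> \<and> (\<forall>p<k. \<sigma> 16 p = int (digit t p)))"
  proof (rule dec_SS[OF t])
    fix \<sigma> \<sigma>' assume P: "upd_inv q G0 G t \<sigma>" and e: "\<And>a. a \<notin> {14, 15, 16, 17} \<Longrightarrow> \<sigma>' a = \<sigma> a"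
    have s: "stats \<sigma>" "round_inv G q \<sigma>" "z_is (conv G0) \<sigma>" "\<sigma> 31 0 = int t" using P by (simp_all add: upd_inv_def)
    have "stats \<sigma>'" by (rule stats_cong[OF s(1)], rule e, auto)
    moreover have "round_inv G q \<sigma>'" by (rule round_inv_cong[OF s(2)]; rule e; simp)
    moreover have "z_is (conv G0) \<sigma>'" by (rule z_is_cong[OF s(3)], rule e, simp)
    moreover have "\<sigma>' 31 0 = int t" by (subst e) (simp_all add: s)
    ultimately show "upd_inv q G0 G t \<sigma>'" unfolding upd_inv_def by blast
  qed (simp add: upd_inv_def)
  then have 0: "ht Bd (upd_inv q G0 G t) (dec 31 23) (10 * M + 1) (\<lambda>\<sigma>. upd_inv q G0 G t \<sigma> \<and> digits_at t \<sigma>)" unfolding digits_at_def .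
  show ?thesis unfolding T_upd_def stepm_def
    by (rule ht_seq[OF 0 ht_seq[OF c_base_ht[OF t] ht_seq[OF c_forget_intro_ht[OF t] ht_seq[OF c_join_ht[OF t q G0] c_mark_ht[OF t]]]]])
qed

text \<open>The resulting set depends on the order of the codes and is not described exactly: it
  consists of good codes and contains everything that one step from \<open>G0\<close>
  yields.\<close>

lemma c_upd_ht:
  assumes q: "q \<le> n" and G0: "G0 \<subseteq> Goods q"
  shows "ht Bd (\<lambda>\<sigma>. stats \<sigma> \<and> round_inv G0 q \<sigma> \<and> z_is (conv G0) \<sigma>) c_upd ((T_upd M + 2) * K0)
    (\<lambda>\<sigma>. stats \<sigma> \<and> (\<exists>G. round_inv G q \<sigma> \<and> G0 \<subseteq> G \<and> G \<subseteq> Goods q \<and> (\<forall>t<3 ^ k. stepp q G0 t \<longrightarrow> t \<in> G)))"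
proof -
  define R where "R t G \<longleftrightarrow> G0 \<subseteq> G \<and> G \<subseteq> Goods q \<and> (\<forall>t'<t. stepp q G0 t' \<longrightarrow> t' \<in> G)" for t G
  let ?Inv = "\<lambda>t \<sigma>. stats \<sigma> \<and> z_is (conv G0) \<sigma> \<and> (\<exists>G. round_inv G q \<sigma> \<and> R t G)"
  have G03: "G0 \<subseteq> {..<3 ^ k}" using G0 by (auto simp: Goods_def)
  have "ht Bd (\<lambda>\<sigma>. stats \<sigma> \<and> round_inv G0 q \<sigma> \<and> z_is (conv G0) \<sigma>) c_upd ((T_upd M + 2) * K0) (?Inv (3 ^ k))"
    unfolding c_upd_def
  proof (rule ht_for2[where Inv = ?Inv])
    fix t :: nat assume t: "t < 3 ^ k"
    show "ht Bd (\<lambda>\<sigma>. ?Inv t \<sigma> \<and> \<sigma> 31 0 = int t) (dec 31 23 ;; c_base ;; c_forget_intro ;; c_join ;; c_mark) (T_upd M)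
      (\<lambda>\<sigma>. ?Inv (Suc t) (\<sigma>(31 := (\<sigma> 31)(0 := int (Suc t)))))"
    proof (rule ht_init)
      fix \<sigma>0 assume s0: "?Inv t \<sigma>0 \<and> \<sigma>0 31 0 = int t"
      then obtain G where G: "round_inv G q \<sigma>0" "R t G" by blast
      define G' where "G' = (if stepm q G0 G t then insert t G else G)"
      have "R (Suc t) G'"
      proof -
        have g: "G0 \<subseteq> G" "G \<subseteq> Goods q" using G(2) by (auto simp: R_def)
        have "t \<in> Goods q" if "stepm q G0 G t"
          using step_sound[OF g(2) t] stepm_mono[OF g(1) subset_refl that] by (simp add: stepp_stepm)
        moreover have "stepm q G0 G t" if "stepp q G0 t"
          using stepm_mono[OF subset_refl g(1)] that by (simp add: stepp_stepm)
        ultimately show ?thesis using G(2) unfolding R_def G'_def by (auto simp: less_Suc_eq)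
      qed
      then show "ht Bd (\<lambda>\<sigma>. \<sigma> = \<sigma>0) (dec 31 23 ;; c_base ;; c_forget_intro ;; c_join ;; c_mark) (T_upd M)
        (\<lambda>\<sigma>. ?Inv (Suc t) (\<sigma>(31 := (\<sigma> 31)(0 := int (Suc t)))))"
        using s0 G(1)
        by (intro ht_use[OF upd_body_ht[OF t q G03, of G, folded G'_def]]) (auto simp: upd_inv_def)
    qed
  next
    fix \<sigma> assume a: "stats \<sigma> \<and> round_inv G0 q \<sigma> \<and> z_is (conv G0) \<sigma>"
    have "R 0 G0" using G0 by (simp add: R_def)
    moreover have "\<sigma> 53 0 = 3 ^ k" using a tabsD(3) stats_tabs by blast
    ultimately show "okx (Vr 53) \<sigma> \<and> eval (Vr 53) \<sigma> = int (3 ^ k) \<and> ?Inv 0 (\<sigma>(31 := (\<sigma> 31)(0 := 0)))"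
      using a by auto
  qed (use pow3_k K0_1 K3B B in simp_all)
  then show ?thesis by (rule ht_use) (auto simp: R_def)
qed

lemma mods_conv [simp]: "mods c_conv = {14, 15, 16, 17, 31, 47, 51, 52, 57, 58}"
  by (auto simp: c_conv_def c_enc_def c_zeta_def c_square_def c_sqstep_def c_moeb_def)

lemma mods_upd [simp]: "mods c_upd = {14, 15, 16, 17, 31, 46, 57, 59, 61}"
  by (auto simp: c_upd_def)

text \<open>Every round completes one more value of \<open>meas\<close>, which is at most \<open>2 * k\<close>.\<close>

definition c_round :: com where "c_round = CFor 49 (Pl (Pl (Vr 23) (Vr 23)) (Cn 1)) (c_conv ;; c_upd)"

definition T_round :: "nat \<Rightarrow> nat \<Rightarrow> nat" where
  "T_round m x = (T_conv m x + (T_upd m + 2) * x + 2) * m"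

lemma c_round_ht:
  assumes q: "q \<le> n"
  shows "ht Bd (\<lambda>\<sigma>. stats \<sigma> \<and> round_inv {} q \<sigma>) c_round (T_round M K0) (\<lambda>\<sigma>. stats \<sigma> \<and> round_inv (Goods q) q \<sigma>)"
proof -
  define R where "R r G \<longleftrightarrow> G \<subseteq> Goods q \<and> (\<forall>t\<in>Goods q. meas t < r \<longrightarrow> t \<in> G)" for r G
  let ?Inv = "\<lambda>r \<sigma>. stats \<sigma> \<and> (\<exists>G. round_inv G q \<sigma> \<and> R r G)"
  have "ht Bd (\<lambda>\<sigma>. stats \<sigma> \<and> round_inv {} q \<sigma>) c_round (T_round M K0) (?Inv (2 * k + 1))"
    unfolding c_round_def T_round_def
  proof (rule ht_for2[where Inv = ?Inv])
    fix r
    show "ht Bd (\<lambda>\<sigma>. ?Inv r \<sigma> \<and> \<sigma> 49 0 = int r) (c_conv ;; c_upd) (T_conv M K0 + (T_upd M + 2) * K0)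
      (\<lambda>\<sigma>. ?Inv (Suc r) (\<sigma>(49 := (\<sigma> 49)(0 := int (Suc r)))))"
    proof (rule ht_init)
      fix \<sigma>0 assume s0: "?Inv r \<sigma>0 \<and> \<sigma>0 49 0 = int r"
      then obtain G0 where G0: "round_inv G0 q \<sigma>0" "R r G0" by blast
      have g: "G0 \<subseteq> Goods q" using G0(2) by (simp add: R_def)
      have fin: "R (Suc r) G" if G: "G0 \<subseteq> G" "G \<subseteq> Goods q" "\<forall>t<3 ^ k. stepp q G0 t \<longrightarrow> t \<in> G" for G
        unfolding R_def
      proof (intro conjI ballI impI G(2))
        fix t assume t: "t \<in> Goods q" "meas t < Suc r"
        have "stepp q G0 t" using G0(2) t(2) by (intro step_complete[OF t(1)]) (simp add: R_def)
        moreover have "t < 3 ^ k" using t(1) by (simp add: Goods_def)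
        ultimately show "t \<in> G" using G(3) by blast
      qed
      show "ht Bd (\<lambda>\<sigma>. \<sigma> = \<sigma>0) (c_conv ;; c_upd) (T_conv M K0 + (T_upd M + 2) * K0)
        (\<lambda>\<sigma>. ?Inv (Suc r) (\<sigma>(49 := (\<sigma> 49)(0 := int (Suc r)))))"
      proof (rule ht_use[OF ht_seq[OF c_conv_ht[of G0 q] c_upd_ht[OF q g]]])
        fix \<sigma> \<sigma>' assume "stats \<sigma>' \<and> (\<exists>G. round_inv G q \<sigma>' \<and> G0 \<subseteq> G \<and> G \<subseteq> Goods q \<and> (\<forall>t<3 ^ k. stepp q G0 t \<longrightarrow> t \<in> G))"
        then obtain G where "stats \<sigma>'" "round_inv G q \<sigma>'" "R (Suc r) G" using fin by blast
        then show "?Inv (Suc r) (\<sigma>'(49 := (\<sigma>' 49)(0 := int (Suc r))))" by auto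
      qed (use s0 G0(1) in simp_all)
    qed
  next
    fix \<sigma> assume a: "stats \<sigma> \<and> round_inv {} q \<sigma>"
    have "R 0 {}" by (simp add: R_def)
    moreover have "\<sigma> 23 0 = int k" using a tabsD(2) stats_tabs by blast
    ultimately show "okx (Pl (Pl (Vr 23) (Vr 23)) (Cn 1)) \<sigma> \<and> eval (Pl (Pl (Vr 23) (Vr 23)) (Cn 1)) \<sigma> = int (2 * k + 1) \<and>
        ?Inv 0 (\<sigma>(49 := (\<sigma> 49)(0 := 0)))"
      using a by auto
  next
    show "2 * k + 1 \<le> M" using k_le_n by (simp add: M_def)
    then show "int (2 * k + 1) \<le> Bd" using M3 by (intro small) linarith
  qed (use M1 B in simp_all)
  moreover have "G = Goods q" if "R (2 * k + 1) G" for G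
    using that meas_le by (auto simp: R_def less_Suc_eq_le)
  ultimately show ?thesis by (elim ht_use) auto
qed

definition c_clr :: com where "c_clr = CFor 31 (Vr 53) (CAsg 46 (Vr 31) (Cn 0))"

lemma c_clr_ht: "ht Bd (\<lambda>\<sigma>. stats \<sigma> \<and> \<sigma> 60 0 = int q) c_clr ((1 + 2) * K0) (\<lambda>\<sigma>. stats \<sigma> \<and> round_inv {} q \<sigma>)"
proof -
  let ?Inv = "\<lambda>t \<sigma>. (stats \<sigma> \<and> \<sigma> 60 0 = int q) \<and> (\<forall>t'<t. \<sigma> 46 t' = 0)"
  have "ht Bd (\<lambda>\<sigma>. stats \<sigma> \<and> \<sigma> 60 0 = int q) c_clr ((1 + 2) * K0) (?Inv (3 ^ k))"
    unfolding c_clr_def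
  proof (rule ht_for2[where Inv = ?Inv])
    fix t :: nat
    show "ht Bd (\<lambda>\<sigma>. ?Inv t \<sigma> \<and> \<sigma> 31 0 = int t) (CAsg 46 (Vr 31) (Cn 0)) 1
      (\<lambda>\<sigma>. ?Inv (Suc t) (\<sigma>(31 := (\<sigma> 31)(0 := int (Suc t)))))"
      apply (rule ht_pre)
        apply (rule wp)+
      subgoal for \<sigma> using B by (auto simp: less_Suc_eq)
      by simp
  next
    fix \<sigma> assume a: "stats \<sigma> \<and> \<sigma> 60 0 = int q"
    then have "\<sigma> 53 0 = 3 ^ k" using tabsD(3) stats_tabs by blast
    then show "okx (Vr 53) \<sigma> \<and> eval (Vr 53) \<sigma> = int (3 ^ k) \<and> ?Inv 0 (\<sigma>(31 := (\<sigma> 31)(0 := 0)))" using a by simp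
  qed (use pow3_k K0_1 K3B B in simp_all)
  then show ?thesis by (rule ht_use) (auto simp: round_inv_def g_is_def)
qed

section \<open>Search for the width\<close>

abbreviation "tw \<equiv> treewidth {..<n} E"

text \<open>Once there is a vertex, some bag is nonempty; the value -1 belongs to
  \<open>n = 0\<close> alone.\<close>

lemma tw_bounds: "- 1 \<le> tw" "tw \<le> int n - 1" "0 < n \<Longrightarrow> 0 \<le> tw"
proof -
  obtain I :: "nat set" and F X where D: "tree_decomposition {..<n} E I F X" "td_width I X = tw"
    using treewidth_attained[OF graph] by blast
  show "- 1 \<le> tw" using td_width_ge[OF D(1)] D(2) by simp
  show "tw \<le> int n - 1"
    using treewidth_le[OF graph tree_decomposition_trivial[OF graph]] by (simp add: td_width_def)
  assume n: "0 < n"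
  then obtain i where i: "i \<in> I" "0 \<in> X i" using D(1) unfolding tree_decomposition_def by blast
  have "finite I" using D(1) by (simp add: tree_decomposition_def is_tree_def simple_graph_def)
  moreover have "X i \<subseteq> {..<n}" using D(1) i by (simp add: tree_decomposition_def)
  then have "0 < card (X i)" using i finite_subset by (fastforce simp: card_gt_0_iff)
  ultimately have "1 \<le> Max ((\<lambda>i. int (card (X i))) ` I)"
    using i by (subst Max_ge_iff) (auto intro!: bexI[of _ i])
  then show "0 \<le> tw" using D(2) by (simp add: td_width_def)
qed

lemma full_Goods: "full \<in> Goods (Suc i) \<longleftrightarrow> tw \<le> int i"
  using good_iff_treewidth[of "Suc i"] full by (simp add: Goods_def)

definition c_width :: com where
  "c_width = CSet 60 (Pl (Vr 48) (Cn 1)) ;; c_clr ;; c_round ;;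
     CIf (Ar 46 (Vr 56)) (CSet 0 (Vr 48) ;; CSet 50 (Cn 1)) CSkip"

text \<open>The default result -1 is the treewidth of the graph without vertices; for
  \<open>n \<ge> 1\<close> one of the widths below \<open>n\<close> replaces it.\<close>

definition c_dp :: com where
  "c_dp = (CSet 0 (Cn (- 1)) ;; CSet 50 (Cn 0)) ;; CFor 48 (Vr 2) (CIf (Vr 50) CSkip c_width)"

definition width_inv :: "nat \<Rightarrow> store \<Rightarrow> bool" where
  "width_inv i \<sigma> \<longleftrightarrow> stats \<sigma> \<and> ((0 \<le> tw \<and> tw < int i \<and> \<sigma> 0 0 = tw \<and> \<sigma> 50 0 = 1) \<or>
     ((tw < 0 \<or> int i \<le> tw) \<and> \<sigma> 0 0 = - 1 \<and> \<sigma> 50 0 = 0))"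

definition T_width :: "nat \<Rightarrow> nat \<Rightarrow> nat" where
  "T_width m x = 1 + ((1 + 2) * x + (T_round m x + 3))"

lemma mods_round [simp]: "mods c_clr = {31, 46}" "mods c_round = {14, 15, 16, 17, 31, 46, 47, 49, 51, 52, 57, 58, 59, 61}"
  by (auto simp: c_clr_def c_round_def)

lemma c_width_ht:
  assumes i: "i < n"
  shows "ht Bd (\<lambda>\<sigma>. (width_inv i \<sigma> \<and> \<sigma> 48 0 = int i) \<and> \<sigma> 50 0 = 0) c_width (T_width M K0) (\<lambda>\<sigma>. width_inv (Suc i) \<sigma>)"
proof -
  let ?P = "\<lambda>\<sigma>. \<sigma> 48 0 = int i \<and> \<sigma> 50 0 = 0 \<and> \<sigma> 0 0 = - 1"
  have ti: "0 \<le> tw" using tw_bounds(3) i by simp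
  have iB: "int i + 1 \<le> Bd" "int i \<le> Bd" using i nB by linarith+
  have 1: "ht Bd (\<lambda>\<sigma>. (width_inv i \<sigma> \<and> \<sigma> 48 0 = int i) \<and> \<sigma> 50 0 = 0) (CSet 60 (Pl (Vr 48) (Cn 1))) 1
      (\<lambda>\<sigma>. (stats \<sigma> \<and> \<sigma> 60 0 = int (Suc i)) \<and> int i \<le> tw \<and> ?P \<sigma>)"
    apply (rule ht_pre)
      apply (rule wp)+
    subgoal for \<sigma> using iB ti by (auto simp: width_inv_def)
    by simp
  have 2: "ht Bd (\<lambda>\<sigma>. (stats \<sigma> \<and> \<sigma> 60 0 = int (Suc i)) \<and> int i \<le> tw \<and> ?P \<sigma>) c_clr ((1 + 2) * K0)
      (\<lambda>\<sigma>. (stats \<sigma> \<and> round_inv {} (Suc i) \<sigma>) \<and> int i \<le> tw \<and> ?P \<sigma>)"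
    by (rule ht_use[OF c_clr_ht[of "Suc i"]]) auto
  have 3: "ht Bd (\<lambda>\<sigma>. (stats \<sigma> \<and> round_inv {} (Suc i) \<sigma>) \<and> int i \<le> tw \<and> ?P \<sigma>) c_round (T_round M K0)
      (\<lambda>\<sigma>. (stats \<sigma> \<and> round_inv (Goods (Suc i)) (Suc i) \<sigma>) \<and> int i \<le> tw \<and> ?P \<sigma>)"
    using i by (intro ht_use[OF c_round_ht[of "Suc i"]]) auto
  have 4: "ht Bd (\<lambda>\<sigma>. (stats \<sigma> \<and> round_inv (Goods (Suc i)) (Suc i) \<sigma>) \<and> int i \<le> tw \<and> ?P \<sigma>)
      (CIf (Ar 46 (Vr 56)) (CSet 0 (Vr 48) ;; CSet 50 (Cn 1)) CSkip) 3 (width_inv (Suc i))"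
    apply (rule ht_pre)
      apply (rule wp)+
    subgoal premises pr for \<sigma>
    proof -
      have s: "stats \<sigma>" "round_inv (Goods (Suc i)) (Suc i) \<sigma>" "int i \<le> tw" "?P \<sigma>" using pr by auto
      have f: "\<sigma> 56 0 = int full" using tabsD(13)[OF stats_tabs[OF s(1)]] .
      have g: "\<sigma> 46 full = of_bool (tw \<le> int i)" using s(2) full(1) by (simp add: round_inv_def g_is_def full_Goods)
      show ?thesis
      proof (cases "tw \<le> int i")
        case True
        then have "tw = int i" using s(3) by simp
        then show ?thesis using s f g iB B by (simp add: width_inv_def)
      next
        case False
        then show ?thesis using s f g by (simp add: width_inv_def)
      qed
    qed
    by simp
  show ?thesis unfolding c_width_def T_width_def by (rule ht_seq[OF 1 ht_seq[OF 2 ht_seq[OF 3 4]]])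
qed

lemma mods_width [simp]: "mods c_width = {0, 14, 15, 16, 17, 31, 46, 47, 49, 50, 51, 52, 57, 58, 59, 60, 61}"
  by (auto simp: c_width_def)

lemma c_dp_ht: "ht Bd stats c_dp (2 + (Suc (0 + T_width M K0) + 2) * M) (\<lambda>\<sigma>. \<sigma> 0 0 = tw)"
proof -
  have 1: "ht Bd stats (CSet 0 (Cn (- 1)) ;; CSet 50 (Cn 0)) 2 (width_inv 0)"
    apply (rule ht_pre)
      apply (rule wp)+
    subgoal for \<sigma> using B tw_bounds(1) by (auto simp: width_inv_def)
    by simp
  have 2: "ht Bd (width_inv 0) (CFor 48 (Vr 2) (CIf (Vr 50) CSkip c_width)) ((Suc (0 + T_width M K0) + 2) * M) (width_inv n)"
  proof (rule ht_for2[where Inv = width_inv and N = n])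
    fix i assume i: "i < n"
    have "ht Bd (\<lambda>\<sigma>. width_inv i \<sigma> \<and> \<sigma> 48 0 = int i) (CIf (Vr 50) CSkip c_width) (Suc (0 + T_width M K0)) (width_inv (Suc i))"
    proof (rule ht_pre[OF ht_if2[OF B ht_skip c_width_ht[OF i]]])
      fix \<sigma> assume a: "width_inv i \<sigma> \<and> \<sigma> 48 0 = int i"
      then show "okx (Vr 50) \<sigma> \<and> (if 0 < eval (Vr 50) \<sigma> then width_inv (Suc i) \<sigma>
          else (width_inv i \<sigma> \<and> \<sigma> 48 0 = int i) \<and> \<sigma> 50 0 = 0)"
        by (auto simp: width_inv_def)
    qed simp
    then show "ht Bd (\<lambda>\<sigma>. width_inv i \<sigma> \<and> \<sigma> 48 0 = int i) (CIf (Vr 50) CSkip c_width) (Suc (0 + T_width M K0))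
      (\<lambda>\<sigma>. width_inv (Suc i) (\<sigma>(48 := (\<sigma> 48)(0 := int (Suc i)))))"
      by (rule ht_use) (auto simp: width_inv_def)
  next
    fix \<sigma> assume a: "width_inv 0 \<sigma>"
    then have "\<sigma> 2 0 = int n" using tabsD(1) stats_tabs by (auto simp: width_inv_def)
    then show "okx (Vr 2) \<sigma> \<and> eval (Vr 2) \<sigma> = int n \<and> width_inv 0 (\<sigma>(48 := (\<sigma> 48)(0 := 0)))" using a by (simp add: width_inv_def)
  qed (use nM M1 nB B in simp_all)
  have e: "\<sigma> 0 0 = tw" if "width_inv n \<sigma>" for \<sigma>
    using that tw_bounds by (auto simp: width_inv_def)
  show ?thesis unfolding c_dp_def by (rule ht_use[OF ht_seq[OF 1 2]]) (auto intro: e)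
qed

section \<open>The complete program\<close>

definition T_main :: "nat \<Rightarrow> nat \<Rightarrow> nat" where
  "T_main m x = 6 + ((1 + (2 + (3 + 2) * m + 2) * m + 2) * m + (1 + 2) * m) +
     ((T_stat m + 2) * x + (2 + (Suc (0 + T_width m x) + 2) * m))"

lemma main_ht: "ht Bd (listed C k cl) (c_tab ;; c_stat ;; c_dp) (T_main M K0) (\<lambda>\<sigma>. \<sigma> 0 0 = tw)"
proof -
  have "ht Bd tabs c_stat ((T_stat M + 2) * K0) stats"
    by (rule ht_use[OF c_stat_ht]) (auto simp: stats_def)
  from ht_seq[OF c_tab_ht ht_seq[OF this c_dp_ht]] show ?thesis unfolding T_main_def .
qed

end

text \<open>The commands are defined inside locales, but no parameter occurs in them: this is one
  program for all graphs.\<close>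

definition c_treewidth :: com where
  "c_treewidth = pctx.c_read ;; pctx.c_pow3 ;; pctx.c_cover ;; pctx.c_list ;; dctx.c_tab ;; dctx.c_stat ;; dctx.c_dp"

definition T_all :: "nat \<Rightarrow> nat \<Rightarrow> nat" where
  "T_all m x = 2 + ((1 + 5 * m) + 2) * m + (1 + 3 * m + (1 + (3 + (Suc (pctx.T_try m) + 2) * x + 2) * m +
     (1 + 5 * m + dctx.T_main m x)))"

lemma (in pctx) c_treewidth_ht:
  "ht Bd (\<lambda>\<sigma>. \<sigma> = inp_store (graph_input n E)) c_treewidth (T_all M K0) (\<lambda>\<sigma>. \<sigma> 0 0 = treewidth {..<n} E)"
proof -
  have "ht Bd (\<lambda>\<sigma>. \<exists>C k cl. vertex_cover {..<n} E C \<and> card C \<le> vcn \<and> bij_betw cl {..<k} C \<and> listed C k cl \<sigma>)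
     (dctx.c_tab ;; dctx.c_stat ;; dctx.c_dp) (dctx.T_main M K0) (\<lambda>\<sigma>. \<sigma> 0 0 = treewidth {..<n} E)"
  proof (rule ht_init)
    fix \<sigma>0 assume "\<exists>C k cl. vertex_cover {..<n} E C \<and> card C \<le> vcn \<and> bij_betw cl {..<k} C \<and> listed C k cl \<sigma>0"
    then obtain C k cl where c: "vertex_cover {..<n} E C" "card C \<le> vcn" "bij_betw cl {..<k} C" "listed C k cl \<sigma>0"
      by blast
    have "card C = k" using bij_betw_same_card[OF c(3)] by simp
    \<comment> \<open>The cover found by the run is fixed by now and can serve as a parameter of the
      locale.\<close>
    then interpret dctx n E C k cl
      using c graph by unfold_locales auto
    show "ht Bd (\<lambda>\<sigma>. \<sigma> = \<sigma>0) (c_tab ;; c_stat ;; c_dp) (T_main M K0) (\<lambda>\<sigma>. \<sigma> 0 0 = treewidth {..<n} E)"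
      by (rule ht_pre[OF main_ht]) (use c in simp_all)
  qed
  from ht_seq[OF c_read_ht ht_seq[OF c_pow3_ht ht_seq[OF c_cover_ht ht_seq[OF c_list_ht this]]]]
  show ?thesis unfolding c_treewidth_def T_all_def .
qed

text \<open>An instance at which definitions made inside the locales can be unfolded.\<close>

lemma dctx_empty: "dctx 0 {} {} 0 id"
  by unfold_locales (auto simp: simple_graph_def vertex_cover_def)

lemma wfc_treewidth: "wfc 0 c_treewidth"
proof -
  interpret dctx 0 "{}" "{}" 0 id by (rule dctx_empty)
  show ?thesis
    by (simp add: c_treewidth_def wfe_def dec_def dec_step_def c_read_def c_pow3_def c_cover_def c_try_def c_branch_def
        c_list_def c_tab_def c_stat_def c_sizes_def c_closed_def c_indep_def c_cnt_def c_store_def c_dp_def c_width_def c_clr_def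
        c_round_def c_conv_def c_enc_def c_zeta_def c_moeb_def c_pass_def c_square_def c_sqstep_def c_upd_def
        c_base_def c_forget_intro_def c_join_def c_mark_def)
qed

subsection \<open>The running time\<close>

definition poly_bd :: "(nat \<Rightarrow> nat) \<Rightarrow> bool" where
  "poly_bd f \<longleftrightarrow> (\<exists>c d. \<forall>m\<ge>1. f m \<le> c * m ^ d)"

text \<open>\<open>m\<close> stands for \<open>2 * n + 1\<close> and \<open>x\<close> for
  \<open>3 ^ k\<close>. Linearity in \<open>x\<close> keeps the exponential factor at
  \<open>3 ^ k\<close>, so the rules below never multiply two functions of \<open>x\<close>.\<close>

definition lin_bd :: "(nat \<Rightarrow> nat \<Rightarrow> nat) \<Rightarrow> bool" where
  "lin_bd f \<longleftrightarrow> (\<exists>c d. \<forall>m\<ge>1. \<forall>x\<ge>1. f m x \<le> c * m ^ d * x)"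

lemma poly_bd_const: "poly_bd (\<lambda>m. a)" unfolding poly_bd_def by (intro exI[of _ a] exI[of _ 0]) simp
lemma poly_bd_id: "poly_bd (\<lambda>m. m)" unfolding poly_bd_def by (intro exI[of _ 1] exI[of _ 1]) simp

lemma poly_bd_mult: "poly_bd f \<Longrightarrow> poly_bd g \<Longrightarrow> poly_bd (\<lambda>m. f m * g m)"
proof -
  assume "poly_bd f" "poly_bd g"
  then obtain c d c' d' where f: "\<And>m. m \<ge> 1 \<Longrightarrow> f m \<le> c * m ^ d" and g: "\<And>m. m \<ge> 1 \<Longrightarrow> g m \<le> c' * m ^ d'"
    unfolding poly_bd_def by blast
  have "f m * g m \<le> (c * c') * m ^ (d + d')" if "m \<ge> 1" for m
    using mult_mono[OF f[OF that] g[OF that]] by (simp add: power_add mult_ac)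
  then show ?thesis unfolding poly_bd_def by blast
qed

lemma poly_bd_add: "poly_bd f \<Longrightarrow> poly_bd g \<Longrightarrow> poly_bd (\<lambda>m. f m + g m)"
proof -
  assume "poly_bd f" "poly_bd g"
  then obtain c d c' d' where f: "\<And>m. m \<ge> 1 \<Longrightarrow> f m \<le> c * m ^ d" and g: "\<And>m. m \<ge> 1 \<Longrightarrow> g m \<le> c' * m ^ d'"
    unfolding poly_bd_def by blast
  have "f m + g m \<le> (c + c') * m ^ (d + d')" if m: "m \<ge> 1" for m
  proof -
    have "m ^ d \<le> m ^ (d + d')" "m ^ d' \<le> m ^ (d + d')" using m by (auto intro: power_increasing)
    then have "c * m ^ d \<le> c * m ^ (d + d')" "c' * m ^ d' \<le> c' * m ^ (d + d')" by (auto intro: mult_le_mono2)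
    then show ?thesis using f[OF m] g[OF m] unfolding distrib_right by linarith
  qed
  then show ?thesis unfolding poly_bd_def by blast
qed

lemma poly_bd_Suc: "poly_bd f \<Longrightarrow> poly_bd (\<lambda>m. Suc (f m))"
  using poly_bd_add[OF poly_bd_const[of 1]] by fastforce

lemma poly_bd_power: "poly_bd f \<Longrightarrow> poly_bd (\<lambda>m. f m ^ e)"
  by (induction e) (auto intro: poly_bd_const poly_bd_mult)

lemma lin_bd_mult_x: "poly_bd f \<Longrightarrow> lin_bd (\<lambda>m x. f m * x)"
  unfolding poly_bd_def lin_bd_def by (meson mult_le_mono1)

lemma lin_bd_poly: "poly_bd f \<Longrightarrow> lin_bd (\<lambda>m x. f m)"
proof -
  assume "poly_bd f"
  then obtain c d where f: "\<And>m. m \<ge> 1 \<Longrightarrow> f m \<le> c * m ^ d" unfolding poly_bd_def by blast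
  have "f m \<le> c * m ^ d * x" if "m \<ge> 1" "x \<ge> 1" for m x
    using mult_le_mono[OF f[OF that(1)] that(2)] by simp
  then show ?thesis unfolding lin_bd_def by blast
qed

lemma lin_bd_mult: "lin_bd f \<Longrightarrow> poly_bd g \<Longrightarrow> lin_bd (\<lambda>m x. f m x * g m)"
proof -
  assume "lin_bd f" "poly_bd g"
  then obtain c d c' d' where f: "\<And>m x. m \<ge> 1 \<Longrightarrow> x \<ge> 1 \<Longrightarrow> f m x \<le> c * m ^ d * x" and g: "\<And>m. m \<ge> 1 \<Longrightarrow> g m \<le> c' * m ^ d'"
    unfolding lin_bd_def poly_bd_def by blast
  have "f m x * g m \<le> (c * c') * m ^ (d + d') * x" if "m \<ge> 1" "x \<ge> 1" for m x
    using mult_mono[OF f[OF that] g[OF that(1)]] by (simp add: power_add mult_ac)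
  then show ?thesis unfolding lin_bd_def by blast
qed

lemma lin_bd_add: "lin_bd f \<Longrightarrow> lin_bd g \<Longrightarrow> lin_bd (\<lambda>m x. f m x + g m x)"
proof -
  assume "lin_bd f" "lin_bd g"
  then obtain c d c' d' where f: "\<And>m x. m \<ge> 1 \<Longrightarrow> x \<ge> 1 \<Longrightarrow> f m x \<le> c * m ^ d * x"
    and g: "\<And>m x. m \<ge> 1 \<Longrightarrow> x \<ge> 1 \<Longrightarrow> g m x \<le> c' * m ^ d' * x"
    unfolding lin_bd_def by blast
  have "f m x + g m x \<le> (c + c') * m ^ (d + d') * x" if m: "m \<ge> 1" "x \<ge> 1" for m x
  proof -
    have "m ^ d \<le> m ^ (d + d')" "m ^ d' \<le> m ^ (d + d')" using m by (auto intro: power_increasing)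
    then have "c * m ^ d * x \<le> c * m ^ (d + d') * x" "c' * m ^ d' * x \<le> c' * m ^ (d + d') * x"
      by (auto intro!: mult_le_mono)
    then show ?thesis using f[OF m] g[OF m] unfolding distrib_right by linarith
  qed
  then show ?thesis unfolding lin_bd_def by blast
qed

lemma lin_bd_Suc: "lin_bd f \<Longrightarrow> lin_bd (\<lambda>m x. Suc (f m x))"
  using lin_bd_add[OF lin_bd_poly[OF poly_bd_const[of 1]]] by fastforce

text \<open>The factor \<open>4096 = 2 ^ 12\<close> turns the bound into
  \<open>2 ^ (2 * m ^ 3 + 28)\<close>, of binary length \<open>2 * m ^ 3 + 29\<close>.\<close>

lemma KB_pow: "KB (2 ^ (2 * m ^ 3 + 16)) = 2 * (2 * m ^ 3 + 29)"
proof -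
  define e where "e = 2 * m ^ 3 + 28"
  have "MB (2 ^ (2 * m ^ 3 + 16)) = 2 ^ e" by (simp add: MB_def e_def power_add)
  moreover have "floorlog 2 (2 ^ e) = Suc e" using floorlog_power[of 1 2 e] by (simp add: floorlog_def)
  then have "bits (2 ^ e) = Suc e" by (simp add: bits_def nat_power_eq)
  ultimately show ?thesis by (simp add: KB_def e_def)
qed

lemma lin_bd_time: "lin_bd (\<lambda>m x. 600 * T_all m x * (2 * (2 * m ^ 3 + 29)))"
proof -
  interpret dctx 0 "{}" "{}" 0 id by (rule dctx_empty)
  have "lin_bd (\<lambda>m x. T_all m x * (600 * (2 * (2 * m ^ 3 + 29))))"
    unfolding T_all_def T_try_def T_main_def T_stat_def T_width_def T_round_def T_conv_def T_upd_def
    by (intro lin_bd_add lin_bd_Suc lin_bd_mult_x lin_bd_mult lin_bd_poly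
        poly_bd_add poly_bd_Suc poly_bd_mult poly_bd_power poly_bd_id poly_bd_const)
  then show ?thesis by (simp only: mult_ac)
qed

theorem theorem7:
  shows "\<exists>(P :: instr list) (T :: nat \<Rightarrow> nat \<Rightarrow> real).
    T \<in> O_star (\<lambda>n k. 3 ^ k) \<and>
    (\<forall>(n :: nat) (E :: nat set set). simple_graph {..<n} E \<longrightarrow>
       computes_within P (graph_input n E) (treewidth {..<n} E)
         (T n (vertex_cover_number {..<n} E)))"
proof -
  \<comment> \<open>\<open>M\<close> and \<open>K0\<close> are inserted into \<open>T_all\<close>;
    the last factor is \<open>KB Bd\<close>.\<close>
  define T where "T n k = real (600 * T_all (2 * n + 1) (3 ^ k) * (2 * (2 * (2 * n + 1) ^ 3 + 29)))" for n k
  have "T \<in> O_star (\<lambda>n k. 3 ^ k)"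
  proof -
    obtain c d where cd: "\<And>m x. m \<ge> 1 \<Longrightarrow> x \<ge> 1 \<Longrightarrow> 600 * T_all m x * (2 * (2 * m ^ 3 + 29)) \<le> c * m ^ d * x"
      using lin_bd_time unfolding lin_bd_def by blast
    have "\<bar>T n k\<bar> \<le> real (c * 3 ^ d) * \<bar>3 ^ k\<bar> * real n ^ d" if n: "n \<ge> 1" for n k
    proof -
      \<comment> \<open>\<open>2 * n + 1 \<le> 3 * n\<close> for \<open>n \<ge> 1\<close> turns a
        power of \<open>M\<close> into one of \<open>n\<close>, at the price of the constant
        \<open>3 ^ d\<close>.\<close>
      have "(2 * n + 1) ^ d \<le> (3 * n) ^ d" using n by (intro power_mono) auto
      then have "c * (2 * n + 1) ^ d * 3 ^ k \<le> c * (3 * n) ^ d * 3 ^ k" by (intro mult_le_mono) auto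
      then have "600 * T_all (2 * n + 1) (3 ^ k) * (2 * (2 * (2 * n + 1) ^ 3 + 29)) \<le> c * (3 * n) ^ d * 3 ^ k"
        by (rule le_trans[OF cd, rotated 2]) simp_all
      then have "T n k \<le> real (c * (3 * n) ^ d * 3 ^ k)" unfolding T_def by (simp only: of_nat_le_iff)
      moreover have "0 \<le> T n k" by (simp add: T_def)
      ultimately show ?thesis by (simp add: power_mult_distrib mult_ac)
    qed
    then show ?thesis unfolding O_star_def by blast
  qed
  moreover have "computes_within (comp c_treewidth 0 0) (graph_input n E) (treewidth {..<n} E)
      (T n (vertex_cover_number {..<n} E))" if G: "simple_graph {..<n} E" for n E
  proof -
    interpret pctx n E by unfold_locales (rule G)
    have "real (600 * T_all M K0 * KB Bd) \<le> T n (vertex_cover_number {..<n} E)"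
      unfolding T_def Bd_def KB_pow by (simp add: M_def K0_def vcn_def)
    then show ?thesis by (rule ht_computes[OF c_treewidth_ht wfc_treewidth B graph_input_bd])
  qed
  ultimately show ?thesis by blast
qed

end
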